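(* Let $m\ge 2$ and let $(x,y)=(x_1,\dots,x_m,y_1,\dots,y_m)$ be coordinates on $\mathbb{R}^{2m}$. Let $$f_{ij}=\sum_{p<q<r}f_{ij}^{pqr}\bigwedge_{\substack{s=1,\dots,m\\ s\neq p,q,r}}dx_s ,\qquad 1\le i<j\le m,$$ be a collection of germs at $0$ of $(m-3)$-forms on $\mathbb{R}^{2m}$ (absent, i.e. $f_{ij}=0$, if $m=2$) satisfying $f_{ij}(0,y)=0$. Consider the following system for germs at $0$ of functions $\theta=(\theta_{kl})_{1\le k<l\le m}$ on $\mathbb{R}^{2m}$, where one puts $\theta_{lk}=-\theta_{kl}$ and $\theta_{kk}=0$: $$\sum_{p,q=1}^m(-1)^{p+q}\Big((\partial_{x_i}\partial_{x_p}\theta_{pl})(\partial_{x_j}\partial_{x_q}\theta_{qk})-(\partial_{x_j}\partial_{x_p}\theta_{pl})(\partial_{x_i}\partial_{x_q}\theta_{qk})\Big)=\partial_{y_j}\partial_{x_i}\theta_{kl}-\partial_{y_i}\partial_{x_j}\theta_{kl}+(d_xf_{ij})_{kl}\qquad(\ast)$$ for all $i<j$ and $k<l$, where $(d_xf_{ij})_{kl}$ is the coefficient of $d_xf_{ij}$ at $\bigwedge_{s\neq k,l}dx_s$. Then any solution $\theta$ of $(\ast)$ gives rise to a germ of a Ricci-flat hyper-para-complex structure on $\mathbb{R}^{2m}$, namely the one defined by the Lax tuple $$L_i(t)=\partial_{x_i}+t\,\partial_{y_i}+t\sum_{j=1}^m(\partial_{x_i}R^j)\,\partial_{x_j},\quad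 i=1,\dots,m,\qquad\text{with}\quad R^i=\sum_{j\neq i}(-1)^{i+j+1}\partial_{x_j}\theta_{ji}.$$ Conversely, any germ of a Ricci-flat hyper-para-complex structure in dimension $2m$ is obtained in this way, in suitable local coordinates $(x,y)$, from some collection $(f_{ij})$ with $f_{ij}(0,y)=0$ and some solution $\theta$ of $(\ast)$.
   Context: $d_x$ denotes the exterior differential with respect to the $x$-coordinates only; in all products $\bigwedge_s dx_s$ the indices are in increasing order. A hyper-para-complex structure on a $2m$-manifold is a triple $(I,K,J)$ of anti-commuting endomorphisms of the tangent bundle such that $J$ is an (integrable) complex structure, $I,K$ are para-complex structures (square $\mathrm{Id}$, with $\pm1$-eigendistributions $\mathcal{D}^\pm_I$, $\mathcal{D}^\pm_K$ of rank $m$ and integrable) and $IK=-KI=J$. Structure defined by a Lax tuple: put $E_i=\partial_{y_i}+\sum_j(\partial_{x_i}R^j)\partial_{x_j}$, so that $L_i(t)=\partial_{x_i}+tE_i$. The associated hyper-para-complex structure is given by $I\partial_{x_i}=\partial_{x_i}$, $IE_i=-E_i$, $K\partial_{x_i}=E_i$, $KE_i=\partial_{x_i}$, $J=IK$. Thus with $\mathcal{V}_t=\mathrm{span}\{L_i(t)\}$ and $\mathcal{V}_\infty=\mathrm{span}\{E_i\}$ one has $\mathcal{D}_I^+=\mathcal{V}_0$, $\mathcal{D}_I^-=\mathcal{V}_\infty$, $\mathcal{D}_K^+=\mathcal{V}_1$, $\mathcal{D}_K^-=\mathcal{V}_{-1}$; the distributions $\mathcal{V}_t$, $t\in\mathbb{R}\cup\{\infty\}$,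 are all integrable when the vector fields $L_1(t),\dots,L_m(t)$ commute. Chern connection: a hyper-para-complex structure defines the 3-web (triple of pairwise transversal $m$-dimensional foliations) with $T\mathcal{F}_1=\mathcal{D}_I^+$, $T\mathcal{F}_2=\mathcal{D}_I^-$, $T\mathcal{F}_3=\mathcal{D}_K^+$. The Chern connection $\nabla^C$ of a 3-web is the unique affine connection for which $T\mathcal{F}_1,T\mathcal{F}_2,T\mathcal{F}_3$ are parallel and whose torsion vanishes on pairs $(X,Y)$ with $X$ tangent to $\mathcal{F}_1$ and $Y$ tangent to $\mathcal{F}_2$. For the 3-web of a hyper-para-complex structure it is torsion-free. The hyper-para-complex structure is called Ricci-flat if the Ricci tensor of $\nabla^C$ vanishes. *)

theory Defs
  imports "HOL-Analysis.Analysis"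
begin

section \<open>Smooth maps, vector fields and distributions on open subsets of a Euclidean space\<close>

primrec Ck_on :: "nat \<Rightarrow> 'a::real_normed_vector set \<Rightarrow> ('a \<Rightarrow> 'b::real_normed_vector) \<Rightarrow> bool" where
  "Ck_on 0 U f \<longleftrightarrow> continuous_on U f"
| "Ck_on (Suc k) U f \<longleftrightarrow>
     (\<forall>x\<in>U. f differentiable (at x)) \<and> (\<forall>v. Ck_on k U (\<lambda>x. frechet_derivative f (at x) v))"

text \<open>To be used for open \<open>U\<close> only (the derivatives are the unrestricted ones).\<close>

definition smooth_on :: "'a::real_normed_vector set \<Rightarrow> ('a \<Rightarrow> 'b::real_normed_vector) \<Rightarrow> bool" where
  "smooth_on U f \<longleftrightarrow> (\<forall>k. Ck_on k U f)"

definition diffeo_onto_image :: "'a::real_normed_vector set \<Rightarrow> ('a \<Rightarrow> 'b::real_normed_vector) \<Rightarrow> bool" where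
  "diffeo_onto_image V \<phi> \<longleftrightarrow> open V \<and> open (\<phi> ` V) \<and> smooth_on V \<phi> \<and>
     (\<exists>\<psi>. smooth_on (\<phi> ` V) \<psi> \<and> (\<forall>q\<in>V. \<psi> (\<phi> q) = q))"

definition lie_bracket :: "('a::real_normed_vector \<Rightarrow> 'a) \<Rightarrow> ('a \<Rightarrow> 'a) \<Rightarrow> 'a \<Rightarrow> 'a" where
  "lie_bracket X Y p = frechet_derivative Y (at p) (X p) - frechet_derivative X (at p) (Y p)"

text \<open>
  A distribution is integrable if it is the tangent distribution of a foliation: around every point
  there is a chart \<open>\<phi>\<close> in which it becomes a constant distribution \<open>S\<close>, so that the leaves
  are locally given by \<open>\<phi> q \<in> c + S\<close>.
\<close>

definition integrable_distribution :: "'a::euclidean_space set \<Rightarrow> ('a \<Rightarrow> 'a set) \<Rightarrow> bool" where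
  "integrable_distribution U D \<longleftrightarrow>
     (\<forall>p\<in>U. \<exists>V (\<phi>::'a \<Rightarrow> 'a) S. p \<in> V \<and> V \<subseteq> U \<and> diffeo_onto_image V \<phi> \<and> subspace S \<and>
        (\<forall>q\<in>V. D q = {v. frechet_derivative \<phi> (at q) v \<in> S}))"


section \<open>Hyper-para-complex structures\<close>

definition endomorphism_field :: "'a::euclidean_space set \<Rightarrow> ('a \<Rightarrow> 'a \<Rightarrow> 'a) \<Rightarrow> bool" where
  "endomorphism_field U A \<longleftrightarrow> (\<forall>p\<in>U. linear (A p)) \<and> (\<forall>v. smooth_on U (\<lambda>p. A p v))"

definition eigendistribution :: "('a::euclidean_space \<Rightarrow> 'a \<Rightarrow> 'a) \<Rightarrow> real \<Rightarrow> 'a \<Rightarrow> 'a set" where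
  "eigendistribution A c p = {v. A p v = c *\<^sub>R v}"

definition para_complex_on :: "'a::euclidean_space set \<Rightarrow> ('a \<Rightarrow> 'a \<Rightarrow> 'a) \<Rightarrow> bool" where
  "para_complex_on U A \<longleftrightarrow> endomorphism_field U A \<and> (\<forall>p\<in>U. \<forall>v. A p (A p v) = v) \<and>
     (\<forall>c\<in>{1, -1}. (\<forall>p\<in>U. 2 * dim (eigendistribution A c p) = DIM('a)) \<and>
        integrable_distribution U (eigendistribution A c))"

definition nijenhuis :: "('a::euclidean_space \<Rightarrow> 'a \<Rightarrow> 'a) \<Rightarrow> ('a \<Rightarrow> 'a) \<Rightarrow> ('a \<Rightarrow> 'a) \<Rightarrow> 'a \<Rightarrow> 'a" where
  "nijenhuis J X Y p =
     lie_bracket (\<lambda>q. J q (X q)) (\<lambda>q. J q (Y q)) p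
     - J p (lie_bracket (\<lambda>q. J q (X q)) Y p)
     - J p (lie_bracket X (\<lambda>q. J q (Y q)) p)
     - lie_bracket X Y p"

definition complex_structure_on :: "'a::euclidean_space set \<Rightarrow> ('a \<Rightarrow> 'a \<Rightarrow> 'a) \<Rightarrow> bool" where
  "complex_structure_on U J \<longleftrightarrow> endomorphism_field U J \<and> (\<forall>p\<in>U. \<forall>v. J p (J p v) = - v) \<and>
     (\<forall>X Y. smooth_on U X \<longrightarrow> smooth_on U Y \<longrightarrow> (\<forall>p\<in>U. nijenhuis J X Y p = 0))"

definition hyper_para_complex_on ::
  "'a::euclidean_space set \<Rightarrow> ('a \<Rightarrow> 'a \<Rightarrow> 'a) \<Rightarrow> ('a \<Rightarrow> 'a \<Rightarrow> 'a) \<Rightarrow> ('a \<Rightarrow> 'a \<Rightarrow> 'a) \<Rightarrow> bool" where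
  "hyper_para_complex_on U I K J \<longleftrightarrow> open U \<and>
     para_complex_on U I \<and> para_complex_on U K \<and> complex_structure_on U J \<and>
     (\<forall>p\<in>U. \<forall>v. I p (K p v) = J p v \<and> K p (I p v) = - J p v \<and>
        I p (J p v) = - J p (I p v) \<and> K p (J p v) = - J p (K p v))"


section \<open>The Chern connection of a 3-web and Ricci-flatness\<close>

definition affine_connection_on :: "'a::euclidean_space set \<Rightarrow> (('a \<Rightarrow> 'a) \<Rightarrow> ('a \<Rightarrow> 'a) \<Rightarrow> 'a \<Rightarrow> 'a) \<Rightarrow> bool" where
  "affine_connection_on U N \<longleftrightarrow>
     (\<forall>X Y. smooth_on U X \<longrightarrow> smooth_on U Y \<longrightarrow> smooth_on U (N X Y)) \<and>
     (\<forall>X X' Y. smooth_on U X \<longrightarrow> smooth_on U X' \<longrightarrow> smooth_on U Y \<longrightarrow>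
        (\<forall>p\<in>U. N (\<lambda>q. X q + X' q) Y p = N X Y p + N X' Y p)) \<and>
     (\<forall>X Y Y'. smooth_on U X \<longrightarrow> smooth_on U Y \<longrightarrow> smooth_on U Y' \<longrightarrow>
        (\<forall>p\<in>U. N X (\<lambda>q. Y q + Y' q) p = N X Y p + N X Y' p)) \<and>
     (\<forall>(g::'a \<Rightarrow> real) X Y. smooth_on U g \<longrightarrow> smooth_on U X \<longrightarrow> smooth_on U Y \<longrightarrow>
        (\<forall>p\<in>U. N (\<lambda>q. g q *\<^sub>R X q) Y p = g p *\<^sub>R N X Y p \<and>
           N X (\<lambda>q. g q *\<^sub>R Y q) p =
             frechet_derivative g (at p) (X p) *\<^sub>R Y p + g p *\<^sub>R N X Y p))"

definition parallel_on :: "'a::euclidean_space set \<Rightarrow> (('a \<Rightarrow> 'a) \<Rightarrow> ('a \<Rightarrow> 'a) \<Rightarrow> 'a \<Rightarrow> 'a) \<Rightarrow> ('a \<Rightarrow> 'a set) \<Rightarrow> bool" where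
  "parallel_on U N D \<longleftrightarrow>
     (\<forall>X Y. smooth_on U X \<longrightarrow> smooth_on U Y \<longrightarrow> (\<forall>p\<in>U. Y p \<in> D p) \<longrightarrow> (\<forall>p\<in>U. N X Y p \<in> D p))"

definition torsion :: "(('a::euclidean_space \<Rightarrow> 'a) \<Rightarrow> ('a \<Rightarrow> 'a) \<Rightarrow> 'a \<Rightarrow> 'a) \<Rightarrow> ('a \<Rightarrow> 'a) \<Rightarrow> ('a \<Rightarrow> 'a) \<Rightarrow> 'a \<Rightarrow> 'a" where
  "torsion N X Y p = N X Y p - N Y X p - lie_bracket X Y p"

definition curvature ::
  "(('a::euclidean_space \<Rightarrow> 'a) \<Rightarrow> ('a \<Rightarrow> 'a) \<Rightarrow> 'a \<Rightarrow> 'a) \<Rightarrow> ('a \<Rightarrow> 'a) \<Rightarrow> ('a \<Rightarrow> 'a) \<Rightarrow> ('a \<Rightarrow> 'a) \<Rightarrow> 'a \<Rightarrow> 'a" where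
  "curvature N X Y Z p = N X (N Y Z) p - N Y (N X Z) p - N (lie_bracket X Y) Z p"

text \<open>\<open>Ric(Y,Z)\<close> is the trace of \<open>X \<mapsto> R(X,Y)Z\<close>, computed in the standard frame.\<close>

definition ricci :: "(('a::euclidean_space \<Rightarrow> 'a) \<Rightarrow> ('a \<Rightarrow> 'a) \<Rightarrow> 'a \<Rightarrow> 'a) \<Rightarrow> ('a \<Rightarrow> 'a) \<Rightarrow> ('a \<Rightarrow> 'a) \<Rightarrow> 'a \<Rightarrow> real" where
  "ricci N Y Z p = (\<Sum>b\<in>Basis. curvature N (\<lambda>_. b) Y Z p \<bullet> b)"

definition chern_connection ::
  "'a::euclidean_space set \<Rightarrow> ('a \<Rightarrow> 'a set) \<Rightarrow> ('a \<Rightarrow> 'a set) \<Rightarrow> ('a \<Rightarrow> 'a set) \<Rightarrow>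
   (('a \<Rightarrow> 'a) \<Rightarrow> ('a \<Rightarrow> 'a) \<Rightarrow> 'a \<Rightarrow> 'a) \<Rightarrow> bool" where
  "chern_connection U T1 T2 T3 N \<longleftrightarrow> affine_connection_on U N \<and>
     parallel_on U N T1 \<and> parallel_on U N T2 \<and> parallel_on U N T3 \<and>
     (\<forall>X Y. smooth_on U X \<longrightarrow> smooth_on U Y \<longrightarrow> (\<forall>p\<in>U. X p \<in> T1 p \<and> Y p \<in> T2 p) \<longrightarrow>
        (\<forall>p\<in>U. torsion N X Y p = 0))"

text \<open>
  The Chern connection exists and is unique (on vector fields smooth on \<open>U\<close>, at points of
  \<open>U\<close>), so the existential quantifier just selects it.
\<close>

definition ricci_flat_on ::
  "'a::euclidean_space set \<Rightarrow> ('a \<Rightarrow> 'a \<Rightarrow> 'a) \<Rightarrow> ('a \<Rightarrow> 'a \<Rightarrow> 'a) \<Rightarrow> bool" where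
  "ricci_flat_on U I K \<longleftrightarrow>
     (\<exists>N. chern_connection U (eigendistribution I 1) (eigendistribution I (-1)) (eigendistribution K 1) N \<and>
        (\<forall>Y Z. smooth_on U Y \<longrightarrow> smooth_on U Z \<longrightarrow> (\<forall>p\<in>U. ricci N Y Z p = 0)))"


section \<open>Coordinates \<open>(x,y)\<close> and Lax tuples\<close>

text \<open>
  The index set \<open>{1,\<dots>,m}\<close> is a finite linearly ordered type \<open>'m\<close> with \<open>CARD('m) = m\<close>;
  \<open>idx\<close> gives the number of an index, which is only needed for signs.
\<close>

type_synonym 'm xy = "(real^'m) \<times> (real^'m)"

definition idx :: "'m::{finite,linorder} \<Rightarrow> nat" where
  "idx i = card {j. j \<le> i}"

definition ex :: "'m::finite \<Rightarrow> 'm xy" where "ex i = (axis i 1, 0)"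
definition ey :: "'m::finite \<Rightarrow> 'm xy" where "ey i = (0, axis i 1)"

definition dx :: "'m::finite \<Rightarrow> ('m xy \<Rightarrow> real) \<Rightarrow> 'm xy \<Rightarrow> real" where
  "dx i g p = frechet_derivative g (at p) (ex i)"

definition dy :: "'m::finite \<Rightarrow> ('m xy \<Rightarrow> real) \<Rightarrow> 'm xy \<Rightarrow> real" where
  "dy i g p = frechet_derivative g (at p) (ey i)"

definition smooth_germ :: "('m::finite xy \<Rightarrow> real) \<Rightarrow> bool" where
  "smooth_germ g \<longleftrightarrow> (\<exists>U. open U \<and> 0 \<in> U \<and> smooth_on U g)"

definition lax_field :: "('m::finite \<Rightarrow> 'm xy \<Rightarrow> real) \<Rightarrow> 'm \<Rightarrow> real \<Rightarrow> 'm xy \<Rightarrow> 'm xy" where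
  "lax_field R i t p = ex i + t *\<^sub>R ey i + t *\<^sub>R (\<Sum>j\<in>UNIV. dx i (R j) p *\<^sub>R ex j)"

text \<open>
  The vectors \<open>ex i\<close> and \<open>E i p\<close> form a basis for the tuples used here, so \<open>I\<close>, \<open>K\<close>, \<open>J\<close>
  are uniquely determined on \<open>W\<close>.
\<close>

definition structure_of_lax ::
  "'m::finite xy set \<Rightarrow> ('m \<Rightarrow> real \<Rightarrow> 'm xy \<Rightarrow> 'm xy) \<Rightarrow>
   ('m xy \<Rightarrow> 'm xy \<Rightarrow> 'm xy) \<Rightarrow> ('m xy \<Rightarrow> 'm xy \<Rightarrow> 'm xy) \<Rightarrow> ('m xy \<Rightarrow> 'm xy \<Rightarrow> 'm xy) \<Rightarrow> bool" where
  "structure_of_lax W L I K J \<longleftrightarrow>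
     (\<exists>E. \<forall>p\<in>W. (\<forall>i t. L i t p = ex i + t *\<^sub>R E i p) \<and>
        linear (I p) \<and> linear (K p) \<and>
        (\<forall>i. I p (ex i) = ex i \<and> I p (E i p) = - E i p \<and>
             K p (ex i) = E i p \<and> K p (E i p) = ex i) \<and>
        (\<forall>v. J p v = I p (K p v)))"


section \<open>Differential forms in the \<open>x\<close>-directions\<close>

text \<open>
  A form \<open>\<Sum>\<^sub>S a\<^sub>S \<And>\<^sub>s\<^sub>\<in>\<^sub>S dx\<^sub>s\<close> (indices increasing in each wedge product) is represented by its
  coefficients \<open>S \<mapsto> a\<^sub>S\<close>. Moving \<open>dx\<^sub>s\<close> into place in
  \<open>dx\<^sub>s \<and> \<And>\<^sub>r dx\<^sub>r\<close>, \<open>r \<in> T - {s}\<close>, costs one sign for each \<open>r < s\<close>.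
\<close>

type_synonym 'm xform = "'m set \<Rightarrow> 'm xy \<Rightarrow> real"

definition d_x :: "'m::{finite,linorder} xform \<Rightarrow> 'm xform" where
  "d_x a T p = (\<Sum>s\<in>T. (-1) ^ card {r\<in>T. r < s} * dx s (a (T - {s})) p)"

text \<open>
  Collections \<open>(f\<^sub>i\<^sub>j)\<close>, \<open>i < j\<close>, of germs of \<open>(m-3)\<close>-forms vanishing at \<open>x = 0\<close>; the coefficient
  \<open>f\<^sub>i\<^sub>j\<^sup>p\<^sup>q\<^sup>r\<close> is \<open>f i j (- {p,q,r})\<close>. If \<open>m = 2\<close> the degree condition forces \<open>f i j = 0\<close>.
\<close>

definition form_collection :: "('m::{finite,linorder} \<Rightarrow> 'm \<Rightarrow> 'm xform) \<Rightarrow> bool" where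
  "form_collection f \<longleftrightarrow> (\<forall>i j. i < j \<longrightarrow>
     (\<forall>S. smooth_germ (f i j S) \<and>
        (card S + 3 \<noteq> CARD('m) \<longrightarrow> f i j S = (\<lambda>_. 0)) \<and>
        (\<forall>\<^sub>F p in nhds 0. fst p = 0 \<longrightarrow> f i j S p = 0)))"


section \<open>The system\<close>

definition skew :: "('m::linorder \<Rightarrow> 'm \<Rightarrow> 'p \<Rightarrow> real) \<Rightarrow> 'm \<Rightarrow> 'm \<Rightarrow> 'p \<Rightarrow> real" where
  "skew \<theta> k l = (if k < l then \<theta> k l else if l < k then (\<lambda>p. - \<theta> l k p) else (\<lambda>_. 0))"

definition solves_system ::
  "('m::{finite,linorder} \<Rightarrow> 'm \<Rightarrow> 'm xform) \<Rightarrow> ('m \<Rightarrow> 'm \<Rightarrow> 'm xy \<Rightarrow> real) \<Rightarrow> bool" where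
  "solves_system f \<theta> \<longleftrightarrow>
     (\<forall>k l. k < l \<longrightarrow> smooth_germ (\<theta> k l)) \<and>
     (\<forall>\<^sub>F z in nhds 0. \<forall>i j k l. i < j \<longrightarrow> k < l \<longrightarrow>
        (\<Sum>p\<in>UNIV. \<Sum>q\<in>UNIV. (-1) ^ (idx p + idx q) *
           (dx i (dx p (skew \<theta> p l)) z * dx j (dx q (skew \<theta> q k)) z
            - dx j (dx p (skew \<theta> p l)) z * dx i (dx q (skew \<theta> q k)) z))
        = dy j (dx i (skew \<theta> k l)) z - dy i (dx j (skew \<theta> k l)) z + d_x (f i j) (- {k, l}) z)"

definition R_of :: "('m::{finite,linorder} \<Rightarrow> 'm \<Rightarrow> 'm xy \<Rightarrow> real) \<Rightarrow> 'm \<Rightarrow> 'm xy \<Rightarrow> real" where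
  "R_of \<theta> i p = (\<Sum>j\<in>UNIV - {i}. (-1) ^ (idx i + idx j + 1) * dx j (skew \<theta> j i) p)"

end

theory Submission
  imports Defs
begin

text \<open>
  Write \<open>A p w = \<Sum>\<^sub>i w\<^sub>i (\<partial>R\<^sup>j / \<partial>x\<^sub>i)\<^sub>j\<close>, so that \<open>E\<^sub>i = (A e\<^sub>i, e\<^sub>i)\<close>. The Lax fields commute iff
  \<open>\<partial>\<^sub>x A\<close> is symmetric and \<open>[E\<^sub>i, E\<^sub>j] = 0\<close>, and then the Chern connection is
  \<open>\<partial> - \<partial>\<^sub>x A\<close> in the frame \<open>\<partial>\<^sub>x, E\<close>; its Ricci tensor is the \<open>x\<close>-Hessian of \<open>trace A\<close>.
  The divergence \<open>trace A\<close> of \<open>R\<close> vanishes because \<open>R\<close> is the divergence of the skew field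
  \<open>(-1)\<^sup>i\<^sup>+\<^sup>j \<theta>\<^sub>i\<^sub>j\<close>, and by the system the commutator of \<open>E\<^sub>i\<close> and \<open>E\<^sub>j\<close> has the coefficients of
  \<open>d\<^sub>x d\<^sub>x f\<^sub>i\<^sub>j = 0\<close>. Integrability of the distributions \<open>{(A w, w)}\<close> is Frobenius' theorem.

  Conversely, first integrals of the eigendistributions of \<open>I\<close> yield coordinates in which the structure has
  this shape. Ricci-flatness makes \<open>trace A\<close> affine in \<open>x\<close>, with a closed linear part \<open>du\<close>; a change of
  \<open>y\<close> with Jacobian determinant \<open>exp (- u)\<close>, combined with a shear in \<open>x\<close>, removes the trace. The Poincare
  homotopy in the \<open>x\<close>-directions then provides \<open>R\<close>, \<open>\<theta>\<close> and the forms \<open>f\<close>, which vanish at \<open>x = 0\<close>.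
\<close>

section \<open>Calculus of smooth maps\<close>

text \<open>The analytic obstacle is the smooth dependence of leaves on their parameters. It is met
  by one integral equation over rays, a contraction on a small product of balls: the derivatives of
  its solution solve affine equations of the same kind, so every order of differentiability follows
  by induction. Integrability of \<open>J\<close> is not computed: a torsion-free connection for
  which \<open>J\<close> is parallel makes the Nijenhuis tensor cancel. The algebraic core is Hodge
  duality in \<open>x\<close>: forms of degree m - 1, m - 2, m - 3 become arrays with one, two,
  three indices, \<open>d_x\<close> becomes a divergence, and \<open>sg\<close>, \<open>sig\<close>
  are the signs of the duality. The radial homotopies carry the weights \<open>s^(m-2)\<close> and
  \<open>s^(m-3)\<close>; the second requires m \<ge> 3, so m = 2 is separate. In the converse the
  Chern connection is known only through its axioms on fields over all of \<open>U\<close>, while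
  the adapted frame lives on a chart; Christoffel symbols bridge the two. A change of
  \<open>y\<close> alters the linear part of the trace by the differential of the logarithm of its
  Jacobian determinant, whence the role of closedness and the exponential.\<close>

abbreviation FD :: "('a::real_normed_vector \<Rightarrow> 'b::real_normed_vector) \<Rightarrow> 'a \<Rightarrow> 'a \<Rightarrow> 'b" where
  "FD f p \<equiv> frechet_derivative f (at p)"

named_theorems Ck_intros
named_theorems smooth_intros

lemma FD_eqI: "(f has_derivative f') (at p) \<Longrightarrow> FD f p = f'"
  by (metis frechet_derivative_at)

lemma FD_cong:
  assumes "open U" "p \<in> U" "\<And>q. q \<in> U \<Longrightarrow> f q = g q"
  shows "FD f p = FD g p"
proof -
  have "(f has_derivative D) (at p) \<longleftrightarrow> (g has_derivative D) (at p)" for D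
    using assms has_derivative_transform_within_open by (metis (no_types, lifting))
  then show ?thesis unfolding frechet_derivative_def by simp
qed

section \<open>Closure rules for finite differentiability\<close>

lemma Ck_on_SucD: "Ck_on (Suc k) U f \<Longrightarrow> Ck_on k U f"
proof (induction k arbitrary: f)
  case 0
  then show ?case
    by (auto intro!: continuous_at_imp_continuous_on differentiable_imp_continuous_within)
next
  case (Suc k)
  have "Ck_on (Suc k) U (\<lambda>x. FD f x v)" for v using Suc.prems by simp
  then have "Ck_on k U (\<lambda>x. FD f x v)" for v by (rule Suc.IH)
  then show ?case using Suc.prems by simp
qed

lemma Ck_on_imp_continuous: "Ck_on k U f \<Longrightarrow> continuous_on U f"
  by (induction k) (auto dest: Ck_on_SucD simp del: Ck_on.simps(2))

lemma Ck_on_subset: "Ck_on k U f \<Longrightarrow> V \<subseteq> U \<Longrightarrow> Ck_on k V f"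
  by (induction k arbitrary: f) (auto intro: continuous_on_subset)

lemma Ck_on_cong:
  assumes "open U" "\<And>x. x \<in> U \<Longrightarrow> f x = g x" "Ck_on k U f"
  shows "Ck_on k U g"
  using assms(2,3)
proof (induction k arbitrary: f g)
  case 0
  then show ?case by (auto cong: continuous_on_cong)
next
  case (Suc k)
  have eq: "FD f x = FD g x" if "x \<in> U" for x using FD_cong[OF assms(1) that] Suc.prems by blast
  have "g differentiable (at x)" if "x \<in> U" for x
  proof -
    obtain D where "(f has_derivative D) (at x)" using Suc.prems \<open>x \<in> U\<close> by (auto simp: differentiable_def)
    then have "(g has_derivative D) (at x)"
      using has_derivative_transform_within_open assms(1) that Suc.prems(1) by metis
    then show ?thesis by (auto simp: differentiable_def)
  qed
  moreover have "Ck_on k U (\<lambda>x. FD g x v)" for v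
    using Suc.IH[of "\<lambda>x. FD f x v" "\<lambda>x. FD g x v"] eq Suc.prems by simp
  ultimately show ?case by simp
qed

text \<open>The derivative may be named by any convenient \<open>f'\<close>, so each closure rule
  below reduces to a differentiation rule plus the induction hypothesis.\<close>

lemma Ck_on_SucI:
  assumes "open U" "\<And>x. x \<in> U \<Longrightarrow> (f has_derivative f' x) (at x)" "\<And>v. Ck_on k U (\<lambda>x. f' x v)"
  shows "Ck_on (Suc k) U f"
proof -
  have "FD f x v = f' x v" if "x \<in> U" for x v using FD_eqI[OF assms(2)[OF that]] by simp
  then have "Ck_on k U (\<lambda>x. FD f x v)" for v
    using Ck_on_cong[OF assms(1) _ assms(3)[of v], of "\<lambda>x. FD f x v"] by simp
  then show ?thesis using assms(2) by (auto simp: differentiable_def)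
qed

lemma Ck_on_has_derivative: "Ck_on (Suc k) U f \<Longrightarrow> x \<in> U \<Longrightarrow> (f has_derivative FD f x) (at x)"
  by (auto simp: frechet_derivative_works)

lemma Ck_on_FD: "Ck_on (Suc k) U f \<Longrightarrow> Ck_on k U (\<lambda>x. FD f x v)"
  by simp

lemma Ck_on_mono: "Ck_on n U f \<Longrightarrow> k \<le> n \<Longrightarrow> Ck_on k U f"
  by (induction n) (auto simp: le_Suc_eq dest: Ck_on_SucD simp del: Ck_on.simps(2))

lemma Ck_on_const [Ck_intros]: "open U \<Longrightarrow> Ck_on k U (\<lambda>x. c)"
  by (induction k arbitrary: c) (auto intro!: Ck_on_SucI[where f'="\<lambda>_ _. 0"] simp del: Ck_on.simps(2))

lemma Ck_on_bounded_linear: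
  assumes "bounded_linear h" "open U" "Ck_on k U f"
  shows "Ck_on k U (\<lambda>x. h (f x))"
  using assms(3)
proof (induction k arbitrary: f)
  case 0
  then show ?case using assms(1) by (auto intro: bounded_linear.continuous_on)
next
  case (Suc k)
  show ?case
    by (rule Ck_on_SucI[OF assms(2) bounded_linear.has_derivative[OF assms(1) Ck_on_has_derivative[OF Suc.prems]]])
      (auto intro!: Suc.IH Ck_on_FD Suc.prems simp del: Ck_on.simps(2))
qed

lemma Ck_on_ident [Ck_intros]: "open U \<Longrightarrow> Ck_on k U (\<lambda>x. x)"
proof (cases k)
  case (Suc n)
  assume "open U"
  then show ?thesis unfolding Suc
    by (rule Ck_on_SucI[OF _ has_derivative_ident]) (rule Ck_on_const[OF \<open>open U\<close>])
qed simp

lemma Ck_on_add [Ck_intros]: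
  assumes "open U" "Ck_on k U f" "Ck_on k U g"
  shows "Ck_on k U (\<lambda>x. f x + g x)"
  using assms(2,3)
proof (induction k arbitrary: f g)
  case 0
  then show ?case by (auto intro: continuous_intros)
next
  case (Suc k)
  show ?case
    by (rule Ck_on_SucI[OF assms(1) has_derivative_add[OF Suc.prems[THEN Ck_on_has_derivative]]])
      (auto intro!: Suc.IH Ck_on_FD Suc.prems simp del: Ck_on.simps(2))
qed

lemma Ck_on_bilinear:
  assumes "bounded_bilinear h" "open U" "Ck_on k U f" "Ck_on k U g"
  shows "Ck_on k U (\<lambda>x. h (f x) (g x))"
  using assms(3,4)
proof (induction k arbitrary: f g)
  case 0
  then show ?case using assms(1) by (auto intro: bounded_bilinear.continuous_on)
next
  case (Suc k)
  note fg = Suc.prems Suc.prems[THEN Ck_on_SucD] Suc.prems[THEN Ck_on_FD]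
  show ?case
    by (rule Ck_on_SucI[OF assms(2) bounded_bilinear.FDERIV[OF assms(1) fg(1,2)[THEN Ck_on_has_derivative]]])
      (auto intro!: Ck_on_add Suc.IH fg assms(2) simp del: Ck_on.simps(2))
qed

lemma Ck_on_Pair [Ck_intros]:
  assumes "open U" "Ck_on k U f" "Ck_on k U g"
  shows "Ck_on k U (\<lambda>x. (f x, g x))"
  using assms(2,3)
proof (induction k arbitrary: f g)
  case 0
  then show ?case by (auto intro: continuous_intros)
next
  case (Suc k)
  show ?case
    by (rule Ck_on_SucI[OF assms(1) has_derivative_Pair[OF Suc.prems[THEN Ck_on_has_derivative]]])
      (auto intro!: Suc.IH Ck_on_FD Suc.prems simp del: Ck_on.simps(2))
qed

lemmas Ck_on_scaleR [Ck_intros] = Ck_on_bilinear[OF bounded_bilinear_scaleR]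
lemmas Ck_on_inner [Ck_intros] = Ck_on_bilinear[OF bounded_bilinear_inner]
lemmas Ck_on_mult [Ck_intros] = Ck_on_bilinear[OF bounded_bilinear_mult]
lemmas Ck_on_minus [Ck_intros] = Ck_on_bounded_linear[OF bounded_linear_minus[OF bounded_linear_ident]]
lemmas Ck_on_fst [Ck_intros] = Ck_on_bounded_linear[OF bounded_linear_fst]
lemmas Ck_on_snd [Ck_intros] = Ck_on_bounded_linear[OF bounded_linear_snd]

lemma Ck_on_diff [Ck_intros]: "open U \<Longrightarrow> Ck_on k U f \<Longrightarrow> Ck_on k U g \<Longrightarrow> Ck_on k U (\<lambda>x. f x - g x)"
  using Ck_on_add[of U k f "\<lambda>x. - g x"] Ck_on_minus[of U k g] by simp

lemma Ck_on_sum [Ck_intros]: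
  "open U \<Longrightarrow> (\<And>i. i \<in> I \<Longrightarrow> Ck_on k U (f i)) \<Longrightarrow> Ck_on k U (\<lambda>x. \<Sum>i\<in>I. f i x)"
  by (induction I rule: infinite_finite_induct) (auto intro!: Ck_intros)

lemma linear_expand:
  fixes L :: "'a::euclidean_space \<Rightarrow> 'b::real_vector"
  assumes "linear L"
  shows "L v = (\<Sum>b\<in>Basis. (v \<bullet> b) *\<^sub>R L b)"
  by (subst (1) euclidean_representation[of v, symmetric])
     (simp only: linear_sum[OF assms] linear_scale[OF assms])

lemma has_derivative_linear: "(f has_derivative D) F \<Longrightarrow> linear D"
  by (simp add: has_derivative_bounded_linear bounded_linear.linear)

text \<open>In the induction step the chain rule applies a varying linear map to a varying vector.
  Expanding that vector in \<open>Basis\<close> leaves a finite sum of products, to which the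
  hypothesis applies; hence the Euclidean source of \<open>f\<close>.\<close>

lemma Ck_on_compose:
  fixes f :: "'b::euclidean_space \<Rightarrow> 'c::real_normed_vector"
  assumes "open U" "open V" "Ck_on k V f" "Ck_on k U g" "g ` U \<subseteq> V"
  shows "Ck_on k U (\<lambda>x. f (g x))"
  using assms(3,4)
proof (induction k arbitrary: f)
  case 0
  then show ?case using assms(5) by (auto intro: continuous_on_compose2)
next
  case (Suc k)
  have gx: "g x \<in> V" if "x \<in> U" for x using that assms(5) by auto
  have D: "((\<lambda>x. f (g x)) has_derivative (\<lambda>v. \<Sum>b\<in>Basis. (FD g x v \<bullet> b) *\<^sub>R FD f (g x) b)) (at x)"
    if "x \<in> U" for x
  proof -
    have f: "(f has_derivative FD f (g x)) (at (g x))"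
      using Ck_on_has_derivative[OF Suc.prems(1) gx[OF that]] .
    have "((\<lambda>x. f (g x)) has_derivative (\<lambda>v. FD f (g x) (FD g x v))) (at x)"
      using diff_chain_at[OF Ck_on_has_derivative[OF Suc.prems(2) that] f] by (simp add: o_def)
    then show ?thesis
      by (rule has_derivative_eq_rhs) (rule ext, rule linear_expand[OF has_derivative_linear[OF f]])
  qed
  have *: "Ck_on k U (\<lambda>x. FD f (g x) b)" for b
    using Suc.IH[of "\<lambda>y. FD f y b"] Ck_on_FD[OF Suc.prems(1)] Ck_on_SucD[OF Suc.prems(2)] by blast
  show ?case
  proof (rule Ck_on_SucI[OF assms(1) D])
    fix v
    show "Ck_on k U (\<lambda>x. \<Sum>b\<in>Basis. (FD g x v \<bullet> b) *\<^sub>R FD f (g x) b)"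
      by (intro Ck_on_sum Ck_on_scaleR Ck_on_inner Ck_on_const assms(1) * Ck_on_FD Suc.prems)
  qed
qed

lemma Ck_on_exp: "Ck_on k (UNIV::real set) exp"
proof (induction k)
  case 0
  then show ?case by (auto intro: continuous_intros)
next
  case (Suc k)
  show ?case
    by (rule Ck_on_SucI[where f'="\<lambda>x v. v * exp x"])
      (auto intro!: derivative_eq_intros Ck_intros Suc simp del: Ck_on.simps(2))
qed

section \<open>Closure rules for smooth maps\<close>

lemma smooth_on_Ck: "smooth_on U f \<Longrightarrow> Ck_on k U f"
  by (simp add: smooth_on_def)

lemma smooth_on_subset: "smooth_on U f \<Longrightarrow> V \<subseteq> U \<Longrightarrow> smooth_on V f"
  by (auto simp: smooth_on_def intro: Ck_on_subset)

lemma smooth_on_cong: "open U \<Longrightarrow> (\<And>x. x \<in> U \<Longrightarrow> f x = g x) \<Longrightarrow> smooth_on U f \<Longrightarrow> smooth_on U g"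
  unfolding smooth_on_def using Ck_on_cong by metis

lemma smooth_has_derivative: "smooth_on U f \<Longrightarrow> x \<in> U \<Longrightarrow> (f has_derivative FD f x) (at x)"
  by (meson Ck_on_has_derivative smooth_on_def)

lemma smooth_linear_FD: "smooth_on U f \<Longrightarrow> x \<in> U \<Longrightarrow> linear (FD f x)"
  using has_derivative_linear smooth_has_derivative by blast

lemma smooth_imp_continuous: "smooth_on U f \<Longrightarrow> continuous_on U f"
  by (meson Ck_on_imp_continuous smooth_on_def)

lemma smooth_on_FD [smooth_intros]: "smooth_on U f \<Longrightarrow> smooth_on U (\<lambda>x. FD f x v)"
  unfolding smooth_on_def using Ck_on_FD by blast

lemma smooth_on_const [smooth_intros]: "open U \<Longrightarrow> smooth_on U (\<lambda>x. c)"
  and smooth_on_ident [smooth_intros]: "open U \<Longrightarrow> smooth_on U (\<lambda>x. x)"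
  and smooth_on_exp: "smooth_on UNIV (exp :: real \<Rightarrow> real)"
  by (auto simp: smooth_on_def intro: Ck_intros Ck_on_exp)

lemma smooth_on_bounded_linear:
  "bounded_linear h \<Longrightarrow> open U \<Longrightarrow> smooth_on U f \<Longrightarrow> smooth_on U (\<lambda>x. h (f x))"
  by (simp add: smooth_on_def Ck_on_bounded_linear)

lemma smooth_on_linear:
  fixes h :: "'b::euclidean_space \<Rightarrow> 'c::real_normed_vector"
  shows "linear h \<Longrightarrow> open U \<Longrightarrow> smooth_on U f \<Longrightarrow> smooth_on U (\<lambda>x. h (f x))"
  by (simp add: smooth_on_bounded_linear linear_conv_bounded_linear)

lemma smooth_on_bilinear:
  "bounded_bilinear h \<Longrightarrow> open U \<Longrightarrow> smooth_on U f \<Longrightarrow> smooth_on U g \<Longrightarrow> smooth_on U (\<lambda>x. h (f x) (g x))"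
  by (simp add: smooth_on_def Ck_on_bilinear)

lemma smooth_on_add [smooth_intros]: "open U \<Longrightarrow> smooth_on U f \<Longrightarrow> smooth_on U g \<Longrightarrow> smooth_on U (\<lambda>x. f x + g x)"
  and smooth_on_diff [smooth_intros]: "open U \<Longrightarrow> smooth_on U f \<Longrightarrow> smooth_on U g \<Longrightarrow> smooth_on U (\<lambda>x. f x - g x)"
  and smooth_on_Pair [smooth_intros]: "open U \<Longrightarrow> smooth_on U f \<Longrightarrow> smooth_on U g' \<Longrightarrow> smooth_on U (\<lambda>x. (f x, g' x))"
  by (simp_all add: smooth_on_def Ck_intros)

lemmas smooth_on_scaleR [smooth_intros] = smooth_on_bilinear[OF bounded_bilinear_scaleR]
lemmas smooth_on_inner [smooth_intros] = smooth_on_bilinear[OF bounded_bilinear_inner]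
lemmas smooth_on_mult [smooth_intros] = smooth_on_bilinear[OF bounded_bilinear_mult]
lemmas smooth_on_minus [smooth_intros] = smooth_on_bounded_linear[OF bounded_linear_minus[OF bounded_linear_ident]]
lemmas smooth_on_fst [smooth_intros] = smooth_on_bounded_linear[OF bounded_linear_fst]
lemmas smooth_on_snd [smooth_intros] = smooth_on_bounded_linear[OF bounded_linear_snd]

lemma smooth_on_sum [smooth_intros]:
  "open U \<Longrightarrow> (\<And>i. i \<in> I \<Longrightarrow> smooth_on U (f i)) \<Longrightarrow> smooth_on U (\<lambda>x. \<Sum>i\<in>I. f i x)"
  by (auto simp: smooth_on_def intro: Ck_on_sum)

lemma smooth_on_compose:
  fixes f :: "'b::euclidean_space \<Rightarrow> 'c::real_normed_vector"
  shows "smooth_on V f \<Longrightarrow> smooth_on U g \<Longrightarrow> open U \<Longrightarrow> open V \<Longrightarrow> (\<And>x. x \<in> U \<Longrightarrow> g x \<in> V) \<Longrightarrow>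
    smooth_on U (\<lambda>x. f (g x))"
  unfolding smooth_on_def using Ck_on_compose[of U V] by blast

text \<open>Operator families are required to be smooth at each fixed argument only; this rule
  admits a varying argument.\<close>

lemma smooth_on_linear_family:
  fixes L :: "'q::real_normed_vector \<Rightarrow> 'a::euclidean_space \<Rightarrow> 'b::real_normed_vector"
  assumes "open U" "\<And>q. q \<in> U \<Longrightarrow> linear (L q)" "\<And>b. smooth_on U (\<lambda>q. L q b)" "smooth_on U g"
  shows "smooth_on U (\<lambda>q. L q (g q))"
proof (rule smooth_on_cong[OF assms(1)])
  show "smooth_on U (\<lambda>q. \<Sum>b\<in>Basis. (g q \<bullet> b) *\<^sub>R L q b)"
    by (intro smooth_intros assms)
qed (rule linear_expand[OF assms(2), symmetric])

lemma smooth_on_FD2: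
  fixes f :: "'a::euclidean_space \<Rightarrow> 'b::real_normed_vector"
  assumes "open U" "smooth_on U f" "smooth_on U g"
  shows "smooth_on U (\<lambda>x. FD f x (g x))"
  using assms(1) smooth_linear_FD[OF assms(2)] smooth_on_FD[OF assms(2)] assms(3) by (rule smooth_on_linear_family)

lemma smooth_on_FD_compose:
  fixes f :: "'b::euclidean_space \<Rightarrow> 'c::real_normed_vector"
  assumes "smooth_on V f" "smooth_on U g" "open U" "open V" "\<And>x. x \<in> U \<Longrightarrow> g x \<in> V" "smooth_on U h"
  shows "smooth_on U (\<lambda>x. FD f (g x) (h x))"
  using assms(3) smooth_linear_FD[OF assms(1) assms(5)] smooth_on_compose[OF smooth_on_FD[OF assms(1)] assms(2-5)] assms(6)
  by (rule smooth_on_linear_family)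

lemma FD_compose:
  assumes "smooth_on V f" "g p \<in> V" "smooth_on U g" "p \<in> U"
  shows "FD (\<lambda>x. f (g x)) p v = FD f (g p) (FD g p v)"
proof -
  have "((\<lambda>x. f (g x)) has_derivative (\<lambda>v. FD f (g p) (FD g p v))) (at p)"
    using diff_chain_at[OF smooth_has_derivative[OF assms(3,4)] smooth_has_derivative[OF assms(1,2)]]
    by (simp add: o_def)
  then show ?thesis using FD_eqI by metis
qed

text \<open>\<open>Ck_on\<close> uses unrestricted derivatives, so \<open>g\<close> has to be
  controlled on a set \<Omega> containing the closed interval times \<open>Q\<close>, endpoints
  included. The Leibniz rule is applied on a ball, with the partial derivative packaged as a bounded
  operator.\<close>

lemma has_derivative_integral_param:
  fixes g :: "real \<times> 'q::euclidean_space \<Rightarrow> 'b::euclidean_space"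
  assumes \<Omega>: "{0..1} \<times> Q \<subseteq> \<Omega>" and Q: "open Q" and g: "Ck_on (Suc 0) \<Omega> g" and q: "q \<in> Q"
  shows "((\<lambda>q. integral {0..1} (\<lambda>s. g (s, q))) has_derivative (\<lambda>v. integral {0..1} (\<lambda>s. FD g (s, q) (0, v)))) (at q)"
proof -
  obtain r where r: "r > 0" "ball q r \<subseteq> Q" using Q q openE by blast
  define fx where "fx = (\<lambda>x t. Blinfun (\<lambda>v. FD g (t, x) (0, v)))"
  have in\<Omega>: "(t, x) \<in> \<Omega>" if "x \<in> ball q r" "t \<in> cbox 0 1" for x t
  proof -
    have "x \<in> Q" using that r by blast
    then show ?thesis using that(2) \<Omega> by auto
  qed
  have bl: "bounded_linear (\<lambda>v. FD g (t, x) (0, v))" if "x \<in> ball q r" "t \<in> cbox 0 1" for x t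
  proof -
    have "bounded_linear (FD g (t, x))"
      using Ck_on_has_derivative[OF g in\<Omega>[OF that]] has_derivative_bounded_linear by blast
    then show ?thesis
      by (rule bounded_linear_compose) (intro bounded_linear_Pair bounded_linear_zero bounded_linear_ident)
  qed
  have fx: "blinfun_apply (fx x t) v = FD g (t, x) (0, v)" if "x \<in> ball q r" "t \<in> cbox 0 1" for x t v
    unfolding fx_def by (simp add: bounded_linear_Blinfun_apply[OF bl[OF that]])
  have cont: "continuous_on (ball q r \<times> cbox 0 1) (\<lambda>(x, t). fx x t)"
  proof (rule continuous_on_blinfun_componentwise)
    fix i :: 'q
    have "continuous_on \<Omega> (\<lambda>z. FD g z (0, i))" using g by simp
    then have "continuous_on (ball q r \<times> cbox 0 1) (\<lambda>z. FD g (snd z, fst z) (0, i))"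
      by (rule continuous_on_compose2) (auto intro!: continuous_intros in\<Omega> simp: prod.case_eq_if)
    then show "continuous_on (ball q r \<times> cbox 0 1) (\<lambda>x. blinfun_apply (case x of (x, t) \<Rightarrow> fx x t) i)"
      by (rule continuous_on_eq) (auto simp: fx)
  qed
  have "((\<lambda>x. integral (cbox 0 1) (\<lambda>t. g (t, x))) has_derivative integral (cbox 0 1) (fx q)) (at q within ball q r)"
  proof (rule leibniz_rule[OF _ _ cont])
    fix x t assume x: "x \<in> ball q r" and t: "t \<in> cbox (0::real) 1"
    have "((\<lambda>x. g (t, x)) has_derivative (\<lambda>v. FD g (t, x) (0, v))) (at x)"
      using diff_chain_at[OF has_derivative_Pair[OF has_derivative_const has_derivative_ident]
        Ck_on_has_derivative[OF g in\<Omega>[OF x t]]] by (simp add: o_def)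
    moreover have "blinfun_apply (fx x t) = (\<lambda>v. FD g (t, x) (0, v))" by (rule ext) (rule fx[OF x t])
    ultimately show "((\<lambda>x. g (t, x)) has_derivative blinfun_apply (fx x t)) (at x within ball q r)"
      by (simp only: has_derivative_at_withinI)
  next
    fix x assume x: "x \<in> ball q r"
    have "continuous_on (cbox 0 1) (\<lambda>t. g (t, x))"
      by (rule continuous_on_compose2[OF Ck_on_imp_continuous[OF g]]) (auto intro!: continuous_intros in\<Omega>[OF x])
    then show "(\<lambda>t. g (t, x)) integrable_on cbox 0 1" by (rule integrable_continuous)
  qed (use r in auto)
  moreover have "blinfun_apply (integral (cbox 0 1) (fx q)) = (\<lambda>v. integral {0..1} (\<lambda>s. FD g (s, q) (0, v)))"
  proof
    fix v
    have "continuous_on (cbox 0 1) (\<lambda>t. case (q, t) of (x, t) \<Rightarrow> fx x t)"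
      by (rule continuous_on_compose2[OF cont]) (use r in \<open>auto intro!: continuous_intros\<close>)
    then have "fx q integrable_on cbox 0 1" by (intro integrable_continuous) simp
    then have "blinfun_apply (integral (cbox 0 1) (fx q)) v = integral (cbox 0 1) (\<lambda>s. blinfun_apply (fx q s) v)"
      by (rule blinfun_apply_integral)
    also have "\<dots> = integral {0..1} (\<lambda>s. FD g (s, q) (0, v))"
      unfolding interval_cbox by (rule integral_cong) (use r fx in auto)
    finally show "blinfun_apply (integral (cbox 0 1) (fx q)) v = integral {0..1} (\<lambda>s. FD g (s, q) (0, v))" .
  qed
  ultimately show ?thesis
    using r by (simp add: at_within_open[of q "ball q r"])
qed

lemma Ck_on_integral_param:
  fixes g :: "real \<times> 'q::euclidean_space \<Rightarrow> 'b::euclidean_space"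
  assumes "{0..1} \<times> Q \<subseteq> \<Omega>" "open Q" "Ck_on k \<Omega> g"
  shows "Ck_on k Q (\<lambda>q. integral {0..1} (\<lambda>s. g (s, q)))"
  using assms(3)
proof (induction k arbitrary: g)
  case 0
  then have "continuous_on \<Omega> g" by simp
  then have "continuous_on (Q \<times> cbox 0 1) (\<lambda>(q, s). g (s, q))"
    unfolding split_beta by (rule continuous_on_compose2) (use assms(1) in \<open>auto intro!: continuous_intros\<close>)
  then have "continuous_on Q (\<lambda>q. integral (cbox 0 1) (\<lambda>s. g (s, q)))" by (rule integral_continuous_on_param)
  then show ?case by simp
next
  case (Suc k)
  show ?case
    by (rule Ck_on_SucI[OF assms(2) has_derivative_integral_param[OF assms(1,2) Ck_on_mono[OF Suc.prems]]])
      (auto intro!: Suc.IH Ck_on_FD Suc.prems simp del: Ck_on.simps(2))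
qed

lemma smooth_on_integral_param:
  fixes g :: "real \<times> 'q::euclidean_space \<Rightarrow> 'b::euclidean_space"
  shows "{0..1} \<times> Q \<subseteq> \<Omega> \<Longrightarrow> open Q \<Longrightarrow> smooth_on \<Omega> g \<Longrightarrow> smooth_on Q (\<lambda>q. integral {0..1} (\<lambda>s. g (s, q)))"
  unfolding smooth_on_def by (blast intro: Ck_on_integral_param)

text \<open>With \<open>f (p + t w) - f p\<close> written as \<open>t\<close> times the mean of \<open>FD f _ w\<close> over the segment,
  differentiating along \<open>v\<close> under the integral and letting \<open>t\<close> tend to 0 exchanges the derivatives.\<close>

lemma FD_commute:
  fixes f :: "'a::euclidean_space \<Rightarrow> 'b::euclidean_space"
  assumes U: "open U" and f: "Ck_on (Suc (Suc 0)) U f" and p: "p \<in> U"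
  shows "FD (\<lambda>q. FD f q v) p w = FD (\<lambda>q. FD f q w) p v"
proof -
  obtain r where r: "r > 0" "ball p r \<subseteq> U" using U p openE by blast
  have f1: "Ck_on (Suc 0) U (\<lambda>q. FD f q x)" for x using f by simp
  have c1: "continuous_on U (\<lambda>q. FD (\<lambda>q. FD f q x) q y)" for x y using f1[of x] by simp
  have fd: "(f has_derivative FD f q) (at q)" if "q \<in> U" for q using Ck_on_has_derivative[OF f that] .
  have fd1: "((\<lambda>q. FD f q x) has_derivative FD (\<lambda>q. FD f q x) q) (at q)" if "q \<in> U" for q x
    using Ck_on_has_derivative[OF f1 that] .
  have lin: "linear (FD f q)" if "q \<in> U" for q using has_derivative_linear[OF fd[OF that]] .
  \<comment> \<open>This size keeps the segments that start in \<open>ball p (r/2)\<close> inside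
    \<open>ball p r\<close>.\<close>
  obtain \<delta> where d: "\<delta> > 0" "\<delta> * norm w < r / 2"
  proof
    show "r / (2 * (norm w + 1)) > 0" using r by (simp add: add_nonneg_pos)
    have "norm w + 1 > 0" by (simp add: add_nonneg_pos)
    then have "norm w / (norm w + 1) < 1" by simp
    then have "(r / 2) * (norm w / (norm w + 1)) < (r / 2) * 1" using r by (intro mult_strict_left_mono) auto
    then show "r / (2 * (norm w + 1)) * norm w < r / 2" by (simp add: mult.commute)
  qed
  define Q where "Q = ball p (r/2)"
  have seg: "q + (s * t) *\<^sub>R w \<in> U" if "q \<in> Q" "s \<in> {0..1}" "\<bar>t\<bar> \<le> \<delta>" for q s t
  proof -
    have "\<bar>s * t\<bar> \<le> 1 * \<bar>t\<bar>" using that(2) unfolding abs_mult by (intro mult_right_mono) auto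
    then have "\<bar>s * t\<bar> \<le> \<delta>" using that(3) by simp
    then have "norm ((s * t) *\<^sub>R w) < r / 2"
      using d(2) mult_right_mono[of "\<bar>s * t\<bar>" \<delta> "norm w"] by (simp add: abs_mult)
    moreover have "dist p q < r / 2" using that(1) by (simp add: Q_def)
    ultimately have "dist p (q + (s * t) *\<^sub>R w) < r"
      using norm_triangle_ineq4[of "p - q" "(s * t) *\<^sub>R w"] by (simp add: dist_norm algebra_simps)
    then show ?thesis using r by auto
  qed
  have main: "FD f (p + t *\<^sub>R w) v - FD f p v = t *\<^sub>R integral {0..1} (\<lambda>s. FD (\<lambda>q. FD f q w) (p + (s * t) *\<^sub>R w) v)"
    if t: "\<bar>t\<bar> \<le> \<delta>" for t
  proof -
    define \<Omega> where "\<Omega> = (\<lambda>z. snd z + (fst z * t) *\<^sub>R w) -` U"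
    define g where "g = (\<lambda>z. FD f (snd z + (fst z * t) *\<^sub>R w) w)"
    have oO: "open \<Omega>" unfolding \<Omega>_def by (intro open_vimage U continuous_intros)
    have sub: "{0..1} \<times> Q \<subseteq> \<Omega>" using seg t by (auto simp: \<Omega>_def)
    have ck: "Ck_on (Suc 0) \<Omega> (\<lambda>z. snd z + (fst z * t) *\<^sub>R w)"
      by (intro Ck_intros oO)
    have g: "Ck_on (Suc 0) \<Omega> g" unfolding g_def
      by (rule Ck_on_compose[OF oO U f1 ck]) (auto simp: \<Omega>_def)
    have gd: "FD g (s, q) (0, v) = FD (\<lambda>q. FD f q w) (q + (s * t) *\<^sub>R w) v" if "(s, q) \<in> \<Omega>" for s q
    proof -
      have "(g has_derivative (\<lambda>h. FD (\<lambda>q. FD f q w) (q + (s * t) *\<^sub>R w) (snd h + (fst h * t) *\<^sub>R w))) (at (s, q))"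
        unfolding g_def
        by (rule has_derivative_compose[where g="\<lambda>q. FD f q w" and f="\<lambda>z. snd z + (fst z * t) *\<^sub>R w", OF _ ])
          (use that fd1 in \<open>auto simp: \<Omega>_def intro!: derivative_eq_intros\<close>)
      from FD_eqI[OF this] show ?thesis by simp
    qed
    have ftc: "t *\<^sub>R integral {0..1} (\<lambda>s. g (s, q)) = f (q + t *\<^sub>R w) - f q" if q: "q \<in> Q" for q
    proof -
      have "((\<lambda>s. t *\<^sub>R FD f (q + (s * t) *\<^sub>R w) w) has_integral f (q + (1 * t) *\<^sub>R w) - f (q + (0 * t) *\<^sub>R w)) {0..1}"
      proof (rule fundamental_theorem_of_calculus)
        fix s :: real assume s: "s \<in> {0..1}"
        note U' = seg[OF q s t]
        have "((\<lambda>s. f (q + (s * t) *\<^sub>R w)) has_derivative (\<lambda>h. FD f (q + (s * t) *\<^sub>R w) ((h * t) *\<^sub>R w))) (at s)"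
          by (rule has_derivative_compose[where g=f and f="\<lambda>s. q + (s * t) *\<^sub>R w"])
            (use fd[OF U'] in \<open>auto intro!: derivative_eq_intros\<close>)
        then show "((\<lambda>s. f (q + (s * t) *\<^sub>R w)) has_vector_derivative t *\<^sub>R FD f (q + (s * t) *\<^sub>R w) w) (at s within {0..1})"
          unfolding has_vector_derivative_def
          by (simp add: linear_scale[OF lin[OF U']] has_derivative_at_withinI)
      qed simp
      from integral_unique[OF this] show ?thesis by (simp add: g_def)
    qed
    have d1: "((\<lambda>q. t *\<^sub>R integral {0..1} (\<lambda>s. g (s, q))) has_derivative (\<lambda>v. t *\<^sub>R integral {0..1} (\<lambda>s. FD g (s, p) (0, v)))) (at p)"
      using r by (intro has_derivative_scaleR_right has_derivative_integral_param[OF sub _ g]) (auto simp: Q_def)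
    \<comment> \<open>The same function, differentiated through the fundamental theorem instead of
      under the integral; uniqueness of the derivative then gives \<open>main\<close>.\<close>
    have d2: "((\<lambda>q. t *\<^sub>R integral {0..1} (\<lambda>s. g (s, q))) has_derivative (\<lambda>v. FD f (p + t *\<^sub>R w) v - FD f p v)) (at p)"
    proof (rule has_derivative_transform_within_open)
      have pt: "p + t *\<^sub>R w \<in> U" using seg[of p 1 t] t r by (simp add: Q_def)
      have "((\<lambda>q. f (q + t *\<^sub>R w)) has_derivative (\<lambda>v. FD f (p + t *\<^sub>R w) v)) (at p)"
        by (rule has_derivative_compose[where g=f and f="\<lambda>q. q + t *\<^sub>R w"])
          (use fd[OF pt] in \<open>auto intro!: derivative_eq_intros\<close>)
      then show "((\<lambda>q. f (q + t *\<^sub>R w) - f q) has_derivative (\<lambda>v. FD f (p + t *\<^sub>R w) v - FD f p v)) (at p)"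
        using fd[OF p] by (rule has_derivative_diff)
      show "open Q" "p \<in> Q" using r by (auto simp: Q_def)
    qed (use ftc in simp)
    have "FD f (p + t *\<^sub>R w) v - FD f p v = t *\<^sub>R integral {0..1} (\<lambda>s. FD g (s, p) (0, v))"
      by (rule fun_cong[OF has_derivative_unique[OF d2 d1]])
    moreover have "(s, p) \<in> \<Omega>" if "s \<in> {0..1}" for s
      by (rule subsetD[OF sub]) (use that r in \<open>auto simp: Q_def\<close>)
    then have "integral {0..1} (\<lambda>s. FD g (s, p) (0, v)) = integral {0..1} (\<lambda>s. FD (\<lambda>q. FD f q w) (p + (s * t) *\<^sub>R w) v)"
      by (intro integral_cong gd) auto
    ultimately show ?thesis by simp
  qed
  \<comment> \<open>At \<open>t = 0\<close> the integrand is constant in \<open>s\<close>, so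
    \<open>H 0\<close> is the right-hand side of the claim.\<close>
  define H where "H = (\<lambda>t. integral {0..1} (\<lambda>s. FD (\<lambda>q. FD f q w) (p + (s * t) *\<^sub>R w) v))"
  have "continuous_on ({-\<delta>..\<delta>} \<times> cbox 0 1) (\<lambda>(t, s). FD (\<lambda>q. FD f q w) (p + (s * t) *\<^sub>R w) v)"
    unfolding split_beta
    by (rule continuous_on_compose2[OF c1]) (use seg[of p] r in \<open>auto intro!: continuous_intros simp: Q_def abs_le_iff\<close>)
  from integral_continuous_on_param[OF this] have "continuous_on {-\<delta>..\<delta>} H" by (simp add: H_def)
  then have H0: "isCont H 0" using d by (intro continuous_on_interior) auto
  have "((\<lambda>t. FD f (p + t *\<^sub>R w) v) has_vector_derivative H 0) (at 0)"
    unfolding has_vector_derivative_def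
  proof (rule has_derivative_at2[THEN iffD2], intro conjI)
    show "bounded_linear (\<lambda>x. x *\<^sub>R H 0)" by (rule bounded_linear_scaleR_left)
    have "(\<lambda>t. norm (H t - H 0)) \<midarrow>0\<rightarrow> 0"
      using H0 by (simp add: isCont_def LIM_zero tendsto_norm_zero)
    then show "(\<lambda>y. (1 / norm (y - 0)) *\<^sub>R (FD f (p + y *\<^sub>R w) v - (FD f (p + 0 *\<^sub>R w) v + (y - 0) *\<^sub>R H 0))) \<midarrow>0\<rightarrow> 0"
    proof (rule Lim_null_comparison[rotated])
      show "\<forall>\<^sub>F y in at 0. norm ((1 / norm (y - 0)) *\<^sub>R (FD f (p + y *\<^sub>R w) v - (FD f (p + 0 *\<^sub>R w) v + (y - 0) *\<^sub>R H 0))) \<le> norm (H y - H 0)"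
        unfolding eventually_at
      proof (intro exI[of _ \<delta>] conjI d ballI impI)
        fix y :: real assume "y \<noteq> 0 \<and> dist y 0 < \<delta>"
        then have "FD f (p + y *\<^sub>R w) v - FD f p v = y *\<^sub>R H y" "y \<noteq> 0" using main[of y] by (auto simp: H_def)
        then have "FD f (p + y *\<^sub>R w) v - (FD f (p + 0 *\<^sub>R w) v + (y - 0) *\<^sub>R H 0) = y *\<^sub>R (H y - H 0)"
          by (simp add: algebra_simps)
        then show "norm ((1 / norm (y - 0)) *\<^sub>R (FD f (p + y *\<^sub>R w) v - (FD f (p + 0 *\<^sub>R w) v + (y - 0) *\<^sub>R H 0))) \<le> norm (H y - H 0)"
          using \<open>y \<noteq> 0\<close> by simp
      qed
    qed
  qed
  moreover have "((\<lambda>t. FD f (p + t *\<^sub>R w) v) has_vector_derivative FD (\<lambda>q. FD f q v) p w) (at 0)"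
  proof -
    have "((\<lambda>t. FD f (p + t *\<^sub>R w) v) has_derivative (\<lambda>h. FD (\<lambda>q. FD f q v) (p + 0 *\<^sub>R w) (h *\<^sub>R w))) (at 0)"
      by (rule has_derivative_compose[where g="\<lambda>q. FD f q v" and f="\<lambda>t. p + t *\<^sub>R w"])
        (use fd1[OF p] in \<open>auto intro!: derivative_eq_intros\<close>)
    then show ?thesis
      using linear_scale[OF has_derivative_linear[OF fd1[OF p]]] by (simp add: has_vector_derivative_def)
  qed
  ultimately have "H 0 = FD (\<lambda>q. FD f q v) p w" by (rule vector_derivative_unique_at)
  then show ?thesis by (simp add: H_def)
qed

lemma smooth_FD_commute:
  fixes f :: "'a::euclidean_space \<Rightarrow> 'b::euclidean_space"
  shows "open U \<Longrightarrow> smooth_on U f \<Longrightarrow> p \<in> U \<Longrightarrow> FD (\<lambda>q. FD f q v) p w = FD (\<lambda>q. FD f q w) p v"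
  by (rule FD_commute[of U]) (simp_all add: smooth_on_Ck del: Ck_on.simps)

text \<open>Continuity of \<open>m\<close> is enough because the scalar factor is of the order of
  \<open>norm (x - q)\<close>. This breaks the circle in differentiating an inverse, where
  \<open>m\<close> is the inverse itself.\<close>

lemma has_derivative_scaleR_vanishing:
  fixes s :: "'a::real_normed_vector \<Rightarrow> real" and m :: "'a \<Rightarrow> 'b::real_normed_vector"
  assumes s: "(s has_derivative s') (at q)" and 0: "s q = 0" and m: "isCont m q"
  shows "((\<lambda>x. s x *\<^sub>R m x) has_derivative (\<lambda>h. s' h *\<^sub>R m q)) (at q)"
proof -
  have bs: "bounded_linear s'" using s by (rule has_derivative_bounded_linear)
  obtain K where K: "K > 0" "\<And>h. norm (s' h) \<le> norm h * K" using bounded_linear.pos_bounded[OF bs] by blast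
  have "((\<lambda>x. s x *\<^sub>R (m x - m q)) has_derivative (\<lambda>h. 0)) (at q)"
    unfolding has_derivative_within_alt
  proof (intro conjI allI impI bounded_linear_zero)
    fix e :: real assume e: "e > 0"
    obtain d1 where d1: "d1 > 0" "\<And>y. norm (y - q) < d1 \<Longrightarrow> norm (s y - s q - s' (y - q)) \<le> 1 * norm (y - q)"
      using s unfolding has_derivative_within_alt by (metis UNIV_I zero_less_one)
    \<comment> \<open>Near \<open>q\<close>, \<open>s\<close> grows at most like
      \<open>K + 1\<close> times the distance: \<open>K\<close> from \<open>s'\<close>, 1 from the
      remainder.\<close>
    have "e / (K + 1) > 0" using e K by simp
    then obtain d2 where d2: "d2 > 0" "\<And>y. norm (y - q) < d2 \<Longrightarrow> norm (m y - m q) < e / (K + 1)"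
      using m unfolding isCont_def LIM_def dist_norm by (metis diff_self norm_zero)
    have "norm (s y *\<^sub>R (m y - m q)) \<le> e * norm (y - q)" if y: "norm (y - q) < min d1 d2" for y
    proof -
      have "norm (s y) \<le> norm (s y - s q - s' (y - q)) + norm (s' (y - q))"
        using 0 norm_triangle_ineq[of "s y - s q - s' (y - q)" "s' (y - q)"] by simp
      also have "\<dots> \<le> (K + 1) * norm (y - q)"
        using d1(2)[of y] K(2)[of "y - q"] y by (simp add: algebra_simps)
      finally have "norm (s y *\<^sub>R (m y - m q)) \<le> ((K + 1) * norm (y - q)) * (e / (K + 1))"
        unfolding norm_scaleR real_norm_def[symmetric] using d2(2)[of y] y K by (intro mult_mono) auto
      then show ?thesis using K by (simp add: mult.commute)
    qed
    then show "\<exists>d>0. \<forall>y\<in>UNIV. norm (y - q) < d \<longrightarrow> norm (s y *\<^sub>R (m y - m q) - s q *\<^sub>R (m q - m q) - 0) \<le> e * norm (y - q)"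
      using d1(1) d2(1) by (intro exI[of _ "min d1 d2"]) auto
  qed
  moreover have "((\<lambda>x. s x *\<^sub>R m q) has_derivative (\<lambda>h. s' h *\<^sub>R m q)) (at q)"
    using s by (rule has_derivative_scaleR_left)
  ultimately show ?thesis
    using has_derivative_add[of "\<lambda>x. s x *\<^sub>R (m x - m q)" "\<lambda>h. 0" "at q" "\<lambda>x. s x *\<^sub>R m q"]
    by (simp add: scaleR_diff_right)
qed

section \<open>Smooth families of inverse operators\<close>

lemma linear_of_inverse:
  assumes "linear L" "\<And>v. M (L v) = v" "\<And>w. L (M w) = w"
  shows "linear M"
proof
  show "M (x + y) = M x + M y" for x y
    using assms(2)[of "M x + M y"] assms(3) linear_add[OF assms(1), of "M x" "M y"] by simp
  show "M (c *\<^sub>R x) = c *\<^sub>R M x" for c x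
    using assms(2)[of "c *\<^sub>R M x"] assms(3) linear_scale[OF assms(1), of c "M x"] by simp
qed

text \<open>If \<open>L x\<close> is within \<open>1 / (2 * B)\<close> of \<open>L q\<close>, where
  \<open>B\<close> bounds \<open>M q\<close>, then \<open>norm v\<close> is at most
  \<open>2 * B\<close> times \<open>norm (L x v)\<close>. For \<open>v = M x w - M q w\<close> this
  bounds the variation of the inverse by that of \<open>L\<close>.\<close>

lemma continuous_linear_inverse:
  fixes L :: "'q::real_normed_vector \<Rightarrow> 'a::euclidean_space \<Rightarrow> 'b::euclidean_space"
  assumes U: "open U" and lin: "\<And>q. q \<in> U \<Longrightarrow> linear (L q)" and L: "\<And>v. continuous_on U (\<lambda>q. L q v)"
    and inv1: "\<And>q v. q \<in> U \<Longrightarrow> M q (L q v) = v" and inv2: "\<And>q w. q \<in> U \<Longrightarrow> L q (M q w) = w"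
    and q: "q \<in> U"
  shows "isCont (\<lambda>q. M q w) q"
proof -
  have linM: "linear (M x)" if "x \<in> U" for x using linear_of_inverse[OF lin[OF that]] inv1[OF that] inv2[OF that] by blast
  obtain B where B: "B > 0" "\<And>z. norm (M q z) \<le> B * norm z" using linear_bounded_pos[OF linM[OF q]] by blast
  have cL: "((\<lambda>x. L x v) \<longlongrightarrow> L q v) (at q)" for v
    using L[of v] q U by (simp add: continuous_on_eq_continuous_at isCont_def)
  have "((\<lambda>x. \<Sum>b\<in>Basis. norm (L x b - L q b)) \<longlongrightarrow> (\<Sum>b\<in>Basis. norm (L q b - L q b))) (at q)"
    by (intro tendsto_intros cL)
  then have lim0: "((\<lambda>x. \<Sum>b\<in>Basis. norm (L x b - L q b)) \<longlongrightarrow> 0) (at q)" by simp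
  have small: "\<forall>\<^sub>F x in at q. (\<Sum>b\<in>Basis. norm (L x b - L q b)) < 1 / (2 * B)"
    by (rule order_tendstoD(2)[OF lim0]) (use B in simp)
  have inU: "\<forall>\<^sub>F x in at q. x \<in> U" by (rule eventually_at_in_open'[OF U q])
  have bound: "norm v \<le> 2 * B * norm (L x v)" if x: "x \<in> U" "(\<Sum>b\<in>Basis. norm (L x b - L q b)) < 1 / (2 * B)" for x v
  proof -
    have "L x v - L q v = (\<Sum>b\<in>Basis. (v \<bullet> b) *\<^sub>R (L x b - L q b))"
      by (simp add: linear_expand[OF lin[OF x(1)], of v] linear_expand[OF lin[OF q], of v] scaleR_diff_right sum_subtractf)
    then have "norm (L x v - L q v) \<le> (\<Sum>b\<in>Basis. norm v * norm (L x b - L q b))"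
      by (auto intro!: sum_norm_le mult_right_mono Basis_le_norm)
    also have "\<dots> = norm v * (\<Sum>b\<in>Basis. norm (L x b - L q b))" by (simp add: sum_distrib_left)
    also have "\<dots> \<le> norm v * (1 / (2 * B))" using x(2) by (intro mult_left_mono) auto
    finally have d: "norm (L x v - L q v) \<le> norm v / (2 * B)" by simp
    have "norm v \<le> B * norm (L q v)" using B(2)[of "L q v"] inv1[OF q] by simp
    also have "\<dots> \<le> B * (norm (L x v) + norm v / (2 * B))"
      using d B norm_triangle_sub[of "L q v" "L x v"] by (intro mult_left_mono) (auto simp: norm_minus_commute)
    also have "\<dots> = B * norm (L x v) + norm v / 2" using B by (simp add: field_simps)
    finally show ?thesis by simp
  qed
  have "((\<lambda>x. 2 * B * norm (L q (M q w) - L x (M q w))) \<longlongrightarrow> 2 * B * norm (L q (M q w) - L q (M q w))) (at q)"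
    by (intro tendsto_intros cL)
  then have lim: "((\<lambda>x. 2 * B * norm (L q (M q w) - L x (M q w))) \<longlongrightarrow> 0) (at q)" by simp
  have "\<forall>\<^sub>F x in at q. norm (M x w - M q w) \<le> 2 * B * norm (L q (M q w) - L x (M q w))"
    using small inU
  proof eventually_elim
    case (elim x)
    have "L x (M x w - M q w) = L q (M q w) - L x (M q w)"
      using linear_diff[OF lin[OF elim(2)]] inv2 elim(2) q by simp
    then show ?case using bound[OF elim(2,1), of "M x w - M q w"] by simp
  qed
  from Lim_null_comparison[OF this lim] show ?thesis unfolding isCont_def by (simp add: LIM_zero_iff)
qed

text \<open>With \<open>u = M x w\<close> one has \<open>M q w = u - M q ((L q - L x) u)\<close>,
  whose coordinate factors vanish at \<open>q = x\<close>. So continuity of \<open>M\<close> already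
  yields the derivative \<open>- M (dL) M w\<close>, called \<open>D\<close>, and the order is
  raised by induction.\<close>

lemma Ck_on_linear_inverse:
  fixes L :: "'q::real_normed_vector \<Rightarrow> 'a::euclidean_space \<Rightarrow> 'b::euclidean_space"
  assumes U: "open U" and lin: "\<And>q. q \<in> U \<Longrightarrow> linear (L q)" and L: "\<And>v. Ck_on k U (\<lambda>q. L q v)"
    and inv1: "\<And>q v. q \<in> U \<Longrightarrow> M q (L q v) = v" and inv2: "\<And>q w. q \<in> U \<Longrightarrow> L q (M q w) = w"
  shows "Ck_on k U (\<lambda>q. M q w)"
  using L
proof (induction k arbitrary: w)
  case 0
  then show ?case
    using continuous_linear_inverse[where L=L, OF U lin _ inv1 inv2] by (auto intro!: continuous_at_imp_continuous_on)
next
  case (Suc k)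
  have IH: "Ck_on k U (\<lambda>q. M q z)" for z using Suc.IH[OF Ck_on_SucD[OF Suc.prems]] .
  have linM: "linear (M x)" if "x \<in> U" for x using linear_of_inverse[OF lin[OF that]] inv1[OF that] inv2[OF that] by blast
  have cM: "isCont (\<lambda>q. M q z) x" if "x \<in> U" for x z
    using continuous_linear_inverse[where L=L, OF U lin Ck_on_imp_continuous[OF Suc.prems] inv1 inv2 that] by blast
  define D where "D = (\<lambda>x v. - (\<Sum>c\<in>Basis. ((\<Sum>b\<in>Basis. (M x w \<bullet> b) *\<^sub>R FD (\<lambda>q. L q b) x v) \<bullet> c) *\<^sub>R M x c))"
  have "((\<lambda>q. M q w) has_derivative D x) (at x)" if x: "x \<in> U" for x
  proof -
    define u where "u = M x w"
    define s where "s = (\<lambda>c q. ((\<Sum>b\<in>Basis. (u \<bullet> b) *\<^sub>R (L q b - L x b)) \<bullet> c))"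
    have "((\<lambda>q. - (\<Sum>c\<in>Basis. s c q *\<^sub>R M q c)) has_derivative D x) (at x)"
      unfolding D_def u_def[symmetric]
    proof (intro has_derivative_minus has_derivative_sum has_derivative_scaleR_vanishing cM x)
      fix c :: 'b
      have "(s c has_derivative (\<lambda>v. (\<Sum>b\<in>Basis. (u \<bullet> b) *\<^sub>R (FD (\<lambda>q. L q b) x v - 0)) \<bullet> c)) (at x)"
        unfolding s_def
        by (intro has_derivative_inner_left has_derivative_sum has_derivative_scaleR_right has_derivative_diff
            has_derivative_const Ck_on_has_derivative[OF Suc.prems x])
      then show "(s c has_derivative (\<lambda>v. (\<Sum>b\<in>Basis. (u \<bullet> b) *\<^sub>R FD (\<lambda>q. L q b) x v) \<bullet> c)) (at x)" by simp
    qed (simp add: s_def)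
    then have "((\<lambda>q. u - (\<Sum>c\<in>Basis. s c q *\<^sub>R M q c)) has_derivative D x) (at x)"
      using has_derivative_add[OF has_derivative_const[of u]] by fastforce
    then show ?thesis
    proof (rule has_derivative_transform_within_open[OF _ U x])
      fix y assume y: "y \<in> U"
      have "(\<Sum>b\<in>Basis. (u \<bullet> b) *\<^sub>R (L y b - L x b)) = L y u - L x u"
        by (simp add: linear_expand[OF lin[OF x], of u] linear_expand[OF lin[OF y], of u] scaleR_diff_right sum_subtractf)
      then have "(\<Sum>c\<in>Basis. s c y *\<^sub>R M y c) = M y (L y u - L x u)"
        unfolding s_def by (simp add: linear_expand[OF linM[OF y], of "L y u - L x u"])
      also have "\<dots> = u - M y w" using linear_diff[OF linM[OF y]] inv1[OF y] inv2[OF x] by (simp add: u_def)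
      finally show "u - (\<Sum>c\<in>Basis. s c y *\<^sub>R M y c) = M y w" by simp
    qed
  qed
  moreover have "Ck_on k U (\<lambda>x. D x v)" for v
    unfolding D_def by (intro Ck_intros U IH Ck_on_FD Suc.prems)
  ultimately show ?case by (intro Ck_on_SucI[OF U]) auto
qed

lemma smooth_on_linear_inverse:
  fixes L :: "'q::real_normed_vector \<Rightarrow> 'a::euclidean_space \<Rightarrow> 'b::euclidean_space"
  assumes "open U" "\<And>q. q \<in> U \<Longrightarrow> linear (L q)" "\<And>v. smooth_on U (\<lambda>q. L q v)"
    "\<And>q v. q \<in> U \<Longrightarrow> M q (L q v) = v" "\<And>q w. q \<in> U \<Longrightarrow> L q (M q w) = w"
  shows "smooth_on U (\<lambda>q. M q w)"
  unfolding smooth_on_def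
  using Ck_on_linear_inverse[where L=L, OF assms(1,2) smooth_on_Ck[OF assms(3)] assms(4,5)] by blast

section \<open>Diffeomorphisms with a named target and inverse\<close>

definition diffeo_between :: "'a::real_normed_vector set \<Rightarrow> ('a \<Rightarrow> 'b::real_normed_vector) \<Rightarrow> 'b set \<Rightarrow> ('b \<Rightarrow> 'a) \<Rightarrow> bool" where
  "diffeo_between V \<phi> W \<psi> \<longleftrightarrow> open V \<and> open W \<and> smooth_on V \<phi> \<and> smooth_on W \<psi> \<and>
     (\<forall>q\<in>V. \<phi> q \<in> W \<and> \<psi> (\<phi> q) = q) \<and> (\<forall>p\<in>W. \<psi> p \<in> V \<and> \<phi> (\<psi> p) = p)"

lemma diffeo_between_sym: "diffeo_between V \<phi> W \<psi> \<Longrightarrow> diffeo_between W \<psi> V \<phi>"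
  by (auto simp: diffeo_between_def)

lemma diffeo_between_image: "diffeo_between V \<phi> W \<psi> \<Longrightarrow> \<phi> ` V = W"
  unfolding diffeo_between_def by force

lemma diffeo_between_onto_image: "diffeo_between V \<phi> W \<psi> \<Longrightarrow> diffeo_onto_image V \<phi>"
  using diffeo_between_image[of V \<phi> W \<psi>] unfolding diffeo_onto_image_def diffeo_between_def by auto

lemma diffeo_onto_imageE:
  assumes "diffeo_onto_image V \<phi>"
  obtains \<psi> where "diffeo_between V \<phi> (\<phi> ` V) \<psi>"
proof -
  obtain \<psi> where "smooth_on (\<phi> ` V) \<psi>" "\<forall>q\<in>V. \<psi> (\<phi> q) = q"
    using assms unfolding diffeo_onto_image_def by blast
  then show thesis using assms by (intro that[of \<psi>]) (auto simp: diffeo_onto_image_def diffeo_between_def)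
qed

lemma diffeo_between_FD:
  assumes "diffeo_between V \<phi> W \<psi>" "q \<in> V"
  shows "FD \<psi> (\<phi> q) (FD \<phi> q v) = v" "FD \<phi> q (FD \<psi> (\<phi> q) w) = w"
proof -
  have *: "FD \<psi> (\<phi> q) (FD \<phi> q v) = v" if "diffeo_between V \<phi> W \<psi>" "q \<in> V" for V W \<phi> \<psi> q v
  proof -
    have "FD (\<lambda>q. \<psi> (\<phi> q)) q v = FD \<psi> (\<phi> q) (FD \<phi> q v)"
      using that by (intro FD_compose[of W _ _ _ V]) (auto simp: diffeo_between_def)
    moreover have "FD (\<lambda>q. \<psi> (\<phi> q)) q = FD (\<lambda>q. q) q"
      using that by (intro FD_cong[of V]) (auto simp: diffeo_between_def)
    ultimately show ?thesis using FD_eqI[OF has_derivative_ident] by metis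
  qed
  show "FD \<psi> (\<phi> q) (FD \<phi> q v) = v" using *[OF assms] .
  show "FD \<phi> q (FD \<psi> (\<phi> q) w) = w"
    using *[OF diffeo_between_sym[OF assms(1)], of "\<phi> q" w] assms by (auto simp: diffeo_between_def)
qed

lemma diffeo_between_restrict:
  assumes "diffeo_between V \<phi> W \<psi>" "open V'" "V' \<subseteq> V"
  shows "diffeo_between V' \<phi> (\<phi> ` V') \<psi>"
proof -
  have eq: "\<phi> ` V' = W \<inter> \<psi> -` V'" using assms unfolding diffeo_between_def by force
  have "continuous_on W \<psi>" "open W" using assms(1) by (auto simp: diffeo_between_def smooth_imp_continuous)
  then have "open (\<phi> ` V')" unfolding eq using assms(2) by (rule continuous_open_preimage)
  moreover have "smooth_on V' \<phi>" "smooth_on (\<phi> ` V') \<psi>"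
    using assms eq by (auto simp: diffeo_between_def intro: smooth_on_subset)
  ultimately show ?thesis using assms unfolding diffeo_between_def by fastforce
qed

text \<open>Makes the target a ball: the homotopies on chart images need sets that are stable under
  scaling in \<open>x\<close>.\<close>

lemma diffeo_between_restrict_ball:
  assumes "diffeo_between V \<phi> W \<psi>" "p \<in> V" "open V'" "p \<in> V'"
  obtains r where "r > 0" "ball (\<phi> p) r \<subseteq> W" "diffeo_between (\<psi> ` ball (\<phi> p) r) \<phi> (ball (\<phi> p) r) \<psi>"
    "p \<in> \<psi> ` ball (\<phi> p) r" "\<psi> ` ball (\<phi> p) r \<subseteq> V \<inter> V'"
proof -
  have V: "open (V \<inter> V')" "V \<inter> V' \<subseteq> V" "p \<in> V \<inter> V'" using assms by (auto simp: diffeo_between_def)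
  note d = diffeo_between_restrict[OF assms(1) V(1,2)]
  then have "open (\<phi> ` (V \<inter> V'))" "\<phi> p \<in> \<phi> ` (V \<inter> V')" using V by (auto simp: diffeo_between_def)
  then obtain r where r: "r > 0" "ball (\<phi> p) r \<subseteq> \<phi> ` (V \<inter> V')" by (meson openE)
  show ?thesis
  proof (rule that[OF r(1)])
    show "diffeo_between (\<psi> ` ball (\<phi> p) r) \<phi> (ball (\<phi> p) r) \<psi>"
      by (rule diffeo_between_sym) (rule diffeo_between_restrict[OF diffeo_between_sym[OF d]], use r in auto)
    have "\<psi> (\<phi> p) = p" using assms by (auto simp: diffeo_between_def)
    then show "p \<in> \<psi> ` ball (\<phi> p) r" using r by (metis centre_in_ball image_eqI)
    show "\<psi> ` ball (\<phi> p) r \<subseteq> V \<inter> V'" using r d by (force simp: diffeo_between_def)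
    show "ball (\<phi> p) r \<subseteq> W" using r(2) assms(1) by (force simp: diffeo_between_def)
  qed
qed

text \<open>The inverse function theorem yields an inverse \<open>h\<close> with derivative
  \<open>inv (FD \<phi> (h y))\<close>. If \<open>h\<close> is of class \<open>k\<close>, so is this
  derivative by \<open>Ck_on_linear_inverse\<close>, hence \<open>h\<close> is of class
  \<open>k + 1\<close>.\<close>

lemma local_diffeo:
  fixes \<phi> :: "'a::euclidean_space \<Rightarrow> 'a"
  assumes U: "open U" and sm: "smooth_on U \<phi>" and p: "p \<in> U" and inj: "\<And>v. FD \<phi> p v = 0 \<Longrightarrow> v = 0"
  obtains V W \<psi> where "diffeo_between V \<phi> W \<psi>" "p \<in> V" "V \<subseteq> U"
proof -
  define f' where "f' = (\<lambda>x. Blinfun (FD \<phi> x))"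
  have bl: "bounded_linear (FD \<phi> x)" if "x \<in> U" for x
    using smooth_has_derivative[OF sm that] by (rule has_derivative_bounded_linear)
  have f'[simp]: "blinfun_apply (f' x) = FD \<phi> x" if "x \<in> U" for x
    using bounded_linear_Blinfun_apply[OF bl[OF that]] by (simp add: f'_def)
  have lin: "linear (FD \<phi> x)" if "x \<in> U" for x using bl[OF that] by (rule bounded_linear.linear)
  have "inj (FD \<phi> p)" using inj lin[OF p] by (simp add: linear_injective_0)
  then obtain g where g: "linear g" "\<And>x. g (FD \<phi> p x) = x" "\<And>x. FD \<phi> p (g x) = x"
    using linear_injective_isomorphism[OF lin[OF p]] by blast
  have cont: "continuous_on U f'"
  proof (rule continuous_on_blinfun_componentwise)
    fix i :: 'a
    have "continuous_on U (\<lambda>x. FD \<phi> x i)" by (rule smooth_imp_continuous[OF smooth_on_FD[OF sm]])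
    then show "continuous_on U (\<lambda>x. blinfun_apply (f' x) i)" by (rule continuous_on_eq) simp
  qed
  have id: "Blinfun g o\<^sub>L f' p = id_blinfun"
  proof (rule blinfun_eqI)
    fix i
    have "blinfun_apply (Blinfun g) = g"
      using g(1) by (simp add: bounded_linear_Blinfun_apply linear_conv_bounded_linear)
    then show "blinfun_apply (Blinfun g o\<^sub>L f' p) i = blinfun_apply id_blinfun i" using g p by simp
  qed
  obtain U' V h h' where h: "open U'" "U' \<subseteq> U" "p \<in> U'" "open V" "\<phi> p \<in> V" "homeomorphism U' V \<phi> h"
      "\<And>y. y \<in> V \<Longrightarrow> (h has_derivative (h' y)) (at y)"
      "\<And>y. y \<in> V \<Longrightarrow> h' y = inv (blinfun_apply (f' (h y)))"
      "\<And>y. y \<in> V \<Longrightarrow> bij (blinfun_apply (f' (h y)))"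
    using inverse_function_theorem[OF U _ cont p id] smooth_has_derivative[OF sm] f' by (metis (no_types, lifting))
  have hU: "h y \<in> U'" if "y \<in> V" for y using h(6) that by (auto simp: homeomorphism_def)
  have hU2: "h y \<in> U" if "y \<in> V" for y using hU[OF that] h(2) by blast
  have hd: "(h has_derivative inv (FD \<phi> (h y))) (at y)" and bij: "bij (FD \<phi> (h y))" if "y \<in> V" for y
    using h(7-9)[OF that] hU2[OF that] by auto
  have "Ck_on k V h" for k
  proof (induction k)
    case 0
    then show ?case using h(6) by (simp add: homeomorphism_def)
  next
    case (Suc k)
    have "Ck_on k V (\<lambda>y. inv (FD \<phi> (h y)) w)" for w
    proof (rule Ck_on_linear_inverse[OF h(4), where L="\<lambda>y. FD \<phi> (h y)"])
      show "Ck_on k V (\<lambda>q. FD \<phi> (h q) v)" for v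
        by (rule Ck_on_compose[OF h(4) U smooth_on_Ck[OF smooth_on_FD[OF sm]] Suc]) (use hU2 in auto)
    qed (use lin hU2 bij in \<open>auto simp: bij_is_inj bij_is_surj surj_f_inv_f\<close>)
    then show ?case using hd by (intro Ck_on_SucI[OF h(4)]) auto
  qed
  then have "smooth_on V h" by (simp add: smooth_on_def)
  moreover have "smooth_on U' \<phi>" using sm h(2) by (rule smooth_on_subset)
  ultimately have "diffeo_between U' \<phi> V h"
    using h(1,4,6) unfolding diffeo_between_def homeomorphism_def by auto
  then show ?thesis using that h by blast
qed

lemma diffeo_between_compose:
  fixes \<phi> :: "'a::euclidean_space \<Rightarrow> 'b::euclidean_space" and \<phi>' :: "'b \<Rightarrow> 'c::euclidean_space"
  assumes "diffeo_between V \<phi> W \<psi>" "diffeo_between W \<phi>' X \<psi>'"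
  shows "diffeo_between V (\<lambda>q. \<phi>' (\<phi> q)) X (\<lambda>p. \<psi> (\<psi>' p))"
  using assms smooth_on_compose[of W \<phi>' V \<phi>] smooth_on_compose[of W \<psi> X \<psi>'] unfolding diffeo_between_def by auto

section \<open>A contracting integral equation\<close>

text \<open>The first component is the starting point of a leaf and stays fixed; the second is the
  end of the ray along which one integrates.\<close>

definition scl :: "real \<Rightarrow> 'a::real_normed_vector \<times> 'b::real_normed_vector \<Rightarrow> 'a \<times> 'b" where
  "scl s q = (fst q, s *\<^sub>R snd q)"

lemma scl_scl [simp]: "scl s (scl t q) = scl (s * t) q" and scl_1 [simp]: "scl 1 q = q"
  by (simp_all add: scl_def)

lemma continuous_on_scl [continuous_intros]:
  "continuous_on S f \<Longrightarrow> continuous_on S g \<Longrightarrow> continuous_on S (\<lambda>x. scl (f x) (g x))"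
  unfolding scl_def by (intro continuous_intros)

lemma Ck_on_scl [Ck_intros]:
  "open S \<Longrightarrow> Ck_on k S f \<Longrightarrow> Ck_on k S g \<Longrightarrow> Ck_on k S (\<lambda>x. scl (f x) (g x))"
  unfolding scl_def by (intro Ck_intros)

text \<open>Basis vectors are eigenvectors of \<open>scl s\<close>; \<open>scl_ev\<close> is the eigenvalue.\<close>

definition scl_ev :: "'a::real_normed_vector \<times> 'b::real_normed_vector \<Rightarrow> real \<Rightarrow> real" where
  "scl_ev v s = (if snd v = 0 then 1 else s)"

lemma scl_Basis: "v \<in> Basis \<Longrightarrow> scl s v = scl_ev v s *\<^sub>R v"
  by (auto simp: Basis_prod_def scl_def scl_ev_def)

lemma Ck_on_scl_ev [Ck_intros]: "open S \<Longrightarrow> Ck_on k S f \<Longrightarrow> Ck_on k S (\<lambda>x. scl_ev v (f x))"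
  unfolding scl_ev_def by (cases "snd v = 0") (simp_all add: Ck_on_const)

lemma scl_ev_le: "s \<in> {0..1} \<Longrightarrow> \<bar>scl_ev v s\<bar> \<le> 1"
  by (auto simp: scl_ev_def)

definition scl_stable :: "('a::real_normed_vector \<times> 'b::real_normed_vector) set \<Rightarrow> bool" where
  "scl_stable K \<longleftrightarrow> (\<forall>q\<in>K. \<forall>s\<in>{0..1}. scl s q \<in> K)"

text \<open>The Picard map. Time is absorbed into the parameter: the unknown at \<open>q\<close> is
  determined by its values at the points \<open>scl s q\<close> of the ray to
  \<open>q\<close>.\<close>

definition pic :: "('a::euclidean_space \<times> 'b::euclidean_space \<Rightarrow> 'c) \<Rightarrow> (real \<times> ('a \<times> 'b) \<times> 'c \<Rightarrow> 'c) \<Rightarrow>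
    ('a \<times> 'b \<Rightarrow> 'c) \<Rightarrow> 'a \<times> 'b \<Rightarrow> 'c::euclidean_space" where
  "pic b h u q = b q + integral {0..1} (\<lambda>s. h (s, q, u (scl s q)))"

text \<open>Iterates are bounded only on compact sets. \<open>exhaust\<close> supplies compact sets
  on which the recursion closes up; convexity is for the theorem on differentiating a limit.\<close>

locale star_domain =
  fixes Q :: "('a::euclidean_space \<times> 'b::euclidean_space) set"
  assumes open_Q: "open Q"
    and stable_Q: "scl_stable Q"
    and exhaust: "q \<in> Q \<Longrightarrow> \<exists>K. compact K \<and> convex K \<and> K \<subseteq> Q \<and> q \<in> interior K \<and> scl_stable K"
begin

lemma scl_in: "q \<in> Q \<Longrightarrow> s \<in> {0..1} \<Longrightarrow> scl s q \<in> Q"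
  using stable_Q by (simp add: scl_stable_def)

end

lemma star_domain_balls:
  assumes "\<rho> > 0" "\<epsilon> > 0"
  shows "star_domain (ball (0::'a::euclidean_space) \<rho> \<times> ball (0::'b::euclidean_space) \<epsilon>)"
proof
  have le: "s * norm x \<le> norm x" if "0 \<le> s" "s \<le> 1" for s and x :: 'b
    using that mult_right_mono[of s 1 "norm x"] by auto
  show "open (ball (0::'a) \<rho> \<times> ball (0::'b) \<epsilon>)" by (intro open_Times open_ball)
  show "scl_stable (ball (0::'a) \<rho> \<times> ball (0::'b) \<epsilon>)"
    by (auto simp: scl_stable_def scl_def intro: le_less_trans[OF le])
  fix q :: "'a \<times> 'b" assume q: "q \<in> ball 0 \<rho> \<times> ball 0 \<epsilon>"
  obtain r where r: "norm (fst q) < r" "r < \<rho>" using q dense[of "norm (fst q)" \<rho>] by auto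
  obtain e where e: "norm (snd q) < e" "e < \<epsilon>" using q dense[of "norm (snd q)" \<epsilon>] by auto
  let ?K = "cball (0::'a) r \<times> cball (0::'b) e"
  show "\<exists>K. compact K \<and> convex K \<and> K \<subseteq> ball 0 \<rho> \<times> ball 0 \<epsilon> \<and> q \<in> interior K \<and> scl_stable K"
  proof (intro exI[of _ ?K] conjI)
    show "compact ?K" "convex ?K" by (auto intro: compact_Times convex_Times)
    show "?K \<subseteq> ball 0 \<rho> \<times> ball 0 \<epsilon>" using r e by auto
    show "q \<in> interior ?K" using r e by (cases q) (simp add: interior_Times)
    show "scl_stable ?K" by (auto simp: scl_stable_def scl_def intro: order_trans[OF le])
  qed
qed

text \<open>The factor 1/2 in \<open>h_lip\<close> is the contraction constant, as the interval of
  integration has length 1. \<open>X\<close> confines the values to where \<open>h\<close> is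
  controlled; for affine \<open>h\<close> it is \<open>UNIV\<close>.\<close>

locale picard = star_domain Q for Q :: "('a::euclidean_space \<times> 'b::euclidean_space) set" +
  fixes b :: "'a \<times> 'b \<Rightarrow> 'c::euclidean_space" and h :: "real \<times> ('a \<times> 'b) \<times> 'c \<Rightarrow> 'c"
    and X :: "'c set" and u0 :: 'c
  assumes b_cont: "continuous_on Q b" and X: "closed X" "u0 \<in> X"
    and h_cont: "continuous_on ({0..1} \<times> Q \<times> X) h"
    and h_lip: "s \<in> {0..1} \<Longrightarrow> q \<in> Q \<Longrightarrow> u \<in> X \<Longrightarrow> v \<in> X \<Longrightarrow> norm (h (s, q, u) - h (s, q, v)) \<le> norm (u - v) / 2"
    and inv: "continuous_on Q f \<Longrightarrow> (\<And>q. q \<in> Q \<Longrightarrow> f q \<in> X) \<Longrightarrow> q \<in> Q \<Longrightarrow> pic b h f q \<in> X"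
begin

lemma cont_integrand:
  assumes "continuous_on Q u" "\<And>q. q \<in> Q \<Longrightarrow> u q \<in> X" "q \<in> Q"
  shows "continuous_on {0..1} (\<lambda>s. h (s, q, u (scl s q)))"
  by (rule continuous_on_compose2[OF h_cont])
    (use assms(3) in \<open>auto intro!: continuous_intros continuous_on_compose2[OF assms(1)] assms(2) scl_in\<close>)

lemma pic_cont:
  assumes "continuous_on Q u" "\<And>q. q \<in> Q \<Longrightarrow> u q \<in> X"
  shows "continuous_on Q (pic b h u)"
proof -
  have "continuous_on (Q \<times> cbox 0 1) (\<lambda>(q, s). h (s, q, u (scl s q)))"
    unfolding split_beta
    by (rule continuous_on_compose2[OF h_cont])
      (auto intro!: continuous_intros continuous_on_compose2[OF assms(1)] assms scl_in)
  from integral_continuous_on_param[OF this] show ?thesis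
    unfolding pic_def by (intro continuous_intros b_cont) simp
qed

lemma pic_lip:
  assumes u: "continuous_on Q u" "\<And>q. q \<in> Q \<Longrightarrow> u q \<in> X" and v: "continuous_on Q v" "\<And>q. q \<in> Q \<Longrightarrow> v q \<in> X"
    and q: "q \<in> Q" and B: "\<And>s. s \<in> {0..1} \<Longrightarrow> norm (u (scl s q) - v (scl s q)) \<le> B"
  shows "norm (pic b h u q - pic b h v q) \<le> B / 2"
proof -
  note c = cont_integrand[OF u q] cont_integrand[OF v q]
  have "pic b h u q - pic b h v q = integral {0..1} (\<lambda>s. h (s, q, u (scl s q)) - h (s, q, v (scl s q)))"
    unfolding pic_def by (subst Henstock_Kurzweil_Integration.integral_diff) (auto intro!: integrable_continuous_real c)
  also have "norm \<dots> \<le> B / 2 * (1 - 0)"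
  proof (rule integral_bound)
    fix s :: real assume s: "s \<in> {0..1}"
    have "norm (h (s, q, u (scl s q)) - h (s, q, v (scl s q))) \<le> norm (u (scl s q) - v (scl s q)) / 2"
      by (intro h_lip s q u(2) v(2) scl_in)
    then show "norm (h (s, q, u (scl s q)) - h (s, q, v (scl s q))) \<le> B / 2" using B[OF s] by simp
  qed (auto intro!: continuous_intros c)
  finally show ?thesis by simp
qed

definition iter :: "nat \<Rightarrow> 'a \<times> 'b \<Rightarrow> 'c" where
  "iter n = (pic b h ^^ n) (\<lambda>_. u0)"

lemma iter_0: "iter 0 = (\<lambda>_. u0)" and iter_Suc: "iter (Suc n) = pic b h (iter n)"
  by (simp_all add: iter_def)

lemma iter: "continuous_on Q (iter n)" "q \<in> Q \<Longrightarrow> iter n q \<in> X"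
proof -
  have "continuous_on Q (iter n) \<and> (\<forall>q\<in>Q. iter n q \<in> X)"
    by (induction n) (auto simp: iter_0 iter_Suc X intro!: continuous_intros pic_cont inv)
  then show "continuous_on Q (iter n)" "q \<in> Q \<Longrightarrow> iter n q \<in> X" by auto
qed

lemma bounded_on_compact:
  assumes "compact K" "K \<subseteq> Q" "continuous_on Q (f :: _ \<Rightarrow> 'd::real_normed_vector)"
  obtains M where "M \<ge> 0" "\<And>q. q \<in> K \<Longrightarrow> norm (f q) \<le> M"
proof -
  have "bounded (f ` K)"
    using assms by (intro compact_imp_bounded compact_continuous_image) (auto intro: continuous_on_subset)
  then obtain M where "\<forall>x\<in>f ` K. norm x \<le> M" unfolding bounded_iff by blast
  then show ?thesis by (intro that[of "max M 0"]) (auto simp: le_max_iff_disj)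
qed

lemma iter_diff:
  assumes "K \<subseteq> Q" "scl_stable K" "\<And>q. q \<in> K \<Longrightarrow> norm (iter 1 q - iter 0 q) \<le> M" "q \<in> K"
  shows "norm (iter (Suc n) q - iter n q) \<le> M * (1/2) ^ n"
  using assms(4)
proof (induction n arbitrary: q)
  case 0
  then show ?case using assms(3) by simp
next
  case (Suc n)
  have "norm (pic b h (iter (Suc n)) q - pic b h (iter n) q) \<le> M * (1/2) ^ n / 2"
    using Suc assms by (intro pic_lip iter) (auto simp: scl_stable_def)
  then show ?case by (simp add: iter_Suc)
qed

text \<open>The limit of the iterates, written as a telescoping series so that the Weierstrass test
  applies.\<close>

definition sol :: "'a \<times> 'b \<Rightarrow> 'c" where
  "sol q = u0 + (\<Sum>i. iter (Suc i) q - iter i q)"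

lemma uniform_limit_iter:
  assumes "compact K" "K \<subseteq> Q" "scl_stable K"
  shows "uniform_limit K iter sol sequentially"
proof -
  obtain M where M: "\<And>q. q \<in> K \<Longrightarrow> norm (iter 1 q - iter 0 q) \<le> M"
    using bounded_on_compact[OF assms(1,2) continuous_on_diff[OF iter(1) iter(1)], of 1 0] by blast
  have "uniform_limit K (\<lambda>n q. \<Sum>i<n. iter (Suc i) q - iter i q) (\<lambda>q. \<Sum>i. iter (Suc i) q - iter i q) sequentially"
    by (rule Weierstrass_m_test[where M="\<lambda>n. M * (1/2) ^ n"])
      (use iter_diff[OF assms(2,3) M] in \<open>auto intro!: summable_mult summable_geometric\<close>)
  then have "uniform_limit K (\<lambda>n q. u0 + (\<Sum>i<n. iter (Suc i) q - iter i q)) sol sequentially"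
    unfolding sol_def by (intro uniform_limit_intros)
  moreover have "u0 + (\<Sum>i<n. iter (Suc i) q - iter i q) = iter n q" for n q
    using sum_lessThan_telescope[of "\<lambda>i. iter i q" n] by (simp add: iter_0)
  ultimately show ?thesis by simp
qed

lemma iter_tendsto: "q \<in> Q \<Longrightarrow> (\<lambda>n. iter n q) \<longlonglongrightarrow> sol q"
  using exhaust[of q] uniform_limit_iter interior_subset by (blast intro: tendsto_uniform_limitI)

lemma sol_cont: "continuous_on Q sol"
proof (rule continuous_at_imp_continuous_on, rule ballI)
  fix q assume "q \<in> Q"
  then obtain K where K: "compact K" "K \<subseteq> Q" "q \<in> interior K" "scl_stable K" using exhaust by blast
  have "continuous_on K sol"
    by (rule uniform_limit_theorem[OF _ uniform_limit_iter[OF K(1,2,4)]])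
      (auto intro!: always_eventually continuous_on_subset[OF iter(1) K(2)])
  then show "isCont sol q" using K(3) by (rule continuous_on_interior)
qed

lemma sol_in: "q \<in> Q \<Longrightarrow> sol q \<in> X"
  by (rule Lim_in_closed_set[OF X(1) _ _ iter_tendsto]) (auto intro!: always_eventually iter(2))

lemma sol_eq:
  assumes q: "q \<in> Q"
  shows "sol q = pic b h sol q"
proof -
  obtain K where K: "compact K" "K \<subseteq> Q" "q \<in> interior K" "scl_stable K" using exhaust q by blast
  have qK: "q \<in> K" using K(3) interior_subset by blast
  have "(\<lambda>n. iter (Suc n) q) \<longlonglongrightarrow> pic b h sol q"
  proof (rule LIMSEQ_I)
    fix e :: real assume e: "e > 0"
    obtain N where N: "\<And>n q. n \<ge> N \<Longrightarrow> q \<in> K \<Longrightarrow> dist (iter n q) (sol q) < e"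
      using uniform_limitD[OF uniform_limit_iter[OF K(1,2,4)] e] by (auto simp: eventually_sequentially)
    have "norm (pic b h (iter n) q - pic b h sol q) \<le> e / 2" if "n \<ge> N" for n
      using K(4) qK
      by (intro pic_lip iter sol_cont sol_in q) (auto simp: scl_stable_def dist_norm[symmetric] intro!: less_imp_le N[OF that])
    then show "\<exists>N. \<forall>n\<ge>N. norm (iter (Suc n) q - pic b h sol q) < e"
      using e by (intro exI[of _ N]) (force simp: iter_Suc)
  qed
  then show ?thesis using LIMSEQ_Suc[OF iter_tendsto[OF q]] LIMSEQ_unique by blast
qed

text \<open>Transfers the regularity of \<open>sol\<close> to a solution that is merely known to be
  continuous, as needed in \<open>affine_Ck\<close>.\<close>

lemma sol_unique:
  assumes "continuous_on Q \<Phi>" "\<And>q. q \<in> Q \<Longrightarrow> \<Phi> q \<in> X" "\<And>q. q \<in> Q \<Longrightarrow> \<Phi> q = pic b h \<Phi> q" "q \<in> Q"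
  shows "\<Phi> q = sol q"
proof -
  obtain K where K: "compact K" "K \<subseteq> Q" "q \<in> interior K" "scl_stable K" using exhaust assms(4) by blast
  have qK: "q \<in> K" using K(3) interior_subset by blast
  obtain M where M: "M \<ge> 0" "\<And>q. q \<in> K \<Longrightarrow> norm (\<Phi> q - sol q) \<le> M"
    using bounded_on_compact[OF K(1,2) continuous_on_diff[OF assms(1) sol_cont]] by blast
  have *: "norm (\<Phi> q - sol q) \<le> M * (1/2) ^ n" if "q \<in> K" for n q
    using that
  proof (induction n arbitrary: q)
    case (Suc n)
    have q: "q \<in> Q" using Suc.prems K(2) by blast
    have "norm (pic b h \<Phi> q - pic b h sol q) \<le> M * (1/2) ^ n / 2"
      using Suc K by (intro pic_lip assms(1,2) sol_cont sol_in q) (auto simp: scl_stable_def)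
    then show ?case using assms(3)[OF q] sol_eq[OF q] by simp
  qed (use M in simp)
  have "(\<lambda>n. M * (1/2) ^ n) \<longlonglongrightarrow> M * 0" by (intro tendsto_intros LIMSEQ_power_zero) simp
  then have "norm (\<Phi> q - sol q) \<le> M * 0"
    by (rule LIMSEQ_le_const) (use *[OF qK] in auto)
  then show ?thesis by simp
qed

end

section \<open>Regularity of the solution in the parameter\<close>

lemma continuous_on_FD_compose:
  fixes f :: "'a::euclidean_space \<Rightarrow> 'b::real_normed_vector"
  assumes "Ck_on (Suc 0) \<Omega> f" "continuous_on S g" "g ` S \<subseteq> \<Omega>" "continuous_on S w"
  shows "continuous_on S (\<lambda>x. FD f (g x) (w x))"
proof -
  have "continuous_on S (\<lambda>x. FD f (g x) e)" for e
    by (rule continuous_on_compose2[of \<Omega> "\<lambda>z. FD f z e"]) (use assms in auto)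
  then have "continuous_on S (\<lambda>x. \<Sum>e\<in>Basis. (w x \<bullet> e) *\<^sub>R FD f (g x) e)"
    by (intro continuous_intros assms)
  then show ?thesis
  proof (rule continuous_on_eq)
    fix x assume "x \<in> S"
    then have "linear (FD f (g x))"
      using Ck_on_has_derivative[OF assms(1)] assms(3) by (blast intro: has_derivative_linear)
    from linear_expand[OF this] show "(\<Sum>e\<in>Basis. (w x \<bullet> e) *\<^sub>R FD f (g x) e) = FD f (g x) (w x)" by (rule sym)
  qed
qed

lemma Ck_on_FD_compose:
  fixes f :: "'a::euclidean_space \<Rightarrow> 'b::real_normed_vector"
  assumes "open U" "open V" "Ck_on (Suc k) V f" "Ck_on k U g" "g ` U \<subseteq> V" "Ck_on k U w"
  shows "Ck_on k U (\<lambda>x. FD f (g x) (w x))"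
proof (rule Ck_on_cong[OF assms(1)])
  have "Ck_on k U (\<lambda>x. FD f (g x) e)" for e
    using Ck_on_compose[OF assms(1,2) Ck_on_FD[OF assms(3)] assms(4,5)] .
  then show "Ck_on k U (\<lambda>x. \<Sum>e\<in>Basis. (w x \<bullet> e) *\<^sub>R FD f (g x) e)"
    by (intro Ck_intros assms)
  fix x assume "x \<in> U"
  then have "linear (FD f (g x))"
    using Ck_on_has_derivative[OF assms(3)] assms(5) by (blast intro: has_derivative_linear)
  from linear_expand[OF this] show "(\<Sum>e\<in>Basis. (w x \<bullet> e) *\<^sub>R FD f (g x) e) = FD f (g x) (w x)" by (rule sym)
qed

text \<open>For the recursion with errors at most \<open>e / 4\<close> the value
  \<open>e / 2\<close> is a fixed point, and the excess over it halves at each step.\<close>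

lemma contraction_limit:
  fixes E :: "nat \<Rightarrow> 'q \<Rightarrow> 'c::real_normed_vector"
  assumes bdd: "\<And>n. \<exists>M. \<forall>q\<in>K. norm (E n q) \<le> M"
    and step: "\<And>e. e > 0 \<Longrightarrow> \<exists>N. \<forall>n\<ge>N. \<forall>B. (\<forall>p\<in>K. norm (E n p) \<le> B) \<longrightarrow> (\<forall>q\<in>K. norm (E (Suc n) q) \<le> e + B / 2)"
    and e: "e > 0"
  shows "\<exists>N. \<forall>n\<ge>N. \<forall>q\<in>K. norm (E n q) \<le> e"
proof -
  have "e / 4 > 0" using e by simp
  then obtain N where N: "\<And>n B. n \<ge> N \<Longrightarrow> (\<forall>p\<in>K. norm (E n p) \<le> B) \<Longrightarrow> (\<forall>q\<in>K. norm (E (Suc n) q) \<le> e / 4 + B / 2)"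
    using step by blast
  obtain M where M: "\<forall>q\<in>K. norm (E N q) \<le> M" using bdd by blast
  have *: "\<forall>q\<in>K. norm (E (N + j) q) \<le> e / 2 + M * (1/2) ^ j" for j
  proof (induction j)
    case 0
    then show ?case using M e by force
  next
    case (Suc j)
    have "e / 4 + (e / 2 + M * (1/2) ^ j) / 2 = e / 2 + M * (1/2) ^ Suc j" by (simp add: field_simps)
    then show ?case using N[OF _ Suc] by simp
  qed
  have "(\<lambda>j. M * (1/2) ^ j) \<longlonglongrightarrow> M * 0" by (intro tendsto_intros LIMSEQ_power_zero) simp
  then have "\<forall>\<^sub>F j in sequentially. M * (1/2) ^ j < e / 2"
    using e by (intro order_tendstoD) auto
  then obtain j0 where j0: "\<And>j. j \<ge> j0 \<Longrightarrow> M * (1/2) ^ j < e / 2" by (auto simp: eventually_sequentially)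
  show ?thesis
  proof (intro exI[of _ "N + j0"] allI impI ballI)
    fix n q assume "N + j0 \<le> n" "q \<in> K"
    define j where "j = n - N"
    have "n = N + j" "j \<ge> j0" using \<open>N + j0 \<le> n\<close> by (auto simp: j_def)
    then show "norm (E n q) \<le> e" using *[of j] j0[of j] \<open>q \<in> K\<close> by force
  qed
qed

context star_domain
begin

text \<open>Differentiation under the integral. The integrand makes sense only where the ray stays
  in \<open>Q\<close> and the value in \<Omega>; these conditions cut out the open set
  \<open>S2\<close> around \<open>{0..1} \<times> Q\<close>.\<close>

lemma pic_smooth:
  assumes \<Omega>: "open \<Omega>" "\<And>s q. s \<in> {0..1} \<Longrightarrow> q \<in> Q \<Longrightarrow> (s, q, u (scl s q)) \<in> \<Omega>"
    and h: "Ck_on k \<Omega> h" and b: "Ck_on k Q b" and u: "Ck_on k Q u"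
  shows "Ck_on k Q (pic b h u)"
    and "k = Suc 0 \<Longrightarrow> q \<in> Q \<Longrightarrow>
      (pic b h u has_derivative (\<lambda>v. FD b q v + integral {0..1} (\<lambda>s. FD h (s, q, u (scl s q)) (0, v, FD u (scl s q) (scl s v))))) (at q)"
proof -
  define \<phi> where "\<phi> = (\<lambda>z. (fst z, snd z, u (scl (fst z) (snd z))))"
  define S1 where "S1 = {z. snd z \<in> Q \<and> scl (fst z) (snd z) \<in> Q}"
  have "open ((snd -` Q) \<inter> ((\<lambda>z. scl (fst z) (snd z)) -` Q))"
    by (intro open_Int open_vimage open_Q continuous_intros)
  then have S1: "open S1" by (simp add: S1_def vimage_def Int_def)
  have uS: "Ck_on k S1 (\<lambda>z. u (scl (fst z) (snd z)))"
  proof (rule Ck_on_compose[OF S1 open_Q u])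
    show "Ck_on k S1 (\<lambda>z. scl (fst z) (snd z))" by (intro Ck_intros S1)
  qed (auto simp: S1_def)
  have \<phi>: "Ck_on k S1 \<phi>" unfolding \<phi>_def by (intro Ck_intros S1 uS)
  define S2 where "S2 = S1 \<inter> \<phi> -` \<Omega>"
  have S2: "open S2" unfolding S2_def
    by (rule continuous_open_preimage[OF Ck_on_imp_continuous[OF \<phi>] S1 \<Omega>(1)])
  have sub: "{0..1} \<times> Q \<subseteq> S2"
    using \<Omega>(2) scl_in by (auto simp: S2_def S1_def \<phi>_def)
  have g: "Ck_on k S2 (\<lambda>z. h (\<phi> z))"
    by (rule Ck_on_compose[OF S2 \<Omega>(1) h Ck_on_subset[OF \<phi>]]) (auto simp: S2_def)
  have eq: "pic b h u = (\<lambda>q. b q + integral {0..1} (\<lambda>s. h (\<phi> (s, q))))"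
    by (simp add: pic_def \<phi>_def fun_eq_iff)
  show "Ck_on k Q (pic b h u)"
    unfolding eq by (intro Ck_intros open_Q b Ck_on_integral_param[OF sub open_Q g])
  assume k: "k = Suc 0" and q: "q \<in> Q"
  have "FD (\<lambda>z. h (\<phi> z)) (s, q) (0, v) = FD h (s, q, u (scl s q)) (0, v, FD u (scl s q) (scl s v))"
    if s: "s \<in> {0..1}" for s v
  proof -
    have "((\<lambda>z. scl (fst z) (snd z)) has_derivative (\<lambda>d. (fst (snd d), fst d *\<^sub>R snd q + s *\<^sub>R snd (snd d)))) (at (s, q))"
      unfolding scl_def by (auto intro!: derivative_eq_intros)
    then have "(\<phi> has_derivative (\<lambda>d. (fst d, snd d, FD u (scl s q) (fst (snd d), fst d *\<^sub>R snd q + s *\<^sub>R snd (snd d))))) (at (s, q))"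
      unfolding \<phi>_def
      by (intro has_derivative_Pair has_derivative_fst has_derivative_snd has_derivative_ident
          has_derivative_compose[where g=u and f="\<lambda>z. scl (fst z) (snd z)"])
        (use Ck_on_has_derivative[of 0 Q u] u k scl_in[OF q s] in auto)
    moreover have "(h has_derivative FD h (\<phi> (s, q))) (at (\<phi> (s, q)))"
      using Ck_on_has_derivative[of 0 \<Omega> h] h k \<Omega>(2)[OF s q] by (simp add: \<phi>_def)
    ultimately have "((\<lambda>z. h (\<phi> z)) has_derivative (\<lambda>d. FD h (\<phi> (s, q))
        (fst d, snd d, FD u (scl s q) (fst (snd d), fst d *\<^sub>R snd q + s *\<^sub>R snd (snd d))))) (at (s, q))"
      by (rule has_derivative_compose)
    from FD_eqI[OF this] show ?thesis by (simp add: \<phi>_def scl_def)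
  qed
  then have "integral {0..1} (\<lambda>s. FD (\<lambda>z. h (\<phi> z)) (s, q) (0, v)) =
      integral {0..1} (\<lambda>s. FD h (s, q, u (scl s q)) (0, v, FD u (scl s q) (scl s v)))" for v
    by (intro integral_cong) auto
  then show "(pic b h u has_derivative (\<lambda>v. FD b q v + integral {0..1} (\<lambda>s. FD h (s, q, u (scl s q)) (0, v, FD u (scl s q) (scl s v))))) (at q)"
    unfolding eq
    using has_derivative_add[OF Ck_on_has_derivative[of 0 Q b q] has_derivative_integral_param[OF sub open_Q _ q, of "\<lambda>z. h (\<phi> z)"]]
      b g k q by simp
qed

end

context picard
begin

text \<open>The derivatives of the iterates satisfy the linearised recursion up to an error that tends to 0
  uniformly on compact sets, so they converge to the solution \<open>W v\<close> of the linearised equation.\<close>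

lemma sol_has_derivative:
  assumes \<Omega>: "open \<Omega>" "{0..1} \<times> Q \<times> X \<subseteq> \<Omega>" and h: "Ck_on (Suc 0) \<Omega> h" and b: "Ck_on (Suc 0) Q b"
    and dh: "\<And>s q u w. s \<in> {0..1} \<Longrightarrow> q \<in> Q \<Longrightarrow> u \<in> X \<Longrightarrow> norm (FD h (s, q, u) (0, 0, w)) \<le> norm w / 2"
    and W: "\<And>v. v \<in> Basis \<Longrightarrow> continuous_on Q (W v)"
      "\<And>v q. v \<in> Basis \<Longrightarrow> q \<in> Q \<Longrightarrow> W v q = FD b q v +
        integral {0..1} (\<lambda>s. FD h (s, q, sol (scl s q)) (0, v, scl_ev v s *\<^sub>R W v (scl s q)))"
    and q: "q \<in> Q"
  shows "(sol has_derivative (\<lambda>x. \<Sum>v\<in>Basis. (x \<bullet> v) *\<^sub>R W v q)) (at q)"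
proof -
  have in\<Omega>: "(s, q, u) \<in> \<Omega>" if "s \<in> {0..1}" "q \<in> Q" "u \<in> X" for s q u using \<Omega>(2) that by auto
  have ck: "Ck_on (Suc 0) Q (iter n)" for n
  proof (induction n)
    case 0
    then show ?case by (simp only: iter_0 Ck_on_const[OF open_Q])
  next
    case (Suc n)
    then show ?case unfolding iter_Suc
      by (intro pic_smooth(1)[OF \<Omega>(1) _ h b]) (auto intro!: in\<Omega> iter scl_in)
  qed
  have hd: "(iter n has_derivative FD (iter n) q) (at q)" if "q \<in> Q" for n q
    using Ck_on_has_derivative[OF ck that] .
  have lin: "linear (FD h (s, q, u))" if "s \<in> {0..1}" "q \<in> Q" "u \<in> X" for s q u
    using Ck_on_has_derivative[OF h in\<Omega>[OF that]] by (rule has_derivative_linear)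
  obtain K where K: "compact K" "convex K" "K \<subseteq> Q" "q \<in> interior K" "scl_stable K" using exhaust q by blast
  have sclK: "scl s p \<in> K" if "p \<in> K" "s \<in> {0..1}" for s p using K(5) that by (simp add: scl_stable_def)
  have KQ: "p \<in> Q" if "p \<in> K" for p using K(3) that by blast
  define E where "E = (\<lambda>v n q. FD (iter n) q v - W v q)"
  have small: "\<exists>N. \<forall>n\<ge>N. \<forall>q\<in>K. norm (E v n q) \<le> e" if v: "v \<in> Basis" and e: "e > 0" for v e
  proof (rule contraction_limit[OF _ _ e])
    have cE: "continuous_on Q (E v n)" for n
      unfolding E_def using Ck_on_imp_continuous[OF Ck_on_FD[OF ck]] W(1)[OF v] by (intro continuous_intros)
    show "\<exists>M. \<forall>q\<in>K. norm (E v n q) \<le> M" for n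
    proof -
      obtain M where "M \<ge> 0" "\<And>q. q \<in> K \<Longrightarrow> norm (E v n q) \<le> M" by (rule bounded_on_compact[OF K(1,3) cE[of n]]) blast
      then show ?thesis by blast
    qed
    fix e :: real assume e: "e > 0"
    obtain R1 where "R1 \<ge> 0" and R1: "\<And>q. q \<in> K \<Longrightarrow> norm (sol q) \<le> R1" by (rule bounded_on_compact[OF K(1,3) sol_cont]) blast
    \<comment> \<open>A compact set of values containing \<open>sol\<close> over \<open>K\<close>
      and, from some index on, the iterates; on it \<open>G\<close> is uniformly continuous.\<close>
    define X' where "X' = X \<inter> cball 0 (R1 + 1)"
    have cX': "compact X'" unfolding X'_def using X(1) by (intro closed_Int_compact) auto
    define G where "G = (\<lambda>z. FD h z (0, v, scl_ev v (fst z) *\<^sub>R W v (scl (fst z) (fst (snd z)))))"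
    have "continuous_on ({0..1} \<times> K \<times> X') G"
      unfolding G_def
    proof (rule continuous_on_FD_compose[OF h continuous_on_id])
      have "continuous_on ({0..1} \<times> K \<times> X') (\<lambda>z. W v (scl (fst z) (fst (snd z))))"
        by (rule continuous_on_compose2[OF W(1)[OF v]]) (auto intro!: continuous_intros KQ sclK)
      moreover have "continuous_on ({0..1} \<times> K \<times> X') (\<lambda>z. scl_ev v (fst z))"
        unfolding scl_ev_def by (cases "snd v = 0") (auto intro!: continuous_intros)
      ultimately show "continuous_on ({0..1} \<times> K \<times> X') (\<lambda>z. (0, v, scl_ev v (fst z) *\<^sub>R W v (scl (fst z) (fst (snd z)))))"
        by (intro continuous_intros)
    qed (auto intro!: in\<Omega> KQ simp: X'_def)
    then have "uniformly_continuous_on ({0..1} \<times> K \<times> X') G"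
      using K(1) cX' by (intro compact_uniformly_continuous compact_Times) auto
    then obtain d where d: "d > 0" "\<And>z z'. z \<in> {0..1} \<times> K \<times> X' \<Longrightarrow> z' \<in> {0..1} \<times> K \<times> X' \<Longrightarrow> dist z' z < d \<Longrightarrow> dist (G z') (G z) < e"
      using e unfolding uniformly_continuous_on_def by metis
    \<comment> \<open>The 1 keeps the iterates in \<open>X'\<close>, and \<open>d\<close> feeds the
      uniform continuity of \<open>G\<close>.\<close>
    have "min d 1 > 0" using d by simp
    then obtain N where N: "\<And>n q. n \<ge> N \<Longrightarrow> q \<in> K \<Longrightarrow> dist (iter n q) (sol q) < min d 1"
      using uniform_limitD[OF uniform_limit_iter[OF K(1,3,5)]] by (metis (no_types, lifting) eventually_sequentially)
    show "\<exists>N. \<forall>n\<ge>N. \<forall>B. (\<forall>p\<in>K. norm (E v n p) \<le> B) \<longrightarrow> (\<forall>q\<in>K. norm (E v (Suc n) q) \<le> e + B / 2)"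
    proof (intro exI[of _ N] allI impI ballI)
      fix n B q assume n: "N \<le> n" and B: "\<forall>p\<in>K. norm (E v n p) \<le> B" and qK: "q \<in> K"
      note qQ = KQ[OF qK]
      define c where "c = scl_ev v"
      define F1 where "F1 = (\<lambda>s. FD h (s, q, iter n (scl s q)) (0, v, FD (iter n) (scl s q) (c s *\<^sub>R v)))"
      define F2 where "F2 = (\<lambda>s. FD h (s, q, sol (scl s q)) (0, v, c s *\<^sub>R W v (scl s q)))"
      have cc: "continuous_on {0..1} c"
        unfolding c_def scl_ev_def by (cases "snd v = 0") (auto intro!: continuous_intros)
      have comp: "continuous_on {0..1} (\<lambda>s. f (scl s q))" if "continuous_on Q f" for f :: "'a \<times> 'b \<Rightarrow> 'd::topological_space"
        by (rule continuous_on_compose2[OF that]) (use qQ in \<open>auto intro!: continuous_intros scl_in\<close>)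
      have c1: "continuous_on {0..1} F1" unfolding F1_def
      proof (rule continuous_on_FD_compose[OF h])
        have "continuous_on {0..1} (\<lambda>s. FD (iter n) (scl s q) (c s *\<^sub>R v))"
          by (rule continuous_on_FD_compose[OF ck]) (use qQ in \<open>auto intro!: continuous_intros cc scl_in\<close>)
        then show "continuous_on {0..1} (\<lambda>s. (0, v, FD (iter n) (scl s q) (c s *\<^sub>R v)))" by (intro continuous_intros)
      qed (use qQ in \<open>auto intro!: continuous_intros comp iter in\<Omega> scl_in\<close>)
      have c2: "continuous_on {0..1} F2" unfolding F2_def
        by (rule continuous_on_FD_compose[OF h])
          (use qQ in \<open>auto intro!: continuous_intros comp sol_cont W(1) v cc in\<Omega> sol_in scl_in\<close>)
      have "E v (Suc n) q = integral {0..1} F1 - integral {0..1} F2"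
      proof -
        have "FD (iter (Suc n)) q v = FD b q v + integral {0..1} F1"
          unfolding iter_Suc F1_def c_def
          by (subst FD_eqI[OF pic_smooth(2)[OF \<Omega>(1) _ h b ck _ qQ]])
            (auto intro!: in\<Omega> iter scl_in simp: scl_Basis[OF v])
        then show ?thesis using W(2)[OF v qQ] by (simp add: E_def F2_def c_def)
      qed
      also have "\<dots> = integral {0..1} (\<lambda>s. F1 s - F2 s)"
        by (subst Henstock_Kurzweil_Integration.integral_diff) (auto intro!: integrable_continuous_real c1 c2)
      also have "norm \<dots> \<le> (e + B / 2) * (1 - 0)"
      proof (rule integral_bound)
        fix s :: real assume s: "s \<in> {0..1}"
        let ?p = "scl s q"
        have p: "?p \<in> K" "?p \<in> Q" using sclK[OF qK s] KQ by auto
        have u: "iter n ?p \<in> X'" "sol ?p \<in> X'"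
        proof -
          have "norm (iter n ?p) \<le> norm (sol ?p) + dist (iter n ?p) (sol ?p)"
            unfolding dist_norm by (rule norm_triangle_sub)
          then show "iter n ?p \<in> X'" using R1[OF p(1)] N[OF n p(1)] iter(2)[OF p(2)] by (simp add: X'_def)
          show "sol ?p \<in> X'" using R1[OF p(1)] sol_in[OF p(2)] by (simp add: X'_def)
        qed
        have "dist (G (s, q, iter n ?p)) (G (s, q, sol ?p)) < e"
          by (rule d(2)) (use s qK u N[OF n p(1)] in \<open>auto simp: dist_prod_def\<close>)
        then have 1: "norm (G (s, q, iter n ?p) - G (s, q, sol ?p)) \<le> e" by (simp add: dist_norm)
        have it: "iter n ?p \<in> X" using u by (simp add: X'_def)
        have lin1: "linear (FD (iter n) ?p)" using hd[OF p(2)] by (rule has_derivative_linear)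
        \<comment> \<open>The first term halves the error by \<open>dh\<close>; the second is the
          uniformly small cost of replacing \<open>iter n\<close> by \<open>sol\<close> in the
          coefficients.\<close>
        have "F1 s - F2 s = FD h (s, q, iter n ?p) (0, 0, c s *\<^sub>R E v n ?p) + (G (s, q, iter n ?p) - G (s, q, sol ?p))"
        proof -
          have "(0::real, v, FD (iter n) ?p (c s *\<^sub>R v)) = (0, 0, c s *\<^sub>R E v n ?p) + (0, v, c s *\<^sub>R W v ?p)"
            by (simp add: E_def linear_scale[OF lin1] scaleR_diff_right)
          then have "F1 s = FD h (s, q, iter n ?p) (0, 0, c s *\<^sub>R E v n ?p) + G (s, q, iter n ?p)"
            unfolding F1_def G_def by (simp only: linear_add[OF lin[OF s qQ it]] fst_conv snd_conv c_def)
          moreover have "F2 s = G (s, q, sol ?p)" by (simp add: F2_def G_def c_def)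
          ultimately show ?thesis by simp
        qed
        then have "norm (F1 s - F2 s) \<le> norm (c s *\<^sub>R E v n ?p) / 2 + e"
          using norm_triangle_le[OF add_mono[OF dh[OF s qQ it] 1]] by (simp only:)
        moreover have "norm (c s *\<^sub>R E v n ?p) \<le> 1 * B"
          unfolding norm_scaleR c_def using B p(1) by (intro mult_mono scl_ev_le s) auto
        ultimately show "norm (F1 s - F2 s) \<le> e + B / 2" by simp
      qed (auto intro!: continuous_intros c1 c2)
      finally show "norm (E v (Suc n) q) \<le> e + B / 2" by simp
    qed
  qed
  have qK: "q \<in> K" using K(4) interior_subset by blast
  define g' where "g' = (\<lambda>q x. \<Sum>v\<in>Basis. (x \<bullet> v) *\<^sub>R W v q)"
  have "\<exists>g. \<forall>x\<in>K. (\<lambda>n. iter n x) \<longlonglongrightarrow> g x \<and> (g has_derivative g' x) (at x within K)"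
  proof (rule has_derivative_sequence[where f=iter and f'="\<lambda>n. FD (iter n)" and g'=g', OF K(2) _ _ qK iter_tendsto[OF q]])
    show "(iter n has_derivative FD (iter n) x) (at x within K)" if "x \<in> K" for n x
      using hd[OF KQ[OF that]] by (rule has_derivative_at_withinI)
    fix e :: real assume e: "e > 0"
    define e' where "e' = e / DIM('a \<times> 'b)"
    have e': "e' > 0" using e by (simp add: e'_def del: DIM_prod)
    have "\<forall>\<^sub>F n in sequentially. \<forall>v\<in>Basis. \<forall>q\<in>K. norm (E v n q) \<le> e'"
      by (rule eventually_ball_finite) (use small[OF _ e'] in \<open>auto simp: eventually_sequentially\<close>)
    then show "\<forall>\<^sub>F n in sequentially. \<forall>x\<in>K. \<forall>d. norm (FD (iter n) x d - g' x d) \<le> e * norm d"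
    proof eventually_elim
      case (elim n)
      show ?case
      proof (intro ballI allI)
        fix x d assume x: "x \<in> K"
        have "FD (iter n) x d - g' x d = (\<Sum>v\<in>Basis. (d \<bullet> v) *\<^sub>R E v n x)"
          unfolding g'_def E_def
          by (subst linear_expand[OF has_derivative_linear[OF hd[OF KQ[OF x]]]]) (simp add: sum_subtractf scaleR_diff_right)
        also have "norm \<dots> \<le> of_nat (card (Basis :: ('a \<times> 'b) set)) * (norm d * e')"
          by (rule order_trans[OF norm_sum sum_bounded_above])
            (auto intro!: mult_mono Basis_le_norm simp del: norm_Pair, use elim x in blast)
        also have "\<dots> = e * norm d" by (simp add: e'_def del: DIM_prod)
        finally show "norm (FD (iter n) x d - g' x d) \<le> e * norm d" .
      qed
    qed
  qed
  then obtain g where "\<forall>x\<in>K. (\<lambda>n. iter n x) \<longlonglongrightarrow> g x \<and> (g has_derivative g' x) (at x within K)" ..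
  then have g: "(\<lambda>n. iter n x) \<longlonglongrightarrow> g x" "(g has_derivative g' x) (at x within K)" if "x \<in> K" for x
    using that by auto
  have "(g has_derivative g' q) (at q)"
    using g(2)[OF qK] unfolding at_within_interior[OF K(4)] .
  then have "(sol has_derivative g' q) (at q)"
  proof (rule has_derivative_transform_within_open[OF _ open_interior K(4)])
    fix x assume "x \<in> interior K"
    then have x: "x \<in> K" using interior_subset by blast
    show "g x = sol x" by (rule LIMSEQ_unique[OF g(1)[OF x] iter_tendsto[OF KQ[OF x]]])
  qed
  then show ?thesis by (simp add: g'_def)
qed

end

text \<open>The shape of the linearised equation. Differentiating an equation of this shape leads to
  the same shape again.\<close>

definition aff :: "('c \<Rightarrow> real \<times> 'q \<Rightarrow> 'c) \<Rightarrow> (real \<times> 'q \<Rightarrow> 'c) \<Rightarrow> real \<times> 'q \<times> 'c \<Rightarrow> 'c::euclidean_space" where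
  "aff A B z = B (fst z, fst (snd z)) + (\<Sum>e\<in>Basis. (snd (snd z) \<bullet> e) *\<^sub>R A e (fst z, fst (snd z)))"

context star_domain
begin

lemma affine_picard:
  assumes b: "continuous_on Q b" and B: "continuous_on ({0..1} \<times> Q) B"
    and A: "\<And>e. e \<in> Basis \<Longrightarrow> continuous_on ({0..1} \<times> Q) (A e)"
    and bound: "\<And>s q w. s \<in> {0..1} \<Longrightarrow> q \<in> Q \<Longrightarrow> norm (\<Sum>e\<in>Basis. (w \<bullet> e) *\<^sub>R A e (s, q)) \<le> norm w / 2"
  shows "picard Q b (aff A B) UNIV 0"
proof
  show "continuous_on ({0..1} \<times> Q \<times> UNIV) (aff A B)"
    unfolding aff_def
    by (intro continuous_intros continuous_on_compose2[OF B] continuous_on_compose2[OF A]) auto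
  fix s :: real and q u v assume sq: "s \<in> {0..1}" "q \<in> Q"
  have "aff A B (s, q, u) - aff A B (s, q, v) = (\<Sum>e\<in>Basis. ((u - v) \<bullet> e) *\<^sub>R A e (s, q))"
    by (simp add: aff_def inner_diff_left scaleR_diff_left sum_subtractf)
  then show "norm (aff A B (s, q, u) - aff A B (s, q, v)) \<le> norm (u - v) / 2" using bound[OF sq] by simp
qed (use b in auto)

text \<open>Differentiating an affine equation yields an affine equation whose inhomogeneity involves the
  solution itself; hence the induction on the order of differentiability.\<close>

lemma affine_Ck:
  assumes "open \<Omega>" "{0..1} \<times> Q \<subseteq> \<Omega>" "Ck_on k Q b" "Ck_on k \<Omega> B" "\<And>e. e \<in> Basis \<Longrightarrow> Ck_on k \<Omega> (A e)"
    and "\<And>s q w. s \<in> {0..1} \<Longrightarrow> q \<in> Q \<Longrightarrow> norm (\<Sum>e\<in>Basis. (w \<bullet> e) *\<^sub>R A e (s, q)) \<le> norm w / 2"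
    and "continuous_on Q \<Phi>" "\<And>q. q \<in> Q \<Longrightarrow> \<Phi> q = pic b (aff A B) \<Phi> q"
  shows "Ck_on k Q \<Phi>"
  using assms
proof (induction k arbitrary: \<Omega> b B A \<Phi>)
  case 0
  then show ?case by simp
next
  case (Suc k)
  note \<Omega> = Suc.prems(1,2) and b = Suc.prems(3) and B = Suc.prems(4) and A = Suc.prems(5)
    and bound = Suc.prems(6) and \<Phi> = Suc.prems(7,8)
  interpret P: picard Q b "aff A B" UNIV 0
    using \<Omega> b B A bound by (intro affine_picard) (auto intro: continuous_on_subset[OF Ck_on_imp_continuous] simp del: Ck_on.simps(2))
  have sol: "\<Phi> q = P.sol q" if "q \<in> Q" for q
    by (rule P.sol_unique) (use \<Phi> that in auto)
  have \<Phi>k: "Ck_on k Q \<Phi>"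
    using \<Omega> Ck_on_SucD[OF b] Ck_on_SucD[OF B] Ck_on_SucD[OF A] bound \<Phi> by (rule Suc.IH) auto
  define \<Omega>h where "\<Omega>h = {z :: real \<times> ('a \<times> 'b) \<times> 'c. (fst z, fst (snd z)) \<in> \<Omega>}"
  have "open ((\<lambda>z :: real \<times> ('a \<times> 'b) \<times> 'c. (fst z, fst (snd z))) -` \<Omega>)"
    by (intro open_vimage \<Omega> continuous_intros)
  then have o\<Omega>h: "open \<Omega>h" by (simp add: \<Omega>h_def vimage_def)
  have pull: "Ck_on n \<Omega>h (\<lambda>z. f (fst z, fst (snd z)))" if "Ck_on n \<Omega> f" for n and f :: "_ \<Rightarrow> 'c"
  proof (rule Ck_on_compose[OF o\<Omega>h \<Omega>(1) that])
    show "Ck_on n \<Omega>h (\<lambda>z. (fst z, fst (snd z)))" by (intro Ck_intros o\<Omega>h)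
  qed (auto simp: \<Omega>h_def)
  have h: "Ck_on (Suc k) \<Omega>h (aff A B)"
    unfolding aff_def by (intro Ck_intros o\<Omega>h pull B A)
  have FDh: "FD (aff A B) (s, q, u) (0, v, w) =
      FD B (s, q) (0, v) + (\<Sum>e\<in>Basis. (u \<bullet> e) *\<^sub>R FD (A e) (s, q) (0, v) + (w \<bullet> e) *\<^sub>R A e (s, q))"
    if sq: "s \<in> {0..1}" "q \<in> Q" for s q u v w
  proof -
    have in\<Omega>: "(s, q) \<in> \<Omega>" using sq \<Omega> by auto
    have p: "((\<lambda>z :: real \<times> ('a \<times> 'b) \<times> 'c. (fst z, fst (snd z))) has_derivative (\<lambda>d. (fst d, fst (snd d)))) (at (s, q, u))"
      by (auto intro!: derivative_eq_intros)
    have d: "((\<lambda>z :: real \<times> ('a \<times> 'b) \<times> 'c. f (fst z, fst (snd z))) has_derivative (\<lambda>d. FD f (s, q) (fst d, fst (snd d)))) (at (s, q, u))"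
      if "Ck_on (Suc k) \<Omega> f" for f :: "_ \<Rightarrow> 'c"
      using has_derivative_compose[OF p, of f "FD f (s, q)"] Ck_on_has_derivative[OF that in\<Omega>] by simp
    have "(aff A B has_derivative (\<lambda>d. FD B (s, q) (fst d, fst (snd d)) +
        (\<Sum>e\<in>Basis. (snd (snd (s, q, u)) \<bullet> e) *\<^sub>R FD (A e) (s, q) (fst d, fst (snd d)) +
          (snd (snd d) \<bullet> e) *\<^sub>R A e (fst (s, q, u), fst (snd (s, q, u)))))) (at (s, q, u))"
      unfolding aff_def
      by (intro has_derivative_add has_derivative_sum has_derivative_scaleR d B A has_derivative_inner_left
          has_derivative_snd has_derivative_ident)
    from FD_eqI[OF this] show ?thesis by simp
  qed
  define \<Omega>' where "\<Omega>' = \<Omega> \<inter> {z. scl (fst z) (snd z) \<in> Q}"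
  have "open ((\<lambda>z. scl (fst z) (snd z)) -` Q)"
    by (intro open_vimage open_Q continuous_intros)
  then have o\<Omega>': "open \<Omega>'" unfolding \<Omega>'_def using \<Omega>(1) by (simp add: vimage_def open_Int)
  have sub\<Omega>': "{0..1} \<times> Q \<subseteq> \<Omega>'" using \<Omega>(2) scl_in by (auto simp: \<Omega>'_def)
  have \<Phi>': "Ck_on k \<Omega>' (\<lambda>z. \<Phi> (scl (fst z) (snd z)))"
  proof (rule Ck_on_compose[OF o\<Omega>' open_Q \<Phi>k])
    show "Ck_on k \<Omega>' (\<lambda>z. scl (fst z) (snd z))" by (intro Ck_intros o\<Omega>')
  qed (auto simp: \<Omega>'_def)
  \<comment> \<open>Coefficients of the equation for the derivative along \<open>v\<close>. The
    solution enters \<open>B'\<close>, where only its class \<open>k\<close> is known so far; the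
    factor \<open>scl_ev\<close> in \<open>A'\<close> comes from differentiating
    \<open>scl s\<close>.\<close>
  define b' where "b' = (\<lambda>v q. FD b q v)"
  define B' where "B' = (\<lambda>v z. FD B z (0, v) + (\<Sum>e\<in>Basis. (\<Phi> (scl (fst z) (snd z)) \<bullet> e) *\<^sub>R FD (A e) z (0, v)))"
  define A' where "A' = (\<lambda>(v :: 'a \<times> 'b) e z. scl_ev v (fst z) *\<^sub>R A e z)"
  have sub: "Ck_on n \<Omega>' f" if "Ck_on n \<Omega> f" for n and f :: "real \<times> 'a \<times> 'b \<Rightarrow> 'c"
    by (rule Ck_on_subset[OF that]) (auto simp: \<Omega>'_def)
  have b': "Ck_on k Q (b' v)" for v using Ck_on_FD[OF b] by (simp add: b'_def)
  have B': "Ck_on k \<Omega>' (B' v)" for v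
    unfolding B'_def by (intro Ck_intros o\<Omega>' \<Phi>' sub Ck_on_FD[OF A] Ck_on_FD[OF B])
  have A': "Ck_on k \<Omega>' (A' v e)" if "e \<in> Basis" for v e
    unfolding A'_def by (intro Ck_intros o\<Omega>' sub Ck_on_SucD[OF A] that)
  have bound': "norm (\<Sum>e\<in>Basis. (w \<bullet> e) *\<^sub>R A' v e (s, q)) \<le> norm w / 2" if sq: "s \<in> {0..1}" "q \<in> Q" for s q v w
  proof -
    have "(\<Sum>e\<in>Basis. (w \<bullet> e) *\<^sub>R A' v e (s, q)) = (\<Sum>e\<in>Basis. ((scl_ev v s *\<^sub>R w) \<bullet> e) *\<^sub>R A e (s, q))"
      by (simp add: A'_def mult.commute)
    also have "norm \<dots> \<le> norm (scl_ev v s *\<^sub>R w) / 2" by (rule bound[OF sq])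
    also have "\<dots> \<le> norm w / 2" using scl_ev_le[OF sq(1), of v] by (simp add: mult_left_le_one_le)
    finally show ?thesis .
  qed
  have pic': "picard Q (b' v) (aff (A' v) (B' v)) UNIV 0" for v
    by (rule affine_picard[OF Ck_on_imp_continuous[OF b'] continuous_on_subset[OF Ck_on_imp_continuous[OF B'] sub\<Omega>']
          continuous_on_subset[OF Ck_on_imp_continuous[OF A'] sub\<Omega>'] bound'])
  define W where "W = (\<lambda>v. picard.sol (b' v) (aff (A' v) (B' v)) 0)"
  have Wc: "continuous_on Q (W v)" and Weq: "q \<in> Q \<Longrightarrow> W v q = pic (b' v) (aff (A' v) (B' v)) (W v) q" for v q
    unfolding W_def using picard.sol_cont[OF pic'] picard.sol_eq[OF pic'] by auto
  have Wk: "Ck_on k Q (W v)" for v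
    using o\<Omega>' sub\<Omega>' b' B' A' bound' Wc Weq by (rule Suc.IH) auto
  have D: "(P.sol has_derivative (\<lambda>x. \<Sum>v\<in>Basis. (x \<bullet> v) *\<^sub>R W v q)) (at q)" if q: "q \<in> Q" for q
  proof (rule P.sol_has_derivative[OF o\<Omega>h _ Ck_on_mono[OF h] Ck_on_mono[OF b] _ Wc _ q])
    show "{0..1} \<times> Q \<times> UNIV \<subseteq> \<Omega>h" using \<Omega>(2) by (auto simp: \<Omega>h_def)
    show "norm (FD (aff A B) (s, q, u) (0, 0, w)) \<le> norm w / 2" if sq: "s \<in> {0..1}" "q \<in> Q" for s q u w
    proof -
      have in\<Omega>: "(s, q) \<in> \<Omega>" using sq \<Omega> by auto
      have "FD f (s, q) (0, 0) = 0" if "Ck_on (Suc k) \<Omega> f" for f :: "_ \<Rightarrow> 'c"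
        using linear_0[OF has_derivative_linear[OF Ck_on_has_derivative[OF that in\<Omega>]]] by (simp add: zero_prod_def)
      then show ?thesis using bound[OF sq] B A by (simp add: FDh[OF sq] del: Ck_on.simps(2))
    qed
    fix v q assume v: "v \<in> (Basis :: ('a \<times> 'b) set)" and q: "q \<in> Q"
    have "integral {0..1} (\<lambda>s. aff (A' v) (B' v) (s, q, W v (scl s q))) =
        integral {0..1} (\<lambda>s. FD (aff A B) (s, q, P.sol (scl s q)) (0, v, scl_ev v s *\<^sub>R W v (scl s q)))"
    proof (rule integral_cong)
      fix s :: real assume s: "s \<in> {0..1}"
      show "aff (A' v) (B' v) (s, q, W v (scl s q)) = FD (aff A B) (s, q, P.sol (scl s q)) (0, v, scl_ev v s *\<^sub>R W v (scl s q))"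
        unfolding FDh[OF s q] sol[OF scl_in[OF q s], symmetric]
        by (simp add: aff_def A'_def B'_def sum.distrib mult.commute)
    qed
    then show "W v q = FD b q v + integral {0..1} (\<lambda>s. FD (aff A B) (s, q, P.sol (scl s q)) (0, v, scl_ev v s *\<^sub>R W v (scl s q)))"
      using Weq[OF q, of v] by (simp add: pic_def b'_def)
  qed auto
  have "(\<Phi> has_derivative (\<lambda>x. \<Sum>v\<in>Basis. (x \<bullet> v) *\<^sub>R W v q)) (at q)" if "q \<in> Q" for q
    using D[OF that] by (rule has_derivative_transform_within_open[OF _ open_Q that]) (simp add: sol)
  moreover have "Ck_on k Q (\<lambda>q. \<Sum>v\<in>Basis. (x \<bullet> v) *\<^sub>R W v q)" for x
    by (intro Ck_intros open_Q Wk)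
  ultimately show ?case by (intro Ck_on_SucI[OF open_Q]) auto
qed

end

context picard
begin

text \<open>The derivative along a basis vector solves an affine equation whose coefficients are
  derivatives of \<open>h\<close> along \<open>sol\<close>. If \<open>sol\<close> is of class
  \<open>k\<close>, so are they, \<open>affine_Ck\<close> gives class \<open>k\<close> for the
  derivative, and \<open>sol\<close> is of class \<open>k + 1\<close>.\<close>

lemma sol_smooth:
  assumes \<Omega>: "open \<Omega>" "{0..1} \<times> Q \<times> X \<subseteq> \<Omega>" and h: "smooth_on \<Omega> h" and b: "smooth_on Q b"
    and dh: "\<And>s q u w. s \<in> {0..1} \<Longrightarrow> q \<in> Q \<Longrightarrow> u \<in> X \<Longrightarrow> norm (FD h (s, q, u) (0, 0, w)) \<le> norm w / 2"
  shows "smooth_on Q sol"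
  unfolding smooth_on_def
proof
  have in\<Omega>: "(s, q, u) \<in> \<Omega>" if "s \<in> {0..1}" "q \<in> Q" "u \<in> X" for s q u using \<Omega>(2) that by auto
  have lin: "linear (FD h (s, q, u))" if "s \<in> {0..1}" "q \<in> Q" "u \<in> X" for s q u
    using smooth_linear_FD[OF h in\<Omega>[OF that]] .
  fix k
  show "Ck_on k Q sol"
  proof (induction k)
    case 0
    then show ?case using sol_cont by simp
  next
    case (Suc k)
    define \<phi> where "\<phi> = (\<lambda>z. (fst z, snd z, sol (scl (fst z) (snd z))))"
    define S1 where "S1 = {z. snd z \<in> Q \<and> scl (fst z) (snd z) \<in> Q}"
    have "open ((snd -` Q) \<inter> ((\<lambda>z. scl (fst z) (snd z)) -` Q))"
      by (intro open_Int open_vimage open_Q continuous_intros)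
    then have S1: "open S1" by (simp add: S1_def vimage_def Int_def)
    have uS: "Ck_on k S1 (\<lambda>z. sol (scl (fst z) (snd z)))"
    proof (rule Ck_on_compose[OF S1 open_Q Suc])
      show "Ck_on k S1 (\<lambda>z. scl (fst z) (snd z))" by (intro Ck_intros S1)
    qed (auto simp: S1_def)
    have \<phi>: "Ck_on k S1 \<phi>" unfolding \<phi>_def by (intro Ck_intros S1 uS)
    define S2 where "S2 = S1 \<inter> \<phi> -` \<Omega>"
    have S2: "open S2" unfolding S2_def
      by (rule continuous_open_preimage[OF Ck_on_imp_continuous[OF \<phi>] S1 \<Omega>(1)])
    have sub: "{0..1} \<times> Q \<subseteq> S2"
      by (auto intro!: in\<Omega> sol_in scl_in simp: S2_def S1_def \<phi>_def)
    have \<phi>2: "Ck_on k S2 \<phi>" "\<phi> ` S2 \<subseteq> \<Omega>" by (auto intro: Ck_on_subset[OF \<phi>] simp: S2_def)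
    define b' where "b' = (\<lambda>v q. FD b q v)"
    define B' where "B' = (\<lambda>v z. FD h (\<phi> z) (0, v, 0))"
    define A' where "A' = (\<lambda>(v :: 'a \<times> 'b) e z. FD h (\<phi> z) (0, 0, scl_ev v (fst z) *\<^sub>R e))"
    have b': "Ck_on k Q (b' v)" for v using smooth_on_Ck[OF smooth_on_FD[OF b]] by (simp add: b'_def)
    have B': "Ck_on k S2 (B' v)" for v
      unfolding B'_def by (rule Ck_on_FD_compose[OF S2 \<Omega>(1) smooth_on_Ck[OF h] \<phi>2]) (intro Ck_intros S2)
    have A': "Ck_on k S2 (A' v e)" for v e
      unfolding A'_def by (rule Ck_on_FD_compose[OF S2 \<Omega>(1) smooth_on_Ck[OF h] \<phi>2]) (intro Ck_intros S2)
    have sumA': "(\<Sum>e\<in>Basis. (w \<bullet> e) *\<^sub>R A' v e (s, q)) = FD h (s, q, sol (scl s q)) (0, 0, scl_ev v s *\<^sub>R w)"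
      if sq: "s \<in> {0..1}" "q \<in> Q" for s q v w
    proof -
      note L = lin[OF sq sol_in[OF scl_in[OF sq(2,1)]]]
      have "linear (\<lambda>w. FD h (s, q, sol (scl s q)) (0, 0, scl_ev v s *\<^sub>R w))"
        by (intro linear_compose[OF _ L, unfolded o_def] linearI) (auto simp: scaleR_add_right)
      from linear_expand[OF this, of w] show ?thesis by (simp add: A'_def \<phi>_def)
    qed
    have bound': "norm (\<Sum>e\<in>Basis. (w \<bullet> e) *\<^sub>R A' v e (s, q)) \<le> norm w / 2" if sq: "s \<in> {0..1}" "q \<in> Q" for s q v w
    proof -
      have "norm (\<Sum>e\<in>Basis. (w \<bullet> e) *\<^sub>R A' v e (s, q)) \<le> norm (scl_ev v s *\<^sub>R w) / 2"
        unfolding sumA'[OF sq] by (rule dh[OF sq sol_in[OF scl_in[OF sq(2,1)]]])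
      also have "\<dots> \<le> norm w / 2" using scl_ev_le[OF sq(1), of v] by (simp add: mult_left_le_one_le)
      finally show ?thesis .
    qed
    have pic': "picard Q (b' v) (aff (A' v) (B' v)) UNIV 0" for v
      by (intro affine_picard bound' Ck_on_imp_continuous[OF b']
          continuous_on_subset[OF Ck_on_imp_continuous[OF B'] sub] continuous_on_subset[OF Ck_on_imp_continuous[OF A'] sub])
    define W where "W = (\<lambda>v. picard.sol (b' v) (aff (A' v) (B' v)) 0)"
    have Wc: "continuous_on Q (W v)" and Weq: "q \<in> Q \<Longrightarrow> W v q = pic (b' v) (aff (A' v) (B' v)) (W v) q" for v q
      unfolding W_def using picard.sol_cont[OF pic'] picard.sol_eq[OF pic'] by auto
    have Wk: "Ck_on k Q (W v)" for v
      using S2 sub b' B' A' bound' Wc Weq by (rule affine_Ck)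
    have D: "(sol has_derivative (\<lambda>x. \<Sum>v\<in>Basis. (x \<bullet> v) *\<^sub>R W v q)) (at q)" if q: "q \<in> Q" for q
    proof (rule sol_has_derivative[OF \<Omega> smooth_on_Ck[OF h] smooth_on_Ck[OF b] dh Wc _ q])
      fix v q assume v: "v \<in> (Basis :: ('a \<times> 'b) set)" and q: "q \<in> Q"
      have "integral {0..1} (\<lambda>s. aff (A' v) (B' v) (s, q, W v (scl s q))) =
          integral {0..1} (\<lambda>s. FD h (s, q, sol (scl s q)) (0, v, scl_ev v s *\<^sub>R W v (scl s q)))"
      proof (rule integral_cong)
        fix s :: real assume s: "s \<in> {0..1}"
        have "(0, v, scl_ev v s *\<^sub>R W v (scl s q)) = (0::real, v, 0) + (0, 0, scl_ev v s *\<^sub>R W v (scl s q))" by simp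
        then show "aff (A' v) (B' v) (s, q, W v (scl s q)) = FD h (s, q, sol (scl s q)) (0, v, scl_ev v s *\<^sub>R W v (scl s q))"
          using sumA'[OF s q, of "W v (scl s q)" v] linear_add[OF lin[OF s q sol_in[OF scl_in[OF q s]]]]
          by (simp only: aff_def B'_def fst_conv snd_conv) (simp add: \<phi>_def)
      qed
      then show "W v q = FD b q v + integral {0..1} (\<lambda>s. FD h (s, q, sol (scl s q)) (0, v, scl_ev v s *\<^sub>R W v (scl s q)))"
        using Weq[OF q, of v] by (simp add: pic_def b'_def)
    qed
    show ?case
      by (rule Ck_on_SucI[OF open_Q D]) (assumption, intro Ck_intros open_Q Wk)
  qed
qed

end

section \<open>Frobenius' theorem for distributions given as graphs\<close>

lemma linear_bound_on_compact:
  fixes L :: "'q::topological_space \<Rightarrow> 'a::euclidean_space \<Rightarrow> 'b::real_normed_vector"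
  assumes "compact K" "\<And>q. q \<in> K \<Longrightarrow> linear (L q)" "\<And>b. continuous_on K (\<lambda>q. L q b)"
  obtains M where "M \<ge> 0" "\<And>q w. q \<in> K \<Longrightarrow> norm (L q w) \<le> M * norm w"
proof -
  have "bounded ((\<lambda>q. \<Sum>b\<in>Basis. norm (L q b)) ` K)"
    using assms by (intro compact_imp_bounded compact_continuous_image continuous_intros)
  then obtain M where M: "\<forall>x\<in>(\<lambda>q. \<Sum>b\<in>Basis. norm (L q b)) ` K. norm x \<le> M" unfolding bounded_iff by blast
  have "norm (L q w) \<le> max M 0 * norm w" if q: "q \<in> K" for q w
  proof -
    have "norm (L q w) \<le> (\<Sum>b\<in>Basis. norm w * norm (L q b))"
      by (subst linear_expand[OF assms(2)[OF q]]) (auto intro!: sum_norm_le mult_right_mono Basis_le_norm)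
    also have "\<dots> = norm w * (\<Sum>b\<in>Basis. norm (L q b))" by (simp add: sum_distrib_left)
    also have "\<dots> \<le> norm w * max M 0"
      using M q by (intro mult_left_mono) (fastforce simp: le_max_iff_disj)+
    finally show ?thesis by (simp add: mult.commute)
  qed
  then show ?thesis by (intro that[of "max M 0"]) auto
qed

lemma FD_linear_family:
  fixes L :: "'q::euclidean_space \<Rightarrow> 'a::euclidean_space \<Rightarrow> 'b::euclidean_space"
  assumes "open U" "\<And>q. q \<in> U \<Longrightarrow> linear (L q)" "\<And>b. smooth_on U (\<lambda>q. L q b)" "smooth_on U g" "p \<in> U"
  shows "FD (\<lambda>q. L q (g q)) p v = FD (\<lambda>q. L q (g p)) p v + L p (FD g p v)"
proof -
  have "((\<lambda>q. \<Sum>b\<in>Basis. (g q \<bullet> b) *\<^sub>R L q b) has_derivative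
      (\<lambda>v. \<Sum>b\<in>Basis. (g p \<bullet> b) *\<^sub>R FD (\<lambda>q. L q b) p v + (FD g p v \<bullet> b) *\<^sub>R L p b)) (at p)"
    by (intro has_derivative_sum has_derivative_scaleR has_derivative_inner_left smooth_has_derivative[OF _ assms(5)] assms)
  then have "((\<lambda>q. L q (g q)) has_derivative
      (\<lambda>v. \<Sum>b\<in>Basis. (g p \<bullet> b) *\<^sub>R FD (\<lambda>q. L q b) p v + (FD g p v \<bullet> b) *\<^sub>R L p b)) (at p)"
    by (rule has_derivative_transform_within_open[OF _ assms(1,5)]) (rule linear_expand[OF assms(2), symmetric])
  from FD_eqI[OF this] have 1: "FD (\<lambda>q. L q (g q)) p v =
      (\<Sum>b\<in>Basis. (g p \<bullet> b) *\<^sub>R FD (\<lambda>q. L q b) p v) + (\<Sum>b\<in>Basis. (FD g p v \<bullet> b) *\<^sub>R L p b)"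
    by (simp add: sum.distrib)
  have "((\<lambda>q. \<Sum>b\<in>Basis. (g p \<bullet> b) *\<^sub>R L q b) has_derivative (\<lambda>v. \<Sum>b\<in>Basis. (g p \<bullet> b) *\<^sub>R FD (\<lambda>q. L q b) p v)) (at p)"
    by (intro has_derivative_sum has_derivative_scaleR_right smooth_has_derivative[OF _ assms(5)] assms)
  then have "((\<lambda>q. L q (g p)) has_derivative (\<lambda>v. \<Sum>b\<in>Basis. (g p \<bullet> b) *\<^sub>R FD (\<lambda>q. L q b) p v)) (at p)"
    by (rule has_derivative_transform_within_open[OF _ assms(1,5)]) (rule linear_expand[OF assms(2), symmetric])
  from FD_eqI[OF this] have 2: "FD (\<lambda>q. L q (g p)) p v = (\<Sum>b\<in>Basis. (g p \<bullet> b) *\<^sub>R FD (\<lambda>q. L q b) p v)" by simp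
  show ?thesis unfolding 1 2 linear_expand[OF assms(2)[OF assms(5)], of "FD g p v", symmetric] ..
qed

lemma linear_FD_linear_family:
  fixes L :: "'q::euclidean_space \<Rightarrow> 'a::euclidean_space \<Rightarrow> 'b::euclidean_space"
  assumes "open U" "\<And>q. q \<in> U \<Longrightarrow> linear (L q)" "\<And>b. smooth_on U (\<lambda>q. L q b)" "p \<in> U"
  shows "linear (\<lambda>w. FD (\<lambda>q. L q w) p v)"
proof
  show "FD (\<lambda>q. L q (x + y)) p v = FD (\<lambda>q. L q x) p v + FD (\<lambda>q. L q y) p v" for x y
  proof -
    have "((\<lambda>q. L q x + L q y) has_derivative (\<lambda>v. FD (\<lambda>q. L q x) p v + FD (\<lambda>q. L q y) p v)) (at p)"
      by (intro has_derivative_add smooth_has_derivative[OF assms(3,4)])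
    then have "((\<lambda>q. L q (x + y)) has_derivative (\<lambda>v. FD (\<lambda>q. L q x) p v + FD (\<lambda>q. L q y) p v)) (at p)"
      by (rule has_derivative_transform_within_open[OF _ assms(1,4)]) (simp add: linear_add[OF assms(2)])
    from FD_eqI[OF this] show ?thesis by simp
  qed
  show "FD (\<lambda>q. L q (c *\<^sub>R x)) p v = c *\<^sub>R FD (\<lambda>q. L q x) p v" for c x
  proof -
    have "((\<lambda>q. c *\<^sub>R L q x) has_derivative (\<lambda>v. c *\<^sub>R FD (\<lambda>q. L q x) p v)) (at p)"
      by (intro has_derivative_scaleR_right smooth_has_derivative[OF assms(3,4)])
    then have "((\<lambda>q. L q (c *\<^sub>R x)) has_derivative (\<lambda>v. c *\<^sub>R FD (\<lambda>q. L q x) p v)) (at p)"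
      by (rule has_derivative_transform_within_open[OF _ assms(1,4)]) (simp add: linear_scale[OF assms(2)])
    from FD_eqI[OF this] show ?thesis by simp
  qed
qed

lemma open_contains_ball_Times:
  assumes "open U" "(0::'a::euclidean_space \<times> 'b::euclidean_space) \<in> U"
  obtains r where "r > 0" "cball 0 r \<times> cball 0 r \<subseteq> U"
proof -
  obtain A B where AB: "open A" "open B" "0 \<in> A" "0 \<in> B" "A \<times> B \<subseteq> U"
    using assms by (auto simp: open_prod_def zero_prod_def)
  obtain r1 where r1: "r1 > 0" "cball 0 r1 \<subseteq> A" using AB(1,3) open_contains_cball by blast
  obtain r2 where r2: "r2 > 0" "cball 0 r2 \<subseteq> B" using AB(2,4) open_contains_cball by blast
  have "cball 0 (min r1 r2) \<subseteq> A" "cball 0 (min r1 r2) \<subseteq> B"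
    using r1 r2 by (auto simp: subset_iff)
  then have "cball 0 (min r1 r2) \<times> cball 0 (min r1 r2) \<subseteq> U" using AB(5) by blast
  moreover have "min r1 r2 > 0" using r1 r2 by simp
  ultimately show ?thesis using that by blast
qed

text \<open>The leaf through \<open>(z, 0)\<close> is parametrised by \<open>y \<mapsto> (\<Phi> (z, y), y)\<close>, where \<open>\<Phi>\<close> is obtained by
  integrating along the rays \<open>t y\<close>.\<close>

lemma ray_solution:
  fixes A :: "'a::euclidean_space \<times> 'b::euclidean_space \<Rightarrow> 'b \<Rightarrow> 'a"
  assumes U: "open U" "0 \<in> U" and lin: "\<And>p. p \<in> U \<Longrightarrow> linear (A p)" and sm: "\<And>w. smooth_on U (\<lambda>p. A p w)"
  obtains Q \<Phi> where "star_domain Q" "0 \<in> Q" "smooth_on Q \<Phi>" "\<And>q. q \<in> Q \<Longrightarrow> (\<Phi> q, snd q) \<in> U"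
    "\<And>q. q \<in> Q \<Longrightarrow> \<Phi> q = fst q + integral {0..1} (\<lambda>s. A (\<Phi> (scl s q), s *\<^sub>R snd q) (snd q))"
    "\<And>q w s. q \<in> Q \<Longrightarrow> s \<in> {0..1} \<Longrightarrow> norm (FD (\<lambda>p. A p (snd q)) (\<Phi> (scl s q), s *\<^sub>R snd q) (w, 0)) \<le> norm w / 2"
proof -
  obtain r where r: "r > 0" and K: "cball 0 r \<times> cball 0 r \<subseteq> U" using open_contains_ball_Times[OF U] by blast
  define KK where "KK = cball (0::'a) r \<times> cball (0::'b) r"
  have KU: "p \<in> U" if "p \<in> KK" for p using K that unfolding KK_def by blast
  have cK: "compact KK" unfolding KK_def by (intro compact_Times compact_cball)
  have cont: "continuous_on KK f" if "smooth_on U f" for f :: "'a \<times> 'b \<Rightarrow> 'a"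
    using smooth_imp_continuous[OF that] by (rule continuous_on_subset) (use KU in blast)
  obtain M where M: "M \<ge> 0" "\<And>p w. p \<in> KK \<Longrightarrow> norm (A p w) \<le> M * norm w"
    by (rule linear_bound_on_compact[OF cK, of A]) (use lin KU cont sm in blast)+
  have "\<exists>L\<ge>0. \<forall>p\<in>KK. \<forall>v. norm (FD (\<lambda>p. A p b) p v) \<le> L * norm v" for b
    by (rule linear_bound_on_compact[OF cK, of "\<lambda>p. FD (\<lambda>p. A p b) p"])
      (use smooth_linear_FD[OF sm] KU cont smooth_on_FD[OF sm] in blast)+
  then obtain Lb where Lb: "\<And>b. Lb b \<ge> 0" "\<And>b p v. p \<in> KK \<Longrightarrow> norm (FD (\<lambda>p. A p b) p v) \<le> Lb b * norm v" by metis
  define L where "L = (\<Sum>b\<in>Basis. Lb b)"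
  have L0: "L \<ge> 0" unfolding L_def using Lb(1) by (simp add: sum_nonneg)
  have L: "norm (FD (\<lambda>p. A p w) p (v, 0)) \<le> L * norm v * norm w" if p: "p \<in> KK" for p v w
  proof -
    have "linear (\<lambda>w. FD (\<lambda>p. A p w) p (v, 0))" by (rule linear_FD_linear_family[OF U(1) lin sm KU[OF p]])
    from linear_expand[OF this, of w]
    have "norm (FD (\<lambda>p. A p w) p (v, 0)) = norm (\<Sum>b\<in>Basis. (w \<bullet> b) *\<^sub>R FD (\<lambda>p. A p b) p (v, 0))" by (rule arg_cong)
    also have "\<dots> \<le> (\<Sum>b\<in>Basis. norm w * (Lb b * norm v))"
    proof (rule sum_norm_le)
      fix b :: 'b assume "b \<in> Basis"
      then have "norm ((w \<bullet> b) *\<^sub>R FD (\<lambda>p. A p b) p (v, 0)) \<le> norm w * norm (FD (\<lambda>p. A p b) p (v, 0))"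
        by (auto intro!: mult_right_mono Basis_le_norm)
      also have "\<dots> \<le> norm w * (Lb b * norm v)"
        using Lb(2)[OF p, of b "(v, 0)"] by (intro mult_left_mono) (auto simp: norm_Pair)
      finally show "norm ((w \<bullet> b) *\<^sub>R FD (\<lambda>p. A p b) p (v, 0)) \<le> norm w * (Lb b * norm v)" .
    qed
    also have "\<dots> = L * norm v * norm w" by (simp add: L_def sum_distrib_left sum_distrib_right mult_ac)
    finally show ?thesis .
  qed
  \<comment> \<open>\<open>L * \<epsilon> \<le> 1/2\<close> makes the integrand a contraction in the
    unknown; \<open>M * \<epsilon> \<le> r/2\<close> keeps the values in \<open>cball 0 r\<close>
    when the start lies in \<open>ball 0 (r/2)\<close>. The added 1 avoids dividing by 0.\<close>
  define \<epsilon> where "\<epsilon> = min r (min (1 / (2 * (L + 1))) (r / (2 * (M + 1))))"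
  have \<epsilon>: "\<epsilon> > 0" "\<epsilon> \<le> r" "L * \<epsilon> \<le> 1 / 2" "M * \<epsilon> \<le> r / 2"
  proof -
    show "\<epsilon> > 0" "\<epsilon> \<le> r" using r L0 M by (auto simp: \<epsilon>_def)
    have "L * \<epsilon> \<le> (L + 1) * (1 / (2 * (L + 1)))" using L0 \<open>\<epsilon> > 0\<close> by (intro mult_mono) (auto simp: \<epsilon>_def)
    also have "\<dots> = 1 / 2" using L0 by simp
    finally show "L * \<epsilon> \<le> 1 / 2" .
    have "M * \<epsilon> \<le> (M + 1) * (r / (2 * (M + 1)))" using M r \<open>\<epsilon> > 0\<close> by (intro mult_mono) (auto simp: \<epsilon>_def)
    also have "\<dots> = r / 2"
    proof -
      have "x * (r / (2 * x)) = r / 2" if "x \<noteq> 0" for x :: real using that by simp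
      moreover have "M + 1 \<noteq> 0" using M by simp
      ultimately show ?thesis by blast
    qed
    finally show "M * \<epsilon> \<le> r / 2" .
  qed
  define Q where "Q = ball (0::'a) (r/2) \<times> ball (0::'b) \<epsilon>"
  interpret star_domain Q unfolding Q_def by (rule star_domain_balls) (use r \<epsilon> in auto)
  have Qd: "norm (snd q) < \<epsilon>" "norm (fst q) < r / 2" if "q \<in> Q" for q using that by (auto simp: Q_def)
  have sKK: "(u, s *\<^sub>R snd q) \<in> KK" if "q \<in> Q" "s \<in> {0..1}" "u \<in> cball 0 r" for q s u
  proof -
    have "norm (s *\<^sub>R snd q) \<le> 1 * norm (snd q)"
      unfolding norm_scaleR using that by (intro mult_right_mono) auto
    then show ?thesis using Qd(1)[OF that(1)] \<epsilon> that(3) by (simp add: KK_def)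
  qed
  define h where "h = (\<lambda>z :: real \<times> ('a \<times> 'b) \<times> 'a. A (snd (snd z), fst z *\<^sub>R snd (fst (snd z))) (snd (fst (snd z))))"
  define \<Omega> where "\<Omega> = (\<lambda>z :: real \<times> ('a \<times> 'b) \<times> 'a. (snd (snd z), fst z *\<^sub>R snd (fst (snd z)))) -` U"
  have o\<Omega>: "open \<Omega>" unfolding \<Omega>_def by (intro open_vimage U continuous_intros)
  have sub: "{0..1} \<times> Q \<times> cball 0 r \<subseteq> \<Omega>"
    by (auto simp: \<Omega>_def intro!: KU sKK[where q="(a, b)" for a b, simplified])
  have hs: "smooth_on \<Omega> h"
    unfolding h_def
  proof (rule smooth_on_linear_family[where L="\<lambda>z. A (snd (snd z), fst z *\<^sub>R snd (fst (snd z)))", OF o\<Omega>])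
    show "smooth_on \<Omega> (\<lambda>z. A (snd (snd z), fst z *\<^sub>R snd (fst (snd z))) b)" for b
    proof (rule smooth_on_compose[OF sm _ o\<Omega> U(1)])
      show "smooth_on \<Omega> (\<lambda>z. (snd (snd z), fst z *\<^sub>R snd (fst (snd z))))" by (intro smooth_intros o\<Omega>)
    qed (simp add: \<Omega>_def)
    show "smooth_on \<Omega> (\<lambda>z. snd (fst (snd z)))" by (intro smooth_intros o\<Omega>)
  qed (simp add: \<Omega>_def lin)
  have hd: "((\<lambda>u. h (s, q, u)) has_derivative (\<lambda>w. FD (\<lambda>p. A p (snd q)) (u, s *\<^sub>R snd q) (w, 0))) (at u)"
    if "(u, s *\<^sub>R snd q) \<in> U" for s q u
  proof -
    have p: "((\<lambda>u. (u, s *\<^sub>R snd q)) has_derivative (\<lambda>w. (w, 0))) (at u)" by (auto intro!: derivative_eq_intros)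
    show ?thesis
      using has_derivative_compose[OF p smooth_has_derivative[OF sm that]] by (simp add: h_def)
  qed
  have FDb: "norm (FD (\<lambda>p. A p (snd q)) (u, s *\<^sub>R snd q) (w, 0)) \<le> norm w / 2"
    if "q \<in> Q" "s \<in> {0..1}" "u \<in> cball 0 r" for q s u w
  proof -
    have "norm (FD (\<lambda>p. A p (snd q)) (u, s *\<^sub>R snd q) (w, 0)) \<le> L * norm w * norm (snd q)" by (rule L[OF sKK[OF that]])
    also have "\<dots> \<le> L * norm w * \<epsilon>" using Qd(1)[OF that(1)] L0 by (intro mult_left_mono) auto
    also have "\<dots> \<le> norm w / 2" using mult_right_mono[OF \<epsilon>(3), of "norm w"] by (simp add: mult_ac)
    finally show ?thesis .
  qed
  have c1: "continuous_on ({0..1} \<times> Q \<times> cball 0 r) h"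
    using smooth_imp_continuous[OF hs] sub by (rule continuous_on_subset)
  interpret P: picard Q fst h "cball 0 r" 0
  proof
    show "norm (h (s, q, u) - h (s, q, v)) \<le> norm (u - v) / 2"
      if s: "s \<in> {0..1}" and q: "q \<in> Q" and u: "u \<in> cball 0 r" "v \<in> cball 0 r" for s q u v
    proof -
      have "norm (h (s, q, u) - h (s, q, v)) \<le> 1/2 * norm (u - v)"
      proof (rule differentiable_bound[OF convex_cball _ _ u])
        fix w assume w: "w \<in> cball (0::'a) r"
        show "((\<lambda>u. h (s, q, u)) has_derivative (\<lambda>d. FD (\<lambda>p. A p (snd q)) (w, s *\<^sub>R snd q) (d, 0))) (at w within cball 0 r)"
          by (rule has_derivative_at_withinI) (rule hd[OF KU[OF sKK[OF q s w]]])
        show "onorm (\<lambda>d. FD (\<lambda>p. A p (snd q)) (w, s *\<^sub>R snd q) (d, 0)) \<le> 1/2"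
          by (rule onorm_le) (use FDb[OF q s w] in simp)
      qed
      then show ?thesis by simp
    qed
    show "pic fst h f q \<in> cball 0 r" if f: "continuous_on Q f" "\<And>q. q \<in> Q \<Longrightarrow> f q \<in> cball 0 r" and q: "q \<in> Q" for f q
    proof -
      have "norm (integral {0..1} (\<lambda>s. h (s, q, f (scl s q)))) \<le> r / 2 * (1 - 0)"
      proof (rule integral_bound)
        show "continuous_on {0..1} (\<lambda>s. h (s, q, f (scl s q)))"
          by (rule continuous_on_compose2[OF c1])
            (use q in \<open>auto intro!: continuous_intros continuous_on_compose2[OF f(1)] scl_in f(2)[unfolded mem_cball dist_0_norm]\<close>)
        fix s :: real assume s: "s \<in> {0..1}"
        have "norm (h (s, q, f (scl s q))) \<le> M * norm (snd q)"
          unfolding h_def using M(2)[OF sKK[OF q s f(2)[OF scl_in[OF q s]]]] by simp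
        also have "\<dots> \<le> M * \<epsilon>" using Qd(1)[OF q] M by (intro mult_left_mono) auto
        finally show "norm (h (s, q, f (scl s q))) \<le> r / 2" using \<epsilon> by simp
      qed simp
      then show ?thesis using Qd(2)[OF q] norm_triangle_ineq[of "fst q" "integral {0..1} (\<lambda>s. h (s, q, f (scl s q)))"]
        by (simp add: pic_def)
    qed
  qed (use r c1 in \<open>auto intro: continuous_intros\<close>)
  show ?thesis
  proof (rule that[of Q P.sol])
    show "star_domain Q" by unfold_locales
    show "0 \<in> Q" using r \<epsilon> by (simp add: Q_def zero_prod_def)
    show "smooth_on Q P.sol"
    proof (rule P.sol_smooth[OF o\<Omega> sub hs])
      show "smooth_on Q fst" using smooth_on_fst[OF open_Q smooth_on_ident[OF open_Q]] .
      fix s :: real and q u w assume *: "s \<in> {0..1}" "q \<in> Q" "u \<in> cball (0::'a) r"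
      have in\<Omega>: "(s, q, u) \<in> \<Omega>" using sub * by auto
      have p: "((\<lambda>u. (s, q, u)) has_derivative (\<lambda>w. (0, 0, w))) (at u)" by (auto intro!: derivative_eq_intros)
      have "((\<lambda>u. h (s, q, u)) has_derivative (\<lambda>w. FD h (s, q, u) (0, 0, w))) (at u)"
        using has_derivative_compose[OF p smooth_has_derivative[OF hs in\<Omega>]] .
      from fun_cong[OF has_derivative_unique[OF this hd[OF KU[OF sKK[OF *(2,1,3)]]]], of w]
      show "norm (FD h (s, q, u) (0, 0, w)) \<le> norm w / 2" using FDb[OF *(2,1,3)] by simp
    qed
    show "P.sol q = fst q + integral {0..1} (\<lambda>s. A (P.sol (scl s q), s *\<^sub>R snd q) (snd q))" if "q \<in> Q" for q
      using P.sol_eq[OF that] by (simp add: pic_def h_def)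
    show "(P.sol q, snd q) \<in> U" if "q \<in> Q" for q
      using KU[OF sKK[OF that, of 1]] P.sol_in[OF that] by simp
    show "norm (FD (\<lambda>p. A p (snd q)) (P.sol (scl s q), s *\<^sub>R snd q) (w, 0)) \<le> norm w / 2" if "q \<in> Q" "s \<in> {0..1}" for q w s
      using FDb[OF that P.sol_in[OF scl_in[OF that]]] .
  qed
qed

text \<open>The integral equation yields the leaf condition only in the direction of the ray. Its
  defect \<open>P v\<close> in any other direction satisfies, by \<open>com\<close>, a homogeneous
  linear equation along the ray and therefore vanishes. Thus \<Psi> carries the slices with constant
  first component to the leaves, and its local inverse is the chart.\<close>

lemma frobenius_graph:
  fixes A :: "'a::euclidean_space \<times> 'b::euclidean_space \<Rightarrow> 'b \<Rightarrow> 'a"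
  assumes U: "open U" "0 \<in> U" and lin: "\<And>p. p \<in> U \<Longrightarrow> linear (A p)" and sm: "\<And>w. smooth_on U (\<lambda>p. A p w)"
    and com: "\<And>p v w. p \<in> U \<Longrightarrow> FD (\<lambda>q. A q w) p (A p v, v) = FD (\<lambda>q. A q v) p (A p w, w)"
  obtains W and \<phi> :: "'a \<times> 'b \<Rightarrow> 'a \<times> 'b" and V \<psi> where "diffeo_between W \<phi> V \<psi>" "0 \<in> W" "W \<subseteq> U"
    "\<And>p v. p \<in> W \<Longrightarrow> fst (FD \<phi> p v) = 0 \<longleftrightarrow> fst v = A p (snd v)"
proof -
  obtain Q \<Phi> where Q: "star_domain Q" "0 \<in> Q" and \<Phi>: "smooth_on Q \<Phi>" "\<And>q. q \<in> Q \<Longrightarrow> (\<Phi> q, snd q) \<in> U"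
    and eq: "\<And>q. q \<in> Q \<Longrightarrow> \<Phi> q = fst q + integral {0..1} (\<lambda>s. A (\<Phi> (scl s q), s *\<^sub>R snd q) (snd q))"
    and bd: "\<And>q w s. q \<in> Q \<Longrightarrow> s \<in> {0..1} \<Longrightarrow> norm (FD (\<lambda>p. A p (snd q)) (\<Phi> (scl s q), s *\<^sub>R snd q) (w, 0)) \<le> norm w / 2"
    by (rule ray_solution[OF U lin sm]) (assumption | rule that)+
  interpret star_domain Q by fact
  define \<Psi> where "\<Psi> = (\<lambda>q. (\<Phi> q, snd q))"
  have \<Psi>U: "\<Psi> q \<in> U" if "q \<in> Q" for q using \<Phi>(2)[OF that] by (simp add: \<Psi>_def)
  have \<Psi>: "smooth_on Q \<Psi>" unfolding \<Psi>_def by (intro smooth_intros open_Q \<Phi>)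
  have A\<Psi>: "smooth_on Q (\<lambda>q. A (\<Psi> q) w)" for w
    using smooth_on_compose[OF sm \<Psi> open_Q U(1) \<Psi>U] .
  have lin\<Psi>: "linear (A (\<Psi> q))" if "q \<in> Q" for q using lin[OF \<Psi>U[OF that]] .
  have FD\<Psi>: "FD \<Psi> q d = (FD \<Phi> q d, snd d)" if "q \<in> Q" for q d
  proof -
    have "(\<Psi> has_derivative (\<lambda>d. (FD \<Phi> q d, snd d))) (at q)" unfolding \<Psi>_def
      by (intro has_derivative_Pair smooth_has_derivative[OF \<Phi>(1) that] has_derivative_snd has_derivative_ident)
    from FD_eqI[OF this] show ?thesis by simp
  qed
  have lin\<Phi>: "linear (FD \<Phi> q)" if "q \<in> Q" for q using smooth_linear_FD[OF \<Phi>(1) that] .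
  \<comment> \<open>Substituting \<open>s * t\<close> for \<open>s\<close> shows that \<Phi> along
    the ray is a primitive of \<open>g\<close>. The primitive exists on \<open>{0..1}\<close> only,
    so the derivatives at \<open>t = 1\<close> are compared from one side.\<close>
  have ray: "FD \<Phi> q (0, snd q) = A (\<Psi> q) (snd q)" if q: "q \<in> Q" for q
  proof -
    define g where "g = (\<lambda>t. A (\<Psi> (scl t q)) (snd q))"
    have cg: "continuous_on {0..1} g" unfolding g_def
      by (rule continuous_on_compose2[OF smooth_imp_continuous[OF A\<Psi>]])
        (use q in \<open>auto intro!: continuous_intros scl_in\<close>)
    obtain \<Gamma> where \<Gamma>: "\<And>t. t \<in> {0..1} \<Longrightarrow> (\<Gamma> has_vector_derivative g t) (at t within {0..1})"
      using antiderivative_continuous[OF cg] by blast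
    have G: "\<Phi> (scl t q) = fst q + (\<Gamma> t - \<Gamma> 0)" if t: "t \<in> {0..1}" for t
    proof -
      have "((\<lambda>s. t *\<^sub>R g (s * t)) has_integral \<Gamma> (1 * t) - \<Gamma> (0 * t)) {0..1}"
      proof (rule fundamental_theorem_of_calculus)
        fix s :: real assume s: "s \<in> {0..1}"
        have st: "s * t \<in> {0..1}" using s t by (auto intro: mult_le_one)
        have "((\<lambda>s. s * t) has_vector_derivative t) (at s within {0..1})"
          by (auto intro!: derivative_eq_intros simp: has_vector_derivative_def)
        moreover have "(\<Gamma> has_vector_derivative g (s * t)) (at (s * t) within (\<lambda>s. s * t) ` {0..1})"
          by (rule has_vector_derivative_within_subset[OF \<Gamma>[OF st]]) (use t in \<open>auto intro: mult_le_one\<close>)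
        ultimately show "((\<lambda>s. \<Gamma> (s * t)) has_vector_derivative t *\<^sub>R g (s * t)) (at s within {0..1})"
          using vector_diff_chain_within[of "\<lambda>s. s * t" t s "{0..1}" \<Gamma>] by (simp add: o_def)
      qed simp
      then have "integral {0..1} (\<lambda>s. t *\<^sub>R g (s * t)) = \<Gamma> t - \<Gamma> 0" by (auto dest: integral_unique)
      moreover have "integral {0..1} (\<lambda>s. A (\<Phi> (scl s (scl t q)), s *\<^sub>R snd (scl t q)) (snd (scl t q))) =
          integral {0..1} (\<lambda>s. t *\<^sub>R g (s * t))"
      proof (rule integral_cong)
        fix s :: real assume s: "s \<in> {0..1}"
        have st: "s * t \<in> {0..1}" using s t by (auto intro: mult_le_one)
        have "(\<Phi> (scl s (scl t q)), s *\<^sub>R snd (scl t q)) = \<Psi> (scl (s * t) q)" by (simp add: \<Psi>_def) (simp add: scl_def)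
        moreover have "snd (scl t q) = t *\<^sub>R snd q" by (simp add: scl_def)
        ultimately show "A (\<Phi> (scl s (scl t q)), s *\<^sub>R snd (scl t q)) (snd (scl t q)) = t *\<^sub>R g (s * t)"
          using linear_scale[OF lin\<Psi>[OF scl_in[OF q st]]] by (simp add: g_def)
      qed
      moreover have "fst (scl t q) = fst q" by (simp add: scl_def)
      ultimately show ?thesis using eq[OF scl_in[OF q t]] by simp
    qed
    have "((\<lambda>t. \<Phi> (scl t q)) has_vector_derivative FD \<Phi> (scl 1 q) (0, snd q)) (at 1)"
    proof -
      have "((\<lambda>t. scl t q) has_derivative (\<lambda>h. (0, h *\<^sub>R snd q))) (at 1)"
        unfolding scl_def by (auto intro!: derivative_eq_intros)
      moreover have "(\<Phi> has_derivative FD \<Phi> (scl 1 q)) (at (scl 1 q))" using smooth_has_derivative[OF \<Phi>(1) q] by simp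
      ultimately have "((\<lambda>t. \<Phi> (scl t q)) has_derivative (\<lambda>h. FD \<Phi> (scl 1 q) (0, h *\<^sub>R snd q))) (at 1)"
        by (rule has_derivative_compose)
      moreover have "FD \<Phi> q (0, h *\<^sub>R snd q) = h *\<^sub>R FD \<Phi> q (0, snd q)" for h
        using linear_scale[OF lin\<Phi>[OF q], of h "(0, snd q)"] by simp
      ultimately show ?thesis by (simp add: has_vector_derivative_def)
    qed
    then have 1: "((\<lambda>t. \<Phi> (scl t q)) has_vector_derivative FD \<Phi> q (0, snd q)) (at 1 within {0..1})"
      by (simp add: has_vector_derivative_at_within)
    have "((\<lambda>t. fst q + (\<Gamma> t - \<Gamma> 0)) has_vector_derivative g 1) (at 1 within {0..1})"
      using \<Gamma>[of 1] by (auto intro!: derivative_eq_intros)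
    then have 2: "((\<lambda>t. \<Phi> (scl t q)) has_vector_derivative g 1) (at 1 within {0..1})"
      by (rule has_vector_derivative_transform[rotated 2]) (use G in auto)
    have "FD \<Phi> q (0, snd q) = g 1"
      by (rule vector_derivative_unique_within_closed_interval[OF _ _ 1[unfolded interval_cbox] 2[unfolded interval_cbox]]) auto
    then show ?thesis by (simp add: g_def)
  qed
  define P where "P = (\<lambda>v q. FD \<Phi> q (0, v) - A (\<Psi> q) v)"
  have Psm: "smooth_on Q (P v)" for v unfolding P_def by (intro smooth_intros open_Q A\<Psi> \<Phi>)
  \<comment> \<open>Differentiates \<open>ray\<close> along \<open>(0, v)\<close>. The term
    \<open>- P v q\<close> appears because the direction \<open>snd q\<close> is differentiated as
    well.\<close>
  have dP: "FD (P v) q (0, snd q) = FD (\<lambda>p. A p (snd q)) (\<Psi> q) (P v q, 0) - P v q" if q: "q \<in> Q" for q v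
  proof -
    let ?y = "snd q"
    have FDA: "FD (\<lambda>q. A (\<Psi> q) w) q d = FD (\<lambda>p. A p w) (\<Psi> q) (FD \<Psi> q d)" for w d
      by (rule FD_compose[OF sm \<Psi>U[OF q] \<Psi> q])
    have snd_sm: "smooth_on Q snd" "smooth_on Q (\<lambda>q. (0 :: 'a, snd q))"
      using smooth_on_snd[OF open_Q smooth_on_ident[OF open_Q]] by (auto intro!: smooth_intros open_Q)
    have FDs: "FD snd q d = snd d" "FD (\<lambda>q. (0 :: 'a, snd q)) q d = (0, snd d)" for d :: "'a \<times> 'b"
    proof -
      have "(snd has_derivative snd) (at q)" by (rule bounded_linear_imp_has_derivative[OF bounded_linear_snd])
      then show "FD snd q d = snd d" using FD_eqI by metis
      have "((\<lambda>q. (0 :: 'a, snd q)) has_derivative (\<lambda>d. (0, snd d))) (at q)" by (auto intro!: derivative_eq_intros)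
      from FD_eqI[OF this] show "FD (\<lambda>q. (0 :: 'a, snd q)) q d = (0, snd d)" by simp
    qed
    have "FD (\<lambda>q. FD \<Phi> q (0, snd q)) q (0, v) = FD (\<lambda>q. FD \<Phi> q (0, ?y)) q (0, v) + FD \<Phi> q (0, v)"
      using FD_linear_family[OF open_Q lin\<Phi> smooth_on_FD[OF \<Phi>(1)] snd_sm(2) q] by (simp add: FDs)
    moreover have "FD (\<lambda>q. A (\<Psi> q) (snd q)) q (0, v) = FD (\<lambda>p. A p ?y) (\<Psi> q) (FD \<Phi> q (0, v), v) + A (\<Psi> q) v"
      using FD_linear_family[OF open_Q lin\<Psi> A\<Psi> snd_sm(1) q] by (simp add: FDs FDA FD\<Psi>[OF q])
    moreover have "FD (\<lambda>q. FD \<Phi> q (0, snd q)) q = FD (\<lambda>q. A (\<Psi> q) (snd q)) q"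
      by (rule FD_cong[OF open_Q q ray])
    ultimately have 1: "FD (\<lambda>q. FD \<Phi> q (0, ?y)) q (0, v) + FD \<Phi> q (0, v) = FD (\<lambda>p. A p ?y) (\<Psi> q) (FD \<Phi> q (0, v), v) + A (\<Psi> q) v"
      by simp
    have "FD (P v) q (0, ?y) = FD (\<lambda>q. FD \<Phi> q (0, v)) q (0, ?y) - FD (\<lambda>q. A (\<Psi> q) v) q (0, ?y)"
    proof -
      have "(P v has_derivative (\<lambda>d. FD (\<lambda>q. FD \<Phi> q (0, v)) q d - FD (\<lambda>q. A (\<Psi> q) v) q d)) (at q)"
        unfolding P_def by (intro has_derivative_diff smooth_has_derivative[OF _ q] smooth_on_FD \<Phi> A\<Psi>)
      from FD_eqI[OF this] show ?thesis by simp
    qed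
    also have "FD (\<lambda>q. FD \<Phi> q (0, v)) q (0, ?y) = FD (\<lambda>q. FD \<Phi> q (0, ?y)) q (0, v)"
      by (rule smooth_FD_commute[OF open_Q \<Phi>(1) q])
    also have "FD (\<lambda>q. A (\<Psi> q) v) q (0, ?y) = FD (\<lambda>p. A p ?y) (\<Psi> q) (A (\<Psi> q) v, v)"
      using com[OF \<Psi>U[OF q], of v ?y] by (simp add: FDA FD\<Psi>[OF q] ray[OF q])
    finally have 2: "FD (P v) q (0, ?y) = FD (\<lambda>q. FD \<Phi> q (0, ?y)) q (0, v) - FD (\<lambda>p. A p ?y) (\<Psi> q) (A (\<Psi> q) v, v)" .
    have l: "linear (FD (\<lambda>p. A p ?y) (\<Psi> q))" by (rule smooth_linear_FD[OF sm \<Psi>U[OF q]])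
    have "(P v q, 0) = (FD \<Phi> q (0, v), v) - (A (\<Psi> q) v, v)" by (simp add: P_def)
    then have 3: "FD (\<lambda>p. A p ?y) (\<Psi> q) (P v q, 0) = FD (\<lambda>p. A p ?y) (\<Psi> q) (FD \<Phi> q (0, v), v) - FD (\<lambda>p. A p ?y) (\<Psi> q) (A (\<Psi> q) v, v)"
      by (simp only: linear_diff[OF l])
    show ?thesis unfolding 2 3 using 1 by (simp add: P_def algebra_simps)
  qed
  have P0: "P v q = 0" if q: "q \<in> Q" for v q
  proof -
    \<comment> \<open>The factor \<open>t\<close> absorbs the term \<open>- P v q\<close> of
      \<open>dP\<close>: what remains is a homogeneous linear equation for \<open>w\<close> with
      \<open>w 0 = 0\<close>.\<close>
    define w where "w = (\<lambda>t. t *\<^sub>R P v (scl t q))"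
    define w' where "w' = (\<lambda>t. FD (\<lambda>p. A p (snd q)) (\<Psi> (scl t q)) (w t, 0))"
    have wd: "(w has_vector_derivative w' t) (at t)" if t: "t \<in> {0..1}" for t
    proof -
      have s: "((\<lambda>t. scl t q) has_derivative (\<lambda>h. (0, h *\<^sub>R snd q))) (at t)"
        unfolding scl_def by (auto intro!: derivative_eq_intros)
      have tQ: "scl t q \<in> Q" by (rule scl_in[OF q t])
      have l: "linear (FD (P v) (scl t q))" by (rule smooth_linear_FD[OF Psm tQ])
      have "(w has_derivative (\<lambda>h. t *\<^sub>R FD (P v) (scl t q) (0, h *\<^sub>R snd q) + h *\<^sub>R P v (scl t q))) (at t)"
        unfolding w_def
        by (intro has_derivative_scaleR has_derivative_ident has_derivative_compose[OF s] smooth_has_derivative[OF Psm tQ])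
      moreover have "t *\<^sub>R FD (P v) (scl t q) (0, h *\<^sub>R snd q) + h *\<^sub>R P v (scl t q) = h *\<^sub>R w' t" for h
      proof -
        have "t *\<^sub>R FD (P v) (scl t q) (0, h *\<^sub>R snd q) = h *\<^sub>R FD (P v) (scl t q) (0, snd (scl t q))"
        proof -
          have "t *\<^sub>R (0, h *\<^sub>R snd q) = h *\<^sub>R (0 :: 'a, snd (scl t q))" by (simp add: scl_def mult.commute)
          then show ?thesis by (simp only: linear_scale[OF l, symmetric])
        qed
        also have "\<dots> = h *\<^sub>R (FD (\<lambda>p. A p (snd (scl t q))) (\<Psi> (scl t q)) (P v (scl t q), 0) - P v (scl t q))"
          by (simp only: dP[OF tQ])
        also have "FD (\<lambda>p. A p (snd (scl t q))) (\<Psi> (scl t q)) (P v (scl t q), 0) = w' t"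
        proof -
          have l1: "linear (\<lambda>w. FD (\<lambda>p. A p w) (\<Psi> (scl t q)) d)" for d
            by (rule linear_FD_linear_family[OF U(1) lin sm \<Psi>U[OF tQ]])
          have l2: "linear (FD (\<lambda>p. A p w) (\<Psi> (scl t q)))" for w by (rule smooth_linear_FD[OF sm \<Psi>U[OF tQ]])
          have 1: "(w t, 0 :: 'b) = t *\<^sub>R (P v (scl t q), 0)" by (simp add: w_def)
          have 2: "snd (scl t q) = t *\<^sub>R snd q" by (simp add: scl_def)
          show ?thesis unfolding w'_def 1 2 linear_scale[OF l2] linear_scale[OF l1] ..
        qed
        finally show ?thesis by (simp add: scaleR_diff_right)
      qed
      ultimately show ?thesis by (simp add: has_vector_derivative_def)
    qed
    have "continuous_on {0..1} w"
      using wd has_vector_derivative_continuous by (blast intro: continuous_at_imp_continuous_on)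
    then have "continuous_on {0..1} (\<lambda>t. norm (w t))" by (intro continuous_intros)
    \<comment> \<open>By the mean value inequality from 0, the maximum of \<open>norm (w t)\<close>
      is at most half of itself.\<close>
    then obtain t0 where t0: "t0 \<in> {0..1}" "\<And>t. t \<in> {0..1} \<Longrightarrow> norm (w t) \<le> norm (w t0)"
      using continuous_attains_sup[of "{0..1}" "\<lambda>t. norm (w t)"] by auto
    have "norm (w t - w 0) \<le> norm (w t0) / 2 * norm (t - 0)" if t: "t \<in> {0..1}" for t
    proof (rule differentiable_bound[OF convex_real_interval(5)[of 0 1] _ _ t])
      fix x :: real assume x: "x \<in> {0..1}"
      show "(w has_derivative (\<lambda>h. h *\<^sub>R w' x)) (at x within {0..1})"
        using wd[OF x] unfolding has_vector_derivative_def by (rule has_derivative_at_withinI)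
      have "norm (w' x) \<le> norm (w x) / 2"
        using bd[OF q x, of "w x"] by (simp add: w'_def \<Psi>_def) (simp add: scl_def)
      also have "\<dots> \<le> norm (w t0) / 2" using t0(2)[OF x] by simp
      finally have b: "norm (w' x) \<le> norm (w t0) / 2" .
      show "onorm (\<lambda>h. h *\<^sub>R w' x) \<le> norm (w t0) / 2"
      proof (rule onorm_le)
        show "norm (h *\<^sub>R w' x) \<le> norm (w t0) / 2 * norm h" for h :: real
          using mult_left_mono[OF b, of "\<bar>h\<bar>"] by (simp add: mult.commute)
      qed
    qed simp
    from this[OF t0(1)] have *: "norm (w t0) \<le> norm (w t0) / 2 * t0" using t0(1) by (simp add: w_def)
    have "norm (w t0) / 2 * t0 \<le> norm (w t0) / 2 * 1" using t0(1) by (intro mult_left_mono) auto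
    with * have "norm (w t0) = 0" using norm_ge_zero[of "w t0"] by linarith
    then have "norm (w 1) \<le> 0" using t0(2)[of 1] by simp
    then show ?thesis by (simp add: w_def)
  qed
  have FD\<Phi>: "FD \<Phi> q (0, v) = A (\<Psi> q) v" if "q \<in> Q" for q v using P0[OF that, of v] by (simp add: P_def)
  have z0: "\<Phi> (z, 0) = z" if "(z, 0) \<in> Q" for z
  proof -
    have "A (\<Phi> (scl s (z, 0)), 0) 0 = 0" if "s \<in> {0..1}" for s
      using linear_0[OF lin\<Psi>[OF scl_in[OF \<open>(z, 0) \<in> Q\<close> that]]] by (simp add: \<Psi>_def scl_def)
    then have "integral {0..1} (\<lambda>s. A (\<Phi> (scl s (z, 0)), 0) 0) = integral {0..1} (\<lambda>s::real. 0)" by (rule integral_cong)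
    then show ?thesis using eq[OF that] by simp
  qed
  \<comment> \<open>The leaves start at \<open>(z, 0)\<close>, so \<Psi> is the identity on the
    slice \<open>y = 0\<close>. This makes its differential at 0 injective.\<close>
  have FD0: "FD \<Phi> 0 (d, 0) = d" for d
  proof -
    have o: "open ((\<lambda>z. (z, 0)) -` Q)" by (intro open_vimage open_Q continuous_intros)
    have d: "((\<lambda>z. \<Phi> (z, 0)) has_derivative (\<lambda>h. FD \<Phi> (0, 0) (h, 0))) (at 0)"
      by (rule has_derivative_compose[where f="\<lambda>z. (z, 0)"])
        (use smooth_has_derivative[OF \<Phi>(1) Q(2)] in \<open>auto intro!: derivative_eq_intros simp: zero_prod_def\<close>)
    have "((\<lambda>z. z) has_derivative (\<lambda>h. FD \<Phi> (0, 0) (h, 0))) (at 0)"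
      by (rule has_derivative_transform_within_open[OF d o]) (use Q(2) z0 in \<open>auto simp: zero_prod_def\<close>)
    then have "(\<lambda>h. FD \<Phi> (0, 0) (h, 0)) = (\<lambda>h. h)" using has_derivative_ident has_derivative_unique by blast
    then show ?thesis by (metis zero_prod_def)
  qed
  obtain V W \<psi> where d: "diffeo_between V \<Psi> W \<psi>" "0 \<in> V" "V \<subseteq> Q"
  proof (rule local_diffeo[OF open_Q \<Psi> Q(2)])
    fix v assume "FD \<Psi> 0 v = 0"
    then have *: "FD \<Phi> 0 v = 0" "snd v = 0" using FD\<Psi>[OF Q(2), of v] by (auto simp: zero_prod_def)
    then have "v = (fst v, 0)" by (simp add: prod_eq_iff)
    then have "FD \<Phi> 0 v = fst v" using FD0[of "fst v"] by metis
    then show "v = 0" using * by (simp add: prod_eq_iff)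
  qed
  have \<Psi>0: "\<Psi> 0 = 0" using z0[of 0] Q(2) by (simp add: \<Psi>_def zero_prod_def)
  show ?thesis
  proof (rule that[OF diffeo_between_sym[OF d(1)]])
    show "0 \<in> W" using d \<Psi>0 unfolding diffeo_between_def by metis
    show "W \<subseteq> U" using d \<Psi>U unfolding diffeo_between_def by (metis subset_iff)
    fix p v assume "p \<in> W"
    then have q: "\<psi> p \<in> V" "\<Psi> (\<psi> p) = p" using d(1) by (auto simp: diffeo_between_def)
    then have qQ: "\<psi> p \<in> Q" using d by blast
    note inv = diffeo_between_FD[OF d(1) q(1)]
    define d where "d = FD \<psi> p v"
    have v: "v = (FD \<Phi> (\<psi> p) d, snd d)" using inv(2)[of v] q(2) FD\<Psi>[OF qQ, of d] by (simp add: d_def)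
    have "d = (fst d, 0) + (0, snd d)" by simp
    then have v1: "FD \<Phi> (\<psi> p) d = FD \<Phi> (\<psi> p) (fst d, 0) + A p (snd d)"
      using linear_add[OF lin\<Phi>[OF qQ]] FD\<Phi>[OF qQ] q(2) by metis
    show "fst (FD \<psi> p v) = 0 \<longleftrightarrow> fst v = A p (snd v)"
    proof
      assume "fst (FD \<psi> p v) = 0"
      then have "FD \<Phi> (\<psi> p) (fst d, 0) = 0"
        using linear_0[OF lin\<Phi>[OF qQ]] by (simp add: d_def zero_prod_def)
      then show "fst v = A p (snd v)" using v v1 by (metis add.left_neutral fst_conv snd_conv)
    next
      assume "fst v = A p (snd v)"
      then have "FD \<Phi> (\<psi> p) (0, snd d) = FD \<Phi> (\<psi> p) d" using v FD\<Phi>[OF qQ] q(2) by (metis fst_conv snd_conv)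
      then have "FD \<Psi> (\<psi> p) (0, snd d) = FD \<Psi> (\<psi> p) d" by (simp add: FD\<Psi>[OF qQ])
      then have "(0, snd d) = d" using inv(1) q(2) by metis
      then show "fst (FD \<psi> p v) = 0" by (metis d_def fst_conv)
    qed
  qed
qed

text \<open>The distributions of one structure are straightened on different neighbourhoods; the
  claim for all smaller open sets lets them share one.\<close>

lemma integrable_distribution_graph:
  fixes A :: "'a::euclidean_space \<times> 'b::euclidean_space \<Rightarrow> 'b \<Rightarrow> 'a"
  assumes "open U" "0 \<in> U" "\<And>p. p \<in> U \<Longrightarrow> linear (A p)" "\<And>w. smooth_on U (\<lambda>p. A p w)"
    and "\<And>p v w. p \<in> U \<Longrightarrow> FD (\<lambda>q. A q w) p (A p v, v) = FD (\<lambda>q. A q v) p (A p w, w)"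
  obtains W where "open W" "0 \<in> W" "W \<subseteq> U"
    "\<And>W'. open W' \<Longrightarrow> W' \<subseteq> W \<Longrightarrow> integrable_distribution W' (\<lambda>p. {v. fst v = A p (snd v)})"
proof -
  obtain W and \<phi> :: "'a \<times> 'b \<Rightarrow> 'a \<times> 'b" and V \<psi> where W: "diffeo_between W \<phi> V \<psi>" "0 \<in> W" "W \<subseteq> U"
    and fst: "\<And>p v. p \<in> W \<Longrightarrow> fst (FD \<phi> p v) = 0 \<longleftrightarrow> fst v = A p (snd v)"
    by (rule frobenius_graph[OF assms]) (assumption | rule that)+
  show ?thesis
  proof (rule that[of W])
    show "open W" using W by (simp add: diffeo_between_def)
    fix W' assume W': "open W'" "W' \<subseteq> W"
    have "\<exists>V (\<phi> :: 'a \<times> 'b \<Rightarrow> 'a \<times> 'b) S. p \<in> V \<and> V \<subseteq> W' \<and> diffeo_onto_image V \<phi> \<and> subspace S \<and>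
        (\<forall>q\<in>V. {v. fst v = A q (snd v)} = {v. FD \<phi> q v \<in> S})" if p: "p \<in> W'" for p
    proof (rule exI[of _ W'], rule exI[of _ \<phi>], rule exI[of _ "{0} \<times> UNIV"], intro conjI ballI)
      show "diffeo_onto_image W' \<phi>"
        by (rule diffeo_between_onto_image[OF diffeo_between_restrict[OF W(1) W']])
      show "subspace ({0} \<times> UNIV :: ('a \<times> 'b) set)" by (auto simp: subspace_def zero_prod_def)
      show "{v. fst v = A q (snd v)} = {v. FD \<phi> q v \<in> {0} \<times> UNIV}" if "q \<in> W'" for q
        using fst[of q] that W'(2) by (auto simp: mem_Times_iff)
    qed (use p in auto)
    then show "integrable_distribution W' (\<lambda>p. {v. fst v = A p (snd v)})"
      unfolding integrable_distribution_def by blast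
  qed (use W in auto)
qed

section \<open>The structure defined by a Lax tuple\<close>

lemma FD_add: "smooth_on U f \<Longrightarrow> smooth_on U g \<Longrightarrow> p \<in> U \<Longrightarrow> FD (\<lambda>x. f x + g x) p v = FD f p v + FD g p v"
  using FD_eqI[OF has_derivative_add[OF smooth_has_derivative smooth_has_derivative]] by metis

lemma FD_diff: "smooth_on U f \<Longrightarrow> smooth_on U g \<Longrightarrow> p \<in> U \<Longrightarrow> FD (\<lambda>x. f x - g x) p v = FD f p v - FD g p v"
  using FD_eqI[OF has_derivative_diff[OF smooth_has_derivative smooth_has_derivative]] by metis

lemma FD_bounded_linear:
  "bounded_linear h \<Longrightarrow> smooth_on U f \<Longrightarrow> p \<in> U \<Longrightarrow> FD (\<lambda>x. h (f x)) p v = h (FD f p v)"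
  using FD_eqI[OF bounded_linear.has_derivative[OF _ smooth_has_derivative]] by metis

lemmas FD_fst = FD_bounded_linear[OF bounded_linear_fst]
lemmas FD_snd = FD_bounded_linear[OF bounded_linear_snd]
lemmas FD_minus = FD_bounded_linear[OF bounded_linear_minus[OF bounded_linear_ident]]
lemmas FD_inner_left = FD_bounded_linear[OF bounded_linear_inner_left]

lemma FD_scaleR: "smooth_on U g \<Longrightarrow> smooth_on U f \<Longrightarrow> p \<in> U \<Longrightarrow>
    FD (\<lambda>x. g x *\<^sub>R f x) p v = g p *\<^sub>R FD f p v + FD g p v *\<^sub>R f p"
  using FD_eqI[OF has_derivative_scaleR[OF smooth_has_derivative smooth_has_derivative]] by metis

lemma FD_sum:
  assumes "\<And>i. i \<in> I \<Longrightarrow> smooth_on U (f i)" "p \<in> U"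
  shows "FD (\<lambda>x. \<Sum>i\<in>I. f i x) p v = (\<Sum>i\<in>I. FD (f i) p v)"
proof -
  have "((\<lambda>x. \<Sum>i\<in>I. f i x) has_derivative (\<lambda>v. \<Sum>i\<in>I. FD (f i) p v)) (at p)"
    by (intro has_derivative_sum smooth_has_derivative[OF assms])
  from FD_eqI[OF this] show ?thesis by simp
qed

lemma FD_cong2: "open U \<Longrightarrow> p \<in> U \<Longrightarrow> (\<And>q. q \<in> U \<Longrightarrow> f q = g q) \<Longrightarrow> FD f p v = FD g p v"
  by (metis FD_cong)

lemma trace_commute:
  fixes S T :: "'a::euclidean_space \<Rightarrow> 'a"
  assumes "linear S" "linear T"
  shows "(\<Sum>e\<in>Basis. S (T e) \<bullet> e) = (\<Sum>e\<in>Basis. T (S e) \<bullet> e)"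
proof -
  have *: "(\<Sum>e\<in>Basis. S (T e) \<bullet> e) = (\<Sum>e\<in>Basis. \<Sum>d\<in>Basis. (T e \<bullet> d) * (S d \<bullet> e))" if "linear S" for S T :: "'a \<Rightarrow> 'a"
    by (subst linear_expand[OF that, of "T e" for e]) (simp add: inner_sum_left)
  show ?thesis unfolding *[OF assms(1)] *[OF assms(2)] by (subst sum.swap) (simp add: mult.commute)
qed

lemma sum_Basis_prod:
  "(\<Sum>b\<in>Basis. f b) = (\<Sum>e\<in>Basis. f (e, 0)) + (\<Sum>e\<in>Basis. f (0, e))"
  for f :: "'a::euclidean_space \<times> 'b::euclidean_space \<Rightarrow> 'c::comm_monoid_add"
proof -
  have "inj_on (\<lambda>u :: 'a. (u, 0 :: 'b)) Basis" "inj_on (\<lambda>u :: 'b. (0 :: 'a, u)) Basis" by (auto intro: inj_onI)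
  then show ?thesis
    unfolding Basis_prod_def by (subst sum.union_disjoint) (auto simp: sum.reindex)
qed

text \<open>For \<open>v = (u, 0) + (A w, w)\<close>, \<open>I\<close> negates the second summand
  and \<open>K\<close> exchanges \<open>u\<close> and \<open>w\<close>. This is the structure with
  \<open>E w = (A w, w)\<close> in coordinate-free form.\<close>

definition lax_I :: "('a \<times> 'a \<Rightarrow> 'a \<Rightarrow> 'a) \<Rightarrow> 'a \<times> 'a \<Rightarrow> 'a \<times> 'a \<Rightarrow> 'a::euclidean_space \<times> 'a" where
  "lax_I A p v = (fst v - 2 *\<^sub>R A p (snd v), - snd v)"

definition lax_K :: "('a \<times> 'a \<Rightarrow> 'a \<Rightarrow> 'a) \<Rightarrow> 'a \<times> 'a \<Rightarrow> 'a \<times> 'a \<Rightarrow> 'a::euclidean_space \<times> 'a" where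
  "lax_K A p v = (A p (fst v - A p (snd v)) + snd v, fst v - A p (snd v))"

definition lax_J :: "('a \<times> 'a \<Rightarrow> 'a \<Rightarrow> 'a) \<Rightarrow> 'a \<times> 'a \<Rightarrow> 'a \<times> 'a \<Rightarrow> 'a::euclidean_space \<times> 'a" where
  "lax_J A p v = lax_I A p (lax_K A p v)"

definition ucomp :: "('a \<times> 'a \<Rightarrow> 'a \<Rightarrow> 'a) \<Rightarrow> 'a \<times> 'a \<Rightarrow> 'a \<times> 'a \<Rightarrow> 'a::euclidean_space" where
  "ucomp A p v = fst v - A p (snd v)"

text \<open>Up to sign, the Christoffel symbol of the Chern connection along \<open>E\<close> in the
  frame \<open>(u, 0)\<close>, \<open>(A w, w)\<close>.\<close>

definition Cc :: "('a \<times> 'a \<Rightarrow> 'a \<Rightarrow> 'a) \<Rightarrow> 'a \<times> 'a \<Rightarrow> 'a \<Rightarrow> 'a \<Rightarrow> 'a::euclidean_space" where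
  "Cc A p e u = FD (\<lambda>q. A q u) p (e, 0)"

text \<open>The Chern connection preserves the splitting \<open>v = (u, 0) + (A w, w)\<close>, and is given on both
  components by the same covariant derivative \<open>nab\<close>.\<close>

definition nab :: "('a \<times> 'a \<Rightarrow> 'a \<Rightarrow> 'a) \<Rightarrow> ('a \<times> 'a \<Rightarrow> 'a \<times> 'a) \<Rightarrow> ('a \<times> 'a \<Rightarrow> 'a) \<Rightarrow> 'a \<times> 'a \<Rightarrow> 'a::euclidean_space" where
  "nab A X s p = FD s p (X p) - Cc A p (snd (X p)) (s p)"

definition lax_conn :: "('a \<times> 'a \<Rightarrow> 'a \<Rightarrow> 'a) \<Rightarrow> ('a \<times> 'a \<Rightarrow> 'a \<times> 'a) \<Rightarrow> ('a \<times> 'a \<Rightarrow> 'a \<times> 'a) \<Rightarrow> 'a \<times> 'a \<Rightarrow> 'a::euclidean_space \<times> 'a" where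
  "lax_conn A X Y p = (nab A X (\<lambda>q. ucomp A q (Y q)) p + A p (nab A X (\<lambda>q. snd (Y q)) p), nab A X (\<lambda>q. snd (Y q)) p)"

lemma ucomp_lax_conn: "ucomp A q (lax_conn A X Y q) = nab A X (\<lambda>q. ucomp A q (Y q)) q"
  by (simp add: ucomp_def lax_conn_def)

lemma snd_lax_conn: "snd (lax_conn A X Y q) = nab A X (\<lambda>q. snd (Y q)) q"
  by (simp add: lax_conn_def)

text \<open>\<open>F1\<close> and \<open>F2\<close> express that the coefficients of
  \<open>t\<close> and of \<open>t^2\<close> vanish in the brackets of the Lax fields.\<close>

locale lax =
  fixes W :: "('a::euclidean_space \<times> 'a) set" and A :: "'a \<times> 'a \<Rightarrow> 'a \<Rightarrow> 'a"
  assumes oW: "open W" and lin: "p \<in> W \<Longrightarrow> linear (A p)" and sm: "smooth_on W (\<lambda>p. A p w)"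
    and F1: "p \<in> W \<Longrightarrow> FD (\<lambda>q. A q w) p (v, 0) = FD (\<lambda>q. A q v) p (w, 0)"
    and F2: "p \<in> W \<Longrightarrow> FD (\<lambda>q. A q w) p (A p v, v) = FD (\<lambda>q. A q v) p (A p w, w)"
begin

section \<open>Calculus of the connection in the Lax frame\<close>

lemma C_sym: "p \<in> W \<Longrightarrow> Cc A p e u = Cc A p u e"
  using F1 by (simp add: Cc_def)

lemma lin_FDA: "p \<in> W \<Longrightarrow> linear (FD (\<lambda>q. A q u) p)"
  using smooth_linear_FD[OF sm] .

lemma C_lin2: "p \<in> W \<Longrightarrow> linear (Cc A p e)"
  using linear_FD_linear_family[OF oW lin sm] unfolding Cc_def .

lemma C_lin1: assumes "p \<in> W" shows "linear (\<lambda>e. Cc A p e u)"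
proof -
  have "(\<lambda>e. Cc A p e u) = Cc A p u" by (rule ext) (rule C_sym[OF assms])
  then show ?thesis using C_lin2[OF assms] by simp
qed

lemma C_smooth: "smooth_on W (\<lambda>p. Cc A p e u)"
  unfolding Cc_def by (rule smooth_on_FD[OF sm])

lemma smooth_on_C:
  assumes "smooth_on W f" "smooth_on W g"
  shows "smooth_on W (\<lambda>p. Cc A p (f p) (g p))"
  by (rule smooth_on_linear_family[OF oW C_lin2 _ assms(2)], assumption,
      rule smooth_on_linear_family[where L="\<lambda>p e. Cc A p e b" for b, OF oW C_lin1 C_smooth assms(1)])

lemma FD_C:
  assumes "smooth_on W f" "smooth_on W g" "p \<in> W"
  shows "FD (\<lambda>q. Cc A q (f q) (g q)) p d =
    FD (\<lambda>q. Cc A q (f p) (g p)) p d + Cc A p (FD f p d) (g p) + Cc A p (f p) (FD g p d)"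
proof -
  have "FD (\<lambda>q. Cc A q (f q) (g q)) p d = FD (\<lambda>q. Cc A q (f q) (g p)) p d + Cc A p (f p) (FD g p d)"
    by (rule FD_linear_family[OF oW C_lin2 smooth_on_C[OF assms(1) smooth_on_const[OF oW]] assms(2,3)])
  also have "FD (\<lambda>q. Cc A q (f q) (g p)) p d = FD (\<lambda>q. Cc A q (f p) (g p)) p d + Cc A p (FD f p d) (g p)"
    by (rule FD_linear_family[where L="\<lambda>q e. Cc A q e (g p)", OF oW C_lin1 C_smooth assms(1,3)])
  finally show ?thesis .
qed

lemma smooth_on_A: "smooth_on W f \<Longrightarrow> smooth_on W (\<lambda>p. A p (f p))"
  by (rule smooth_on_linear_family[OF oW lin sm])

lemma smooth_on_ucomp: "smooth_on W Y \<Longrightarrow> smooth_on W (\<lambda>q. ucomp A q (Y q))"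
  unfolding ucomp_def by (intro smooth_intros oW smooth_on_A)

lemma smooth_on_nab: "smooth_on W X \<Longrightarrow> smooth_on W s \<Longrightarrow> smooth_on W (nab A X s)"
  unfolding nab_def by (intro smooth_intros oW smooth_on_FD2 smooth_on_C)

lemma smooth_on_lax_conn: "smooth_on W X \<Longrightarrow> smooth_on W Y \<Longrightarrow> smooth_on W (lax_conn A X Y)"
  unfolding lax_conn_def by (intro smooth_intros oW smooth_on_nab smooth_on_A smooth_on_ucomp)

lemma nab_cong: "p \<in> W \<Longrightarrow> (\<And>q. q \<in> W \<Longrightarrow> s q = s' q) \<Longrightarrow> nab A X s p = nab A X s' p"
  unfolding nab_def using FD_cong2[OF oW] by metis

lemma nab_add: "smooth_on W s \<Longrightarrow> smooth_on W s' \<Longrightarrow> p \<in> W \<Longrightarrow> nab A X (\<lambda>q. s q + s' q) p = nab A X s p + nab A X s' p"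
  by (simp add: nab_def FD_add linear_add[OF C_lin2])

lemma nab_minus: "smooth_on W s \<Longrightarrow> p \<in> W \<Longrightarrow> nab A X (\<lambda>q. - s q) p = - nab A X s p"
  by (simp add: nab_def FD_minus linear_neg[OF C_lin2])

lemma nab_scaleR: "smooth_on W g \<Longrightarrow> smooth_on W s \<Longrightarrow> p \<in> W \<Longrightarrow>
    nab A X (\<lambda>q. g q *\<^sub>R s q) p = FD g p (X p) *\<^sub>R s p + g p *\<^sub>R nab A X s p"
  by (simp add: nab_def FD_scaleR linear_scale[OF C_lin2] algebra_simps)

lemma nab_add1: "smooth_on W s \<Longrightarrow> p \<in> W \<Longrightarrow> nab A (\<lambda>q. X q + X' q) s p = nab A X s p + nab A X' s p"
  by (simp add: nab_def linear_add[OF smooth_linear_FD] linear_add[OF C_lin1])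

lemma nab_scaleR1: "smooth_on W s \<Longrightarrow> p \<in> W \<Longrightarrow> nab A (\<lambda>q. g q *\<^sub>R X q) s p = g p *\<^sub>R nab A X s p"
  by (simp add: nab_def linear_scale[OF smooth_linear_FD] linear_scale[OF C_lin1] scaleR_diff_right)

lemma nab_0: "p \<in> W \<Longrightarrow> (\<And>q. q \<in> W \<Longrightarrow> s q = 0) \<Longrightarrow> nab A X s p = 0"
  using nab_cong[of p s "\<lambda>_. 0"] by (simp add: nab_def linear_0[OF C_lin2])

lemma ucomp_add: "p \<in> W \<Longrightarrow> ucomp A p (v + w) = ucomp A p v + ucomp A p w"
  by (simp add: ucomp_def linear_add[OF lin])

lemma ucomp_scaleR: "p \<in> W \<Longrightarrow> ucomp A p (c *\<^sub>R v) = c *\<^sub>R ucomp A p v"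
  by (simp add: ucomp_def linear_scale[OF lin] scaleR_diff_right)

lemma affine_connection: "affine_connection_on W (lax_conn A)"
  unfolding affine_connection_on_def
proof (intro conjI allI impI ballI)
  fix X Y :: "'a \<times> 'a \<Rightarrow> 'a \<times> 'a" assume X: "smooth_on W X" and Y: "smooth_on W Y"
  note sY = smooth_on_ucomp[OF Y] smooth_on_snd[OF oW Y]
  show "smooth_on W (lax_conn A X Y)" by (rule smooth_on_lax_conn[OF X Y])
  show "lax_conn A (\<lambda>q. X q + X' q) Y p = lax_conn A X Y p + lax_conn A X' Y p" if "p \<in> W" for X' p
    using that by (simp add: lax_conn_def nab_add1[OF sY(1)] nab_add1[OF sY(2)] linear_add[OF lin])
  show "lax_conn A X (\<lambda>q. Y q + Y' q) p = lax_conn A X Y p + lax_conn A X Y' p" if Y': "smooth_on W Y'" and p: "p \<in> W" for Y' p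
  proof -
    note sY' = smooth_on_ucomp[OF Y'] smooth_on_snd[OF oW Y']
    have "nab A X (\<lambda>q. ucomp A q (Y q + Y' q)) p = nab A X (\<lambda>q. ucomp A q (Y q) + ucomp A q (Y' q)) p"
      by (rule nab_cong[OF p]) (rule ucomp_add)
    then show ?thesis
      using p by (simp add: lax_conn_def nab_add[OF sY(1) sY'(1)] nab_add[OF sY(2) sY'(2)] linear_add[OF lin])
  qed
  fix g :: "'a \<times> 'a \<Rightarrow> real" and p assume g: "smooth_on W g" and p: "p \<in> W"
  show "lax_conn A (\<lambda>q. g q *\<^sub>R X q) Y p = g p *\<^sub>R lax_conn A X Y p"
    using p by (simp add: lax_conn_def nab_scaleR1[OF sY(1)] nab_scaleR1[OF sY(2)] linear_scale[OF lin] scaleR_add_right)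
  have "nab A X (\<lambda>q. ucomp A q (g q *\<^sub>R Y q)) p = nab A X (\<lambda>q. g q *\<^sub>R ucomp A q (Y q)) p"
    by (rule nab_cong[OF p]) (rule ucomp_scaleR)
  moreover have "ucomp A p (Y p) = fst (Y p) - A p (snd (Y p))" by (simp add: ucomp_def)
  ultimately show "lax_conn A X (\<lambda>q. g q *\<^sub>R Y q) p = FD g p (X p) *\<^sub>R Y p + g p *\<^sub>R lax_conn A X Y p"
    using p by (simp add: lax_conn_def nab_scaleR[OF g sY(1)] nab_scaleR[OF g sY(2)] linear_add[OF lin] linear_scale[OF lin]
        prod_eq_iff algebra_simps)
qed

text \<open>\<open>C_sym\<close> settles the second component, \<open>F2\<close> enters in the
  first. Vanishing on all pairs, beyond the mixed ones of the Chern condition, is what later yields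
  the integrability of \<open>J\<close>.\<close>

lemma torsion_free:
  assumes X: "smooth_on W X" and Y: "smooth_on W Y" and p: "p \<in> W"
  shows "lax_conn A X Y p - lax_conn A Y X p = lie_bracket X Y p"
proof (rule prod_eqI)
  have s: "snd (FD Y p v) = FD (\<lambda>q. snd (Y q)) p v" "fst (FD Y p v) = FD (\<lambda>q. fst (Y q)) p v"
    if "smooth_on W Y" for Y :: "'a \<times> 'a \<Rightarrow> 'a \<times> 'a" and v
    using FD_snd[OF that p] FD_fst[OF that p] by auto
  show "snd (lax_conn A X Y p - lax_conn A Y X p) = snd (lie_bracket X Y p)"
    by (simp add: snd_lax_conn nab_def lie_bracket_def s[OF X] s[OF Y] C_sym[OF p])
  \<comment> \<open>Every term after the first is harmless under exchanging \<open>X\<close> and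
    \<open>Y\<close>: the second is symmetric by \<open>F2\<close>, the \<open>Cc\<close> terms are
    symmetric singly or in pairs by \<open>C_sym\<close>.\<close>
  have key: "fst (lax_conn A X Y p) = fst (FD Y p (X p)) - FD (\<lambda>q. A q (snd (Y p))) p (A p (snd (X p)), snd (X p))
      - Cc A p (fst (X p)) (snd (Y p)) - Cc A p (snd (X p)) (fst (Y p)) - A p (Cc A p (snd (X p)) (snd (Y p)))
      + Cc A p (A p (snd (X p))) (snd (Y p)) + Cc A p (snd (X p)) (A p (snd (Y p)))"
    if Y: "smooth_on W Y" for X Y :: "'a \<times> 'a \<Rightarrow> 'a \<times> 'a"
  proof -
    have "FD (\<lambda>q. ucomp A q (Y q)) p (X p) = fst (FD Y p (X p)) - FD (\<lambda>q. A q (snd (Y q))) p (X p)"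
      unfolding ucomp_def s[OF Y]
      by (rule FD_diff[OF smooth_on_fst[OF oW Y] smooth_on_A[OF smooth_on_snd[OF oW Y]] p])
    also have "FD (\<lambda>q. A q (snd (Y q))) p (X p) = FD (\<lambda>q. A q (snd (Y p))) p (X p) + A p (snd (FD Y p (X p)))"
      using FD_linear_family[OF oW lin sm smooth_on_snd[OF oW Y] p] by (simp add: s[OF Y])
    also have "FD (\<lambda>q. A q (snd (Y p))) p (X p) = FD (\<lambda>q. A q (snd (Y p))) p (A p (snd (X p)), snd (X p)) +
        (Cc A p (fst (X p)) (snd (Y p)) - Cc A p (A p (snd (X p))) (snd (Y p)))"
    proof -
      have "X p = (A p (snd (X p)), snd (X p)) + ((fst (X p), 0) - (A p (snd (X p)), 0))" by (simp add: prod_eq_iff)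
      then have "FD (\<lambda>q. A q (snd (Y p))) p (X p) =
          FD (\<lambda>q. A q (snd (Y p))) p ((A p (snd (X p)), snd (X p)) + ((fst (X p), 0) - (A p (snd (X p)), 0)))" by (rule arg_cong)
      then show ?thesis
        unfolding linear_add[OF lin_FDA[OF p]] linear_diff[OF lin_FDA[OF p]] Cc_def .
    qed
    finally show ?thesis
      using p by (simp add: lax_conn_def nab_def s[OF Y] ucomp_def linear_diff[OF C_lin2] linear_diff[OF lin])
  qed
  show "fst (lax_conn A X Y p - lax_conn A Y X p) = fst (lie_bracket X Y p)"
    unfolding fst_diff key[OF X] key[OF Y] lie_bracket_def
    by (simp add: F2[OF p, of "snd (Y p)" "snd (X p)"] C_sym[OF p, of "snd (X p)"] C_sym[OF p, of "fst (X p)"] C_sym[OF p, of "A p (snd (X p))"])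
qed

section \<open>Eigendistributions and algebra of the three endomorphisms\<close>

lemma eigen_I_plus:
  assumes "p \<in> W"
  shows "eigendistribution (lax_I A) 1 p = {v. snd v = 0}"
proof -
  have neg: "b = 0" if "- b = b" for b :: 'a
  proof -
    from that have "b + b = 0" using add.right_inverse[of b] by simp
    then have "2 *\<^sub>R b = 0" by (simp only: scaleR_2)
    then show "b = 0" by simp
  qed
  have "lax_I A p v = v \<longleftrightarrow> snd v = 0" for v
  proof
    assume "lax_I A p v = v"
    then have "- snd v = snd v" unfolding lax_I_def by (metis snd_conv)
    then show "snd v = 0" by (rule neg)
  qed (simp add: lax_I_def prod_eq_iff linear_0[OF lin[OF assms]])
  then show ?thesis by (simp add: eigendistribution_def)
qed

lemma eigen_I_minus: "eigendistribution (lax_I A) (-1) p = {v. fst v = A p (snd v)}"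
proof -
  have "x - 2 *\<^sub>R y = - x \<longleftrightarrow> x = y" for x y :: 'a
  proof
    assume "x - 2 *\<^sub>R y = - x"
    then have "2 *\<^sub>R x = 2 *\<^sub>R y" by (simp add: scaleR_2 algebra_simps)
    then show "x = y" by simp
  qed (simp add: scaleR_2)
  then show ?thesis by (auto simp: eigendistribution_def lax_I_def prod_eq_iff)
qed

lemma eigen_K_plus: "eigendistribution (lax_K A) 1 p = {v. fst v = A p (snd v) + snd v}"
  by (auto simp: eigendistribution_def lax_K_def prod_eq_iff algebra_simps)

lemma eigen_K_minus: "p \<in> W \<Longrightarrow> eigendistribution (lax_K A) (-1) p = {v. fst v = A p (snd v) - snd v}"
proof -
  assume p: "p \<in> W"
  have "lax_K A p v = - v \<longleftrightarrow> fst v = A p (snd v) - snd v" for v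
  proof
    assume "fst v = A p (snd v) - snd v"
    then have "fst v - A p (snd v) = - snd v" by simp
    then show "lax_K A p v = - v" using linear_neg[OF lin[OF p]] \<open>fst v = _\<close> by (simp add: lax_K_def prod_eq_iff)
  qed (auto simp: lax_K_def prod_eq_iff algebra_simps)
  then show ?thesis by (simp add: eigendistribution_def)
qed

lemma lax_algebra:
  assumes "p \<in> W"
  shows "lax_I A p (lax_I A p v) = v" "lax_K A p (lax_K A p v) = v" "lax_K A p (lax_I A p v) = - lax_J A p v"
    "lax_J A p (lax_J A p v) = - v" "lax_I A p (lax_J A p v) = - lax_J A p (lax_I A p v)"
    "lax_K A p (lax_J A p v) = - lax_J A p (lax_K A p v)"
    "linear (lax_I A p)" "linear (lax_K A p)" "linear (lax_J A p)"
    "ucomp A p (lax_J A p v) = snd v" "snd (lax_J A p v) = - ucomp A p v"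
proof -
  note l = linear_add[OF lin[OF assms]] linear_diff[OF lin[OF assms]] linear_neg[OF lin[OF assms]] linear_scale[OF lin[OF assms]]
  note d = lax_I_def lax_K_def lax_J_def ucomp_def l scaleR_2 prod_eq_iff
  show "lax_I A p (lax_I A p v) = v" "lax_K A p (lax_K A p v) = v" "lax_K A p (lax_I A p v) = - lax_J A p v"
    "lax_J A p (lax_J A p v) = - v" "lax_I A p (lax_J A p v) = - lax_J A p (lax_I A p v)"
    "lax_K A p (lax_J A p v) = - lax_J A p (lax_K A p v)"
    "ucomp A p (lax_J A p v) = snd v" "snd (lax_J A p v) = - ucomp A p v"
    by (simp_all add: d algebra_simps)
  show I: "linear (lax_I A p)" by (rule linearI) (simp_all add: lax_I_def l prod_eq_iff algebra_simps)
  show K: "linear (lax_K A p)" by (rule linearI) (simp_all add: d algebra_simps)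
  show "linear (lax_J A p)" using linear_compose[OF K I] by (simp add: lax_J_def[abs_def] o_def)
qed

lemma endo:
  "endomorphism_field W (lax_I A)" "endomorphism_field W (lax_K A)" "endomorphism_field W (lax_J A)"
proof -
  have I: "smooth_on W (\<lambda>p. lax_I A p (f p))" if "smooth_on W f" for f
    unfolding lax_I_def by (intro smooth_intros oW smooth_on_A that)
  have K: "smooth_on W (\<lambda>p. lax_K A p (f p))" if "smooth_on W f" for f
    unfolding lax_K_def by (intro smooth_intros oW smooth_on_A that)
  show "endomorphism_field W (lax_I A)" "endomorphism_field W (lax_K A)" "endomorphism_field W (lax_J A)"
    unfolding endomorphism_field_def
    by (intro conjI ballI allI I K smooth_on_const oW lax_algebra(7,8,9); (assumption | unfold lax_J_def)?;
        intro I K smooth_on_const oW)+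
qed

lemma smooth_on_J: "smooth_on W Y \<Longrightarrow> smooth_on W (\<lambda>q. lax_J A q (Y q))"
  using endo(3) smooth_on_linear_family[where L="lax_J A", OF oW lax_algebra(9)] unfolding endomorphism_field_def by blast

lemma conn_J:
  assumes Y: "smooth_on W Y" and p: "p \<in> W"
  shows "lax_conn A X (\<lambda>q. lax_J A q (Y q)) p = lax_J A p (lax_conn A X Y p)"
proof -
  have 1: "nab A X (\<lambda>q. ucomp A q (lax_J A q (Y q))) p = nab A X (\<lambda>q. snd (Y q)) p"
    by (rule nab_cong[OF p]) (rule lax_algebra(10))
  have "nab A X (\<lambda>q. snd (lax_J A q (Y q))) p = nab A X (\<lambda>q. - ucomp A q (Y q)) p"
    by (rule nab_cong[OF p]) (rule lax_algebra(11))
  then have 2: "nab A X (\<lambda>q. snd (lax_J A q (Y q))) p = - nab A X (\<lambda>q. ucomp A q (Y q)) p"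
    using nab_minus[OF smooth_on_ucomp[OF Y] p] by simp
  have 3: "v = w" if "ucomp A p v = ucomp A p w" "snd v = snd w" for v w
    using that by (simp add: ucomp_def prod_eq_iff)
  show ?thesis
    by (rule 3) (simp_all add: ucomp_lax_conn snd_lax_conn 1 2 lax_algebra(10,11)[OF p])
qed

text \<open>Every bracket is rewritten by \<open>torsion_free\<close>, and \<open>conn_J\<close>
  moves \<open>J\<close> outside; then the terms cancel in pairs.\<close>

lemma nijenhuis_J:
  assumes X: "smooth_on W X" and Y: "smooth_on W Y" and p: "p \<in> W"
  shows "nijenhuis (lax_J A) X Y p = 0"
proof -
  note JX = smooth_on_J[OF X] and JY = smooth_on_J[OF Y]
  note J = linear_diff[OF lax_algebra(9)[OF p]] lax_algebra(4)[OF p]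
  show ?thesis
    unfolding nijenhuis_def torsion_free[OF JX JY p, symmetric] torsion_free[OF JX Y p, symmetric]
      torsion_free[OF X JY p, symmetric] torsion_free[OF X Y p, symmetric] conn_J[OF X p] conn_J[OF Y p] J
    by simp
qed

lemma chern:
  "chern_connection W (eigendistribution (lax_I A) 1) (eigendistribution (lax_I A) (-1)) (eigendistribution (lax_K A) 1) (lax_conn A)"
  unfolding chern_connection_def
proof (intro conjI affine_connection)
  have u0: "ucomp A p v = 0 \<longleftrightarrow> fst v = A p (snd v)" and uw: "fst v = A p (snd v) + snd v \<longleftrightarrow> ucomp A p v = snd v" for p v
    by (auto simp: ucomp_def algebra_simps)
  show "parallel_on W (lax_conn A) (eigendistribution (lax_I A) 1)"
    by (auto simp: parallel_on_def eigen_I_plus snd_lax_conn intro!: nab_0)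
  show "parallel_on W (lax_conn A) (eigendistribution (lax_I A) (- 1))"
    by (auto simp: parallel_on_def eigen_I_minus ucomp_lax_conn u0[symmetric] intro!: nab_0)
  show "parallel_on W (lax_conn A) (eigendistribution (lax_K A) 1)"
    by (auto simp: parallel_on_def eigen_K_plus uw ucomp_lax_conn snd_lax_conn intro!: nab_cong)
  show "\<forall>X Y. smooth_on W X \<longrightarrow> smooth_on W Y \<longrightarrow>
      (\<forall>p\<in>W. X p \<in> eigendistribution (lax_I A) 1 p \<and> Y p \<in> eigendistribution (lax_I A) (- 1) p) \<longrightarrow>
      (\<forall>p\<in>W. torsion (lax_conn A) X Y p = 0)"
    using torsion_free by (simp add: torsion_def)
qed

section \<open>Curvature and Ricci tensor of the Lax structure\<close>

definition "Curv p d y s = FD (\<lambda>q. Cc A q (snd d) s) p y - FD (\<lambda>q. Cc A q (snd y) s) p d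
    + Cc A p (snd d) (Cc A p (snd y) s) - Cc A p (snd y) (Cc A p (snd d) s)"

lemma curvature_nab:
  assumes X: "smooth_on W X" and Y: "smooth_on W Y" and s: "smooth_on W s" and p: "p \<in> W"
  shows "nab A X (nab A Y s) p - nab A Y (nab A X s) p - nab A (lie_bracket X Y) s p = Curv p (X p) (Y p) (s p)"
proof -
  have *: "nab A X (nab A Y s) p = FD (\<lambda>q. FD s q (Y p)) p (X p) + FD s p (FD Y p (X p))
      - FD (\<lambda>q. Cc A q (snd (Y p)) (s p)) p (X p) - Cc A p (snd (FD Y p (X p))) (s p) - Cc A p (snd (Y p)) (FD s p (X p))
      - Cc A p (snd (X p)) (FD s p (Y p)) + Cc A p (snd (X p)) (Cc A p (snd (Y p)) (s p))"
    if Y: "smooth_on W Y" for X Y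
  proof -
    note Y2 = smooth_on_snd[OF oW Y]
    have "FD (nab A Y s) p (X p) = FD (\<lambda>q. FD s q (Y q)) p (X p) - FD (\<lambda>q. Cc A q (snd (Y q)) (s q)) p (X p)"
      unfolding nab_def by (rule FD_diff[OF smooth_on_FD2[OF oW s Y] smooth_on_C[OF Y2 s] p])
    also have "FD (\<lambda>q. FD s q (Y q)) p (X p) = FD (\<lambda>q. FD s q (Y p)) p (X p) + FD s p (FD Y p (X p))"
      by (rule FD_linear_family[OF oW smooth_linear_FD[OF s] smooth_on_FD[OF s] Y p])
    also have "FD (\<lambda>q. Cc A q (snd (Y q)) (s q)) p (X p) = FD (\<lambda>q. Cc A q (snd (Y p)) (s p)) p (X p)
        + Cc A p (snd (FD Y p (X p))) (s p) + Cc A p (snd (Y p)) (FD s p (X p))"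
      using FD_C[OF Y2 s p] FD_snd[OF Y p] by simp
    finally show ?thesis
      unfolding nab_def[of A X "nab A Y s"] using p by (simp add: nab_def[of A Y s p] linear_diff[OF C_lin2])
  qed
  have c: "FD (\<lambda>q. FD s q (Y p)) p (X p) = FD (\<lambda>q. FD s q (X p)) p (Y p)" by (rule smooth_FD_commute[OF oW s p])
  show ?thesis
    unfolding *[OF X] *[OF Y] nab_def[of A "lie_bracket X Y"] lie_bracket_def Curv_def c
    using p by (simp add: linear_diff[OF smooth_linear_FD[OF s]] linear_diff[OF C_lin1])
qed

text \<open>The \<open>x\<close>-derivative of \<open>F2\<close> along \<open>w\<close>, with
  derivatives exchanged. It yields both the flatness of \<open>Curv\<close> on pairs of vectors
  \<open>(A e, e)\<close> and the closedness of the linear part of the trace.\<close>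

lemma F2_derivative:
  assumes p: "p \<in> W"
  shows "FD (\<lambda>q. Cc A q w y) p (A p e, e) + Cc A p (Cc A p w e) y = FD (\<lambda>q. Cc A q w e) p (A p y, y) + Cc A p (Cc A p w y) e"
proof -
  have *: "FD (\<lambda>q. FD (\<lambda>q'. A q' y) q (A q e, e)) p (w, 0) = FD (\<lambda>q. Cc A q w y) p (A p e, e) + Cc A p (Cc A p w e) y" for y e
  proof -
    have "FD (\<lambda>q. FD (\<lambda>q'. A q' y) q (A q e, e)) p (w, 0) =
        FD (\<lambda>q. FD (\<lambda>q'. A q' y) q (A p e, e)) p (w, 0) + FD (\<lambda>q'. A q' y) p (FD (\<lambda>q. (A q e, e)) p (w, 0))"
      by (rule FD_linear_family[OF oW lin_FDA smooth_on_FD[OF sm] _ p]) (assumption | intro smooth_intros oW sm)+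
    also have "FD (\<lambda>q. (A q e, e)) p (w, 0) = (Cc A p w e, 0)"
      using FD_eqI[OF has_derivative_Pair[OF smooth_has_derivative[OF sm p] has_derivative_const[of e]], of e] by (simp add: Cc_def)
    also have "FD (\<lambda>q. FD (\<lambda>q'. A q' y) q (A p e, e)) p (w, 0) = FD (\<lambda>q. FD (\<lambda>q'. A q' y) q (w, 0)) p (A p e, e)"
      by (rule smooth_FD_commute[OF oW sm p])
    finally show ?thesis by (simp add: Cc_def)
  qed
  have "FD (\<lambda>q. FD (\<lambda>q'. A q' y) q (A q e, e)) p (w, 0) = FD (\<lambda>q. FD (\<lambda>q'. A q' e) q (A q y, y)) p (w, 0)"
    by (rule FD_cong2[OF oW p F2])
  then show ?thesis unfolding * .
qed

text \<open>The second \<open>x\<close>-derivative of \<open>A\<close>, formally the third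
  derivative of a potential \<open>R\<close>; hence the symmetry in all three arguments.\<close>

definition "T p v e u = FD (\<lambda>q. Cc A q e u) p (v, 0)"

lemma T_sym: assumes "p \<in> W" shows "T p v e u = T p v u e" "T p v e u = T p e v u"
proof -
  show "T p v e u = T p v u e" unfolding T_def by (rule FD_cong2[OF oW assms C_sym])
  show "T p v e u = T p e v u" unfolding T_def Cc_def by (rule smooth_FD_commute[OF oW sm assms])
qed

lemma T_lin: "p \<in> W \<Longrightarrow> linear (\<lambda>v. T p v e u)"
  unfolding T_def
  by (rule linear_compose[of "\<lambda>v. (v, 0)" "FD (\<lambda>q. Cc A q e u) p" for p, unfolded o_def])
    (auto intro: linearI smooth_linear_FD[OF C_smooth])

lemma T_trace:
  assumes p: "p \<in> W"
  shows "(\<Sum>e\<in>Basis. T p e v w \<bullet> e) = FD (\<lambda>q. FD (\<lambda>q'. \<Sum>e\<in>Basis. A q' e \<bullet> e) q (v, 0)) p (w, 0)"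
proof -
  have i: "smooth_on W (\<lambda>q. A q e \<bullet> e)" for e by (intro smooth_intros oW sm)
  have "FD (\<lambda>q. FD (\<lambda>q'. \<Sum>e\<in>Basis. A q' e \<bullet> e) q (v, 0)) p (w, 0) = FD (\<lambda>q. \<Sum>e\<in>Basis. FD (\<lambda>q'. A q' e \<bullet> e) q (v, 0)) p (w, 0)"
    by (rule FD_cong2[OF oW p]) (rule FD_sum[OF i])
  also have "\<dots> = (\<Sum>e\<in>Basis. FD (\<lambda>q. FD (\<lambda>q'. A q' e \<bullet> e) q (v, 0)) p (w, 0))"
    by (rule FD_sum[OF smooth_on_FD[OF i] p])
  also have "\<dots> = (\<Sum>e\<in>Basis. T p w v e \<bullet> e)"
  proof (rule sum.cong[OF refl])
    fix e :: 'a
    have "FD (\<lambda>q. FD (\<lambda>q'. A q' e \<bullet> e) q (v, 0)) p (w, 0) = FD (\<lambda>q. Cc A q v e \<bullet> e) p (w, 0)"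
      unfolding Cc_def by (rule FD_cong2[OF oW p]) (rule FD_inner_left[OF sm])
    also have "\<dots> = T p w v e \<bullet> e" unfolding T_def by (rule FD_inner_left[OF C_smooth p])
    finally show "FD (\<lambda>q. FD (\<lambda>q'. A q' e \<bullet> e) q (v, 0)) p (w, 0) = T p w v e \<bullet> e" .
  qed
  also have "\<dots> = (\<Sum>e\<in>Basis. T p e v w \<bullet> e)" using T_sym[OF p] by metis
  finally show ?thesis by (rule sym)
qed

lemma Curv_lin: assumes p: "p \<in> W" shows "linear (\<lambda>d. Curv p d y s)" "linear (\<lambda>y. Curv p d y s)"
proof -
  have a: "linear (\<lambda>d. FD (\<lambda>q. Cc A q (snd d) s) p y)" for y
    using linear_compose[OF linear_snd linear_FD_linear_family[where L="\<lambda>q e. Cc A q e s", OF oW C_lin1 C_smooth p]]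
    by (simp add: o_def)
  have b: "linear (FD (\<lambda>q. Cc A q (snd y) s) p)" for y by (rule smooth_linear_FD[OF C_smooth p])
  have c: "linear (\<lambda>d. Cc A p (snd d) z)" for z
    using linear_compose[OF linear_snd C_lin1[OF p]] by (simp add: o_def)
  have e: "linear (\<lambda>d. Cc A p z (Cc A p (snd d) s))" for z
    using linear_compose[OF c C_lin2[OF p]] by (simp add: o_def)
  show "linear (\<lambda>d. Curv p d y s)" "linear (\<lambda>y. Curv p d y s)"
    unfolding Curv_def by (intro linear_compose_add linear_compose_sub a b c e)+
qed

lemma Curv_flat: assumes p: "p \<in> W" shows "Curv p (A p e, e) (A p y, y) w = 0"
proof -
  have s: "FD (\<lambda>q. Cc A q y w) p d = FD (\<lambda>q. Cc A q w y) p d" for y d by (rule FD_cong2[OF oW p C_sym])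
  show ?thesis
    unfolding Curv_def snd_conv s
    using F2_derivative[OF p, of w y e] C_sym[OF p, of _ "Cc A p y w"] C_sym[OF p, of _ "Cc A p e w"] C_sym[OF p, of y w] C_sym[OF p, of e w]
    by (simp add: algebra_simps)
qed

text \<open>Since \<open>Curv\<close> vanishes on pairs \<open>(A e, e)\<close>,
  \<open>(A y, y)\<close>, only terms in \<open>T\<close> remain. The two that contain
  \<open>A\<close> cancel by \<open>trace_commute\<close>; the other two are second
  \<open>x\<close>-derivatives of the trace of \<open>A\<close>.\<close>

lemma ricci_zero:
  assumes tr: "\<And>q. q \<in> W \<Longrightarrow> (\<Sum>e\<in>Basis. A q e \<bullet> e) = 0"
    and Y: "smooth_on W Y" and Z: "smooth_on W Z" and p: "p \<in> W"
  shows "ricci (lax_conn A) Y Z p = 0"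
proof -
  define u where "u = ucomp A p (Z p)"
  define w where "w = snd (Z p)"
  define y where "y = Y p"
  have TT: "(\<Sum>e\<in>Basis. T p e v w \<bullet> e) = 0" for v w
  proof -
    have "FD (\<lambda>q'. \<Sum>e\<in>Basis. A q' e \<bullet> e) q (v, 0) = 0" if "q \<in> W" for q
      using FD_cong2[OF oW that tr] by simp
    then have "FD (\<lambda>q. FD (\<lambda>q'. \<Sum>e\<in>Basis. A q' e \<bullet> e) q (v, 0)) p (w, 0) = FD (\<lambda>q. 0) p (w, 0)"
      by (rule FD_cong2[OF oW p])
    then show ?thesis unfolding T_trace[OF p] by simp
  qed
  have curv: "curvature (lax_conn A) (\<lambda>_. b) Y Z p = (Curv p b y u + A p (Curv p b y w), Curv p b y w)" for b
  proof -
    note X = smooth_on_const[OF oW, of b]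
    have eq: "v = (x + A p z, z)" if "ucomp A p v = x" "snd v = z" for v x z using that by (auto simp: ucomp_def)
    have ud: "ucomp A p (a - b) = ucomp A p a - ucomp A p b" for a b
      by (simp add: ucomp_def linear_diff[OF lin[OF p]])
    show ?thesis
      unfolding curvature_def u_def w_def y_def
      by (rule eq) (simp_all only: ud snd_diff ucomp_lax_conn snd_lax_conn curvature_nab[OF X Y _ p] smooth_on_ucomp[OF Z] smooth_on_snd[OF oW Z])
  qed
  have c1: "Curv p (e, 0) y s = - T p e (snd y) s" for e s y
    unfolding Curv_def T_def
    by (simp add: linear_0[OF C_lin1[OF p]] linear_0[OF C_lin2[OF p]] linear_0[OF smooth_linear_FD[OF C_smooth p]]
        linear_0[OF linear_FD_linear_family[where L="\<lambda>q e. Cc A q e s", OF oW C_lin1 C_smooth p]])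
  have anti: "Curv p d y s = - Curv p y d s" for d y s by (simp add: Curv_def)
  have c2: "Curv p (0, e) y w = T p (ucomp A p y) e w + T p (A p e) (snd y) w" for e
  proof -
    have "(0, e) = (A p e, e) - (A p e, 0)" by simp
    then have "Curv p (0, e) y w = Curv p (A p e, e) y w - Curv p (A p e, 0) y w"
      using linear_diff[OF Curv_lin(1)[OF p]] by metis
    also have "Curv p (A p e, e) y w = Curv p (A p e, e) (A p (snd y), snd y) w + Curv p (A p e, e) (ucomp A p y, 0) w"
    proof -
      have "(A p (snd y), snd y) + (ucomp A p y, 0) = y" by (simp add: ucomp_def prod_eq_iff)
      then show ?thesis using linear_add[OF Curv_lin(2)[OF p]] by metis
    qed
    also have "Curv p (A p e, e) (ucomp A p y, 0) w = T p (ucomp A p y) e w"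
      by (subst anti) (simp add: c1)
    finally show ?thesis by (simp add: Curv_flat[OF p] c1)
  qed
  have "ricci (lax_conn A) Y Z p = (\<Sum>e\<in>Basis. (Curv p (e, 0) y u + A p (Curv p (e, 0) y w)) \<bullet> e) + (\<Sum>e\<in>Basis. Curv p (0, e) y w \<bullet> e)"
    unfolding ricci_def curv by (subst sum_Basis_prod) simp
  also have "\<dots> = - (\<Sum>e\<in>Basis. T p e (snd y) u \<bullet> e) - (\<Sum>e\<in>Basis. A p (T p e (snd y) w) \<bullet> e)
      + (\<Sum>e\<in>Basis. T p (ucomp A p y) e w \<bullet> e) + (\<Sum>e\<in>Basis. T p (A p e) (snd y) w \<bullet> e)"
    by (simp add: c1 c2 linear_neg[OF lin[OF p]] inner_add_left inner_diff_left sum.distrib sum_subtractf sum_negf)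
  also have "(\<Sum>e\<in>Basis. A p (T p e (snd y) w) \<bullet> e) = (\<Sum>e\<in>Basis. T p (A p e) (snd y) w \<bullet> e)"
    by (rule trace_commute[OF lin[OF p] T_lin[OF p]])
  also have "(\<Sum>e\<in>Basis. T p (ucomp A p y) e w \<bullet> e) = (\<Sum>e\<in>Basis. T p e (ucomp A p y) w \<bullet> e)"
    by (simp only: T_sym(2)[OF p, of "ucomp A p y"])
  finally show ?thesis by (simp add: TT)
qed

end

section \<open>Integrability of the four eigendistributions\<close>

lemma lax_subset: "lax U A \<Longrightarrow> open W \<Longrightarrow> W \<subseteq> U \<Longrightarrow> lax W A"
  unfolding lax_def using smooth_on_subset by blast

text \<open>The graph of \<open>A + c id\<close> is the member of the pencil with parameter
  \<open>t = 1/c\<close>, so the eigendistributions of \<open>K\<close> are reduced to the form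
  \<open>fst v = A p (snd v)\<close>. The additional terms in \<open>F2\<close> are \<open>c\<close>
  times \<open>F1\<close>.\<close>

lemma lax_shift:
  assumes "lax U A"
  shows "lax U (\<lambda>p w. A p w + c *\<^sub>R w)"
proof -
  interpret lax U A by fact
  have FD: "FD (\<lambda>q. A q w + c *\<^sub>R w) p d = FD (\<lambda>q. A q w) p d" if "p \<in> U" for p w d
    using FD_add[OF sm smooth_on_const[OF oW] that] by simp
  have l: "linear (\<lambda>w. A p w + c *\<^sub>R w)" if "p \<in> U" for p
    by (rule linearI) (simp_all add: linear_add[OF lin[OF that]] linear_scale[OF lin[OF that]] algebra_simps)
  have s: "smooth_on U (\<lambda>p. A p w + c *\<^sub>R w)" for w by (intro smooth_intros oW sm)
  have f1: "FD (\<lambda>q. A q w + c *\<^sub>R w) p (v, 0) = FD (\<lambda>q. A q v + c *\<^sub>R v) p (w, 0)" if "p \<in> U" for p v w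
    unfolding FD[OF that] by (rule F1[OF that])
  have f2: "FD (\<lambda>q. A q w + c *\<^sub>R w) p (A p v + c *\<^sub>R v, v) = FD (\<lambda>q. A q v + c *\<^sub>R v) p (A p w + c *\<^sub>R w, w)"
    if p: "p \<in> U" for p v w
  proof -
    have "(A p v + c *\<^sub>R v, v) = (A p v, v) + c *\<^sub>R (v, 0)" for v by simp
    then show ?thesis
      unfolding FD[OF p] using F1[OF p, of w v] F2[OF p, of w v]
      by (simp only: linear_add[OF lin_FDA[OF p]] linear_scale[OF lin_FDA[OF p]])
  qed
  show ?thesis by (rule lax.intro[OF oW l s f1 f2])
qed

lemma dim_graph:
  fixes B :: "'a::euclidean_space \<Rightarrow> 'a"
  assumes "linear B"
  shows "2 * dim {v. fst v = B (snd v)} = DIM('a \<times> 'a)"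
proof -
  have "linear (\<lambda>w. (B w, w))" using assms by (auto simp: linear_iff)
  moreover have "inj_on (\<lambda>w. (B w, w)) (span UNIV)" by (auto intro: inj_onI)
  ultimately have "dim ((\<lambda>w. (B w, w)) ` UNIV) = dim (UNIV :: 'a set)" by (rule dim_image_eq)
  moreover have "(\<lambda>w. (B w, w)) ` UNIV = {v. fst v = B (snd v)}" by (auto simp: image_iff prod_eq_iff)
  ultimately show ?thesis by (simp add: dim_UNIV)
qed

lemma dim_horizontal: "2 * dim {v :: 'a::euclidean_space \<times> 'a. snd v = 0} = DIM('a \<times> 'a)"
proof -
  have "linear (\<lambda>w :: 'a. (w, 0 :: 'a))" by (auto simp: linear_iff)
  moreover have "inj_on (\<lambda>w :: 'a. (w, 0 :: 'a)) (span UNIV)" by (auto intro: inj_onI)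
  ultimately have "dim ((\<lambda>w :: 'a. (w, 0 :: 'a)) ` UNIV) = dim (UNIV :: 'a set)" by (rule dim_image_eq)
  moreover have "(\<lambda>w :: 'a. (w, 0 :: 'a)) ` UNIV = {v. snd v = 0}" by (auto simp: image_iff prod_eq_iff)
  ultimately show ?thesis by (simp add: dim_UNIV)
qed

lemma integrable_distribution_cong:
  assumes "\<And>q. q \<in> U \<Longrightarrow> D q = D' q" "integrable_distribution U D"
  shows "integrable_distribution U D'"
  unfolding integrable_distribution_def
proof
  fix p assume "p \<in> U"
  from bspec[OF assms(2)[unfolded integrable_distribution_def] this]
  obtain V and \<phi> :: "'a \<Rightarrow> 'a" and S where *: "p \<in> V \<and> V \<subseteq> U \<and> diffeo_onto_image V \<phi> \<and> subspace S \<and>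
      (\<forall>q\<in>V. D q = {v. FD \<phi> q v \<in> S})"
    by (elim exE) (rule that)
  have "D' q = {v. FD \<phi> q v \<in> S}" if "q \<in> V" for q
  proof -
    have "q \<in> U" using * that by blast
    then show ?thesis using * that assms(1)[of q] by simp
  qed
  with * show "\<exists>V (\<phi> :: 'a \<Rightarrow> 'a) S. p \<in> V \<and> V \<subseteq> U \<and> diffeo_onto_image V \<phi> \<and> subspace S \<and> (\<forall>q\<in>V. D' q = {v. FD \<phi> q v \<in> S})"
    by (intro exI[where x=V] exI[where x=\<phi>] exI[where x=S]) simp
qed

lemma integrable_distribution_horizontal:
  assumes "open W"
  shows "integrable_distribution W (\<lambda>_. {v :: 'a::euclidean_space \<times> 'a. snd v = 0})"
proof -
  have d: "diffeo_onto_image W (\<lambda>q. q)"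
    using assms smooth_on_ident[OF assms] unfolding diffeo_onto_image_def by auto
  have s: "subspace {v :: 'a \<times> 'a. snd v = 0}" by (auto simp: subspace_def)
  have "\<forall>q\<in>W. {v. snd v = 0} = {v. FD (\<lambda>q. q) q v \<in> {v :: 'a \<times> 'a. snd v = 0}}" by simp
  with d s show ?thesis unfolding integrable_distribution_def by blast
qed

lemma lax_structure:
  fixes A :: "'a::euclidean_space \<times> 'a \<Rightarrow> 'a \<Rightarrow> 'a"
  assumes "lax U A" "0 \<in> U" and tr: "\<And>q. q \<in> U \<Longrightarrow> (\<Sum>e\<in>Basis. A q e \<bullet> e) = 0"
  obtains W where "open W" "0 \<in> W" "W \<subseteq> U" "hyper_para_complex_on W (lax_I A) (lax_K A) (lax_J A)"
    "ricci_flat_on W (lax_I A) (lax_K A)"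
proof -
  \<comment> \<open>The values 0, 1 and -1 of \<open>c\<close> serve the \<open>-1\<close>
    eigendistribution of \<open>I\<close> and the two of \<open>K\<close>; the \<open>+1\<close>
    eigendistribution of \<open>I\<close> is constant.\<close>
  have ex: "\<exists>W. open W \<and> 0 \<in> W \<and> W \<subseteq> U \<and>
      (\<forall>W'. open W' \<longrightarrow> W' \<subseteq> W \<longrightarrow> integrable_distribution W' (\<lambda>p. {v. fst v = A p (snd v) + c *\<^sub>R snd v}))" for c :: real
  proof -
    interpret L: lax U "\<lambda>p w. A p w + c *\<^sub>R w" by (rule lax_shift[OF assms(1)])
    show ?thesis by (rule integrable_distribution_graph[OF L.oW assms(2) L.lin L.sm L.F2]) blast+
  qed
  obtain W0 where W0: "open W0" "0 \<in> W0" "W0 \<subseteq> U"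
      "\<And>W'. open W' \<Longrightarrow> W' \<subseteq> W0 \<Longrightarrow> integrable_distribution W' (\<lambda>p. {v. fst v = A p (snd v) + 0 *\<^sub>R snd v})"
    using ex[of 0] by blast
  obtain W1 where W1: "open W1" "0 \<in> W1" "W1 \<subseteq> U"
      "\<And>W'. open W' \<Longrightarrow> W' \<subseteq> W1 \<Longrightarrow> integrable_distribution W' (\<lambda>p. {v. fst v = A p (snd v) + 1 *\<^sub>R snd v})"
    using ex[of 1] by blast
  obtain W2 where W2: "open W2" "0 \<in> W2" "W2 \<subseteq> U"
      "\<And>W'. open W' \<Longrightarrow> W' \<subseteq> W2 \<Longrightarrow> integrable_distribution W' (\<lambda>p. {v. fst v = A p (snd v) + (-1) *\<^sub>R snd v})"
    using ex[of "-1"] by blast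
  define W where "W = W0 \<inter> W1 \<inter> W2"
  have W: "open W" "0 \<in> W" "W \<subseteq> U" "W \<subseteq> W0" "W \<subseteq> W1" "W \<subseteq> W2" using W0 W1 W2 by (auto simp: W_def)
  interpret lax W A by (rule lax_subset[OF assms(1) W(1,3)])
  have lin1: "linear (\<lambda>w. A p w + c *\<^sub>R w)" if "p \<in> W" for p c
    by (intro linear_compose_add lin[OF that] linear_compose_scale_right linear_id[unfolded id_def])
  have I1: "2 * dim (eigendistribution (lax_I A) 1 p) = DIM('a \<times> 'a)" if "p \<in> W" for p
    unfolding eigen_I_plus[OF that] by (rule dim_horizontal)
  have I2: "2 * dim (eigendistribution (lax_I A) (-1) p) = DIM('a \<times> 'a)" if "p \<in> W" for p
    unfolding eigen_I_minus by (rule dim_graph[OF lin[OF that]])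
  have K1: "2 * dim (eigendistribution (lax_K A) 1 p) = DIM('a \<times> 'a)" if "p \<in> W" for p
    unfolding eigen_K_plus using dim_graph[OF lin1[OF that, of 1]] by simp
  have K2: "2 * dim (eigendistribution (lax_K A) (-1) p) = DIM('a \<times> 'a)" if "p \<in> W" for p
    unfolding eigen_K_minus[OF that] using dim_graph[OF lin1[OF that, of "-1"]] by simp
  have J1: "integrable_distribution W (eigendistribution (lax_I A) 1)"
    by (rule integrable_distribution_cong[OF _ integrable_distribution_horizontal[OF W(1)]]) (simp add: eigen_I_plus)
  have J2: "integrable_distribution W (eigendistribution (lax_I A) (-1))"
    by (rule integrable_distribution_cong[OF _ W0(4)[OF W(1,4)]]) (simp add: eigen_I_minus)
  have J3: "integrable_distribution W (eigendistribution (lax_K A) 1)"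
    by (rule integrable_distribution_cong[OF _ W1(4)[OF W(1,5)]]) (simp add: eigen_K_plus)
  have J4: "integrable_distribution W (eigendistribution (lax_K A) (-1))"
    by (rule integrable_distribution_cong[OF _ W2(4)[OF W(1,6)]]) (simp add: eigen_K_minus)
  have "hyper_para_complex_on W (lax_I A) (lax_K A) (lax_J A)"
    unfolding hyper_para_complex_on_def para_complex_on_def complex_structure_on_def
    using W(1) endo I1 I2 K1 K2 J1 J2 J3 J4 nijenhuis_J
    by (auto simp only: lax_algebra lax_J_def[symmetric] ball_simps simp_thms insert_iff empty_iff)
  moreover have "ricci_flat_on W (lax_I A) (lax_K A)"
    unfolding ricci_flat_on_def
  proof (intro exI[of _ "lax_conn A"] conjI chern allI impI ballI)
    show "ricci (lax_conn A) Y Z p = 0" if "smooth_on W Y" "smooth_on W Z" "p \<in> W" for Y Z p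
      using tr W(3) by (intro ricci_zero that) blast
  qed
  ultimately show ?thesis using that W by blast
qed

section \<open>Index calculus\<close>

lemma sum_Basis_vec: "(\<Sum>e\<in>Basis. f e) = (\<Sum>i\<in>UNIV. f (axis i 1))" for f :: "real ^ 'm \<Rightarrow> 'c::comm_monoid_add"
proof -
  have b: "(Basis :: (real ^ 'm) set) = range (\<lambda>i. axis i 1)" by (auto simp: Basis_vec_def)
  have i: "inj (\<lambda>i. axis i (1::real) :: real ^ 'm)" by (auto intro: injI simp: axis_eq_axis)
  show ?thesis unfolding b by (simp add: sum.reindex[OF i])
qed

lemma linear_ext_axis:
  fixes L :: "real ^ 'm \<Rightarrow> 'b::real_vector"
  assumes "linear L"
  shows "L v = (\<Sum>i\<in>UNIV. (v $ i) *\<^sub>R L (axis i 1))"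
  using linear_expand[OF assms, of v] by (simp add: sum_Basis_vec inner_axis)

lemma dx_eta: "dx i g = (\<lambda>p. FD g p (ex i))" and dy_eta: "dy i g = (\<lambda>p. FD g p (ey i))"
  by (auto simp: dx_def dy_def)

lemma smooth_on_vec_nth [smooth_intros]: "open U \<Longrightarrow> smooth_on U f \<Longrightarrow> smooth_on U (\<lambda>x. f x $ i)"
  by (rule smooth_on_bounded_linear[OF bounded_linear_vec_nth])

lemma smooth_on_chi [smooth_intros]:
  fixes f :: "'m::finite \<Rightarrow> 'q::real_normed_vector \<Rightarrow> real"
  assumes "open U" "\<And>i. smooth_on U (f i)"
  shows "smooth_on U (\<lambda>x. \<chi> i. f i x)"
proof -
  have "(\<lambda>x. \<chi> i. f i x) = (\<lambda>x. \<Sum>i\<in>UNIV. f i x *\<^sub>R axis i 1)"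
    by (auto simp: vec_eq_iff axis_def if_distrib sum.delta cong: if_cong)
  then show ?thesis using assms by (simp, intro smooth_intros) auto
qed

lemma FD_vec_nth: "smooth_on U f \<Longrightarrow> p \<in> U \<Longrightarrow> FD (\<lambda>x. f x $ i) p v = FD f p v $ i"
  by (rule FD_bounded_linear[OF bounded_linear_vec_nth])

lemma smooth_on_dx [smooth_intros]: "smooth_on U g \<Longrightarrow> smooth_on U (dx i g)"
  and smooth_on_dy [smooth_intros]: "smooth_on U g \<Longrightarrow> smooth_on U (dy i g)"
  unfolding dx_eta dy_eta by (rule smooth_on_FD, assumption)+

lemma dx_commute:
  assumes "open U" "smooth_on U g" "p \<in> U"
  shows "dx i (dx j g) p = dx j (dx i g) p" "dx i (dy j g) p = dy j (dx i g) p"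
  unfolding dx_eta dy_eta by (rule smooth_FD_commute[OF assms])+

lemma dx_cong: "open U \<Longrightarrow> p \<in> U \<Longrightarrow> (\<And>q. q \<in> U \<Longrightarrow> f q = g q) \<Longrightarrow> dx i f p = dx i g p"
  and dy_cong: "open U \<Longrightarrow> p \<in> U \<Longrightarrow> (\<And>q. q \<in> U \<Longrightarrow> f q = g q) \<Longrightarrow> dy i f p = dy i g p"
  unfolding dx_def dy_def by (rule FD_cong2; assumption)+

lemma FD_mult: "smooth_on U g \<Longrightarrow> smooth_on U f \<Longrightarrow> p \<in> U \<Longrightarrow>
    FD (\<lambda>x. g x * f x) p v = g p * FD f p v + FD g p v * f p" for f g :: "_ \<Rightarrow> real"
  using FD_scaleR[of U g f p v] by simp

lemma FD_mult_const: "smooth_on U f \<Longrightarrow> p \<in> U \<Longrightarrow> FD (\<lambda>x. c * f x) p v = c * FD f p v" for f :: "_ \<Rightarrow> real"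
  by (rule FD_bounded_linear[OF bounded_linear_mult_right])

lemma FD_xy:
  fixes g :: "'m::finite xy \<Rightarrow> real"
  assumes "smooth_on U g" "p \<in> U"
  shows "FD g p (v, w) = (\<Sum>l\<in>UNIV. v $ l * dx l g p) + (\<Sum>l\<in>UNIV. w $ l * dy l g p)"
proof -
  note l = smooth_linear_FD[OF assms]
  have "FD g p (v, w) = FD g p (v, 0) + FD g p (0, w)" using linear_add[OF l, of "(v, 0)" "(0, w)"] by simp
  moreover have "FD g p (v, 0) = (\<Sum>l\<in>UNIV. (v $ l) *\<^sub>R FD g p (axis l 1, 0))"
    by (rule linear_ext_axis[OF linear_compose[of "\<lambda>v. (v, 0)", unfolded o_def, OF _ l]]) (auto simp: linear_iff)
  moreover have "FD g p (0, w) = (\<Sum>l\<in>UNIV. (w $ l) *\<^sub>R FD g p (0, axis l 1))"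
    by (rule linear_ext_axis[OF linear_compose[of "\<lambda>w. (0, w)", unfolded o_def, OF _ l]]) (auto simp: linear_iff)
  ultimately show ?thesis by (simp add: dx_def dy_def ex_def ey_def)
qed

lemma structure_of_lax_lax:
  fixes A :: "'m::finite xy \<Rightarrow> real ^ 'm \<Rightarrow> real ^ 'm"
  assumes "\<And>p. p \<in> W \<Longrightarrow> lax_I A p = I p \<and> lax_K A p = K p \<and> lax_J A p = J p \<and> linear (A p)"
    and "\<And>p i j. p \<in> W \<Longrightarrow> A p (axis i 1) $ j = dx i (R j) p"
  shows "structure_of_lax W (lax_field R) I K J"
  unfolding structure_of_lax_def
proof (intro exI[of _ "\<lambda>i p. (A p (axis i 1), axis i 1)"] ballI)
  fix p assume p: "p \<in> W"
  have l: "linear (A p)" using assms(1)[OF p] by blast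
  note IKJ = assms(1)[OF p, THEN conjunct1, symmetric] assms(1)[OF p, THEN conjunct2, THEN conjunct1, symmetric]
    assms(1)[OF p, THEN conjunct2, THEN conjunct2, THEN conjunct1, symmetric]
  have "(\<Sum>j\<in>UNIV. dx i (R j) p *\<^sub>R ex j) = (A p (axis i 1), 0)" for i
  proof -
    have "(\<Sum>j\<in>UNIV. dx i (R j) p *\<^sub>R axis j 1) = A p (axis i 1)"
      using assms(2)[OF p] by (simp add: vec_eq_iff axis_def if_distrib sum.delta cong: if_cong)
    moreover have "(\<Sum>j\<in>UNIV. dx i (R j) p *\<^sub>R ex j) = (\<Sum>j\<in>UNIV. dx i (R j) p *\<^sub>R axis j 1, 0)"
      by (simp add: ex_def sum_prod[of _ "\<lambda>_. 0", simplified])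
    ultimately show ?thesis by simp
  qed
  then have L: "lax_field R i t p = ex i + t *\<^sub>R (A p (axis i 1), axis i 1)" for i t
    by (simp add: lax_field_def ex_def ey_def)
  have "linear (I p)" "linear (K p)"
    unfolding IKJ by (auto intro!: linearI simp: lax_I_def lax_K_def linear_add[OF l] linear_diff[OF l] linear_scale[OF l] algebra_simps)
  then show "(\<forall>i t. lax_field R i t p = ex i + t *\<^sub>R (A p (axis i 1), axis i 1)) \<and> linear (I p) \<and> linear (K p) \<and>
      (\<forall>i. I p (ex i) = ex i \<and> I p (A p (axis i 1), axis i 1) = - (A p (axis i 1), axis i 1) \<and>
        K p (ex i) = (A p (axis i 1), axis i 1) \<and> K p (A p (axis i 1), axis i 1) = ex i) \<and>
      (\<forall>v. J p v = I p (K p v))"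
    using L unfolding IKJ by (auto simp: lax_I_def lax_K_def lax_J_def ex_def linear_0[OF l] scaleR_2)
qed

text \<open>The alternating signs of the system; as \<open>sg i\<close> squares to 1, they can be
  moved freely between the two sides of an equation.\<close>

definition sg :: "'m::{finite,linorder} \<Rightarrow> real" where "sg i = (-1) ^ idx i"

text \<open>For distinct indices, \<open>sig k l * sig k s * sig l s\<close> is the sign of the
  permutation that sorts the triple.\<close>

definition sig :: "'m::linorder \<Rightarrow> 'm \<Rightarrow> real" where "sig a b = (if a < b then 1 else -1)"

lemma sg_sg [simp]: "sg i * sg i = 1" "sg i * (sg i * x) = x"
  by (simp_all add: sg_def power_add[symmetric] mult.assoc[symmetric])

lemma sg_nz [simp]: "sg i \<noteq> 0" by (simp add: sg_def)

lemma sig_sig [simp]: "sig a b * sig a b = 1" "sig a b * (sig a b * x) = x" by (simp_all add: sig_def)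

lemma sig_swap: "a \<noteq> b \<Longrightarrow> sig b a = - sig a b" by (auto simp: sig_def)

lemma sum_antisym:
  fixes f :: "'m \<Rightarrow> 'm \<Rightarrow> real"
  assumes "\<And>i j. f i j = - f j i"
  shows "(\<Sum>i\<in>I. \<Sum>j\<in>I. f i j) = 0"
proof -
  have "(\<Sum>i\<in>I. \<Sum>j\<in>I. f i j) = (\<Sum>j\<in>I. \<Sum>i\<in>I. f i j)" by (rule sum.swap)
  also have "\<dots> = - (\<Sum>j\<in>I. \<Sum>i\<in>I. f j i)" by (subst assms) (simp add: sum_negf)
  finally show ?thesis by simp
qed

lemma sum_axis: "(\<Sum>l\<in>UNIV. axis i 1 $ l * g l) = g i" for g :: "'m::finite \<Rightarrow> real"
proof -
  have "(\<Sum>l\<in>UNIV. axis i 1 $ l * g l) = (\<Sum>l\<in>UNIV. if l = i then g l else 0)"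
    by (rule sum.cong) (auto simp: axis_def)
  then show ?thesis by simp
qed

lemma dx_sum:
  assumes "\<And>l. smooth_on U (g l)" "p \<in> U"
  shows "dx i (\<lambda>q. \<Sum>l\<in>I. g l q) p = (\<Sum>l\<in>I. dx i (g l) p)" "dy i (\<lambda>q. \<Sum>l\<in>I. g l q) p = (\<Sum>l\<in>I. dy i (g l) p)"
  unfolding dx_def dy_def by (rule FD_sum[OF assms])+

lemma dx_mult_const:
  assumes "smooth_on U g" "p \<in> U"
  shows "dx i (\<lambda>q. c * g q) p = c * dx i g p" "dy i (\<lambda>q. c * g q) p = c * dy i g p"
  unfolding dx_def dy_def by (rule FD_mult_const[OF assms])+

lemma dx_minus:
  assumes "smooth_on U g" "p \<in> U"
  shows "dx i (\<lambda>q. - g q) p = - dx i g p" "dy i (\<lambda>q. - g q) p = - dy i g p"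
  unfolding dx_def dy_def by (rule FD_minus[OF assms])+

lemma dx_zero: "open U \<Longrightarrow> p \<in> U \<Longrightarrow> (\<And>q. q \<in> U \<Longrightarrow> g q = 0) \<Longrightarrow> dx i g p = 0"
  using dx_cong[of U p g "\<lambda>_. 0" i] by (simp add: dx_def)

text \<open>\<open>B k l\<close> stands for \<open>(-1) ^ (k + l) * \<theta>\<^sub>k\<^sub>l\<close>, which absorbs the signs of the paper.\<close>

locale div_free =
  fixes U :: "'m::finite xy set" and B :: "'m \<Rightarrow> 'm \<Rightarrow> 'm xy \<Rightarrow> real"
  assumes oU: "open U" and smB: "smooth_on U (B i j)" and skewB: "p \<in> U \<Longrightarrow> B i j p = - B j i p"
begin

definition "R i p = (\<Sum>j\<in>UNIV. dx j (B i j) p)"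

text \<open>The difference of the two sides of the system without the form \<open>f\<close>, with
  signs absorbed. By \<open>sum_dx_S\<close> its divergence over \<open>l\<close> is the
  \<open>k\<close>-component of the bracket of \<open>E_i\<close> and \<open>E_j\<close>.\<close>

definition "S i j k l p = dx i (R l) p * dx j (R k) p - dx j (R l) p * dx i (R k) p
    + (dy i (dx j (B k l)) p - dy j (dx i (B k l)) p)"

definition "Av p w = FD (\<lambda>q. \<chi> k. R k q) p (w, 0)"

lemma smR: "smooth_on U (R i)"
  unfolding R_def by (intro smooth_intros oU smB)

lemma smRv: "smooth_on U (\<lambda>q. \<chi> k. R k q)"
  by (intro smooth_intros oU smR)

lemma smS: "smooth_on U (S i j k l)"
  unfolding S_def by (intro smooth_intros oU smR smB)

lemma div_R:
  assumes p: "p \<in> U"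
  shows "(\<Sum>i\<in>UNIV. dx i (R i) p) = 0"
proof -
  have "dx i (R i) p = (\<Sum>j\<in>UNIV. dx i (dx j (B i j)) p)" for i
    unfolding R_def by (rule dx_sum(1)[OF smooth_on_dx[OF smB] p])
  moreover have "(\<Sum>i\<in>UNIV. \<Sum>j\<in>UNIV. dx i (dx j (B i j)) p) = 0"
  proof (rule sum_antisym)
    fix i j
    have "dx i (dx j (B i j)) p = dx i (\<lambda>q. - dx j (B j i) q) p"
    proof (rule dx_cong[OF oU p])
      fix q assume q: "q \<in> U"
      have "dx j (B i j) q = dx j (\<lambda>q. - B j i q) q" by (rule dx_cong[OF oU q]) (rule skewB)
      then show "dx j (B i j) q = - dx j (B j i) q" using dx_minus[OF smB q] by simp
    qed
    also have "\<dots> = - dx i (dx j (B j i)) p" by (rule dx_minus(1)[OF smooth_on_dx[OF smB] p])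
    also have "\<dots> = - dx j (dx i (B j i)) p" using dx_commute(1)[OF oU smB p] by metis
    finally show "dx i (dx j (B i j)) p = - dx j (dx i (B j i)) p" .
  qed
  ultimately show ?thesis by simp
qed

lemma Av_nth: "p \<in> U \<Longrightarrow> Av p w $ k = FD (R k) p (w, 0)"
  unfolding Av_def using FD_vec_nth[OF smRv, of p k "(w, 0)"] by simp

lemma Av_axis: "p \<in> U \<Longrightarrow> Av p (axis i 1) $ k = dx i (R k) p"
  by (simp add: Av_nth dx_def ex_def)

lemma Av_trace: "p \<in> U \<Longrightarrow> (\<Sum>e\<in>Basis. Av p e \<bullet> e) = 0"
  using div_R[of p] by (simp add: sum_Basis_vec inner_axis Av_axis)

lemma linAv: "p \<in> U \<Longrightarrow> linear (Av p)"
  unfolding Av_def using linear_compose[of "\<lambda>w. (w, 0)" "FD (\<lambda>q. \<chi> k. R k q) p"] smooth_linear_FD[OF smRv]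
  by (auto simp: o_def linear_iff)

lemma smAv: "smooth_on U (\<lambda>p. Av p w)"
  unfolding Av_def by (rule smooth_on_FD[OF smRv])

lemma F1Av: "p \<in> U \<Longrightarrow> FD (\<lambda>q. Av q w) p (v, 0) = FD (\<lambda>q. Av q v) p (w, 0)"
  unfolding Av_def by (rule smooth_FD_commute[OF oU smRv])

lemma FDAv:
  assumes p: "p \<in> U"
  shows "FD (\<lambda>q. Av q (axis j 1)) p (Av p (axis i 1), axis i 1) $ k =
    (\<Sum>l\<in>UNIV. dx i (R l) p * dx l (dx j (R k)) p) + dy i (dx j (R k)) p"
proof -
  have "FD (\<lambda>q. Av q (axis j 1)) p (Av p (axis i 1), axis i 1) $ k = FD (\<lambda>q. Av q (axis j 1) $ k) p (Av p (axis i 1), axis i 1)"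
    by (rule FD_vec_nth[OF smAv p, symmetric])
  also have "\<dots> = FD (dx j (R k)) p (Av p (axis i 1), axis i 1)"
    by (rule FD_cong2[OF oU p Av_axis])
  also have "\<dots> = (\<Sum>l\<in>UNIV. dx i (R l) p * dx l (dx j (R k)) p) + (\<Sum>l\<in>UNIV. axis i 1 $ l * dy l (dx j (R k)) p)"
    by (subst FD_xy[OF smooth_on_dx[OF smR] p]) (simp add: Av_axis[OF p])
  also have "(\<Sum>l\<in>UNIV. axis i 1 $ l * dy l (dx j (R k)) p) = dy i (dx j (R k)) p"
    by (rule sum_axis)
  finally show ?thesis .
qed

text \<open>In the divergence, the terms with \<open>dx l (dx a (R l))\<close> add up to a
  derivative of the divergence of \<open>R\<close> and vanish; the others form the derivatives of
  \<open>A\<close> along \<open>E_i\<close> and \<open>E_j\<close>.\<close>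

lemma sum_dx_S:
  assumes p: "p \<in> U"
  shows "(\<Sum>l\<in>UNIV. dx l (S i j k l) p) =
    FD (\<lambda>q. Av q (axis j 1)) p (Av p (axis i 1), axis i 1) $ k - FD (\<lambda>q. Av q (axis i 1)) p (Av p (axis j 1), axis j 1) $ k"
proof -
  have m: "FD (\<lambda>q. dx a (R l) q * dx b (R k) q) p v = dx a (R l) p * FD (dx b (R k)) p v + FD (dx a (R l)) p v * dx b (R k) p" for a b l v
    by (rule FD_mult[OF smooth_on_dx[OF smR] smooth_on_dx[OF smR] p])
  have sm1: "smooth_on U (\<lambda>q. dx a (R l) q * dx b (R k) q)" for a b l by (intro smooth_intros oU smR)
  have sm2: "smooth_on U (dy a (dx b (B k l)))" for a b l by (intro smooth_intros smB)
  have 1: "dx l (S i j k l) p = (dx i (R l) p * dx l (dx j (R k)) p + dx l (dx i (R l)) p * dx j (R k) p)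
      - (dx j (R l) p * dx l (dx i (R k)) p + dx l (dx j (R l)) p * dx i (R k) p)
      + (dx l (dy i (dx j (B k l))) p - dx l (dy j (dx i (B k l))) p)" for l
    unfolding S_def dx_def[of l]
    by (subst FD_add[OF smooth_on_diff[OF oU sm1 sm1] smooth_on_diff[OF oU sm2 sm2] p],
        subst FD_diff[OF sm1 sm1 p], subst FD_diff[OF sm2 sm2 p]) (simp only: m)
  have d0: "(\<Sum>l\<in>UNIV. dx l (dx a (R l)) p) = 0" for a
  proof -
    have "(\<Sum>l\<in>UNIV. dx l (dx a (R l)) p) = (\<Sum>l\<in>UNIV. dx a (dx l (R l)) p)"
      by (rule sum.cong[OF refl]) (rule dx_commute(1)[OF oU smR p])
    also have "\<dots> = dx a (\<lambda>q. \<Sum>l\<in>UNIV. dx l (R l) q) p" by (rule dx_sum(1)[OF smooth_on_dx[OF smR] p, symmetric])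
    also have "\<dots> = 0" by (rule dx_zero[OF oU p div_R])
    finally show ?thesis .
  qed
  have B0: "(\<Sum>l\<in>UNIV. dx l (dy a (dx b (B k l))) p) = dy a (dx b (R k)) p" for a b
  proof -
    have "dx l (dy a (dx b (B k l))) p = dy a (dx b (dx l (B k l))) p" for l
    proof -
      have "dx l (dy a (dx b (B k l))) p = dy a (dx l (dx b (B k l))) p" by (rule dx_commute(2)[OF oU smooth_on_dx[OF smB] p])
      also have "\<dots> = dy a (dx b (dx l (B k l))) p" by (rule dy_cong[OF oU p]) (rule dx_commute(1)[OF oU smB])
      finally show ?thesis .
    qed
    then have "(\<Sum>l\<in>UNIV. dx l (dy a (dx b (B k l))) p) = dy a (\<lambda>q. \<Sum>l\<in>UNIV. dx b (dx l (B k l)) q) p"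
      using dx_sum(2)[where g="\<lambda>l. dx b (dx l (B k l))", OF smooth_on_dx[OF smooth_on_dx[OF smB]] p] by simp
    also have "\<dots> = dy a (dx b (R k)) p"
      unfolding R_def by (rule dy_cong[OF oU p]) (rule dx_sum(1)[OF smooth_on_dx[OF smB], symmetric])
    finally show ?thesis .
  qed
  have "(\<Sum>l\<in>UNIV. dx l (S i j k l) p) = (\<Sum>l\<in>UNIV. dx i (R l) p * dx l (dx j (R k)) p) - (\<Sum>l\<in>UNIV. dx j (R l) p * dx l (dx i (R k)) p)
      + (\<Sum>l\<in>UNIV. dx l (dx i (R l)) p) * dx j (R k) p - (\<Sum>l\<in>UNIV. dx l (dx j (R l)) p) * dx i (R k) p
      + ((\<Sum>l\<in>UNIV. dx l (dy i (dx j (B k l))) p) - (\<Sum>l\<in>UNIV. dx l (dy j (dx i (B k l))) p))"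
    unfolding 1 by (simp add: sum.distrib sum_subtractf sum_distrib_right)
  then show ?thesis unfolding FDAv[OF p] d0 B0 by simp
qed

text \<open>\<open>F1\<close> is the symmetry of second derivatives of \<open>R\<close>.
  \<open>F2\<close> is bilinear, so it suffices to have it for basis vectors, where it is
  \<open>sum_dx_S\<close>.\<close>

lemma lax_Av:
  assumes "\<And>p i j k. p \<in> U \<Longrightarrow> (\<Sum>l\<in>UNIV. dx l (S i j k l) p) = 0"
  shows "lax U Av"
proof -
  have F2: "FD (\<lambda>q. Av q w) p (Av p v, v) = FD (\<lambda>q. Av q v) p (Av p w, w)" if p: "p \<in> U" for p v w
  proof -
    define H where "H v w = FD (\<lambda>q. Av q w) p (Av p v, v)" for v w
    have l1: "linear (\<lambda>v. H v w)" for w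
      unfolding H_def using linear_compose[of "\<lambda>v. (Av p v, v)" "FD (\<lambda>q. Av q w) p"] smooth_linear_FD[OF smAv p] linAv[OF p]
      by (auto simp: o_def linear_iff)
    have l2: "linear (H v)" for v
      unfolding H_def by (rule linear_FD_linear_family[OF oU linAv smAv p])
    have sym: "H (axis i 1) (axis j 1) = H (axis j 1) (axis i 1)" for i j
      using assms[OF p, of i j] sum_dx_S[OF p, of i j] by (simp add: vec_eq_iff H_def)
    have ex: "H v w = (\<Sum>i\<in>UNIV. \<Sum>j\<in>UNIV. (v $ i * w $ j) *\<^sub>R H (axis i 1) (axis j 1))" for v w
    proof -
      have 1: "H v w = (\<Sum>i\<in>UNIV. (v $ i) *\<^sub>R H (axis i 1) w)" by (rule linear_ext_axis[OF l1])
      have 2: "H (axis i 1) w = (\<Sum>j\<in>UNIV. (w $ j) *\<^sub>R H (axis i 1) (axis j 1))" for i by (rule linear_ext_axis[OF l2])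
      show ?thesis by (simp only: 1 2 scaleR_sum_right scaleR_scaleR)
    qed
    have "H v w = (\<Sum>i\<in>UNIV. \<Sum>j\<in>UNIV. (v $ i * w $ j) *\<^sub>R H (axis i 1) (axis j 1))" by (rule ex)
    also have "\<dots> = (\<Sum>i\<in>UNIV. \<Sum>j\<in>UNIV. (w $ j * v $ i) *\<^sub>R H (axis j 1) (axis i 1))"
      by (intro sum.cong refl arg_cong2[where f=scaleR] mult.commute sym)
    also have "\<dots> = (\<Sum>j\<in>UNIV. \<Sum>i\<in>UNIV. (w $ j * v $ i) *\<^sub>R H (axis j 1) (axis i 1))" by (rule sum.swap)
    also have "\<dots> = H w v" by (rule ex[symmetric])
    finally show ?thesis by (simp add: H_def)
  qed
  show ?thesis by (rule lax.intro[OF oU linAv smAv F1Av F2])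
qed

end

text \<open>There are \<open>idx s - 1\<close> indices below \<open>s\<close>, and each of
  \<open>k\<close>, \<open>l\<close> among them is removed. This turns the sign in
  \<open>d_x\<close> into a product of \<open>sg\<close> and \<open>sig\<close>.\<close>

lemma card_below:
  fixes s :: "'m::{finite,linorder}"
  assumes "k \<noteq> l" "s \<noteq> k" "s \<noteq> l"
  shows "(-1 :: real) ^ card {r \<in> - {k, l}. r < s} = - sg s * sig k s * sig l s"
proof -
  define L where "L = {r. r < s}"
  have "{j. j \<le> s} = insert s L" by (auto simp: L_def)
  then have "idx s = Suc (card L)" by (simp add: idx_def L_def)
  then have 1: "sg s = - ((-1) ^ card L)" by (simp add: sg_def)
  have "{r \<in> - {k, l}. r < s} = L - {k} - {l}" by (auto simp: L_def)
  moreover have "(-1 :: real) ^ card (M - {x}) = (-1) ^ card M * (if x \<in> M then -1 else 1)" for M :: "'m set" and x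
  proof (cases "x \<in> M")
    case True
    then obtain c where "card (M - {x}) = c" "card M = Suc c" by (metis card_Suc_Diff1 finite)
    then show ?thesis using True by simp
  qed simp
  ultimately have "(-1 :: real) ^ card {r \<in> - {k, l}. r < s} = (-1) ^ card L * (if k < s then -1 else 1) * (if l < s then -1 else 1)"
    using assms by (simp add: L_def)
  then show ?thesis using 1 by (simp add: sig_def)
qed

text \<open>Hodge duality in the \<open>x\<close>-directions: the exterior derivative of a form is
  the divergence of the dual alternating array. The sign in \<open>F\<close> combines the sorting
  sign of the triple with \<open>sg k * sg l * sg s\<close>.\<close>

lemma sum_dx_form:
  fixes a :: "'m::{finite,linorder} xform"
  assumes U: "open U" "p \<in> U" and kl: "k \<noteq> l" and a: "\<And>T. smooth_on U (a T)"
    and F: "\<And>s q. q \<in> U \<Longrightarrow> s \<noteq> k \<Longrightarrow> s \<noteq> l \<Longrightarrow> F s q = - (sig k l * sig k s * sig l s * sg k * sg l * sg s) * a (- {k, l, s}) q"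
    and F0: "\<And>s q. q \<in> U \<Longrightarrow> s = k \<or> s = l \<Longrightarrow> F s q = 0"
  shows "(\<Sum>s\<in>UNIV. dx s (F s) p) = sig k l * sg k * sg l * d_x a (- {k, l}) p"
proof -
  have "(\<Sum>s\<in>UNIV. dx s (F s) p) = (\<Sum>s\<in>- {k, l}. dx s (F s) p)"
    by (rule sum.mono_neutral_right) (auto intro!: dx_zero[OF U] F0)
  also have "\<dots> = (\<Sum>s\<in>- {k, l}. sig k l * sg k * sg l * ((-1) ^ card {r \<in> - {k, l}. r < s} * dx s (a (- {k, l} - {s})) p))"
  proof (rule sum.cong[OF refl])
    fix s assume "s \<in> - {k, l}"
    then have s: "s \<noteq> k" "s \<noteq> l" by auto
    have "dx s (F s) p = dx s (\<lambda>q. - (sig k l * sig k s * sig l s * sg k * sg l * sg s) * a (- {k, l, s}) q) p"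
      by (rule dx_cong[OF U]) (rule F[OF _ s])
    also have "\<dots> = - (sig k l * sig k s * sig l s * sg k * sg l * sg s) * dx s (a (- {k, l, s})) p"
      by (rule dx_mult_const(1)[OF a U(2)])
    also have "- {k, l, s} = - {k, l} - {s}" by auto
    finally show "dx s (F s) p = sig k l * sg k * sg l * ((-1) ^ card {r \<in> - {k, l}. r < s} * dx s (a (- {k, l} - {s})) p)"
      using card_below[OF kl s] by simp
  qed
  also have "\<dots> = sig k l * sg k * sg l * d_x a (- {k, l}) p" by (simp add: d_x_def sum_distrib_left)
  finally show ?thesis .
qed

text \<open>The system is the statement that \<open>S i j\<close> is, up to signs, the exterior derivative of \<open>f i j\<close>.\<close>

locale theta_pot =
  fixes U :: "'m::{finite,linorder} xy set" and \<theta> :: "'m \<Rightarrow> 'm \<Rightarrow> 'm xy \<Rightarrow> real"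
  assumes oU': "open U" and sm\<theta>: "k < l \<Longrightarrow> smooth_on U (\<theta> k l)"
begin

definition "B k l p = sg k * sg l * skew \<theta> k l p"

lemma smskew: "smooth_on U (skew \<theta> k l)"
  unfolding skew_def by (auto intro!: smooth_intros oU' sm\<theta>)

sublocale div_free U B
proof
  show "smooth_on U (B i j)" for i j unfolding B_def by (intro smooth_intros oU' smskew)
  show "B i j p = - B j i p" for i j p by (auto simp: B_def skew_def)
qed (rule oU')

lemma R_of_eq:
  assumes p: "p \<in> U"
  shows "R_of \<theta> i p = R i p"
proof -
  have "R i p = (\<Sum>j\<in>UNIV - {i}. dx j (B i j) p)"
    unfolding R_def by (rule sum.mono_neutral_right) (auto simp: B_def skew_def dx_def)
  also have "\<dots> = R_of \<theta> i p"
    unfolding R_of_def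
  proof (rule sum.cong[OF refl])
    fix j
    have "dx j (B i j) p = dx j (\<lambda>q. - (sg i * sg j) * skew \<theta> j i q) p"
      by (rule dx_cong[OF oU p]) (auto simp: B_def skew_def)
    also have "\<dots> = - (sg i * sg j) * dx j (skew \<theta> j i) p" by (rule dx_mult_const(1)[OF smskew p])
    finally show "dx j (B i j) p = (-1) ^ (idx i + idx j + 1) * dx j (skew \<theta> j i) p" by (simp add: sg_def power_add)
  qed
  finally show ?thesis by simp
qed

text \<open>The double sum factors into the single sums \<open>a\<close>, which are derivatives of
  \<open>R\<close> up to sign. Multiplication by \<open>sg k * sg l\<close> is an involution, which
  gives both directions.\<close>

lemma system_iff:
  assumes z: "z \<in> U"
  shows "(\<Sum>p\<in>UNIV. \<Sum>q\<in>UNIV. (-1) ^ (idx p + idx q) *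
           (dx i (dx p (skew \<theta> p l)) z * dx j (dx q (skew \<theta> q k)) z
            - dx j (dx p (skew \<theta> p l)) z * dx i (dx q (skew \<theta> q k)) z))
        = dy j (dx i (skew \<theta> k l)) z - dy i (dx j (skew \<theta> k l)) z + c
    \<longleftrightarrow> S i j k l z = sg k * sg l * c"
proof -
  have a: "(\<Sum>p\<in>UNIV. sg p * dx i (dx p (skew \<theta> p l)) z) = - sg l * dx i (R l) z" for i l
  proof -
    have 1: "dx i (R l) z = (\<Sum>p\<in>UNIV. dx i (dx p (B l p)) z)"
      unfolding R_def by (rule dx_sum(1)[OF smooth_on_dx[OF smB] z])
    have 2: "dx i (dx p (B l p)) z = - (sg l * sg p) * dx i (dx p (skew \<theta> p l)) z" for p
    proof -
      have "dx i (dx p (B l p)) z = dx i (\<lambda>q. - (sg l * sg p) * dx p (skew \<theta> p l) q) z"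
      proof (rule dx_cong[OF oU z])
        fix q assume q: "q \<in> U"
        have "dx p (B l p) q = dx p (\<lambda>q. - (sg l * sg p) * skew \<theta> p l q) q"
          by (rule dx_cong[OF oU q]) (auto simp: B_def skew_def)
        then show "dx p (B l p) q = - (sg l * sg p) * dx p (skew \<theta> p l) q" by (simp only: dx_mult_const(1)[OF smskew q])
      qed
      then show ?thesis by (simp only: dx_mult_const(1)[OF smooth_on_dx[OF smskew] z])
    qed
    have 3: "dx i (R l) z = - sg l * (\<Sum>p\<in>UNIV. sg p * dx i (dx p (skew \<theta> p l)) z)"
      by (simp only: 1 2) (simp add: sum_distrib_left mult.assoc sum_negf)
    show ?thesis unfolding 3 by simp
  qed
  have b: "dy j (dx i (skew \<theta> k l)) z = sg k * sg l * dy j (dx i (B k l)) z" for i j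
  proof -
    have "dy j (dx i (B k l)) z = dy j (\<lambda>q. (sg k * sg l) * dx i (skew \<theta> k l) q) z"
      unfolding B_def by (rule dy_cong[OF oU z]) (rule dx_mult_const(1)[OF smskew])
    then have e: "dy j (dx i (B k l)) z = sg k * sg l * dy j (dx i (skew \<theta> k l)) z"
      by (simp only: dx_mult_const(2)[OF smooth_on_dx[OF smskew] z])
    show ?thesis by (simp add: e mult.assoc mult.left_commute[of "sg l"])
  qed
  have "(\<Sum>p\<in>UNIV. \<Sum>q\<in>UNIV. (-1) ^ (idx p + idx q) *
           (dx i (dx p (skew \<theta> p l)) z * dx j (dx q (skew \<theta> q k)) z
            - dx j (dx p (skew \<theta> p l)) z * dx i (dx q (skew \<theta> q k)) z)) =
        (\<Sum>p\<in>UNIV. sg p * dx i (dx p (skew \<theta> p l)) z) * (\<Sum>q\<in>UNIV. sg q * dx j (dx q (skew \<theta> q k)) z) -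
        (\<Sum>p\<in>UNIV. sg p * dx j (dx p (skew \<theta> p l)) z) * (\<Sum>q\<in>UNIV. sg q * dx i (dx q (skew \<theta> q k)) z)"
    unfolding sum_product sum_subtractf[symmetric]
    by (intro sum.cong refl) (simp add: sg_def power_add right_diff_distrib mult_ac)
  also have "\<dots> = sg k * sg l * (dx i (R l) z * dx j (R k) z - dx j (R l) z * dx i (R k) z)"
    unfolding a by (simp add: algebra_simps)
  finally have 1: "(\<Sum>p\<in>UNIV. \<Sum>q\<in>UNIV. (-1) ^ (idx p + idx q) *
           (dx i (dx p (skew \<theta> p l)) z * dx j (dx q (skew \<theta> q k)) z
            - dx j (dx p (skew \<theta> p l)) z * dx i (dx q (skew \<theta> q k)) z)) =
        sg k * sg l * (dx i (R l) z * dx j (R k) z - dx j (R l) z * dx i (R k) z)" .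
  have "sg k * sg l * x = sg k * sg l * y - sg k * sg l * y' + c \<longleftrightarrow> x + (y' - y) = sg k * sg l * c" for x y y'
  proof
    assume "sg k * sg l * x = sg k * sg l * y - sg k * sg l * y' + c"
    then have "c = sg k * sg l * (x + (y' - y))" by (simp add: algebra_simps)
    then show "x + (y' - y) = sg k * sg l * c" by (simp add: mult_ac)
  next
    assume "x + (y' - y) = sg k * sg l * c"
    then have "c = sg k * sg l * (x + (y' - y))" by (simp add: mult_ac)
    then show "sg k * sg l * x = sg k * sg l * y - sg k * sg l * y' + c" by (simp add: algebra_simps)
  qed
  then show ?thesis unfolding 1 b S_def .
qed

lemma S_skew: assumes "p \<in> U" shows "S i j k l p = - S i j l k p" "S i j k l p = - S j i k l p"
proof -
  have "dy i (dx j (B k l)) p = - dy i (dx j (B l k)) p" for i j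
  proof -
    have "dy i (dx j (B k l)) p = dy i (\<lambda>q. - dx j (B l k) q) p"
    proof (rule dy_cong[OF oU assms])
      fix q assume q: "q \<in> U"
      have "dx j (B k l) q = dx j (\<lambda>q. - B l k q) q" by (rule dx_cong[OF oU q]) (rule skewB)
      then show "dx j (B k l) q = - dx j (B l k) q" using dx_minus[OF smB q] by simp
    qed
    then show ?thesis using dx_minus(2)[OF smooth_on_dx[OF smB] assms] by simp
  qed
  from this[of i j] this[of j i] show "S i j k l p = - S i j l k p" by (simp add: S_def algebra_simps)
  show "S i j k l p = - S j i k l p" by (simp add: S_def algebra_simps)
qed

text \<open>The square of the exterior derivative vanishes, so \<open>S\<close> is divergence free.\<close>

lemma div_S:
  assumes f: "\<And>i j T. i < j \<Longrightarrow> smooth_on U (f i j T)"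
    and S: "\<And>i j k l p. i < j \<Longrightarrow> k < l \<Longrightarrow> p \<in> U \<Longrightarrow> S i j k l p = sg k * sg l * d_x (f i j) (- {k, l}) p"
    and p: "p \<in> U"
  shows "(\<Sum>l\<in>UNIV. dx l (S i j k l) p) = 0"
proof -
  have *: "(\<Sum>l\<in>UNIV. dx l (S i j k l) p) = 0" if ij: "i < j" for i j
  proof -
    \<comment> \<open>The array dual to \<open>f i j\<close>, put to 0 for coinciding indices so
      that all sums run over \<open>UNIV\<close>. It is antisymmetric in \<open>l\<close> and
      \<open>s\<close>, so its double divergence vanishes.\<close>
    define g where "g l s q = (if l \<noteq> k \<and> s \<noteq> k \<and> s \<noteq> l
        then - (sig k l * sig k s * sig l s * sg k * sg l * sg s) * f i j (- {k, l, s}) q else 0)" for l s q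
    have smg: "smooth_on U (g l s)" for l s
      unfolding g_def by (cases "l \<noteq> k \<and> s \<noteq> k \<and> s \<noteq> l") (auto intro!: smooth_intros oU f ij)
    have Sg: "S i j k l q = (\<Sum>s\<in>UNIV. dx s (g l s) q)" if q: "q \<in> U" for l q
    proof (cases "k = l")
      case True
      have "dx s (g l s) q = 0" for s by (rule dx_zero[OF oU q]) (simp add: g_def True)
      moreover have "S i j k l q = 0" using S_skew(1)[OF q, of i j k k] True by simp
      ultimately show ?thesis by simp
    next
      case False
      have "(\<Sum>s\<in>UNIV. dx s (g l s) q) = sig k l * sg k * sg l * d_x (f i j) (- {k, l}) q"
        by (rule sum_dx_form[OF oU q False f[OF ij]]) (use False in \<open>auto simp: g_def\<close>)
      moreover have "S i j k l q = sig k l * sg k * sg l * d_x (f i j) (- {k, l}) q"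
      proof (cases "k < l")
        case True
        then show ?thesis using S[OF ij True q] by (simp add: sig_def)
      next
        case False
        then have lk: "l < k" using \<open>k \<noteq> l\<close> by simp
        show ?thesis using lk S[OF ij lk q] S_skew(1)[OF q, of i j k l] by (simp add: sig_def insert_commute)
      qed
      ultimately show ?thesis by simp
    qed
    have "(\<Sum>l\<in>UNIV. dx l (S i j k l) p) = (\<Sum>l\<in>UNIV. \<Sum>s\<in>UNIV. dx l (dx s (g l s)) p)"
    proof (rule sum.cong[OF refl])
      fix l
      have "dx l (S i j k l) p = dx l (\<lambda>q. \<Sum>s\<in>UNIV. dx s (g l s) q) p" by (rule dx_cong[OF oU p Sg])
      then show "dx l (S i j k l) p = (\<Sum>s\<in>UNIV. dx l (dx s (g l s)) p)" using dx_sum(1)[OF smooth_on_dx[OF smg] p] by simp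
    qed
    also have "\<dots> = 0"
    proof (rule sum_antisym)
      fix l s
      have gs: "g l s q = - g s l q" for q
        by (auto simp: g_def sig_swap[of l s] insert_commute mult_ac)
      have "dx l (dx s (g l s)) p = dx l (\<lambda>q. - dx s (g s l) q) p"
      proof (rule dx_cong[OF oU p])
        fix q assume q: "q \<in> U"
        have "dx s (g l s) q = dx s (\<lambda>q. - g s l q) q" by (rule dx_cong[OF oU q]) (rule gs)
        then show "dx s (g l s) q = - dx s (g s l) q" using dx_minus(1)[OF smg q] by simp
      qed
      also have "\<dots> = - dx l (dx s (g s l)) p" by (rule dx_minus(1)[OF smooth_on_dx[OF smg] p])
      also have "\<dots> = - dx s (dx l (g s l)) p" using dx_commute(1)[OF oU smg p, of l s] by simp
      finally show "dx l (dx s (g l s)) p = - dx s (dx l (g s l)) p" .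
    qed
    finally show ?thesis .
  qed
  consider "i < j" | "i = j" | "j < i" by fastforce
  then show ?thesis
  proof cases
    case 2
    have "dx l (S i j k l) p = 0" for l
      by (rule dx_zero[OF oU p]) (use S_skew(2)[of _ i i k l] 2 in simp)
    then show ?thesis by simp
  next
    case 3
    have "dx l (S i j k l) p = - dx l (S j i k l) p" for l
    proof -
      have "dx l (S i j k l) p = dx l (\<lambda>q. - S j i k l q) p" by (rule dx_cong[OF oU p]) (rule S_skew(2))
      then show ?thesis using dx_minus(1)[OF smS p] by simp
    qed
    then show ?thesis using *[OF 3] by (simp add: sum_negf)
  qed (rule *)
qed

end

lemma forward:
  fixes f :: "'m::{finite,linorder} \<Rightarrow> 'm \<Rightarrow> 'm xform"
  assumes f: "form_collection f" and \<theta>: "solves_system f \<theta>"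
  shows "\<exists>W I K J. open W \<and> 0 \<in> W \<and> structure_of_lax W (lax_field (R_of \<theta>)) I K J \<and>
    hyper_para_complex_on W I K J \<and> ricci_flat_on W I K"
proof -
  have "\<forall>k l. \<exists>U. open U \<and> 0 \<in> U \<and> (k < l \<longrightarrow> smooth_on U (\<theta> k l))"
    using \<theta> open_UNIV unfolding solves_system_def smooth_germ_def by blast
  then obtain U1 where U1: "\<And>k l. open (U1 k l)" "\<And>k l. 0 \<in> U1 k l" "\<And>k l. k < l \<Longrightarrow> smooth_on (U1 k l) (\<theta> k l)" by metis
  have "\<forall>i j T. \<exists>U. open U \<and> 0 \<in> U \<and> (i < j \<longrightarrow> smooth_on U (f i j T))"
    using f open_UNIV unfolding form_collection_def smooth_germ_def by blast
  then obtain U2 where U2: "\<And>i j T. open (U2 i j T)" "\<And>i j T. 0 \<in> U2 i j T" "\<And>i j T. i < j \<Longrightarrow> smooth_on (U2 i j T) (f i j T)" by metis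
  obtain U3 where U3: "open U3" "0 \<in> U3" and sys: "\<And>z i j k l. z \<in> U3 \<Longrightarrow> i < j \<Longrightarrow> k < l \<Longrightarrow>
        (\<Sum>p\<in>UNIV. \<Sum>q\<in>UNIV. (-1) ^ (idx p + idx q) *
           (dx i (dx p (skew \<theta> p l)) z * dx j (dx q (skew \<theta> q k)) z
            - dx j (dx p (skew \<theta> p l)) z * dx i (dx q (skew \<theta> q k)) z))
        = dy j (dx i (skew \<theta> k l)) z - dy i (dx j (skew \<theta> k l)) z + d_x (f i j) (- {k, l}) z"
    using \<theta> unfolding solves_system_def eventually_nhds by blast
  define U where "U = (\<Inter>k. \<Inter>l. U1 k l) \<inter> (\<Inter>i. \<Inter>j. \<Inter>T. U2 i j T) \<inter> U3"
  have "open U" unfolding U_def using U1(1) U2(1) U3(1) by (intro open_Int open_INT finite ballI) auto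
  have U0: "0 \<in> U" using U1(2) U2(2) U3(2) by (simp add: U_def)
  interpret theta_pot U \<theta>
  proof
    show "smooth_on U (\<theta> k l)" if "k < l" for k l
      using U1(3)[OF that] by (rule smooth_on_subset) (auto simp: U_def)
  qed fact
  have smf: "smooth_on U (f i j T)" if "i < j" for i j T
    using U2(3)[OF that] by (rule smooth_on_subset) (auto simp: U_def)
  have S: "S i j k l p = sg k * sg l * d_x (f i j) (- {k, l}) p" if "i < j" "k < l" "p \<in> U" for i j k l p
    using sys[OF _ that(1,2), of p] that(3) unfolding system_iff[OF that(3)] by (simp add: U_def)
  have lax: "lax U Av" by (rule lax_Av) (rule div_S[where f=f, OF smf S])
  obtain W where W: "open W" "0 \<in> W" "W \<subseteq> U" "hyper_para_complex_on W (lax_I Av) (lax_K Av) (lax_J Av)"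
      "ricci_flat_on W (lax_I Av) (lax_K Av)"
    by (rule lax_structure[OF lax U0 Av_trace]) (assumption | rule that)+
  have "structure_of_lax W (lax_field (R_of \<theta>)) (lax_I Av) (lax_K Av) (lax_J Av)"
  proof (rule structure_of_lax_lax)
    fix p i j assume "p \<in> W"
    then have p: "p \<in> U" using W by blast
    show "lax_I Av p = lax_I Av p \<and> lax_K Av p = lax_K Av p \<and> lax_J Av p = lax_J Av p \<and> linear (Av p)" using linAv[OF p] by simp
    have "dx i (R_of \<theta> j) p = dx i (R j) p" by (rule dx_cong[OF oU p R_of_eq])
    then show "Av p (axis i 1) $ j = dx i (R_of \<theta> j) p" using Av_axis[OF p] by simp
  qed
  then show ?thesis using W by blast
qed

section \<open>Potentials of closed one-forms along a projection\<close>

text \<open>The range of \<pi> contains the directions of integration; the contraction moves points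
  along it towards the kernel. It is used for the \<open>x\<close>-directions of a product, for all
  directions, and for a single line.\<close>

locale projection =
  fixes \<pi> :: "'q::euclidean_space \<Rightarrow> 'q" and Q :: "'q set"
  assumes lin_\<pi>: "linear \<pi>" and idem: "\<pi> (\<pi> v) = \<pi> v" and oQ: "open Q"
    and stab: "p \<in> Q \<Longrightarrow> s \<in> {0..1} \<Longrightarrow> p - (1 - s) *\<^sub>R \<pi> p \<in> Q"
begin

definition "\<sigma> s p = p - (1 - s) *\<^sub>R \<pi> p"

lemma \<sigma>_1 [simp]: "\<sigma> 1 p = p" by (simp add: \<sigma>_def)

lemma \<sigma>_in: "p \<in> Q \<Longrightarrow> s \<in> {0..1} \<Longrightarrow> \<sigma> s p \<in> Q"
  using stab by (simp add: \<sigma>_def)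

lemma smooth_\<pi>: "open S \<Longrightarrow> smooth_on S f \<Longrightarrow> smooth_on S (\<lambda>x. \<pi> (f x))"
  by (rule smooth_on_linear[OF lin_\<pi>])

lemma bl_\<pi>: "bounded_linear \<pi>" using lin_\<pi> by (simp add: linear_conv_bounded_linear)

definition "sdom = {z. \<sigma> (fst z) (snd z) \<in> Q}"

lemma smooth_\<sigma>: "open S \<Longrightarrow> smooth_on S (\<lambda>z. \<sigma> (fst z) (snd z))"
  unfolding \<sigma>_def by (intro smooth_intros smooth_\<pi>; assumption)

lemma open_sdom: "open sdom"
proof -
  have "open ((\<lambda>z. \<sigma> (fst z) (snd z)) -` Q)"
    using smooth_imp_continuous[OF smooth_\<sigma>[OF open_UNIV]] oQ by (intro open_vimage) auto
  then show ?thesis by (simp add: sdom_def vimage_def)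
qed

lemma sub_sdom: "{0..1} \<times> Q \<subseteq> sdom"
  by (auto simp: sdom_def intro: \<sigma>_in)

lemma smooth_on_\<sigma>: "smooth_on Q f \<Longrightarrow> smooth_on sdom (\<lambda>z. f (\<sigma> (fst z) (snd z)))"
  by (rule smooth_on_compose[OF _ smooth_\<sigma>[OF open_sdom] open_sdom oQ]) (auto simp: sdom_def)

text \<open>Integrates the derivative of \<open>s ^ n *\<^sub>R f (\<sigma> s p)\<close>; the
  boundary term at 0 vanishes because \<open>n \<ge> 1\<close>. The case \<open>n = 1\<close> serves
  \<open>potential\<close>, larger \<open>n\<close> the homotopies for fields with several
  indices.\<close>

lemma ftc:
  fixes f :: "'q \<Rightarrow> 'c::euclidean_space"
  assumes f: "smooth_on Q f" and p: "p \<in> Q" and n: "n \<ge> 1"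
  shows "((\<lambda>s. s ^ n *\<^sub>R FD f (\<sigma> s p) (\<pi> p) + (real n * s ^ (n - 1)) *\<^sub>R f (\<sigma> s p)) has_integral f p) {0..1}"
proof -
  have "((\<lambda>s. s ^ n *\<^sub>R FD f (\<sigma> s p) (\<pi> p) + (real n * s ^ (n - 1)) *\<^sub>R f (\<sigma> s p)) has_integral
      1 ^ n *\<^sub>R f (\<sigma> 1 p) - 0 ^ n *\<^sub>R f (\<sigma> 0 p)) {0..1}"
  proof (rule fundamental_theorem_of_calculus)
    fix s :: real assume s: "s \<in> {0..1}"
    have "((\<lambda>s. \<sigma> s p) has_derivative (\<lambda>h. h *\<^sub>R \<pi> p)) (at s)"
      unfolding \<sigma>_def by (auto intro!: derivative_eq_intros simp: algebra_simps)
    from has_derivative_compose[OF this smooth_has_derivative[OF f \<sigma>_in[OF p s]]]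
    have "((\<lambda>s. f (\<sigma> s p)) has_vector_derivative FD f (\<sigma> s p) (\<pi> p)) (at s)"
      by (simp add: has_vector_derivative_def linear_scale[OF smooth_linear_FD[OF f \<sigma>_in[OF p s]]])
    moreover have "((\<lambda>s. s ^ n) has_vector_derivative (real n * s ^ (n - 1))) (at s)"
      by (auto intro!: derivative_eq_intros simp: has_real_derivative_iff_has_vector_derivative[symmetric])
    ultimately have "((\<lambda>s. s ^ n *\<^sub>R f (\<sigma> s p)) has_vector_derivative
        s ^ n *\<^sub>R FD f (\<sigma> s p) (\<pi> p) + (real n * s ^ (n - 1)) *\<^sub>R f (\<sigma> s p)) (at s)"
      unfolding has_real_derivative_iff_has_vector_derivative[symmetric] by (rule has_vector_derivative_scaleR[rotated])
    then show "((\<lambda>s. s ^ n *\<^sub>R f (\<sigma> s p)) has_vector_derivative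
        s ^ n *\<^sub>R FD f (\<sigma> s p) (\<pi> p) + (real n * s ^ (n - 1)) *\<^sub>R f (\<sigma> s p)) (at s within {0..1})"
      by (rule has_vector_derivative_at_within)
  qed simp
  then show ?thesis using n by (simp add: power_0_left)
qed

text \<open>The Poincare lemma along the range of \<pi>, the remaining variables being parameters.
  \<open>closed\<close> exchanges derivatives in those directions only, so only those derivatives of
  \<xi> are prescribed.\<close>

lemma potential:
  fixes P :: "'q \<Rightarrow> 'q \<Rightarrow> 'c::euclidean_space"
  assumes lin: "\<And>p. p \<in> Q \<Longrightarrow> linear (P p)" and sm: "\<And>w. smooth_on Q (\<lambda>p. P p w)"
    and closed: "\<And>p v w. p \<in> Q \<Longrightarrow> FD (\<lambda>q. P q (\<pi> w)) p (\<pi> v) = FD (\<lambda>q. P q (\<pi> v)) p (\<pi> w)"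
  defines "\<xi> \<equiv> \<lambda>p. integral {0..1} (\<lambda>s. P (\<sigma> s p) (\<pi> p))"
  shows "smooth_on Q \<xi>" "p \<in> Q \<Longrightarrow> FD \<xi> p (\<pi> w) = P p (\<pi> w)"
proof -
  define g where "g = (\<lambda>z. P (\<sigma> (fst z) (snd z)) (\<pi> (snd z)))"
  have l: "linear (P (\<sigma> (fst z) (snd z)))" if "z \<in> sdom" for z using lin that by (simp add: sdom_def)
  have s\<pi>: "smooth_on sdom (\<lambda>z. \<pi> (snd z))" by (intro smooth_\<pi> smooth_intros open_sdom)
  have g: "smooth_on sdom g"
    unfolding g_def by (rule smooth_on_linear_family[OF open_sdom l smooth_on_\<sigma>[OF sm] s\<pi>])
  have \<xi>: "\<xi> = (\<lambda>p. integral {0..1} (\<lambda>s. g (s, p)))" by (simp add: \<xi>_def g_def)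
  show "smooth_on Q \<xi>" unfolding \<xi> by (rule smooth_on_integral_param[OF sub_sdom oQ g])
  assume p: "p \<in> Q"
  have "FD \<xi> p (\<pi> w) = integral {0..1} (\<lambda>s. FD g (s, p) (0, \<pi> w))"
    unfolding \<xi> by (subst FD_eqI[OF has_derivative_integral_param[OF sub_sdom oQ smooth_on_Ck[OF g] p]]) simp
  also have "\<dots> = integral {0..1} (\<lambda>s. s ^ 1 *\<^sub>R FD (\<lambda>q. P q (\<pi> w)) (\<sigma> s p) (\<pi> p) + (real 1 * s ^ (1 - 1)) *\<^sub>R P (\<sigma> s p) (\<pi> w))"
  proof (rule integral_cong)
    fix s :: real assume s: "s \<in> {0..1}"
    have z: "(s, p) \<in> sdom" using sub_sdom s p by auto
    have d: "FD (\<lambda>z. P (\<sigma> (fst z) (snd z)) (\<pi> p)) (s, p) (0, \<pi> w) = FD (\<lambda>q. P q (\<pi> p)) (\<sigma> s p) (s *\<^sub>R \<pi> w)"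
    proof -
      have "((\<lambda>z. \<sigma> (fst z) (snd z)) has_derivative (\<lambda>d. snd d - ((1 - s) *\<^sub>R \<pi> (snd d) + (- fst d) *\<^sub>R \<pi> p))) (at (s, p))"
        unfolding \<sigma>_def
        by (auto intro!: derivative_eq_intros bounded_linear.has_derivative[OF bl_\<pi>])
      from has_derivative_compose[OF this, of "\<lambda>q. P q (\<pi> p)"] smooth_has_derivative[OF sm \<sigma>_in[OF p s]]
      have "((\<lambda>z. P (\<sigma> (fst z) (snd z)) (\<pi> p)) has_derivative
          (\<lambda>d. FD (\<lambda>q. P q (\<pi> p)) (\<sigma> s p) (snd d - ((1 - s) *\<^sub>R \<pi> (snd d) + (- fst d) *\<^sub>R \<pi> p)))) (at (s, p))"
        by simp
      from FD_eqI[OF this] show ?thesis by (simp add: idem scaleR_diff_left)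
    qed
    have d2: "FD (\<lambda>z. \<pi> (snd z)) (s, p) (0, \<pi> w) = \<pi> w"
    proof -
      have "((\<lambda>z :: real \<times> 'q. \<pi> (snd z)) has_derivative (\<lambda>d. \<pi> (snd d))) (at (s, p))"
        by (intro bounded_linear.has_derivative[OF bl_\<pi>] has_derivative_snd has_derivative_ident)
      from FD_eqI[OF this] show ?thesis by (simp add: idem)
    qed
    have "FD g (s, p) (0, \<pi> w) = FD (\<lambda>q. P q (\<pi> p)) (\<sigma> s p) (s *\<^sub>R \<pi> w) + P (\<sigma> s p) (\<pi> w)"
      unfolding g_def using FD_linear_family[OF open_sdom l smooth_on_\<sigma>[OF sm] s\<pi> z] by (simp add: d d2)
    also have "FD (\<lambda>q. P q (\<pi> p)) (\<sigma> s p) (s *\<^sub>R \<pi> w) = s *\<^sub>R FD (\<lambda>q. P q (\<pi> w)) (\<sigma> s p) (\<pi> p)"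
      using closed[OF \<sigma>_in[OF p s], of p w] by (simp add: linear_scale[OF smooth_linear_FD[OF sm \<sigma>_in[OF p s]]])
    finally show "FD g (s, p) (0, \<pi> w) = s ^ 1 *\<^sub>R FD (\<lambda>q. P q (\<pi> w)) (\<sigma> s p) (\<pi> p) + (real 1 * s ^ (1 - 1)) *\<^sub>R P (\<sigma> s p) (\<pi> w)"
      by simp
  qed
  also have "\<dots> = P p (\<pi> w)" by (rule integral_unique[OF ftc[OF sm p]]) simp
  finally show "FD \<xi> p (\<pi> w) = P p (\<pi> w)" .
qed

end

lemma projection_fst: "projection (\<lambda>v :: 'a::euclidean_space \<times> 'b::euclidean_space. (fst v, 0)) (ball 0 r)"
proof (rule projection.intro)
  show "linear (\<lambda>v :: 'a \<times> 'b. (fst v, 0 :: 'b))" by (auto simp: linear_iff)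
  fix p :: "'a \<times> 'b" and s :: real assume p: "p \<in> ball 0 r" and s: "s \<in> {0..1}"
  have eq: "p - (1 - s) *\<^sub>R (fst p, 0) = (s *\<^sub>R fst p, snd p)" by (simp add: prod_eq_iff scaleR_diff_left)
  have "(s * norm (fst p))\<^sup>2 \<le> (1 * norm (fst p))\<^sup>2"
    using s by (intro power_mono mult_right_mono) auto
  then have "norm (s *\<^sub>R fst p, snd p) \<le> norm (fst p, snd p)"
    using s unfolding norm_Pair by (intro real_sqrt_le_mono) simp
  then show "p - (1 - s) *\<^sub>R (fst p, 0) \<in> ball 0 r" unfolding eq using p by simp
qed auto

lemma projection_id: "projection (\<lambda>v :: 'a::euclidean_space. v) (ball 0 r)"
proof (rule projection.intro)
  fix p :: 'a and s :: real assume p: "p \<in> ball 0 r" and s: "s \<in> {0..1}"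
  have eq: "p - (1 - s) *\<^sub>R p = s *\<^sub>R p" by (simp add: scaleR_diff_left)
  have "norm (s *\<^sub>R p) \<le> 1 * norm p" unfolding norm_scaleR using s by (intro mult_right_mono) auto
  then show "p - (1 - s) *\<^sub>R p \<in> ball 0 r" unfolding eq using p by simp
qed (auto simp: linear_iff)

lemma projection_line:
  fixes e :: "'a::euclidean_space"
  assumes "norm e = 1"
  shows "projection (\<lambda>v. (v \<bullet> e) *\<^sub>R e) (ball 0 r)"
proof (rule projection.intro)
  have ee: "e \<bullet> e = 1" using assms by (simp add: norm_eq_1)
  show "linear (\<lambda>v. (v \<bullet> e) *\<^sub>R e)" by (auto simp: linear_iff inner_add_left scaleR_add_left)
  show "(((v \<bullet> e) *\<^sub>R e) \<bullet> e) *\<^sub>R e = (v \<bullet> e) *\<^sub>R e" for v by (simp add: ee)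
  fix p :: 'a and s :: real assume p: "p \<in> ball 0 r" and s: "s \<in> {0..1}"
  define a where "a = p \<bullet> e"
  define t where "t = 1 - s"
  have t: "0 \<le> t" "t \<le> 1" using s by (auto simp: t_def)
  have "(norm (p - t *\<^sub>R a *\<^sub>R e))\<^sup>2 = (norm p)\<^sup>2 - t * (2 - t) * a\<^sup>2"
    unfolding power2_norm_eq_inner
    by (simp add: inner_diff_left inner_diff_right ee inner_commute[of e p] a_def[symmetric] power2_eq_square algebra_simps)
  also have "\<dots> \<le> (norm p)\<^sup>2" using t by simp
  finally have "norm (p - t *\<^sub>R a *\<^sub>R e) \<le> norm p" by simp
  then show "p - (1 - s) *\<^sub>R (p \<bullet> e) *\<^sub>R e \<in> ball 0 r" using p by (simp add: a_def t_def)
qed auto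

text \<open>On a line every one-form is closed, so \<open>potential\<close> applies to
  \<open>(v \<bullet> e) * c p\<close>.\<close>

lemma directional_antiderivative:
  fixes c :: "'a::euclidean_space \<Rightarrow> real"
  assumes "norm e = 1" "smooth_on (ball 0 r) c"
  obtains g where "smooth_on (ball 0 r) g" "\<And>p. p \<in> ball 0 r \<Longrightarrow> FD g p e = c p"
proof -
  interpret projection "\<lambda>v. (v \<bullet> e) *\<^sub>R e" "ball 0 r" by (rule projection_line[OF assms(1)])
  have ee: "e \<bullet> e = 1" using assms by (simp add: norm_eq_1)
  define P where "P p v = (v \<bullet> e) * c p" for p v
  have lin: "linear (P p)" for p unfolding P_def by (auto simp: linear_iff inner_add_left distrib_right)
  have sm: "smooth_on (ball 0 r) (\<lambda>p. P p w)" for w unfolding P_def by (intro smooth_intros open_ball assms)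
  have closed: "FD (\<lambda>q. P q ((w \<bullet> e) *\<^sub>R e)) p ((v \<bullet> e) *\<^sub>R e) = FD (\<lambda>q. P q ((v \<bullet> e) *\<^sub>R e)) p ((w \<bullet> e) *\<^sub>R e)"
    if p: "p \<in> ball 0 r" for p v w
  proof -
    have "FD (\<lambda>q. P q ((w \<bullet> e) *\<^sub>R e)) p ((v \<bullet> e) *\<^sub>R e) = (w \<bullet> e) * ((v \<bullet> e) * FD c p e)" for v w
      unfolding P_def by (simp add: ee FD_mult_const[OF assms(2) p] linear_scale[OF smooth_linear_FD[OF assms(2) p]])
    then show ?thesis by simp
  qed
  show ?thesis
  proof (rule that)
    show "smooth_on (ball 0 r) (\<lambda>p. integral {0..1} (\<lambda>s. P (\<sigma> s p) ((p \<bullet> e) *\<^sub>R e)))"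
      by (rule potential(1)[where P=P, OF lin sm]) (rule closed)
    fix p :: 'a assume p: "p \<in> ball 0 r"
    have "FD (\<lambda>p. integral {0..1} (\<lambda>s. P (\<sigma> s p) ((p \<bullet> e) *\<^sub>R e))) p ((e \<bullet> e) *\<^sub>R e) = P p ((e \<bullet> e) *\<^sub>R e)"
      by (rule potential(2)[where P=P, OF lin sm _ p]) (rule closed)
    then show "FD (\<lambda>p. integral {0..1} (\<lambda>s. P (\<sigma> s p) ((p \<bullet> e) *\<^sub>R e))) p e = c p"
      by (simp add: ee P_def)
  qed
qed

section \<open>Brackets and first integrals\<close>

text \<open>The second derivatives of \<phi> cancel by symmetry.\<close>

lemma lie_push:
  fixes \<phi> :: "'a::euclidean_space \<Rightarrow> 'b::euclidean_space"
  assumes "open V" "smooth_on V \<phi>" "smooth_on V X" "smooth_on V Y" "q \<in> V"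
  shows "FD \<phi> q (lie_bracket X Y q) = FD (\<lambda>q. FD \<phi> q (Y q)) q (X q) - FD (\<lambda>q. FD \<phi> q (X q)) q (Y q)"
proof -
  have *: "FD (\<lambda>q. FD \<phi> q (Y q)) q v = FD (\<lambda>q'. FD \<phi> q' (Y q)) q v + FD \<phi> q (FD Y q v)" if "smooth_on V Y" for Y v
    by (rule FD_linear_family[OF assms(1) smooth_linear_FD[OF assms(2)] smooth_on_FD[OF assms(2)] that assms(5)])
  have "FD (\<lambda>q'. FD \<phi> q' (Y q)) q (X q) = FD (\<lambda>q'. FD \<phi> q' (X q)) q (Y q)"
    by (rule smooth_FD_commute[OF assms(1,2,5)])
  then show ?thesis
    unfolding lie_bracket_def *[OF assms(3)] *[OF assms(4)] by (simp add: linear_diff[OF smooth_linear_FD[OF assms(2,5)]])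
qed

lemma FD_in_subspace:
  fixes f :: "'a::euclidean_space \<Rightarrow> 'b::euclidean_space"
  assumes "open V" "smooth_on V f" "q \<in> V" "subspace S" "\<And>x. x \<in> V \<Longrightarrow> f x \<in> S"
  shows "FD f q v \<in> S"
proof -
  have "FD f q v \<bullet> w = 0" if w: "w \<in> orthogonal_comp S" for w
  proof -
    have "FD f q v \<bullet> w = FD (\<lambda>x. f x \<bullet> w) q v" by (rule FD_inner_left[OF assms(2,3), symmetric])
    also have "\<dots> = FD (\<lambda>x. 0 :: real) q v"
      by (rule FD_cong2[OF assms(1,3)]) (use assms(5) w in \<open>auto simp: orthogonal_comp_def orthogonal_def inner_commute\<close>)
    finally show ?thesis by simp
  qed
  then have "FD f q v \<in> orthogonal_comp (orthogonal_comp S)"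
    by (auto simp: orthogonal_comp_def[of "orthogonal_comp S"] orthogonal_def inner_commute)
  then show ?thesis using orthogonal_comp_self[OF assms(4)] by simp
qed

lemma integrable_distributionE:
  assumes "integrable_distribution U D" "p \<in> U"
  obtains V and \<phi> :: "'a::euclidean_space \<Rightarrow> 'a" and S where "p \<in> V" "V \<subseteq> U" "diffeo_onto_image V \<phi>" "subspace S"
    "\<And>q. q \<in> V \<Longrightarrow> D q = {v. FD \<phi> q v \<in> S}"
proof -
  from bspec[OF assms(1)[unfolded integrable_distribution_def] assms(2)]
  obtain V and \<phi> :: "'a \<Rightarrow> 'a" and S where "p \<in> V \<and> V \<subseteq> U \<and> diffeo_onto_image V \<phi> \<and> subspace S \<and>
      (\<forall>q\<in>V. D q = {v. FD \<phi> q v \<in> S})"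
    by (elim exE) (rule that)
  then show ?thesis by (intro that[of V \<phi> S]) auto
qed

text \<open>The easy half of Frobenius: in a straightening chart both fields have values in the
  fixed subspace \<open>S\<close>, and so have their derivatives.\<close>

lemma bracket_in_integrable:
  fixes X Y :: "'a::euclidean_space \<Rightarrow> 'a"
  assumes D: "integrable_distribution U D" and V: "open V" "V \<subseteq> U" "smooth_on V X" "smooth_on V Y"
    and XY: "\<And>q. q \<in> V \<Longrightarrow> X q \<in> D q" "\<And>q. q \<in> V \<Longrightarrow> Y q \<in> D q" and q: "q \<in> V"
  shows "lie_bracket X Y q \<in> D q"
proof -
  have "q \<in> U" using V q by blast
  then obtain N and \<phi> :: "'a \<Rightarrow> 'a" and S where N: "q \<in> N" "N \<subseteq> U" "diffeo_onto_image N \<phi>" "subspace S"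
    and DN: "\<And>q. q \<in> N \<Longrightarrow> D q = {v. FD \<phi> q v \<in> S}"
    by (rule integrable_distributionE[OF D]) (assumption | rule that)+
  define V' where "V' = V \<inter> N"
  have V': "open V'" "V' \<subseteq> V" "V' \<subseteq> N" "q \<in> V'" using V N q by (auto simp: V'_def diffeo_onto_image_def)
  have \<phi>: "smooth_on V' \<phi>" using N(3) V'(3) by (auto simp: diffeo_onto_image_def intro: smooth_on_subset)
  note sX = smooth_on_subset[OF V(3) V'(2)] and sY = smooth_on_subset[OF V(4) V'(2)]
  have in_S: "FD \<phi> x (X x) \<in> S" "FD \<phi> x (Y x) \<in> S" if "x \<in> V'" for x
    using XY[of x] DN[of x] that V' by auto
  have "FD \<phi> q (lie_bracket X Y q) = FD (\<lambda>q. FD \<phi> q (Y q)) q (X q) - FD (\<lambda>q. FD \<phi> q (X q)) q (Y q)"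
    by (rule lie_push[OF V'(1) \<phi> sX sY V'(4)])
  also have "\<dots> \<in> S"
    by (intro subspace_diff[OF N(4)] FD_in_subspace[OF V'(1) _ V'(4) N(4)] smooth_on_FD2 V' \<phi> sX sY in_S)
  finally show ?thesis using DN N(1) by simp
qed

text \<open>The straightening chart is followed by a linear map with kernel \<open>S\<close>, namely
  the adjoint of a linear map of \<open>'a\<close> onto the orthogonal complement of
  \<open>S\<close>; the dimensions match by \<open>dim\<close>.\<close>

lemma first_integrals:
  fixes D :: "'a::euclidean_space \<times> 'a \<Rightarrow> ('a \<times> 'a) set"
  assumes D: "integrable_distribution U D" and p0: "p0 \<in> U" and dim: "2 * dim (D p0) = DIM('a \<times> 'a)"
  obtains V and y :: "'a \<times> 'a \<Rightarrow> 'a" where "open V" "p0 \<in> V" "V \<subseteq> U" "smooth_on V y" "y p0 = 0"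
    "\<And>q v. q \<in> V \<Longrightarrow> FD y q v = 0 \<longleftrightarrow> v \<in> D q"
proof -
  obtain V and \<phi> :: "'a \<times> 'a \<Rightarrow> 'a \<times> 'a" and S where V: "p0 \<in> V" "V \<subseteq> U" "diffeo_onto_image V \<phi>" "subspace S"
    and DV: "\<And>q. q \<in> V \<Longrightarrow> D q = {v. FD \<phi> q v \<in> S}"
    by (rule integrable_distributionE[OF D p0]) (assumption | rule that)+
  obtain \<psi> where d: "diffeo_between V \<phi> (\<phi> ` V) \<psi>" by (rule diffeo_onto_imageE[OF V(3)])
  have oV: "open V" and sm: "smooth_on V \<phi>" using d by (auto simp: diffeo_between_def)
  note lin = smooth_linear_FD[OF sm V(1)]
  have "FD \<phi> p0 ` D p0 = S"
  proof
    show "FD \<phi> p0 ` D p0 \<subseteq> S" by (auto simp: DV[OF V(1)])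
    show "S \<subseteq> FD \<phi> p0 ` D p0"
    proof
      fix w assume w: "w \<in> S"
      have e: "FD \<phi> p0 (FD \<psi> (\<phi> p0) w) = w" by (rule diffeo_between_FD(2)[OF d V(1)])
      then have "FD \<psi> (\<phi> p0) w \<in> D p0" using w DV[OF V(1)] by simp
      then show "w \<in> FD \<phi> p0 ` D p0" using e by (metis image_eqI)
    qed
  qed
  moreover have "inj_on (FD \<phi> p0) (span (D p0))"
    using diffeo_between_FD(1)[OF d V(1)] by (metis inj_onI)
  ultimately have "dim S = dim (D p0)" using dim_image_eq[OF lin] by metis
  then have dimS: "dim S = DIM('a)" using dim by simp
  have "dim (orthogonal_comp S) = DIM('a)"
    using dim_subspace_orthogonal_to_vectors[OF V(4) subspace_UNIV subset_UNIV] dimS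
    by (simp add: orthogonal_comp_def orthogonal_commute)
  then obtain g :: "'a \<Rightarrow> 'a \<times> 'a" where g: "linear g" "range g = orthogonal_comp S"
    using isometries_subspaces[of "UNIV :: 'a set" "orthogonal_comp S"] by (metis dim_UNIV subspace_UNIV subspace_orthogonal_comp)
  define l where "l = adjoint g"
  have l: "linear l" unfolding l_def by (rule adjoint_linear[OF g(1)])
  have ker: "l v = 0 \<longleftrightarrow> v \<in> S" for v
  proof -
    have "l v = 0 \<longleftrightarrow> (\<forall>a. a \<bullet> l v = 0)" by (metis inner_eq_zero_iff inner_zero_right)
    also have "\<dots> \<longleftrightarrow> (\<forall>a. g a \<bullet> v = 0)" unfolding l_def by (simp add: adjoint_works[OF g(1)] inner_commute)
    also have "\<dots> \<longleftrightarrow> v \<in> orthogonal_comp (range g)" by (auto simp: orthogonal_comp_def orthogonal_def)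
    also have "\<dots> \<longleftrightarrow> v \<in> S" by (simp add: g(2) orthogonal_comp_self[OF V(4)])
    finally show ?thesis .
  qed
  show ?thesis
  proof (rule that[OF oV V(1,2)])
    show "smooth_on V (\<lambda>q. l (\<phi> q) - l (\<phi> p0))" by (intro smooth_intros oV smooth_on_linear[OF l] sm)
    show "l (\<phi> p0) - l (\<phi> p0) = 0" by simp
    fix q v assume q: "q \<in> V"
    have "FD (\<lambda>q. l (\<phi> q) - l (\<phi> p0)) q v = FD (\<lambda>q. l (\<phi> q)) q v"
      using FD_diff[OF smooth_on_linear[OF l oV sm] smooth_on_const[OF oV] q] by simp
    also have "\<dots> = l (FD \<phi> q v)"
      using l by (intro FD_bounded_linear[OF _ sm q]) (simp add: linear_conv_bounded_linear)
    finally show "FD (\<lambda>q. l (\<phi> q) - l (\<phi> p0)) q v = 0 \<longleftrightarrow> v \<in> D q" using ker DV[OF q] by simp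
  qed
qed

section \<open>Bracket relations of an adapted frame\<close>

lemma lie_bracket_add:
  assumes "smooth_on V X" "smooth_on V X'" "smooth_on V Y" "smooth_on V Y'" "q \<in> V"
  shows "lie_bracket (\<lambda>x. X x + X' x) (\<lambda>x. Y x + Y' x) q =
    lie_bracket X Y q + lie_bracket X Y' q + lie_bracket X' Y q + lie_bracket X' Y' q"
  using assms by (simp add: lie_bracket_def FD_add[of V] linear_add[OF smooth_linear_FD[of V]])

lemma lie_bracket_minus:
  assumes "smooth_on V X" "smooth_on V Y" "q \<in> V"
  shows "lie_bracket (\<lambda>x. - X x) Y q = - lie_bracket X Y q" "lie_bracket X (\<lambda>x. - Y x) q = - lie_bracket X Y q"
  using assms by (simp_all add: lie_bracket_def FD_minus[of V] linear_neg[OF smooth_linear_FD[of V]])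

text \<open>\<open>y\<close> consists of first integrals of the \<open>+1\<close> eigendistribution
  of \<open>I\<close>, and \<open>X\<close> is the frame of that distribution normalised through
  \<open>K\<close>: the fields \<open>K X w\<close> project under \<open>y\<close> to the constant
  \<open>w\<close>.\<close>

locale frames =
  fixes U :: "('a::euclidean_space \<times> 'a) set" and I K J :: "'a \<times> 'a \<Rightarrow> 'a \<times> 'a \<Rightarrow> 'a \<times> 'a"
    and V :: "('a \<times> 'a) set" and y :: "'a \<times> 'a \<Rightarrow> 'a" and X :: "'a \<times> 'a \<Rightarrow> 'a \<Rightarrow> 'a \<times> 'a"
  assumes hpc: "hyper_para_complex_on U I K J" and V: "open V" "V \<subseteq> U" and sm_y: "smooth_on V y"
    and lin_X: "q \<in> V \<Longrightarrow> linear (X q)" and sm_X: "smooth_on V (\<lambda>q. X q w)"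
    and IX: "q \<in> V \<Longrightarrow> I q (X q w) = X q w" and yKX: "q \<in> V \<Longrightarrow> FD y q (K q (X q w)) = w"
    and ker_y: "q \<in> V \<Longrightarrow> FD y q v = 0 \<longleftrightarrow> I q v = v"
begin

lemma pc: "para_complex_on U I" "para_complex_on U K"
  and IKJ: "\<And>p v. p \<in> U \<Longrightarrow> I p (K p v) = J p v" "\<And>p v. p \<in> U \<Longrightarrow> K p (I p v) = - J p v"
  using hpc unfolding hyper_para_complex_on_def by blast+

lemma IK:
  assumes "q \<in> V"
  shows "linear (I q)" "linear (K q)" "K q (K q v) = v" "I q (K q v) = - K q (I q v)" "I q (I q v) = v"
proof -
  have q: "q \<in> U" using assms V by blast
  show "linear (I q)" "linear (K q)" "K q (K q v) = v" "I q (I q v) = v"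
    using pc q unfolding para_complex_on_def endomorphism_field_def by blast+
  show "I q (K q v) = - K q (I q v)" using IKJ[OF q] by simp
qed

definition "E q w = K q (X q w)"

lemma sm_K: "smooth_on V f \<Longrightarrow> smooth_on V (\<lambda>q. K q (f q))"
proof (rule smooth_on_linear_family[OF V(1) IK(2)])
  show "smooth_on V (\<lambda>q. K q b)" for b
  proof (rule smooth_on_subset[OF _ V(2)])
    show "smooth_on U (\<lambda>q. K q b)" using pc(2) unfolding para_complex_on_def endomorphism_field_def by blast
  qed
qed

lemma sm_E: "smooth_on V (\<lambda>q. E q w)" unfolding E_def by (rule sm_K[OF sm_X])

lemma lin_E: "q \<in> V \<Longrightarrow> linear (E q)"
  unfolding E_def using linear_compose[OF lin_X IK(2)] by (simp add: o_def)

lemma IE: "q \<in> V \<Longrightarrow> I q (E q w) = - E q w" by (simp add: E_def IK(4) IX)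

lemma KE: "q \<in> V \<Longrightarrow> K q (E q w) = X q w" by (simp add: E_def IK(3))

lemma yX: "q \<in> V \<Longrightarrow> FD y q (X q w) = 0" by (simp add: ker_y IX)

lemma yE: "q \<in> V \<Longrightarrow> FD y q (E q w) = w" by (simp add: E_def yKX)

lemma zero_if: assumes "v = - v" shows "v = (0 :: 'a \<times> 'a)"
proof -
  have "2 *\<^sub>R v = v + v" by (rule scaleR_2)
  also have "\<dots> = 0" using assms by (metis add.right_inverse)
  finally show ?thesis by simp
qed

lemma trivial_int:
  assumes "q \<in> V" "I q v = v"
  shows "I q v = - v \<Longrightarrow> v = 0" "K q v = v \<Longrightarrow> v = 0" "K q v = - v \<Longrightarrow> v = 0"
proof -
  show "I q v = - v \<Longrightarrow> v = 0" using assms(2) zero_if by metis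
  show "K q v = v \<Longrightarrow> v = 0" using IK(4)[OF assms(1), of v] assms(2) zero_if by metis
  assume "K q v = - v"
  then have "v = - v" using IK(4)[OF assms(1), of v] assms(2) linear_neg[OF IK(1)[OF assms(1)], of v] by simp
  then show "v = 0" by (rule zero_if)
qed

lemma decomp_X: assumes q: "q \<in> V" and v: "I q v = v" shows "v = X q (FD y q (K q v))"
proof -
  define a where "a = FD y q (K q v)"
  have "FD y q (K q v - E q a) = 0" using q by (simp add: linear_diff[OF smooth_linear_FD[OF sm_y]] yE a_def)
  then have 1: "I q (K q v - E q a) = K q v - E q a" using ker_y[OF q] by simp
  have "I q (K q v - E q a) = - (K q v - E q a)" using q v by (simp add: linear_diff[OF IK(1)] IK(4) IE)
  then have "K q v = E q a" using trivial_int(1)[OF q 1] by simp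
  then have "K q (K q v) = K q (E q a)" by simp
  then show ?thesis using q by (simp add: IK(3) KE a_def)
qed

lemma decomp: assumes q: "q \<in> V" shows "\<exists>a. v = X q a + E q (FD y q v)"
proof -
  have "FD y q (v - E q (FD y q v)) = 0" using q by (simp add: linear_diff[OF smooth_linear_FD[OF sm_y]] yE)
  then have "v - E q (FD y q v) = X q (FD y q (K q (v - E q (FD y q v))))" using decomp_X[OF q] ker_y[OF q] by blast
  then show ?thesis by (metis diff_add_cancel)
qed

text \<open>Fields that \<open>y\<close> sends to constants have a bracket annihilated by
  \<open>FD y\<close>, by \<open>lie_push\<close>.\<close>

lemma bracket_y:
  assumes q: "q \<in> V" and "smooth_on V Z" "smooth_on V Z'" "\<And>q. q \<in> V \<Longrightarrow> FD y q (Z q) = c" "\<And>q. q \<in> V \<Longrightarrow> FD y q (Z' q) = c'"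
  shows "I q (lie_bracket Z Z' q) = lie_bracket Z Z' q"
proof -
  have "FD y q (lie_bracket Z Z' q) = FD (\<lambda>q. FD y q (Z' q)) q (Z q) - FD (\<lambda>q. FD y q (Z q)) q (Z' q)"
    by (rule lie_push[OF V(1) sm_y assms(2,3) q])
  also have "FD (\<lambda>q. FD y q (Z' q)) q (Z q) = FD (\<lambda>_. c') q (Z q)" by (rule FD_cong2[OF V(1) q assms(5)])
  also have "FD (\<lambda>q. FD y q (Z q)) q (Z' q) = FD (\<lambda>_. c) q (Z' q)" by (rule FD_cong2[OF V(1) q assms(4)])
  finally show ?thesis using ker_y[OF q] by simp
qed

text \<open>By \<open>bracket_y\<close> all these brackets lie in the \<open>+1\<close>
  eigendistribution of \<open>I\<close>. Integrability of the \<open>-1\<close> eigendistribution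
  kills \<open>[E, E]\<close>. The eigendistributions of \<open>K\<close>, spanned by
  \<open>X + E\<close> and \<open>X - E\<close>, give \<open>[X, X]\<close> plus and minus the same
  difference of mixed brackets; sum and difference of these two relations give the second and third
  claims.\<close>

lemma brackets:
  assumes q: "q \<in> V"
  shows "lie_bracket (\<lambda>q. E q v) (\<lambda>q. E q w) q = 0" (is "?EE = 0")
    and "lie_bracket (\<lambda>q. X q v) (\<lambda>q. X q w) q = 0" (is "?XX = 0")
    and "lie_bracket (\<lambda>q. X q v) (\<lambda>q. E q w) q = lie_bracket (\<lambda>q. X q w) (\<lambda>q. E q v) q" (is "?XE = ?XE'")
    and "I q (lie_bracket (\<lambda>q. X q v) (\<lambda>q. E q w) q) = lie_bracket (\<lambda>q. X q v) (\<lambda>q. E q w) q"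
proof -
  have int: "integrable_distribution U (eigendistribution I 1)" "integrable_distribution U (eigendistribution I (-1))"
    "integrable_distribution U (eigendistribution K 1)" "integrable_distribution U (eigendistribution K (-1))"
    using pc unfolding para_complex_on_def by blast+
  have EE1: "I q ?EE = ?EE" by (rule bracket_y[OF q sm_E sm_E yE yE])
  have "?EE \<in> eigendistribution I (-1) q"
    by (rule bracket_in_integrable[OF int(2) V sm_E sm_E _ _ q]) (simp_all add: eigendistribution_def IE)
  then show EE: "?EE = 0" using trivial_int(1)[OF q EE1] by (simp add: eigendistribution_def)
  have XX1: "I q ?XX = ?XX" by (rule bracket_y[OF q sm_X sm_X yX yX])
  have XE1: "I q (lie_bracket (\<lambda>q. X q a) (\<lambda>q. E q b) q) = lie_bracket (\<lambda>q. X q a) (\<lambda>q. E q b) q" for a b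
    by (rule bracket_y[OF q sm_X sm_E yX yE])
  show "I q ?XE = ?XE" by (rule XE1)
  have flip: "lie_bracket (\<lambda>q. E q v) (\<lambda>q. X q w) q = - ?XE'" by (simp add: lie_bracket_def)
  note sE' = smooth_on_minus[OF V(1) sm_E]
  have p: "?XX + (?XE - ?XE') = 0"
  proof (rule trivial_int(2)[OF q])
    show "I q (?XX + (?XE - ?XE')) = ?XX + (?XE - ?XE')"
      using XX1 XE1 by (simp add: linear_add[OF IK(1)[OF q]] linear_diff[OF IK(1)[OF q]])
    have "lie_bracket (\<lambda>q. X q v + E q v) (\<lambda>q. X q w + E q w) q \<in> eigendistribution K 1 q"
      by (rule bracket_in_integrable[OF int(3) V _ _ _ _ q])
        (auto intro!: smooth_intros V sm_X sm_E simp: eigendistribution_def linear_add[OF IK(2)] KE E_def[symmetric] add.commute)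
    then show "K q (?XX + (?XE - ?XE')) = ?XX + (?XE - ?XE')"
      unfolding lie_bracket_add[OF sm_X sm_E sm_X sm_E q] by (simp add: eigendistribution_def EE flip add_diff_eq)
  qed
  have m: "?XX - (?XE - ?XE') = 0"
  proof (rule trivial_int(3)[OF q])
    show "I q (?XX - (?XE - ?XE')) = ?XX - (?XE - ?XE')"
      using XX1 XE1 by (simp add: linear_diff[OF IK(1)[OF q]])
    have "lie_bracket (\<lambda>q. X q v + (- E q v)) (\<lambda>q. X q w + (- E q w)) q \<in> eigendistribution K (-1) q"
      by (rule bracket_in_integrable[OF int(4) V _ _ _ _ q])
        (auto intro!: smooth_intros V sm_X sm_E simp: eigendistribution_def linear_diff[OF IK(2)] KE E_def[symmetric])
    moreover have "lie_bracket (\<lambda>q. X q v + (- E q v)) (\<lambda>q. X q w + (- E q w)) q = ?XX - (?XE - ?XE')"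
      unfolding lie_bracket_add[OF sm_X sE' sm_X sE' q] lie_bracket_minus(1)[OF sm_E sm_X q]
        lie_bracket_minus(2)[OF sm_X sm_E q] lie_bracket_minus(1)[OF sm_E sE' q] lie_bracket_minus(2)[OF sm_E sm_E q]
      by (simp add: EE flip)
    ultimately show "K q (?XX - (?XE - ?XE')) = - (?XX - (?XE - ?XE'))" by (simp add: eigendistribution_def)
  qed
  have "a + a = 0" if "a + d = 0" "a - d = 0" for a d :: "'a \<times> 'a"
  proof -
    have "a + a = (a + d) + (a - d)" by simp
    then show ?thesis using that by simp
  qed
  then have "?XX + ?XX = 0" using p m by blast
  then have "2 *\<^sub>R ?XX = 0" by (simp only: scaleR_2)
  then show "?XX = 0" by simp
  then show "?XE = ?XE'" using p by simp
qed

end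

section \<open>Adapted charts\<close>

lemma diffeo_betweenD:
  assumes "diffeo_between V \<phi> W \<psi>"
  shows "open V" "open W" "smooth_on V \<phi>" "smooth_on W \<psi>" "q \<in> V \<Longrightarrow> \<phi> q \<in> W" "q \<in> V \<Longrightarrow> \<psi> (\<phi> q) = q"
    "p \<in> W \<Longrightarrow> \<psi> p \<in> V" "p \<in> W \<Longrightarrow> \<phi> (\<psi> p) = p"
  using assms unfolding diffeo_between_def by blast+

lemma lie_bracket_push:
  fixes \<phi> :: "'a::euclidean_space \<Rightarrow> 'b::euclidean_space"
  assumes d: "diffeo_between V \<phi> W \<psi>" and Z: "smooth_on V Z" "smooth_on V Z'" and z: "smooth_on W z" "smooth_on W z'"
    and rel: "\<And>q. q \<in> V \<Longrightarrow> FD \<phi> q (Z q) = z (\<phi> q)" "\<And>q. q \<in> V \<Longrightarrow> FD \<phi> q (Z' q) = z' (\<phi> q)" and q: "q \<in> V"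
  shows "FD \<phi> q (lie_bracket Z Z' q) = lie_bracket z z' (\<phi> q)"
proof -
  note D = diffeo_betweenD[OF d]
  have "FD \<phi> q (lie_bracket Z Z' q) = FD (\<lambda>q. FD \<phi> q (Z' q)) q (Z q) - FD (\<lambda>q. FD \<phi> q (Z q)) q (Z' q)"
    by (rule lie_push[OF D(1,3) Z q])
  also have "FD (\<lambda>q. FD \<phi> q (Z' q)) q (Z q) = FD (\<lambda>q. z' (\<phi> q)) q (Z q)" by (rule FD_cong2[OF D(1) q rel(2)])
  also have "\<dots> = FD z' (\<phi> q) (FD \<phi> q (Z q))" by (rule FD_compose[OF z(2) D(5)[OF q] D(3) q])
  also have "FD (\<lambda>q. FD \<phi> q (Z q)) q (Z' q) = FD (\<lambda>q. z (\<phi> q)) q (Z' q)" by (rule FD_cong2[OF D(1) q rel(1)])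
  also have "\<dots> = FD z (\<phi> q) (FD \<phi> q (Z' q))" by (rule FD_compose[OF z(1) D(5)[OF q] D(3) q])
  finally show ?thesis by (simp add: lie_bracket_def rel q)
qed

context frames begin

text \<open>Since the frame itself commutes, only the coefficients are differentiated.\<close>

lemma bracket_X:
  assumes q: "q \<in> V" and a: "smooth_on V a" and b: "smooth_on V b"
  shows "lie_bracket (\<lambda>q. X q (a q)) (\<lambda>q. X q (b q)) q = X q (FD b q (X q (a q)) - FD a q (X q (b q)))"
proof -
  have *: "FD (\<lambda>q. X q (b q)) q v = FD (\<lambda>q'. X q' (b q)) q v + X q (FD b q v)" if "smooth_on V b" for b v
    by (rule FD_linear_family[OF V(1) lin_X sm_X that q])
  have "lie_bracket (\<lambda>q'. X q' (a q)) (\<lambda>q'. X q' (b q)) q = 0" by (rule brackets(2)[OF q])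
  then have "FD (\<lambda>q'. X q' (b q)) q (X q (a q)) = FD (\<lambda>q'. X q' (a q)) q (X q (b q))" by (simp add: lie_bracket_def)
  then show ?thesis unfolding lie_bracket_def *[OF a] *[OF b] by (simp add: linear_diff[OF lin_X[OF q]])
qed

lemma X_inj: "q \<in> V \<Longrightarrow> X q a = X q b \<Longrightarrow> a = b"
  using yKX by metis

end

text \<open>A chart onto a ball that brings the structure to the normal form \<open>lax_I A\<close>,
  \<open>lax_K A\<close>. The equations \<open>F1\<close> and \<open>F2\<close> for \<open>A\<close>
  are derived below from the bracket relations.\<close>

locale adapted =
  fixes U :: "('a::euclidean_space \<times> 'a) set" and I K J :: "'a \<times> 'a \<Rightarrow> 'a \<times> 'a \<Rightarrow> 'a \<times> 'a"
    and V :: "('a \<times> 'a) set" and \<phi> :: "'a \<times> 'a \<Rightarrow> 'a \<times> 'a" and r :: real and \<kappa> :: "'a \<times> 'a \<Rightarrow> 'a \<times> 'a"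
    and A :: "'a \<times> 'a \<Rightarrow> 'a \<Rightarrow> 'a"
  assumes hpc: "hyper_para_complex_on U I K J" and VU: "V \<subseteq> U" and r: "r > 0"
    and d: "diffeo_between V \<phi> (ball 0 r) \<kappa>"
    and linA: "p \<in> ball 0 r \<Longrightarrow> linear (A p)" and smA: "smooth_on (ball 0 r) (\<lambda>p. A p w)"
    and push_I: "q \<in> V \<Longrightarrow> FD \<phi> q (I q v) = lax_I A (\<phi> q) (FD \<phi> q v)"
    and push_K: "q \<in> V \<Longrightarrow> FD \<phi> q (K q v) = lax_K A (\<phi> q) (FD \<phi> q v)"
begin

lemmas D = diffeo_betweenD[OF d]

lemmas D_inv = diffeo_between_FD[OF d]

lemma push_inj: "q \<in> V \<Longrightarrow> FD \<phi> q v = FD \<phi> q w \<Longrightarrow> v = w"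
  using D_inv(1) by metis

definition "y q = snd (\<phi> q)"
definition "X q w = FD \<kappa> (\<phi> q) (w, 0)"

lemma push_X: "q \<in> V \<Longrightarrow> FD \<phi> q (X q w) = (w, 0)"
  unfolding X_def by (rule D_inv(2))

lemma FD_y: "q \<in> V \<Longrightarrow> FD y q v = snd (FD \<phi> q v)"
  unfolding y_def by (rule FD_snd[OF D(3)])

lemma linear_pair0: "linear f \<Longrightarrow> linear (\<lambda>w :: 'a. f (w, 0 :: 'a))"
  using linear_compose[of "\<lambda>w. (w, 0)" f] by (auto simp: linear_iff o_def)

sublocale frames U I K J V y X
proof (rule frames.intro[OF hpc D(1) VU])
  show "smooth_on V y" unfolding y_def by (intro smooth_intros D)
  fix q w assume q: "q \<in> V"
  have A: "linear (A (\<phi> q))" by (rule linA[OF D(5)[OF q]])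
  show "linear (X q)"
    unfolding X_def[abs_def] by (rule linear_pair0) (rule smooth_linear_FD[OF D(4) D(5)[OF q]])
  show "I q (X q w) = X q w"
    by (rule push_inj[OF q]) (simp add: push_I[OF q] push_X[OF q] lax_I_def linear_0[OF A])
  show "FD y q (K q (X q w)) = w"
    by (simp add: FD_y[OF q] push_K[OF q] push_X[OF q] lax_K_def linear_0[OF A])
  fix v
  have "I q v = v \<longleftrightarrow> lax_I A (\<phi> q) (FD \<phi> q v) = FD \<phi> q v"
    using push_inj[OF q] push_I[OF q] by metis
  also have "\<dots> \<longleftrightarrow> snd (FD \<phi> q v) = 0"
  proof
    assume "lax_I A (\<phi> q) (FD \<phi> q v) = FD \<phi> q v"
    then have "- snd (FD \<phi> q v) = snd (FD \<phi> q v)" by (metis lax_I_def snd_conv)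
    then have "2 *\<^sub>R snd (FD \<phi> q v) = 0" by (metis add.right_inverse scaleR_2)
    then show "snd (FD \<phi> q v) = 0" by simp
  qed (simp add: lax_I_def linear_0[OF A] prod_eq_iff)
  finally show "FD y q v = 0 \<longleftrightarrow> I q v = v" by (simp add: FD_y[OF q])
next
  show "smooth_on V (\<lambda>q. X q w)" for w
    unfolding X_def by (rule smooth_on_compose[OF smooth_on_FD[OF D(4)] D(3) D(1,2,5)])
qed

lemma push_E: "q \<in> V \<Longrightarrow> FD \<phi> q (E q w) = (A (\<phi> q) w, w)"
  using linA[OF D(5)] by (simp add: E_def push_K push_X lax_K_def linear_0)

lemma sm_pair: "smooth_on (ball 0 r) (\<lambda>p. (A p w, w))"
  by (intro smooth_intros open_ball smA)

lemma FD_pair: "p \<in> ball 0 r \<Longrightarrow> FD (\<lambda>p. (A p w, w)) p v = (FD (\<lambda>q. A q w) p v, 0)"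
  using FD_eqI[OF has_derivative_Pair[OF smooth_has_derivative[OF smA] has_derivative_const]] by metis

lemma push_bracket_XE:
  "q \<in> V \<Longrightarrow> FD \<phi> q (lie_bracket (\<lambda>q. X q v) (\<lambda>q. E q w) q) = (FD (\<lambda>p. A p w) (\<phi> q) (v, 0), 0)"
  by (subst lie_bracket_push[OF d sm_X sm_E smooth_on_const[OF open_ball] sm_pair push_X push_E])
    (simp_all add: lie_bracket_def FD_pair[OF D(5)])

lemma push_bracket_EE:
  "q \<in> V \<Longrightarrow> FD \<phi> q (lie_bracket (\<lambda>q. E q v) (\<lambda>q. E q w) q) =
    (FD (\<lambda>p. A p w) (\<phi> q) (A (\<phi> q) v, v) - FD (\<lambda>p. A p v) (\<phi> q) (A (\<phi> q) w, w), 0)"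
  by (subst lie_bracket_push[OF d sm_E sm_E sm_pair sm_pair push_E push_E])
    (simp_all add: lie_bracket_def FD_pair[OF D(5)])

text \<open>The bracket relations pushed forward by \<phi>: the symmetry of the mixed bracket is
  \<open>F1\<close>, and \<open>[E, E] = 0\<close> is \<open>F2\<close>.\<close>

lemma lax: "lax (ball 0 r) A"
proof (rule lax.intro[OF open_ball linA smA])
  fix p :: "'a \<times> 'a" and v w assume p: "p \<in> ball 0 r"
  note q = D(7)[OF p] and [simp] = D(8)[OF p]
  have "(FD (\<lambda>q. A q w) p (v, 0), 0 :: 'a) = (FD (\<lambda>q. A q v) p (w, 0), 0)"
    using push_bracket_XE[OF q, of v w] push_bracket_XE[OF q, of w v] brackets(3)[OF q, of v w] by simp
  then show "FD (\<lambda>q. A q w) p (v, 0) = FD (\<lambda>q. A q v) p (w, 0)" by simp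
  have "(FD (\<lambda>q. A q w) p (A p v, v) - FD (\<lambda>q. A q v) p (A p w, w), 0 :: 'a) = 0"
    using push_bracket_EE[OF q, of v w] brackets(1)[OF q, of v w] linear_0[OF smooth_linear_FD[OF D(3) q]] by simp
  then show "FD (\<lambda>q. A q w) p (A p v, v) = FD (\<lambda>q. A q v) p (A p w, w)" by (simp add: zero_prod_def)
qed

end

text \<open>Functions \<open>x\<close> dual to the frame \<open>X\<close> complete \<open>y\<close>
  to a chart, since \<open>X\<close> spans the kernel of \<open>FD y\<close>. The operator
  \<open>A\<close> is the \<open>x\<close>-part of \<open>E\<close>.\<close>

lemma (in frames) adapted_chart:
  assumes x: "smooth_on V x" and xX: "\<And>q w. q \<in> V \<Longrightarrow> FD x q (X q w) = w" and p0: "p0 \<in> V"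
    and 0: "x p0 = 0" "y p0 = 0"
  obtains V' \<phi> r \<kappa> A where "adapted U I K J V' \<phi> r \<kappa> A" "p0 \<in> V'" "\<phi> p0 = 0"
proof -
  define \<phi> where "\<phi> q = (x q, y q)" for q
  have sm: "smooth_on V \<phi>" unfolding \<phi>_def by (intro smooth_intros V x sm_y)
  have FD\<phi>: "FD \<phi> q v = (FD x q v, FD y q v)" if "q \<in> V" for q v
    using FD_eqI[OF has_derivative_Pair[OF smooth_has_derivative[OF x that] smooth_has_derivative[OF sm_y that]]]
    by (simp add: \<phi>_def[abs_def])
  have inj: "v = 0" if "FD \<phi> p0 v = 0" for v
  proof -
    have "FD x p0 v = 0" "I p0 v = v" using that FD\<phi>[OF p0] ker_y[OF p0] by (auto simp: zero_prod_def)
    then have "v = X p0 (FD x p0 v)" using decomp_X[OF p0, of v] xX[OF p0] by metis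
    then show ?thesis using \<open>FD x p0 v = 0\<close> linear_0[OF lin_X[OF p0]] by simp
  qed
  obtain V1 W1 \<kappa> where d1: "diffeo_between V1 \<phi> W1 \<kappa>" "p0 \<in> V1" "V1 \<subseteq> V"
    by (rule local_diffeo[OF V(1) sm p0 inj]) (assumption | rule that)+
  obtain r where r: "r > 0" "diffeo_between (\<kappa> ` ball (\<phi> p0) r) \<phi> (ball (\<phi> p0) r) \<kappa>"
    "p0 \<in> \<kappa> ` ball (\<phi> p0) r" "\<kappa> ` ball (\<phi> p0) r \<subseteq> V1 \<inter> V"
    by (rule diffeo_between_restrict_ball[OF d1(1,2) V(1) p0]) (assumption | rule that)+
  have \<phi>0: "\<phi> p0 = 0" by (simp add: \<phi>_def 0 zero_prod_def)
  define V' where "V' = \<kappa> ` ball 0 r"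
  have d: "diffeo_between V' \<phi> (ball 0 r) \<kappa>" and V': "p0 \<in> V'" "V' \<subseteq> V" using r(2-) by (auto simp: \<phi>0 V'_def)
  note D = diffeo_betweenD[OF d]
  define A where "A p w = FD x (\<kappa> p) (E (\<kappa> p) w)" for p w
  have \<kappa>V: "\<kappa> p \<in> V" if "p \<in> ball 0 r" for p using D(7)[OF that] V'(2) by blast
  show ?thesis
  proof (rule that[of V' \<phi> r \<kappa> A])
    show "adapted U I K J V' \<phi> r \<kappa> A"
    proof (rule adapted.intro[OF hpc _ r(1) d])
      show "V' \<subseteq> U" using V V' by blast
      show "linear (A p)" if "p \<in> ball 0 r" for p
        unfolding A_def using linear_compose[OF lin_E[OF \<kappa>V[OF that]] smooth_linear_FD[OF x \<kappa>V[OF that]]] by (simp add: o_def)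
      have "smooth_on V (\<lambda>q. FD x q (E q w))" for w by (intro smooth_on_FD2 V x sm_E)
      from smooth_on_compose[OF this D(4,2) V(1) \<kappa>V] show "smooth_on (ball 0 r) (\<lambda>p. A p w)" for w
        unfolding A_def .
      fix q v assume "q \<in> V'"
      then have q: "q \<in> V" and c: "\<kappa> (\<phi> q) = q" and b: "\<phi> q \<in> ball 0 r" using V' D by blast+
      obtain a w where v: "v = X q a + E q w" using decomp[OF q] by metis
      have 1: "FD \<phi> q (X q a) = (a, 0)" for a by (simp add: FD\<phi>[OF q] xX[OF q] yX[OF q])
      have 2: "FD \<phi> q (E q w) = (A (\<phi> q) w, w)" for w by (simp add: FD\<phi>[OF q] A_def c yE[OF q])
      note l = linear_add[OF smooth_linear_FD[OF sm q]] linear_diff[OF smooth_linear_FD[OF sm q]]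
      show "FD \<phi> q (I q v) = lax_I A (\<phi> q) (FD \<phi> q v)"
        by (simp add: v linear_add[OF IK(1)[OF q]] IX[OF q] IE[OF q] l 1 2 lax_I_def scaleR_2)
      show "FD \<phi> q (K q v) = lax_K A (\<phi> q) (FD \<phi> q v)"
        by (simp add: v linear_add[OF IK(2)[OF q]] KE[OF q] E_def[symmetric] l 1 2 lax_K_def)
    qed
  qed (use V' \<phi>0 in auto)
qed

text \<open>First integrals \<open>z, y\<close> of the two eigendistributions of \<open>I\<close> are coordinates; \<open>x\<close> replaces \<open>z\<close> so as
  to be dual to the frame \<open>X\<close>, the integrability condition being \<open>[X v, X w] = 0\<close>.\<close>

lemma adapted_chart_exists:
  fixes U :: "('a::euclidean_space \<times> 'a) set"
  assumes hpc: "hyper_para_complex_on U I K J" and p0: "p0 \<in> U"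
  obtains V' \<phi> r \<kappa> A where "adapted U I K J V' \<phi> r \<kappa> A" "p0 \<in> V'" "\<phi> p0 = 0"
proof -
  have pc: "para_complex_on U I" "para_complex_on U K" and
    IK: "\<And>p v. p \<in> U \<Longrightarrow> I p (K p v) = J p v" "\<And>p v. p \<in> U \<Longrightarrow> K p (I p v) = - J p v"
    using hpc unfolding hyper_para_complex_on_def by blast+
  have int: "integrable_distribution U (eigendistribution I 1)" "integrable_distribution U (eigendistribution I (-1))"
    and dim: "2 * dim (eigendistribution I 1 p0) = DIM('a \<times> 'a)" "2 * dim (eigendistribution I (-1) p0) = DIM('a \<times> 'a)"
    using pc p0 unfolding para_complex_on_def by blast+
  have KK: "K q (K q v) = v" if "q \<in> U" for q v using pc(2) that unfolding para_complex_on_def by blast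
  have linK: "linear (K q)" if "q \<in> U" for q using pc(2) that unfolding para_complex_on_def endomorphism_field_def by blast
  have smK: "smooth_on U (\<lambda>q. K q v)" for v using pc(2) unfolding para_complex_on_def endomorphism_field_def by blast
  obtain Vy and y :: "'a \<times> 'a \<Rightarrow> 'a" where y: "open Vy" "p0 \<in> Vy" "Vy \<subseteq> U" "smooth_on Vy y" "y p0 = 0"
    "\<And>q v. q \<in> Vy \<Longrightarrow> FD y q v = 0 \<longleftrightarrow> v \<in> eigendistribution I 1 q"
    by (rule first_integrals[OF int(1) p0 dim(1)]) (assumption | rule that)+
  obtain Vz and z :: "'a \<times> 'a \<Rightarrow> 'a" where z: "open Vz" "p0 \<in> Vz" "Vz \<subseteq> U" "smooth_on Vz z" "z p0 = 0"
    "\<And>q v. q \<in> Vz \<Longrightarrow> FD z q v = 0 \<longleftrightarrow> v \<in> eigendistribution I (-1) q"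
    by (rule first_integrals[OF int(2) p0 dim(2)]) (assumption | rule that)+
  define V where "V = Vy \<inter> Vz"
  have V: "open V" "p0 \<in> V" "V \<subseteq> U" using y z by (auto simp: V_def)
  have sy: "smooth_on V y" and sz: "smooth_on V z" using y z by (auto simp: V_def intro: smooth_on_subset)
  have ky: "FD y q v = 0 \<longleftrightarrow> I q v = v" and kz: "FD z q v = 0 \<longleftrightarrow> I q v = - v" if "q \<in> V" for q v
    using that y(6) z(6) by (auto simp: V_def eigendistribution_def)
  have half: "v = 0" if "v = - v" for v :: "'a \<times> 'a"
  proof -
    have "2 *\<^sub>R v = v + v" by (rule scaleR_2)
    also have "\<dots> = 0" using that by (metis add.right_inverse)
    finally show ?thesis by simp
  qed
  \<comment> \<open>The frame vector \<open>X q w\<close> is the solution \<open>v\<close> of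
    \<open>\<Lambda> q v = (w, 0)\<close>: the second component puts it into the \<open>+1\<close>
    eigendistribution, the first normalises it.\<close>
  define \<Lambda> where "\<Lambda> q v = (FD y q (K q v), FD y q v)" for q v
  have lin\<Lambda>: "linear (\<Lambda> q)" if q: "q \<in> V" for q
  proof -
    have "q \<in> U" using q V(3) by blast
    note l = linear_add[OF linK[OF this]] linear_scale[OF linK[OF this]]
      linear_add[OF smooth_linear_FD[OF sy q]] linear_scale[OF smooth_linear_FD[OF sy q]]
    show ?thesis by (rule linearI) (simp_all add: \<Lambda>_def l)
  qed
  have sKV: "smooth_on V (\<lambda>q. K q v)" for v using smK V(3) by (rule smooth_on_subset)
  have sm\<Lambda>: "smooth_on V (\<lambda>q. \<Lambda> q v)" for v
    unfolding \<Lambda>_def by (intro smooth_intros V smooth_on_FD2 sy sKV)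
  have inj\<Lambda>: "inj (\<Lambda> q)" if q: "q \<in> V" for q
  proof -
    have "v = 0" if "\<Lambda> q v = 0" for v
    proof -
      have qU: "q \<in> U" using q V by blast
      have 1: "I q v = v" "I q (K q v) = K q v" using that ky[OF q] by (auto simp: \<Lambda>_def zero_prod_def)
      then have "K q v = - K q v" using IK[OF qU, of v] by (metis add.inverse_inverse)
      then have "K q (K q v) = K q 0" using half by metis
      then show ?thesis using KK[OF qU] linear_0[OF linK[OF qU]] by simp
    qed
    then show ?thesis using linear_injective_0[OF lin\<Lambda>[OF q]] by blast
  qed
  define M where "M q = inv (\<Lambda> q)" for q
  have M: "M q (\<Lambda> q v) = v" "\<Lambda> q (M q w) = w" if "q \<in> V" for q v w
    using inv_f_f[OF inj\<Lambda>[OF that]] surj_f_inv_f[OF linear_injective_imp_surjective[OF lin\<Lambda>[OF that] inj\<Lambda>[OF that]]]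
    by (auto simp: M_def)
  define X where "X q w = M q (w, 0)" for q w
  have \<Lambda>X: "\<Lambda> q (X q w) = (w, 0)" if "q \<in> V" for q w unfolding X_def by (rule M(2)[OF that])
  define \<psi> where "\<psi> q = (z q, y q)" for q
  have sm\<psi>: "smooth_on V \<psi>" unfolding \<psi>_def by (intro smooth_intros V sy sz)
  have FD\<psi>: "FD \<psi> q v = (FD z q v, FD y q v)" if "q \<in> V" for q v
    using FD_eqI[OF has_derivative_Pair[OF smooth_has_derivative[OF sz that] smooth_has_derivative[OF sy that]]]
    by (simp add: \<psi>_def[abs_def])
  have inj\<psi>: "v = 0" if "FD \<psi> p0 v = 0" for v
  proof -
    have "FD y p0 v = 0" "FD z p0 v = 0" using that by (simp_all add: FD\<psi>[OF V(2)] zero_prod_def)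
    then have "I p0 v = v" "I p0 v = - v" using ky[OF V(2)] kz[OF V(2)] by blast+
    then show ?thesis using half by metis
  qed
  obtain V1 W1 \<kappa> where d1: "diffeo_between V1 \<psi> W1 \<kappa>" "p0 \<in> V1" "V1 \<subseteq> V"
    by (rule local_diffeo[OF V(1) sm\<psi> V(2) inj\<psi>]) (assumption | rule that)+
  obtain r where r: "r > 0" "diffeo_between (\<kappa> ` ball (\<psi> p0) r) \<psi> (ball (\<psi> p0) r) \<kappa>"
    "p0 \<in> \<kappa> ` ball (\<psi> p0) r" "\<kappa> ` ball (\<psi> p0) r \<subseteq> V1 \<inter> V"
    by (rule diffeo_between_restrict_ball[OF d1(1,2) V(1,2)]) (assumption | rule that)+
  have \<psi>0: "\<psi> p0 = 0" by (simp add: \<psi>_def y z zero_prod_def)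
  define V2 where "V2 = \<kappa> ` ball 0 r"
  have d: "diffeo_between V2 \<psi> (ball 0 r) \<kappa>" and V2: "p0 \<in> V2" "V2 \<subseteq> V" using r(2-) by (auto simp: \<psi>0 V2_def)
  note D = diffeo_betweenD[OF d] and FDinv = diffeo_between_FD[OF d]
  have V2V: "q \<in> V" if "q \<in> V2" for q using that V2 by blast
  interpret frames U I K J V2 y X
  proof (rule frames.intro[OF hpc D(1)])
    show "V2 \<subseteq> U" using V2 V by blast
    show "smooth_on V2 y" by (rule smooth_on_subset[OF sy V2(2)])
    have "smooth_on V (\<lambda>q. X q w)" for w
      unfolding X_def by (rule smooth_on_linear_inverse[OF V(1) lin\<Lambda> sm\<Lambda> M])
    then show "smooth_on V2 (\<lambda>q. X q w)" for w by (rule smooth_on_subset[OF _ V2(2)])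
    fix q w assume "q \<in> V2" then have q: "q \<in> V" by (rule V2V)
    have "linear (M q)" by (rule linear_of_inverse[OF lin\<Lambda>[OF q] M[OF q]])
    from linear_compose[OF _ this, of "\<lambda>w. (w, 0)"]
    show "linear (X q)" unfolding X_def by (auto simp: linear_iff o_def)
    show "FD y q (K q (X q w)) = w" using \<Lambda>X[OF q, of w] by (simp add: \<Lambda>_def)
    show "FD y q v = 0 \<longleftrightarrow> I q v = v" for v by (rule ky[OF q])
    show "I q (X q w) = X q w" using \<Lambda>X[OF q, of w] ky[OF q, of "X q w"] by (simp add: \<Lambda>_def)
  qed
  define Z where "Z w q = FD \<kappa> (\<psi> q) (w, 0)" for w q
  define P where "P p v = FD y (\<kappa> p) (K (\<kappa> p) (FD \<kappa> p (fst v, 0)))" for p and v :: "'a \<times> 'a"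
  have smZ: "smooth_on V2 (Z w)" for w
    unfolding Z_def[abs_def] by (rule smooth_on_compose[OF smooth_on_FD[OF D(4)] D(3) D(1,2,5)])
  have push_Z: "FD \<psi> q (Z w q) = (w, 0)" if "q \<in> V2" for q w unfolding Z_def by (rule FDinv(2)[OF that])
  have Z: "Z w q = X q (P (\<psi> q) (w, 0))" if q: "q \<in> V2" for w q
  proof -
    have "I q (Z w q) = Z w q" using push_Z[OF q, of w] ky[OF V2V[OF q]] by (simp add: FD\<psi>[OF V2V[OF q]])
    then show ?thesis using decomp_X[OF q] D(6)[OF q] by (simp add: P_def Z_def)
  qed
  have linP: "linear (P p)" if p: "p \<in> ball 0 r" for p
  proof -
    note q = D(7)[OF p]
    have "linear (\<lambda>v :: 'a \<times> 'a. FD \<kappa> p (fst v, 0))"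
      using linear_compose[OF _ smooth_linear_FD[OF D(4) p], of "\<lambda>v :: 'a \<times> 'a. (fst v, 0)"] by (auto simp: linear_iff o_def)
    from linear_compose[OF linear_compose[OF this IK(2)] smooth_linear_FD[OF sm_y]] q
    show ?thesis unfolding P_def by (simp add: o_def)
  qed
  have smP: "smooth_on (ball 0 r) (\<lambda>p. P p v)" for v
  proof (rule smooth_on_cong[OF open_ball])
    have "smooth_on V2 (\<lambda>q. FD y q (K q (Z (fst v) q)))"
      by (intro smooth_on_FD2 D sm_y sm_K smZ)
    from smooth_on_compose[OF this D(4,2,1,7)]
    show "smooth_on (ball 0 r) (\<lambda>p. FD y (\<kappa> p) (K (\<kappa> p) (Z (fst v) (\<kappa> p))))" .
    show "FD y (\<kappa> p) (K (\<kappa> p) (Z (fst v) (\<kappa> p))) = P p v" if "p \<in> ball 0 r" for p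
      using D(8)[OF that] by (simp add: P_def Z_def)
  qed
  \<comment> \<open>The coordinate fields \<open>Z\<close> commute and so does the frame
    \<open>X\<close>. Expanding \<open>[Z v, Z w] = 0\<close> in the frame by
    \<open>bracket_X\<close> leaves the closedness of the transition matrix \<open>P\<close>, whose
    potential is the new coordinate.\<close>
  have closed: "FD (\<lambda>q. P q (fst w, 0)) p (fst v, 0) = FD (\<lambda>q. P q (fst v, 0)) p (fst w, 0)"
    if p: "p \<in> ball 0 r" for p and v w :: "'a \<times> 'a"
  proof -
    define q where "q = \<kappa> p"
    have q: "q \<in> V2" "\<psi> q = p" using D(7,8)[OF p] by (auto simp: q_def)
    define a where "a w q = P (\<psi> q) (w, 0)" for w q
    have sa: "smooth_on V2 (a w)" for w
      unfolding a_def[abs_def] by (rule smooth_on_compose[OF smP D(3) D(1,2,5)])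
    have FDa: "FD (a w) q (Z v q) = FD (\<lambda>q. P q (w, 0)) p (v, 0)" for v w
      unfolding a_def[abs_def] using FD_compose[OF smP D(5) D(3) q(1)] q by (simp add: push_Z)
    have "FD \<psi> q (lie_bracket (Z v) (Z w) q) = 0" for v w
      by (subst lie_bracket_push[OF d smZ smZ smooth_on_const[OF open_ball] smooth_on_const[OF open_ball] push_Z push_Z q(1)])
        (assumption | simp add: lie_bracket_def)+
    then have "lie_bracket (Z v) (Z w) q = 0" for v w
      using FDinv(1)[OF q(1)] linear_0[OF smooth_linear_FD[OF D(4) D(5)[OF q(1)]]] by metis
    moreover have "lie_bracket (Z v) (Z w) q = lie_bracket (\<lambda>q. X q (a v q)) (\<lambda>q. X q (a w q)) q" for v w
      unfolding lie_bracket_def a_def using Z q(1) FD_cong2[OF D(1) q(1), of "Z v" "\<lambda>q. X q (P (\<psi> q) (v, 0))" for v]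
      by simp
    ultimately have "X q (FD (a w) q (X q (a v q)) - FD (a v) q (X q (a w q))) = X q 0" for v w
      using bracket_X[OF q(1) sa sa] linear_0[OF lin_X[OF q(1)]] by metis
    then have "FD (a w) q (X q (a v q)) - FD (a v) q (X q (a w q)) = 0" for v w by (rule X_inj[OF q(1)])
    then have "FD (a w) q (Z v q) = FD (a v) q (Z w q)" for v w using Z[OF q(1)] by (simp add: a_def)
    then show ?thesis unfolding FDa .
  qed
  interpret pr: projection "\<lambda>v :: 'a \<times> 'a. (fst v, 0 :: 'a)" "ball 0 r" by (rule projection_fst)
  define \<xi> where "\<xi> p = integral {0..1} (\<lambda>s. P (pr.\<sigma> s p) (fst p, 0))" for p
  have s\<xi>: "smooth_on (ball 0 r) \<xi>"
    unfolding \<xi>_def by (rule pr.potential(1)[where P=P, OF linP smP]) (assumption | rule closed)+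
  have FD\<xi>: "FD \<xi> p (w, 0) = P p (w, 0)" if "p \<in> ball 0 r" for p w
  proof -
    have "FD \<xi> p (fst (w, 0 :: 'a), 0) = P p (fst (w, 0 :: 'a), 0)"
      unfolding \<xi>_def[abs_def] by (rule pr.potential(2)[where P=P, OF linP smP _ that]) (assumption | rule closed)+
    then show ?thesis by simp
  qed
  define x where "x q = \<xi> (\<psi> q) - \<xi> 0" for q
  have s\<xi>\<psi>: "smooth_on V2 (\<lambda>q. \<xi> (\<psi> q))" by (rule smooth_on_compose[OF s\<xi> D(3,1,2,5)])
  show ?thesis
  proof (rule adapted_chart[of x])
    show "smooth_on V2 x" unfolding x_def by (intro smooth_intros D s\<xi>\<psi>)
    fix q w assume q: "q \<in> V2"
    have u: "FD \<psi> q (X q w) = (FD z q (X q w), 0)" by (simp add: FD\<psi>[OF V2V[OF q]] yX[OF q])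
    have "FD x q (X q w) = FD (\<lambda>q. \<xi> (\<psi> q)) q (X q w)"
      unfolding x_def[abs_def] using FD_diff[OF s\<xi>\<psi> smooth_on_const[OF D(1)] q] by simp
    also have "\<dots> = FD \<xi> (\<psi> q) (FD \<psi> q (X q w))" by (rule FD_compose[OF s\<xi> D(5)[OF q] D(3) q])
    also have "\<dots> = P (\<psi> q) (FD z q (X q w), 0)" unfolding u by (rule FD\<xi>[OF D(5)[OF q]])
    also have "\<dots> = FD y q (K q (FD \<kappa> (\<psi> q) (FD \<psi> q (X q w))))" by (simp add: P_def u D(6)[OF q])
    also have "\<dots> = w" by (simp add: FDinv(1)[OF q] yKX[OF q])
    finally show "FD x q (X q w) = w" .
  next
    show "x p0 = 0" by (simp add: x_def \<psi>0)
  qed (assumption | rule that V2 y)+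
qed

section \<open>The Ricci tensor in an adapted chart\<close>

definition christoffel :: "(('a::euclidean_space \<Rightarrow> 'a) \<Rightarrow> ('a \<Rightarrow> 'a) \<Rightarrow> 'a \<Rightarrow> 'a) \<Rightarrow> 'a \<Rightarrow> 'a \<Rightarrow> 'a \<Rightarrow> 'a" where
  "christoffel N p u v = (\<Sum>b\<in>Basis. \<Sum>c\<in>Basis. ((u \<bullet> b) * (v \<bullet> c)) *\<^sub>R N (\<lambda>_. b) (\<lambda>_. c) p)"

text \<open>The axioms of \<open>N\<close> speak of fields smooth on all of \<open>U\<close>,
  whereas the frames \<open>X\<close> and \<open>E\<close> exist only on \<open>V\<close>. A
  connection given by symbols restricts to \<open>V\<close>.\<close>

locale local_connection =
  fixes V :: "'a::euclidean_space set" and \<Gamma> :: "'a \<Rightarrow> 'a \<Rightarrow> 'a \<Rightarrow> 'a"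
  assumes oV: "open V" and lin1: "q \<in> V \<Longrightarrow> linear (\<lambda>u. \<Gamma> q u v)" and lin2: "q \<in> V \<Longrightarrow> linear (\<Gamma> q u)"
    and sm: "smooth_on V (\<lambda>q. \<Gamma> q u v)"
begin

definition "cov X Y q = FD Y q (X q) + \<Gamma> q (X q) (Y q)"

definition "Riem q u v w = FD (\<lambda>q. \<Gamma> q v w) q u - FD (\<lambda>q. \<Gamma> q u w) q v + \<Gamma> q u (\<Gamma> q v w) - \<Gamma> q v (\<Gamma> q u w)"

lemma smooth_on_\<Gamma>:
  assumes "smooth_on V f" "smooth_on V g"
  shows "smooth_on V (\<lambda>p. \<Gamma> p (f p) (g p))"
  by (rule smooth_on_linear_family[OF oV lin2 _ assms(2)], assumption,
      rule smooth_on_linear_family[where L="\<lambda>p e. \<Gamma> p e b" for b, OF oV lin1 sm assms(1)])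

lemma smooth_on_cov: "smooth_on V X \<Longrightarrow> smooth_on V Y \<Longrightarrow> smooth_on V (cov X Y)"
  unfolding cov_def by (intro smooth_intros oV smooth_on_FD2 smooth_on_\<Gamma>)

lemma FD_\<Gamma>:
  assumes "smooth_on V f" "smooth_on V g" "p \<in> V"
  shows "FD (\<lambda>q. \<Gamma> q (f q) (g q)) p d = FD (\<lambda>q. \<Gamma> q (f p) (g p)) p d + \<Gamma> p (FD f p d) (g p) + \<Gamma> p (f p) (FD g p d)"
proof -
  have "FD (\<lambda>q. \<Gamma> q (f q) (g q)) p d = FD (\<lambda>q. \<Gamma> q (f q) (g p)) p d + \<Gamma> p (f p) (FD g p d)"
    by (rule FD_linear_family[OF oV lin2 smooth_on_\<Gamma>[OF assms(1) smooth_on_const[OF oV]] assms(2,3)])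
  also have "FD (\<lambda>q. \<Gamma> q (f q) (g p)) p d = FD (\<lambda>q. \<Gamma> q (f p) (g p)) p d + \<Gamma> p (FD f p d) (g p)"
    by (rule FD_linear_family[where L="\<lambda>q e. \<Gamma> q e (g p)", OF oV lin1 sm assms(1,3)])
  finally show ?thesis .
qed

lemma cov_curvature:
  assumes X: "smooth_on V X" and Y: "smooth_on V Y" and Z: "smooth_on V Z" and p: "p \<in> V"
  shows "cov X (cov Y Z) p - cov Y (cov X Z) p - cov (lie_bracket X Y) Z p = Riem p (X p) (Y p) (Z p)"
proof -
  have *: "cov X (cov Y Z) p = FD (\<lambda>q. FD Z q (Y p)) p (X p) + FD Z p (FD Y p (X p)) + FD (\<lambda>q. \<Gamma> q (Y p) (Z p)) p (X p)
      + \<Gamma> p (FD Y p (X p)) (Z p) + \<Gamma> p (Y p) (FD Z p (X p)) + \<Gamma> p (X p) (FD Z p (Y p)) + \<Gamma> p (X p) (\<Gamma> p (Y p) (Z p))"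
    if Y: "smooth_on V Y" for X Y
  proof -
    have "FD (cov Y Z) p (X p) = FD (\<lambda>q. FD Z q (Y q)) p (X p) + FD (\<lambda>q. \<Gamma> q (Y q) (Z q)) p (X p)"
      unfolding cov_def[abs_def] by (rule FD_add[OF smooth_on_FD2[OF oV Z Y] smooth_on_\<Gamma>[OF Y Z] p])
    also have "FD (\<lambda>q. FD Z q (Y q)) p (X p) = FD (\<lambda>q. FD Z q (Y p)) p (X p) + FD Z p (FD Y p (X p))"
      by (rule FD_linear_family[OF oV smooth_linear_FD[OF Z] smooth_on_FD[OF Z] Y p])
    finally show ?thesis
      unfolding cov_def[of X "cov Y Z"] using p
      by (simp add: cov_def[of Y Z p] linear_add[OF lin2] FD_\<Gamma>[OF Y Z p])
  qed
  have c: "FD (\<lambda>q. FD Z q (Y p)) p (X p) = FD (\<lambda>q. FD Z q (X p)) p (Y p)" by (rule smooth_FD_commute[OF oV Z p])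
  show ?thesis
    unfolding *[OF X] *[OF Y] cov_def[of "lie_bracket X Y"] lie_bracket_def Riem_def c
    using p by (simp add: linear_diff[OF smooth_linear_FD[OF Z]] linear_diff[OF lin1])
qed

lemma Riem_lin: assumes p: "p \<in> V" shows "linear (\<lambda>u. Riem p u v w)"
proof -
  have a: "linear (\<lambda>u. FD (\<lambda>q. \<Gamma> q u w) p v)"
    by (rule linear_FD_linear_family[where L="\<lambda>q u. \<Gamma> q u w", OF oV lin1 sm p])
  have b: "linear (\<lambda>u. \<Gamma> p v (\<Gamma> p u w))"
    using linear_compose[OF lin1[OF p] lin2[OF p]] by (simp add: o_def)
  show ?thesis
    unfolding Riem_def by (intro linear_compose_add linear_compose_sub a b lin1[OF p] smooth_linear_FD[OF sm p])
qed

end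

section \<open>From the axioms of a connection to its symbols\<close>

locale affine_connection =
  fixes U :: "'a::euclidean_space set" and N :: "('a \<Rightarrow> 'a) \<Rightarrow> ('a \<Rightarrow> 'a) \<Rightarrow> 'a \<Rightarrow> 'a"
  assumes oU: "open U" and aff: "affine_connection_on U N"
begin

lemmas connection_axioms = aff[unfolded affine_connection_on_def]

lemma N_smooth: "smooth_on U X \<Longrightarrow> smooth_on U Y \<Longrightarrow> smooth_on U (N X Y)"
  by (rule connection_axioms[THEN conjunct1, rule_format])

lemma N_add:
  "smooth_on U X \<Longrightarrow> smooth_on U X' \<Longrightarrow> smooth_on U Y \<Longrightarrow> p \<in> U \<Longrightarrow> N (\<lambda>q. X q + X' q) Y p = N X Y p + N X' Y p"
  "smooth_on U X \<Longrightarrow> smooth_on U Y \<Longrightarrow> smooth_on U Y' \<Longrightarrow> p \<in> U \<Longrightarrow> N X (\<lambda>q. Y q + Y' q) p = N X Y p + N X Y' p"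
  by (rule connection_axioms[THEN conjunct2, THEN conjunct1, rule_format], assumption+)
    (rule connection_axioms[THEN conjunct2, THEN conjunct2, THEN conjunct1, rule_format], assumption+)

lemma N_scale:
  fixes g :: "'a \<Rightarrow> real"
  shows "smooth_on U g \<Longrightarrow> smooth_on U X \<Longrightarrow> smooth_on U Y \<Longrightarrow> p \<in> U \<Longrightarrow> N (\<lambda>q. g q *\<^sub>R X q) Y p = g p *\<^sub>R N X Y p"
    "smooth_on U g \<Longrightarrow> smooth_on U X \<Longrightarrow> smooth_on U Y \<Longrightarrow> p \<in> U \<Longrightarrow>
      N X (\<lambda>q. g q *\<^sub>R Y q) p = FD g p (X p) *\<^sub>R Y p + g p *\<^sub>R N X Y p"
  by (rule connection_axioms[THEN conjunct2, THEN conjunct2, THEN conjunct2, rule_format, THEN conjunct1], assumption+)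
    (rule connection_axioms[THEN conjunct2, THEN conjunct2, THEN conjunct2, rule_format, THEN conjunct2], assumption+)

lemma N_sum1:
  assumes f: "\<And>b. b \<in> B \<Longrightarrow> smooth_on U (f b)" and Y: "smooth_on U Y" and p: "p \<in> U" and B: "finite B"
  shows "N (\<lambda>q. \<Sum>b\<in>B. f b q) Y p = (\<Sum>b\<in>B. N (f b) Y p)"
  using B f
proof (induction B rule: finite_induct)
  case empty
  show ?case using N_scale(1)[OF smooth_on_const[OF oU] Y Y p, of 0] by simp
next
  case (insert b B)
  have "smooth_on U (\<lambda>q. \<Sum>b\<in>B. f b q)" using insert by (intro smooth_intros oU) auto
  from N_add(1)[OF _ this Y p, of "f b"] show ?case using insert by simp
qed

lemma N_sum2:
  assumes f: "\<And>b. b \<in> B \<Longrightarrow> smooth_on U (f b)" and X: "smooth_on U X" and p: "p \<in> U" and B: "finite B"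
  shows "N X (\<lambda>q. \<Sum>b\<in>B. f b q) p = (\<Sum>b\<in>B. N X (f b) p)"
  using B f
proof (induction B rule: finite_induct)
  case empty
  show ?case using N_scale(2)[OF smooth_on_const[OF oU] X X p, of 0] by simp
next
  case (insert b B)
  have "smooth_on U (\<lambda>q. \<Sum>b\<in>B. f b q)" using insert by (intro smooth_intros oU) auto
  from N_add(2)[OF X _ this p, of "f b"] show ?case using insert by simp
qed

text \<open>Both fields are expanded in the constant frame, with coefficients smooth on all of
  \<open>U\<close>. This shows that \<open>N\<close> is local.\<close>

lemma N_eq:
  assumes X: "smooth_on U X" and Y: "smooth_on U Y" and p: "p \<in> U"
  shows "N X Y p = FD Y p (X p) + christoffel N p (X p) (Y p)"
proof -
  note c = smooth_on_const[OF oU]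
  have i: "smooth_on U (\<lambda>q. Z q \<bullet> b)" if "smooth_on U Z" for Z :: "'a \<Rightarrow> 'a" and b by (intro smooth_intros oU that)
  have s: "smooth_on U (\<lambda>q. (Z q \<bullet> b) *\<^sub>R b)" if "smooth_on U Z" for Z :: "'a \<Rightarrow> 'a" and b by (intro smooth_intros oU i that)
  have rep: "Z = (\<lambda>q. \<Sum>b\<in>Basis. (Z q \<bullet> b) *\<^sub>R b)" for Z :: "'a \<Rightarrow> 'a" by (simp add: euclidean_representation)
  have 1: "N (\<lambda>_. b) Y p = FD Y p b + (\<Sum>c\<in>Basis. (Y p \<bullet> c) *\<^sub>R N (\<lambda>_. b) (\<lambda>_. c) p)" for b
  proof -
    have "N (\<lambda>_. b) Y p = N (\<lambda>_. b) (\<lambda>q. \<Sum>c\<in>Basis. (Y q \<bullet> c) *\<^sub>R c) p" using rep[of Y] by simp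
    also have "\<dots> = (\<Sum>d\<in>Basis. N (\<lambda>_. b) (\<lambda>q. (Y q \<bullet> d) *\<^sub>R d) p)" by (rule N_sum2[OF s[OF Y] c p]) simp
    also have "\<dots> = (\<Sum>d\<in>Basis. (FD Y p b \<bullet> d) *\<^sub>R d + (Y p \<bullet> d) *\<^sub>R N (\<lambda>_. b) (\<lambda>_. d) p)"
      by (intro sum.cong[OF refl]) (simp add: N_scale(2)[OF i[OF Y] c c p] FD_inner_left[OF Y p])
    finally show ?thesis by (simp add: sum.distrib euclidean_representation)
  qed
  have "N X Y p = N (\<lambda>q. \<Sum>b\<in>Basis. (X q \<bullet> b) *\<^sub>R b) Y p" using rep[of X] by simp
  also have "\<dots> = (\<Sum>b\<in>Basis. N (\<lambda>q. (X q \<bullet> b) *\<^sub>R b) Y p)" by (rule N_sum1[OF s[OF X] Y p]) simp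
  also have "\<dots> = (\<Sum>b\<in>Basis. (X p \<bullet> b) *\<^sub>R N (\<lambda>_. b) Y p)"
    by (intro sum.cong[OF refl]) (rule N_scale(1)[OF i[OF X] c Y p])
  also have "\<dots> = (\<Sum>b\<in>Basis. (X p \<bullet> b) *\<^sub>R FD Y p b) + christoffel N p (X p) (Y p)"
    by (simp add: 1 scaleR_add_right sum.distrib christoffel_def scaleR_sum_right)
  also have "(\<Sum>b\<in>Basis. (X p \<bullet> b) *\<^sub>R FD Y p b) = FD Y p (X p)"
    by (rule linear_expand[OF smooth_linear_FD[OF Y p], symmetric])
  finally show ?thesis .
qed

sublocale local_connection U "christoffel N"
proof (rule local_connection.intro[OF oU])
  show "linear (\<lambda>u. christoffel N q u v)" "linear (christoffel N q u)" for q u v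
    unfolding christoffel_def[abs_def]
    by (auto intro!: linearI simp: inner_add_left algebra_simps sum.distrib scaleR_sum_right)
  show "smooth_on U (\<lambda>q. christoffel N q u v)" for u v
    unfolding christoffel_def by (intro smooth_intros oU N_smooth)
qed

lemma curvature_eq:
  assumes X: "smooth_on U X" and Y: "smooth_on U Y" and Z: "smooth_on U Z" and p: "p \<in> U"
  shows "curvature N X Y Z p = Riem p (X p) (Y p) (Z p)"
proof -
  have *: "N X (N Y Z) p = cov X (cov Y Z) p" if X: "smooth_on U X" and Y: "smooth_on U Y" for X Y
  proof -
    have "FD (N Y Z) p = FD (cov Y Z) p" by (rule FD_cong[OF oU p]) (simp add: cov_def N_eq[OF Y Z])
    moreover have "N Y Z p = cov Y Z p" by (simp add: cov_def N_eq[OF Y Z p])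
    ultimately show ?thesis by (simp add: N_eq[OF X N_smooth[OF Y Z] p] cov_def[of X "cov Y Z"])
  qed
  have "smooth_on U (lie_bracket X Y)"
    unfolding lie_bracket_def[abs_def] by (intro smooth_intros smooth_on_FD2 oU X Y)
  from N_eq[OF this Z p] show ?thesis
    unfolding curvature_def *[OF X Y] *[OF Y X] cov_curvature[OF X Y Z p, symmetric] by (simp add: cov_def[of "lie_bracket X Y" Z])
qed

end

text \<open>\<open>N\<close> is any connection with the defining properties. It is evaluated in the
  frame through these properties rather than compared with \<open>lax_conn\<close>.\<close>

locale ricci_flat_chart = adapted U I K J V \<phi> r \<kappa> A
  for U :: "('a::euclidean_space \<times> 'a) set" and I K J V \<phi> r \<kappa> A +
  fixes N :: "('a \<times> 'a \<Rightarrow> 'a \<times> 'a) \<Rightarrow> ('a \<times> 'a \<Rightarrow> 'a \<times> 'a) \<Rightarrow> 'a \<times> 'a \<Rightarrow> 'a \<times> 'a"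
  assumes chern: "chern_connection U (eigendistribution I 1) (eigendistribution I (-1)) (eigendistribution K 1) N"
    and flat: "\<And>Y Z p. smooth_on U Y \<Longrightarrow> smooth_on U Z \<Longrightarrow> p \<in> U \<Longrightarrow> ricci N Y Z p = 0"
begin

sublocale affine_connection U N
  using hpc chern unfolding hyper_para_complex_on_def chern_connection_def by (intro affine_connection.intro) blast+

sublocale L: local_connection V "christoffel N"
  by (rule local_connection.intro[OF D(1) lin1 lin2 smooth_on_subset[OF sm VU]]) (use VU in blast)+

lemma parallel: "parallel_on U N (eigendistribution I 1)" "parallel_on U N (eigendistribution I (-1))"
    "parallel_on U N (eigendistribution K 1)"
  and tors: "smooth_on U X' \<Longrightarrow> smooth_on U Y' \<Longrightarrow> (\<And>p. p \<in> U \<Longrightarrow> X' p \<in> eigendistribution I 1 p) \<Longrightarrow>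
    (\<And>p. p \<in> U \<Longrightarrow> Y' p \<in> eigendistribution I (-1) p) \<Longrightarrow> p \<in> U \<Longrightarrow> torsion N X' Y' p = 0"
  using chern unfolding chern_connection_def by blast+

section \<open>Parallelism of \<open>I\<close> and \<open>K\<close>\<close>

lemma endoU:
  assumes "p \<in> U"
  shows "linear (I p)" "linear (K p)" "I p (I p v) = v" "K p (K p v) = v" "I p (K p v) = - K p (I p v)"
proof -
  show "linear (I p)" "linear (K p)" "I p (I p v) = v" "K p (K p v) = v"
    using pc assms unfolding para_complex_on_def endomorphism_field_def by blast+
  show "I p (K p v) = - K p (I p v)" using IKJ[OF assms] by simp
qed

lemma smooth_endoU: "smooth_on U (\<lambda>p. I p v)" "smooth_on U (\<lambda>p. K p v)"
  using pc unfolding para_complex_on_def endomorphism_field_def by blast+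

lemma smooth_endoU2:
  assumes "smooth_on U f" shows "smooth_on U (\<lambda>p. I p (f p))" "smooth_on U (\<lambda>p. K p (f p))"
  by (rule smooth_on_linear_family[OF oU endoU(1) smooth_endoU(1) assms], assumption)
    (rule smooth_on_linear_family[OF oU endoU(2) smooth_endoU(2) assms], assumption)

lemma N_cong:
  assumes "smooth_on U X'" "smooth_on U Y'" "smooth_on U Y''" "\<And>q. q \<in> U \<Longrightarrow> Y' q = Y'' q" "p \<in> U"
  shows "N X' Y' p = N X' Y'' p"
  unfolding N_eq[OF assms(1,2,5)] N_eq[OF assms(1,3,5)]
  using FD_cong[OF oU assms(5,4)] assms(4,5) by simp

lemma parallel_I_plus:
  assumes "smooth_on U X'" "smooth_on U Z" "\<And>q. q \<in> U \<Longrightarrow> I q (Z q) = Z q" "p \<in> U"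
  shows "I p (N X' Z p) = N X' Z p"
  using parallel(1) assms by (simp add: parallel_on_def eigendistribution_def)

lemma parallel_I_minus:
  assumes "smooth_on U X'" "smooth_on U Z" "\<And>q. q \<in> U \<Longrightarrow> I q (Z q) = - Z q" "p \<in> U"
  shows "I p (N X' Z p) = - N X' Z p"
  using parallel(2) assms by (simp add: parallel_on_def eigendistribution_def)

lemma parallel_K:
  assumes "smooth_on U X'" "smooth_on U Z" "\<And>q. q \<in> U \<Longrightarrow> K q (Z q) = Z q" "p \<in> U"
  shows "K p (N X' Z p) = N X' Z p"
  using parallel(3) assms by (simp add: parallel_on_def eigendistribution_def)

lemma parallel_I:
  assumes X: "smooth_on U X'" and Z: "smooth_on U Z" and IZ: "\<And>q. q \<in> U \<Longrightarrow> I q (Z q) = s *\<^sub>R Z q" and p: "p \<in> U"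
    and s: "s = 1 \<or> s = -1"
  shows "I p (N X' Z p) = s *\<^sub>R N X' Z p"
  using s
proof
  assume s: "s = 1"
  have "I p (N X' Z p) = N X' Z p" by (rule parallel_I_plus[OF X Z _ p]) (simp add: IZ s)
  then show ?thesis by (simp add: s)
next
  assume s: "s = -1"
  have "I p (N X' Z p) = - N X' Z p" by (rule parallel_I_minus[OF X Z _ p]) (simp add: IZ s)
  then show ?thesis by (simp add: s)
qed

text \<open>With \<open>half_m\<close>, the projections of a constant vector to the
  eigendistributions of \<open>I\<close>: sections over all of \<open>U\<close>, to which the
  parallelism axioms apply.\<close>

definition "half_p c q = (1/2) *\<^sub>R c + I q ((1/2) *\<^sub>R c)"
definition "half_m c q = (1/2) *\<^sub>R c + (-1) *\<^sub>R I q ((1/2) *\<^sub>R c)"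

lemma half_sum: "half_p c q + half_m c q = c"
  by (simp add: half_p_def half_m_def scaleR_left_distrib[symmetric])

lemma smooth_half: "smooth_on U (half_p c)" "smooth_on U (half_m c)"
  unfolding half_p_def[abs_def] half_m_def[abs_def] by (intro smooth_intros oU smooth_endoU)+

lemma I_half: "q \<in> U \<Longrightarrow> I q (half_p c q) = half_p c q" "q \<in> U \<Longrightarrow> I q (half_m c q) = - half_m c q"
  unfolding half_p_def half_m_def
  by (simp_all only: linear_add[OF endoU(1)] linear_scale[OF endoU(1)] endoU(3)) (simp_all add: algebra_simps)

lemma half_I: "q \<in> U \<Longrightarrow> half_p c q - half_m c q = I q c"
  unfolding half_p_def half_m_def
  by (simp add: linear_scale[OF endoU(1)] algebra_simps scaleR_left_distrib[symmetric])

text \<open>Splitting the constant field into \<open>half_p\<close> and \<open>half_m\<close>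
  reduces the claim to the parallelism of the two eigendistributions.\<close>

lemma N_I:
  assumes p: "p \<in> U"
  shows "N (\<lambda>_. b) (\<lambda>q. I q c) p = I p (N (\<lambda>_. b) (\<lambda>_. c) p)"
proof -
  note c = smooth_on_const[OF oU]
  have "N (\<lambda>_. b) (\<lambda>_. c) p = N (\<lambda>_. b) (half_p c) p + N (\<lambda>_. b) (half_m c) p"
    using N_add(2)[OF c smooth_half p, of b c c] by (simp add: half_sum)
  moreover have "N (\<lambda>_. b) (\<lambda>q. I q c) p = N (\<lambda>_. b) (\<lambda>q. half_p c q + (-1) *\<^sub>R half_m c q) p"
    by (rule N_cong[OF c smooth_endoU(1) _ _ p]) (auto intro!: smooth_intros oU smooth_half simp: half_I[symmetric])
  moreover have "\<dots> = N (\<lambda>_. b) (half_p c) p + N (\<lambda>_. b) (\<lambda>q. (-1) *\<^sub>R half_m c q) p"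
    by (rule N_add(2)[OF c smooth_half(1) _ p]) (intro smooth_intros oU smooth_half)
  moreover have "N (\<lambda>_. b) (\<lambda>q. (-1) *\<^sub>R half_m c q) p = - N (\<lambda>_. b) (half_m c) p"
    using N_scale(2)[where g="\<lambda>_. -1" and X="\<lambda>_. b" and Y="half_m c", OF c c smooth_half(2) p] by simp
  ultimately show ?thesis
    using parallel_I_plus[OF c smooth_half(1) I_half(1) p, of b c] parallel_I_minus[OF c smooth_half(2) I_half(2) p, of b c]
    by (simp add: linear_add[OF endoU(1)[OF p]])
qed

lemma double_cancel: "a + a = b + b \<Longrightarrow> a = (b :: 'a \<times> 'a)"
  by (metis scaleR_2 scaleR_cancel_left zero_neq_numeral)

text \<open>Only the \<open>+1\<close> eigendistribution of \<open>K\<close> is assumed parallel. It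
  contains \<open>Z + K Z\<close>; applying \<open>I\<close> to the resulting relation separates its
  eigenparts and identifies the derivative of \<open>K Z\<close>.\<close>

lemma N_K_eigen:
  assumes Z: "smooth_on U Z" and p: "p \<in> U" and s: "s = 1 \<or> s = -1" and IZ: "\<And>q. q \<in> U \<Longrightarrow> I q (Z q) = s *\<^sub>R Z q"
  shows "N (\<lambda>_. b) (\<lambda>q. K q (Z q)) p = K p (N (\<lambda>_. b) Z p)"
proof -
  note c = smooth_on_const[OF oU] and KZ = smooth_endoU2(2)[OF Z] and l = linear_add[OF endoU(1)[OF p]] linear_add[OF endoU(2)[OF p]]
  define a where "a = N (\<lambda>_. b) Z p"
  define d where "d = N (\<lambda>_. b) (\<lambda>q. K q (Z q)) p"
  have IKZ: "I q (K q (Z q)) = - s *\<^sub>R K q (Z q)" if "q \<in> U" for q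
    by (simp add: endoU(5)[OF that] IZ[OF that] linear_scale[OF endoU(2)[OF that]])
  have a: "I p a = s *\<^sub>R a" unfolding a_def by (rule parallel_I[OF c Z IZ p s])
  have d: "I p d = - s *\<^sub>R d" unfolding d_def by (rule parallel_I[OF c KZ IKZ p]) (use s in auto)
  have "K p (N (\<lambda>_. b) (\<lambda>q. Z q + K q (Z q)) p) = N (\<lambda>_. b) (\<lambda>q. Z q + K q (Z q)) p"
    by (rule parallel_K[OF c smooth_on_add[OF oU Z KZ] _ p]) (simp add: linear_add[OF endoU(2)] endoU(4))
  then have 1: "K p a + K p d = a + d"
    using N_add(2)[OF c Z KZ p] by (simp add: a_def d_def eigendistribution_def l)
  then have "I p (K p a + K p d) = I p (a + d)" by simp
  then have "- K p (s *\<^sub>R a) + - K p (- s *\<^sub>R d) = s *\<^sub>R a + - s *\<^sub>R d" by (simp only: l endoU(5)[OF p] a d)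
  then have "K p d - K p a = a - d" using s
    by (auto simp: linear_scale[OF endoU(2)[OF p]] linear_neg[OF endoU(2)[OF p]] algebra_simps)
  then have "(K p a + K p d) + (K p d - K p a) = (a + d) + (a - d)" using 1 by simp
  then have "K p d + K p d = a + a" by (simp add: algebra_simps)
  then have "K p d = a" by (rule double_cancel)
  then show ?thesis using endoU(4)[OF p] unfolding a_def d_def by metis
qed

lemma N_K:
  assumes p: "p \<in> U"
  shows "N (\<lambda>_. b) (\<lambda>q. K q c) p = K p (N (\<lambda>_. b) (\<lambda>_. c) p)"
proof -
  note c = smooth_on_const[OF oU]
  have "N (\<lambda>_. b) (\<lambda>q. K q c) p = N (\<lambda>_. b) (\<lambda>q. K q (half_p c q) + K q (half_m c q)) p"
    by (rule N_cong[OF c smooth_endoU(2) _ _ p])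
      (auto intro!: smooth_intros oU smooth_endoU2 smooth_half simp: linear_add[OF endoU(2), symmetric] half_sum)
  also have "\<dots> = K p (N (\<lambda>_. b) (half_p c) p) + K p (N (\<lambda>_. b) (half_m c) p)"
    using N_add(2)[OF c smooth_endoU2(2)[OF smooth_half(1)] smooth_endoU2(2)[OF smooth_half(2)] p, of b c c]
      N_K_eigen[OF smooth_half(1) p, of 1 c b] N_K_eigen[OF smooth_half(2) p, of "-1" c b] I_half by simp
  also have "\<dots> = K p (N (\<lambda>_. b) (\<lambda>q. half_p c q + half_m c q) p)"
    by (simp add: N_add(2)[OF c smooth_half p] linear_add[OF endoU(2)[OF p]])
  finally show ?thesis by (simp add: half_sum)
qed

text \<open>For constant fields the commutation is an identity between symbols, hence pointwise; the
  product rule extends it to arbitrary fields on \<open>V\<close>.\<close>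

lemma cov_endo:
  assumes B: "\<And>q. q \<in> U \<Longrightarrow> linear (B q)" "\<And>v. smooth_on U (\<lambda>q. B q v)"
    and NB: "\<And>b c p. p \<in> U \<Longrightarrow> N (\<lambda>_. b) (\<lambda>q. B q c) p = B p (N (\<lambda>_. b) (\<lambda>_. c) p)"
    and Z: "smooth_on V Z" and q: "q \<in> V"
  shows "cov X' (\<lambda>q. B q (Z q)) q = B q (cov X' Z q)"
proof -
  note c = smooth_on_const[OF oU]
  have qU: "q \<in> U" and BV: "\<And>q. q \<in> V \<Longrightarrow> linear (B q)" using q VU B by blast+
  have 1: "FD (\<lambda>q. B q c) q b + christoffel N q b (B q c) = B q (christoffel N q b c)" for b c
    using NB[OF qU, of b c] by (simp add: N_eq[OF smooth_on_const[OF oU] B(2) qU] N_eq[OF smooth_on_const[OF oU] smooth_on_const[OF oU] qU])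
  have "FD (\<lambda>q. B q (Z q)) q (X' q) = FD (\<lambda>q'. B q' (Z q)) q (X' q) + B q (FD Z q (X' q))"
    by (rule FD_linear_family[OF D(1) BV smooth_on_subset[OF B(2) VU] Z q])
  then show ?thesis using 1[of "Z q" "X' q"] by (simp add: cov_def linear_add[OF B(1)[OF qU]] algebra_simps)
qed

lemma cov_I: "smooth_on V Z \<Longrightarrow> q \<in> V \<Longrightarrow> cov X' (\<lambda>q. I q (Z q)) q = I q (cov X' Z q)"
  by (rule cov_endo[OF endoU(1) smooth_endoU(1) N_I])

lemma cov_K: "smooth_on V Z \<Longrightarrow> q \<in> V \<Longrightarrow> cov X' (\<lambda>q. K q (Z q)) q = K q (cov X' Z q)"
  by (rule cov_endo[OF endoU(2) smooth_endoU(2) N_K])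

lemma cov_cong: "q \<in> V \<Longrightarrow> (\<And>q. q \<in> V \<Longrightarrow> Z q = Z' q) \<Longrightarrow> cov X' Z q = cov X' Z' q"
  unfolding cov_def using FD_cong[OF D(1), of q Z Z'] by simp

lemma cov_plus:
  assumes "smooth_on V Z" "q \<in> V" "\<And>q. q \<in> V \<Longrightarrow> I q (Z q) = Z q"
  shows "I q (cov X' Z q) = cov X' Z q"
proof -
  have "cov X' (\<lambda>q. I q (Z q)) q = cov X' Z q" by (rule cov_cong[OF assms(2)]) (rule assms(3))
  then show ?thesis using cov_I[OF assms(1,2), of X'] by simp
qed

lemma cov_minus:
  assumes "smooth_on V Z" "q \<in> V" "\<And>q. q \<in> V \<Longrightarrow> I q (Z q) = - Z q"
  shows "I q (cov X' Z q) = - cov X' Z q"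
proof -
  have "cov X' (\<lambda>q. I q (Z q)) q = cov X' (\<lambda>q. - Z q) q" by (rule cov_cong[OF assms(2,3)])
  also have "\<dots> = - cov X' Z q" by (simp add: cov_def FD_minus[OF assms(1,2)] linear_neg[OF L.lin2[OF assms(2)]])
  finally show ?thesis using cov_I[OF assms(1,2), of X'] by simp
qed

text \<open>The torsion axiom needs sections over all of \<open>U\<close>; \<open>half_p u\<close>
  and \<open>half_m v\<close> are such sections with the values \<open>u\<close> and
  \<open>v\<close> at \<open>q\<close>.\<close>

lemma christoffel_mixed:
  assumes q: "q \<in> U" and u: "I q u = u" and v: "I q v = - v"
  shows "christoffel N q u v = christoffel N q v u"
proof -
  have "torsion N (half_p u) (half_m v) q = 0"
    by (rule tors[OF smooth_half _ _ q]) (simp_all add: eigendistribution_def I_half)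
  moreover have "half_p u q = u" "half_m v q = v"
    by (simp_all add: half_p_def half_m_def linear_scale[OF endoU(1)[OF q]] u v scaleR_left_distrib[symmetric])
  ultimately show ?thesis
    by (simp add: torsion_def lie_bracket_def N_eq[OF smooth_half(1) smooth_half(2) q] N_eq[OF smooth_half(2) smooth_half(1) q])
qed

section \<open>The Chern connection in the frame \<open>X\<close>, \<open>E\<close>\<close>

definition "CC q v w = Cc A (\<phi> q) v w"

lemma bracket_XE: "q \<in> V \<Longrightarrow> lie_bracket (\<lambda>q. X q v) (\<lambda>q. E q w) q = X q (CC q v w)"
  by (rule push_inj[of q]) (simp_all add: push_bracket_XE push_X CC_def Cc_def)

text \<open>By parallelism \<open>cov X E\<close> lies in the \<open>-1\<close> eigendistribution of
  \<open>I\<close>; by the torsion axiom it equals \<open>[X, E] + cov E X\<close>, which lies in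
  the \<open>+1\<close> one. So it vanishes, and with it
  \<open>cov X X = cov X (K E)\<close>.\<close>

lemma cov_frames:
  assumes q: "q \<in> V"
  shows "cov (\<lambda>q. X q v) (\<lambda>q. E q w) q = 0" "cov (\<lambda>q. E q w) (\<lambda>q. X q v) q = - X q (CC q v w)"
    "cov (\<lambda>q. X q v) (\<lambda>q. X q w) q = 0"
proof -
  have qU: "q \<in> U" using q VU by blast
  have t: "cov (\<lambda>q. X q v) (\<lambda>q. E q w) q - cov (\<lambda>q. E q w) (\<lambda>q. X q v) q = X q (CC q v w)" for v w
    unfolding bracket_XE[OF q, symmetric] lie_bracket_def cov_def
    using christoffel_mixed[OF qU IX[OF q] IE[OF q]] by simp
  show XE: "cov (\<lambda>q. X q v) (\<lambda>q. E q w) q = 0" for v w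
  proof (rule trivial_int(1)[OF q])
    have "cov (\<lambda>q. X q v) (\<lambda>q. E q w) q = X q (CC q v w) + cov (\<lambda>q. E q w) (\<lambda>q. X q v) q"
      using t[of v w] by (simp add: algebra_simps)
    then show "I q (cov (\<lambda>q. X q v) (\<lambda>q. E q w) q) = cov (\<lambda>q. X q v) (\<lambda>q. E q w) q"
      using cov_plus[OF sm_X q IX] by (simp add: linear_add[OF IK(1)[OF q]] IX[OF q])
    show "I q (cov (\<lambda>q. X q v) (\<lambda>q. E q w) q) = - cov (\<lambda>q. X q v) (\<lambda>q. E q w) q"
      by (rule cov_minus[OF sm_E q IE])
  qed
  show "cov (\<lambda>q. E q w) (\<lambda>q. X q v) q = - X q (CC q v w)"
    using t[of v w] by (simp add: XE minus_equation_iff[of _ "X q (CC q v w)"])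
  have "cov (\<lambda>q. X q v) (\<lambda>q. X q w) q = cov (\<lambda>q. X q v) (\<lambda>q. K q (E q w)) q"
    by (rule cov_cong[OF q]) (simp add: KE)
  also have "\<dots> = 0" using cov_K[OF sm_E q] by (simp add: XE linear_0[OF IK(2)[OF q]])
  finally show "cov (\<lambda>q. X q v) (\<lambda>q. X q w) q = 0" .
qed

lemma smooth_CC: "smooth_on V (\<lambda>q. CC q v w)"
  unfolding CC_def by (rule smooth_on_compose[OF lax.C_smooth[OF lax] D(3,1,2,5)])

text \<open>By \<open>cov_frames\<close> only \<open>cov X (cov E X)\<close> survives, and it
  differentiates the Christoffel symbol \<open>CC\<close>.\<close>

lemma Riem_XEX:
  assumes q: "q \<in> V"
  shows "Riem q (X q u) (E q y') (X q w) = - X q (FD (\<lambda>p. Cc A p w y') (\<phi> q) (u, 0))"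
proof -
  have s: "smooth_on V (\<lambda>q. - CC q w y')" by (intro smooth_intros D smooth_CC)
  have "cov (\<lambda>q. X q u) (cov (\<lambda>q. E q y') (\<lambda>q. X q w)) q = cov (\<lambda>q. X q u) (\<lambda>q. X q (- CC q w y')) q"
    by (rule cov_cong[OF q]) (simp add: cov_frames(2) linear_neg[OF lin_X])
  also have "\<dots> = cov (\<lambda>q. X q u) (\<lambda>q'. X q' (- CC q w y')) q + X q (FD (\<lambda>q. - CC q w y') q (X q u))"
    unfolding cov_def using FD_linear_family[OF D(1) lin_X sm_X s q] by simp
  also have "\<dots> = - X q (FD (\<lambda>q. CC q w y') q (X q u))"
    by (simp only: cov_frames(3)[OF q] FD_minus[OF smooth_CC q] linear_neg[OF lin_X[OF q]] add_0)
  also have "FD (\<lambda>q. CC q w y') q (X q u) = FD (\<lambda>p. Cc A p w y') (\<phi> q) (u, 0)"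
    unfolding CC_def using FD_compose[OF lax.C_smooth[OF lax] D(5)[OF q] D(3) q] by (simp add: push_X[OF q])
  finally have 1: "cov (\<lambda>q. X q u) (cov (\<lambda>q. E q y') (\<lambda>q. X q w)) q = - X q (FD (\<lambda>p. Cc A p w y') (\<phi> q) (u, 0))" .
  have "cov (\<lambda>q. E q y') (cov (\<lambda>q. X q u) (\<lambda>q. X q w)) q = cov (\<lambda>q. E q y') (\<lambda>q. 0) q"
    by (rule cov_cong[OF q cov_frames(3)])
  also have "\<dots> = 0" by (simp add: cov_def linear_0[OF L.lin2[OF q]])
  finally have 2: "cov (\<lambda>q. E q y') (cov (\<lambda>q. X q u) (\<lambda>q. X q w)) q = 0" .
  have "cov (lie_bracket (\<lambda>q. X q u) (\<lambda>q. E q y')) (\<lambda>q. X q w) q = cov (\<lambda>q'. X q' (CC q u y')) (\<lambda>q. X q w) q"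
    by (simp add: cov_def bracket_XE[OF q])
  also have "\<dots> = 0" by (rule cov_frames(3)[OF q])
  finally have 3: "cov (lie_bracket (\<lambda>q. X q u) (\<lambda>q. E q y')) (\<lambda>q. X q w) q = 0" .
  show ?thesis unfolding L.cov_curvature[OF sm_X sm_E sm_X q, symmetric] 1 2 3 by simp
qed

lemma Riem_plus:
  assumes q: "q \<in> V"
  shows "I q (Riem q u (E q y') (X q w)) = Riem q u (E q y') (X q w)"
proof -
  note c = smooth_on_const[OF D(1)]
  have s1: "smooth_on V (cov (\<lambda>q. E q y') (\<lambda>q. X q w))" and s2: "smooth_on V (cov (\<lambda>_. u) (\<lambda>q. X q w))"
    by (intro L.smooth_on_cov sm_X sm_E c)+
  have p: "I q (cov Y' (\<lambda>q. X q w) q) = cov Y' (\<lambda>q. X q w) q" if "q \<in> V" for Y' q by (rule cov_plus[OF sm_X that IX])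
  show ?thesis
    unfolding L.cov_curvature[OF c sm_E sm_X q, symmetric, of u]
    by (simp add: linear_diff[OF IK(1)[OF q]] p q cov_plus[OF s1 q p] cov_plus[OF s2 q p])
qed

text \<open>\<open>Ric (E v) (X w)\<close> only involves \<open>Riem (X e) (E v) (X w)\<close>, as \<open>Riem (E e) (E v) (X w)\<close> stays in the
  span of \<open>X\<close> and does not contribute to the trace.\<close>

lemma laplace_trace:
  assumes p: "p \<in> ball 0 r"
  shows "FD (\<lambda>q. FD (\<lambda>q'. \<Sum>e\<in>Basis. A q' e \<bullet> e) q (w, 0)) p (v, 0) = 0"
proof -
  define q where "q = \<kappa> p"
  have q: "q \<in> V" "\<phi> q = p" and qU: "q \<in> U" using D(7,8)[OF p] VU by (auto simp: q_def)
  define R where "R u = Riem q u (E q v) (X q w)" for u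
  have linR: "linear R" unfolding R_def[abs_def] by (rule Riem_lin[OF qU])
  note lin\<phi> = smooth_linear_FD[OF D(3) q(1)] and lin\<kappa> = smooth_linear_FD[OF D(4) p]
  have push: "FD \<phi> q (R (X q u)) = (- FD (\<lambda>p. Cc A p w v) p (u, 0), 0)" for u
    by (simp add: R_def Riem_XEX[OF q(1)] linear_neg[OF lin\<phi>] push_X[OF q(1)] q(2))
  have snd0: "snd (FD \<phi> q (R u)) = 0" for u
    using Riem_plus[OF q(1), of u v w] ker_y[OF q(1)] FD_y[OF q(1)] unfolding R_def by metis
  have "0 = ricci N (\<lambda>_. E q v) (\<lambda>_. X q w) q" by (rule flat[OF smooth_on_const[OF oU] smooth_on_const[OF oU] qU, symmetric])
  also have "\<dots> = (\<Sum>b\<in>Basis. R b \<bullet> b)"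
    unfolding ricci_def R_def by (simp add: curvature_eq[OF smooth_on_const[OF oU] smooth_on_const[OF oU] smooth_on_const[OF oU] qU])
  \<comment> \<open>Conjugation by \<open>FD \<phi> q\<close> moves the trace to the chart, whose
    basis splits into the vectors \<open>(e, 0)\<close> and \<open>(0, e)\<close>.\<close>
  also have "\<dots> = (\<Sum>b\<in>Basis. R (FD \<kappa> p (FD \<phi> q b)) \<bullet> b)" using D_inv(1)[OF q(1)] q(2) by simp
  also have "\<dots> = (\<Sum>b\<in>Basis. FD \<phi> q (R (FD \<kappa> p b)) \<bullet> b)"
    by (rule trace_commute[of "\<lambda>u. R (FD \<kappa> p u)", OF linear_compose[OF lin\<kappa> linR, unfolded o_def] lin\<phi>])
  also have "\<dots> = (\<Sum>e\<in>Basis. FD \<phi> q (R (FD \<kappa> p (e, 0))) \<bullet> (e, 0)) + (\<Sum>e\<in>Basis. FD \<phi> q (R (FD \<kappa> p (0, e))) \<bullet> (0, e))"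
    by (rule sum_Basis_prod)
  also have "(\<Sum>e\<in>Basis. FD \<phi> q (R (FD \<kappa> p (0, e))) \<bullet> (0, e)) = 0" by (simp add: inner_prod_def snd0)
  also have "(\<Sum>e\<in>Basis. FD \<phi> q (R (FD \<kappa> p (e, 0))) \<bullet> (e, 0)) = (\<Sum>e\<in>Basis. - FD (\<lambda>p. Cc A p w v) p (e, 0) \<bullet> e)"
    using push by (simp add: X_def q(2) inner_prod_def)
  finally have "(\<Sum>e\<in>Basis. FD (\<lambda>p. Cc A p w v) p (e, 0) \<bullet> e) = 0" by (simp add: sum_negf)
  then show ?thesis using lax.T_trace[OF lax p, of w v] by (simp add: lax.T_def[OF lax])
qed

end

section \<open>Unimodular coordinates\<close>

lemma FD_fst0: "FD (\<lambda>p. fst p) p d = fst d"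
  by (simp add: FD_eqI[OF has_derivative_fst[OF has_derivative_ident]])

lemma FD_snd0: "FD (\<lambda>p. snd p) p d = snd d"
  by (simp add: FD_eqI[OF has_derivative_snd[OF has_derivative_ident]])

lemma zero_pair_in_ball: "(x, y) \<in> ball 0 r \<Longrightarrow> s \<in> {0..1} \<Longrightarrow> (s *\<^sub>R x, y) \<in> ball (0 :: 'a::euclidean_space \<times> 'b::euclidean_space) r"
  using projection.stab[OF projection_fst, of "(x, y)" r s] by (simp add: scaleR_diff_left)

lemma constant_along_fst:
  fixes f :: "'a::euclidean_space \<times> 'b::euclidean_space \<Rightarrow> 'c::euclidean_space"
  assumes f: "smooth_on (ball 0 r) f" and 0: "\<And>p v. p \<in> ball 0 r \<Longrightarrow> FD f p (v, 0) = 0" and p: "(x, y) \<in> ball 0 r"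
  shows "f (x, y) = f (0, y)"
proof -
  have "((\<lambda>s. f (s *\<^sub>R x, y)) has_derivative (\<lambda>h. 0)) (at s within {0..1})" if s: "s \<in> {0..1 :: real}" for s
  proof -
    note q = zero_pair_in_ball[OF p s]
    have "((\<lambda>s. (s *\<^sub>R x, y)) has_derivative (\<lambda>h. (h *\<^sub>R x, 0))) (at s)"
      by (auto intro!: derivative_eq_intros)
    from has_derivative_compose[OF this smooth_has_derivative[OF f q]]
    have "((\<lambda>s. f (s *\<^sub>R x, y)) has_derivative (\<lambda>h. 0)) (at s)" by (simp add: 0[OF q])
    then show ?thesis by (rule has_derivative_at_withinI)
  qed
  from has_derivative_zero_unique[OF _ this, of 1 0] show ?thesis by simp
qed

context lax begin

definition "trA p = (\<Sum>e\<in>Basis. A p e \<bullet> e)"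

lemma smooth_trA: "smooth_on W trA"
  unfolding trA_def by (intro smooth_intros oW sm)

lemma FD_trA: "p \<in> W \<Longrightarrow> FD trA p (w, 0) = (\<Sum>e\<in>Basis. Cc A p w e \<bullet> e)"
proof -
  assume p: "p \<in> W"
  have "FD trA p (w, 0) = (\<Sum>e\<in>Basis. FD (\<lambda>q. A q e \<bullet> e) p (w, 0))"
    unfolding trA_def by (rule FD_sum[OF _ p]) (intro smooth_intros oW sm)
  then show ?thesis by (simp add: FD_inner_left[OF sm p] Cc_def)
qed

text \<open>Trace of \<open>F2_derivative\<close>: the quadratic terms are symmetric because \<open>trace (S T) = trace (T S)\<close>.\<close>

lemma trace_closed:
  assumes flat: "\<And>p v w. p \<in> W \<Longrightarrow> FD (\<lambda>q. FD trA q (w, 0)) p (v, 0) = 0" and p: "p \<in> W"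
  shows "FD (\<lambda>q. FD trA q (w, 0)) p (0, v) = FD (\<lambda>q. FD trA q (v, 0)) p (0, w)"
proof -
  define X1 where "X1 w v = (\<Sum>e\<in>Basis. FD (\<lambda>q. Cc A q w v) p (A p e, e) \<bullet> e)" for w v
  define X2 where "X2 w v = (\<Sum>e\<in>Basis. Cc A p v (Cc A p w e) \<bullet> e)" for w v
  define X4 where "X4 w v = (\<Sum>e\<in>Basis. Cc A p (Cc A p w v) e \<bullet> e)" for w v
  have *: "FD (\<lambda>q. FD trA q (w, 0)) p (0, v) = X1 w v + X2 w v - X4 w v" for w v
  proof -
    have lF: "linear (FD (\<lambda>q. FD trA q (w, 0)) p)" by (rule smooth_linear_FD[OF smooth_on_FD[OF smooth_trA] p])
    have "X1 w v + X2 w v = (\<Sum>e\<in>Basis. (FD (\<lambda>q. Cc A q w v) p (A p e, e) + Cc A p (Cc A p w e) v) \<bullet> e)"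
      by (simp add: X1_def X2_def inner_add_left sum.distrib C_sym[OF p, of v])
    also have "\<dots> = (\<Sum>e\<in>Basis. (FD (\<lambda>q. Cc A q w e) p (A p v, v) + Cc A p (Cc A p w v) e) \<bullet> e)"
      by (simp only: F2_derivative[OF p, of w v])
    also have "\<dots> = (\<Sum>e\<in>Basis. FD (\<lambda>q. Cc A q w e) p (A p v, v) \<bullet> e) + X4 w v"
      by (simp add: X4_def inner_add_left sum.distrib)
    also have "(\<Sum>e\<in>Basis. FD (\<lambda>q. Cc A q w e) p (A p v, v) \<bullet> e) = FD (\<lambda>q. \<Sum>e\<in>Basis. Cc A q w e \<bullet> e) p (A p v, v)"
      by (subst FD_sum[OF _ p]) (auto intro!: smooth_intros oW C_smooth sum.cong simp: FD_inner_left[OF C_smooth p])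
    also have "\<dots> = FD (\<lambda>q. FD trA q (w, 0)) p (A p v, v)"
      by (rule FD_cong2[OF oW p]) (simp add: FD_trA)
    also have "\<dots> = FD (\<lambda>q. FD trA q (w, 0)) p (A p v, 0) + FD (\<lambda>q. FD trA q (w, 0)) p (0, v)"
      using linear_add[OF lF, of "(A p v, 0)" "(0, v)"] by simp
    finally show ?thesis by (simp add: flat[OF p])
  qed
  have "X1 w v = X1 v w"
  proof -
    have "FD (\<lambda>q. Cc A q w v) p d = FD (\<lambda>q. Cc A q v w) p d" for d by (rule FD_cong2[OF oW p C_sym])
    then show ?thesis by (simp add: X1_def)
  qed
  moreover have "X2 w v = X2 v w" unfolding X2_def by (rule trace_commute[OF C_lin2[OF p] C_lin2[OF p]])
  moreover have "X4 w v = X4 v w" by (simp add: X4_def C_sym[OF p, of w v])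
  ultimately show ?thesis by (simp add: *)
qed

end

text \<open>The map \<open>y \<mapsto> y + \<mu> y e\<close> has Jacobian determinant \<open>exp (- u)\<close>; the lift \<open>T\<close> below changes the trace of
  \<open>A\<close> by \<open>exp u * \<beta> e\<close>, which is affine in \<open>x\<close> and can be made to cancel \<open>trA\<close>.\<close>

locale shear =
  fixes r :: real and \<mu> g u :: "'a::euclidean_space \<Rightarrow> real" and e :: 'a
  assumes sm\<mu>: "smooth_on (ball 0 r) \<mu>" and smg: "smooth_on (ball 0 r) g" and smu: "smooth_on (ball 0 r) u"
    and \<mu>e: "y \<in> ball 0 r \<Longrightarrow> FD \<mu> y e = exp (- u y) - 1" and \<mu>0: "\<mu> 0 = 0" and g0: "g 0 = 0"
begin

abbreviation "B \<equiv> ball (0 :: 'a \<times> 'a) r"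

text \<open>Both components are transformed by the same Jacobian \<open>Dh\<close>, which preserves
  the normal form of the structure; \<open>g\<close> adds a translation in \<open>x\<close>
  depending on \<open>y\<close>.\<close>

definition "T p = (fst p + (FD \<mu> (snd p) (fst p) + g (snd p)) *\<^sub>R e, snd p + \<mu> (snd p) *\<^sub>R e)"

definition "Dh y w = w + FD \<mu> y w *\<^sub>R e"
text \<open>The inverse of a rank-one perturbation of the identity, where
  \<open>1 + FD \<mu> y e = exp (- u y)\<close>.\<close>

definition "Hi y w = w - (exp (u y) * FD \<mu> y w) *\<^sub>R e"
definition "\<beta> p w = FD (\<lambda>y. FD \<mu> y (fst p)) (snd p) w + FD g (snd p) w"

lemma snd_B: "p \<in> B \<Longrightarrow> snd p \<in> ball 0 r"
  using norm_snd_le[of "snd p" "fst p"] by simp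

lemma lin\<mu>: "y \<in> ball 0 r \<Longrightarrow> linear (FD \<mu> y)" by (rule smooth_linear_FD[OF sm\<mu>])

lemma Dh_Hi: assumes "y \<in> ball 0 r" shows "Dh y (Hi y w) = w" "Hi y (Dh y w) = w"
proof -
  have "exp (u y) * exp (- u y) = 1" by (simp add: exp_minus)
  then have 1: "exp (u y) * (FD \<mu> y w * (exp (- u y) - 1)) = FD \<mu> y w - exp (u y) * FD \<mu> y w" for w
    by (simp add: algebra_simps)
  show "Dh y (Hi y w) = w"
    by (simp add: Dh_def Hi_def linear_diff[OF lin\<mu>[OF assms]] linear_scale[OF lin\<mu>[OF assms]] \<mu>e[OF assms] mult.assoc 1
        scaleR_diff_left)
  show "Hi y (Dh y w) = w"
    by (simp add: Dh_def Hi_def linear_add[OF lin\<mu>[OF assms]] linear_scale[OF lin\<mu>[OF assms]] \<mu>e[OF assms] distrib_left 1)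
qed

lemma lin_Dh: "y \<in> ball 0 r \<Longrightarrow> linear (Dh y)"
  using linear_add[OF lin\<mu>] linear_scale[OF lin\<mu>]
  by (intro linearI) (simp_all add: Dh_def scaleR_add_left scaleR_add_right)

lemma lin_Hi: "y \<in> ball 0 r \<Longrightarrow> linear (Hi y)"
  using linear_of_inverse[OF lin_Dh] Dh_Hi by blast

lemma smooth_T: "smooth_on B T"
  unfolding T_def
  by (intro smooth_intros open_ball smooth_on_FD_compose[OF sm\<mu>] smooth_on_compose[OF smg] smooth_on_compose[OF sm\<mu>] snd_B)
  
lemma lin_\<beta>: "p \<in> B \<Longrightarrow> linear (\<beta> p)"
  unfolding \<beta>_def[abs_def]
  by (intro linear_compose_add smooth_linear_FD[OF smg snd_B] smooth_linear_FD[OF smooth_on_FD[OF sm\<mu>] snd_B])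

lemma FD_T: assumes p: "p \<in> B" shows "FD T p d = (Dh (snd p) (fst d) + \<beta> p (snd d) *\<^sub>R e, Dh (snd p) (snd d))"
proof -
  note y = snd_B[OF p] and sb = snd_B
  have s1: "smooth_on B (\<lambda>p. FD \<mu> (snd p) x)" for x by (intro smooth_on_FD_compose[OF sm\<mu>] smooth_intros open_ball snd_B)
  have sfst: "smooth_on B (\<lambda>p. fst p)" and ssnd: "smooth_on B (\<lambda>p. snd p)" by (intro smooth_intros open_ball)+
  have sg: "smooth_on B (\<lambda>p. g (snd p))" and s\<mu>: "smooth_on B (\<lambda>p. \<mu> (snd p))"
    by (rule smooth_on_compose[OF smg ssnd open_ball open_ball snd_B] smooth_on_compose[OF sm\<mu> ssnd open_ball open_ball snd_B]; assumption)+
  have s2: "smooth_on B (\<lambda>p. FD \<mu> (snd p) (fst p))"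
    by (intro smooth_on_FD_compose[OF sm\<mu>] smooth_intros open_ball snd_B)
  have "FD (\<lambda>p. FD \<mu> (snd p) (fst p)) p d = FD (\<lambda>q. FD \<mu> (snd q) (fst p)) p d + FD \<mu> (snd p) (fst d)"
    using FD_linear_family[where L="\<lambda>p. FD \<mu> (snd p)", OF open_ball lin\<mu>[OF snd_B] s1 sfst p] by (simp add: FD_fst0)
  also have "FD (\<lambda>q. FD \<mu> (snd q) (fst p)) p d = FD (\<lambda>y. FD \<mu> y (fst p)) (snd p) (snd d)"
    using FD_compose[OF smooth_on_FD[OF sm\<mu>] y ssnd p, of "fst p" d] by (simp add: FD_snd0)
  finally have 1: "FD (\<lambda>p. FD \<mu> (snd p) (fst p)) p d = FD (\<lambda>y. FD \<mu> y (fst p)) (snd p) (snd d) + FD \<mu> (snd p) (fst d)" .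
  have 2: "FD (\<lambda>p. g (snd p)) p d = FD g (snd p) (snd d)" "FD (\<lambda>p. \<mu> (snd p)) p d = FD \<mu> (snd p) (snd d)"
    using FD_compose[OF smg y ssnd p, of d] FD_compose[OF sm\<mu> y ssnd p, of d] by (simp_all add: FD_snd0)
  have t1: "smooth_on B (\<lambda>p. fst p + (FD \<mu> (snd p) (fst p) + g (snd p)) *\<^sub>R e)"
    and t2: "smooth_on B (\<lambda>p. snd p + \<mu> (snd p) *\<^sub>R e)"
    by (intro smooth_intros open_ball s2 sg s\<mu>)+
  have "FD T p d = (FD (\<lambda>p. fst p + (FD \<mu> (snd p) (fst p) + g (snd p)) *\<^sub>R e) p d, FD (\<lambda>p. snd p + \<mu> (snd p) *\<^sub>R e) p d)"
    unfolding T_def[abs_def]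
    by (subst FD_eqI[OF has_derivative_Pair[OF smooth_has_derivative[OF t1 p] smooth_has_derivative[OF t2 p]]]) (rule refl)
  also have "FD (\<lambda>p. fst p + (FD \<mu> (snd p) (fst p) + g (snd p)) *\<^sub>R e) p d = fst d + (FD (\<lambda>y. FD \<mu> y (fst p)) (snd p) (snd d) + FD \<mu> (snd p) (fst d) + FD g (snd p) (snd d)) *\<^sub>R e"
    by (simp add: FD_add[OF sfst smooth_on_scaleR[OF open_ball smooth_on_add[OF open_ball s2 sg] smooth_on_const[OF open_ball]] p]
       FD_scaleR[OF smooth_on_add[OF open_ball s2 sg] smooth_on_const[OF open_ball] p] FD_add[OF s2 sg p] FD_fst0 1 2)
  also have "FD (\<lambda>p. snd p + \<mu> (snd p) *\<^sub>R e) p d = snd d + FD \<mu> (snd p) (snd d) *\<^sub>R e"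
    by (simp add: FD_add[OF ssnd smooth_on_scaleR[OF open_ball s\<mu> smooth_on_const[OF open_ball]] p]
       FD_scaleR[OF s\<mu> smooth_on_const[OF open_ball] p] FD_snd0 2)
  finally show ?thesis by (simp add: Dh_def \<beta>_def algebra_simps)
qed

lemma T_0: "r > 0 \<Longrightarrow> T 0 = 0"
  by (simp add: T_def \<mu>0 g0 linear_0[OF lin\<mu>] zero_prod_def)

lemma FD_T_inj: "p \<in> B \<Longrightarrow> FD T p d = 0 \<Longrightarrow> d = 0"
proof -
  assume p: "p \<in> B" and d: "FD T p d = 0"
  note y = snd_B[OF p]
  have z: "w = 0" if "Dh (snd p) w = 0" for w using that Dh_Hi(2)[OF y, of w] linear_0[OF lin_Hi[OF y]] by simp
  have "Dh (snd p) (snd d) = 0" using d by (simp add: FD_T[OF p] zero_prod_def)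
  then have sd: "snd d = 0" by (rule z)
  then have "Dh (snd p) (fst d) = 0" using d by (simp add: FD_T[OF p] zero_prod_def linear_0[OF lin_\<beta>[OF p]])
  then have "fst d = 0" by (rule z)
  then show "d = 0" using sd by (simp add: prod_eq_iff)
qed

text \<open>The operator \<open>A\<close> in the new coordinates, indexed by the old point.\<close>

definition "push A p w = Dh (snd p) (A p (Hi (snd p) w)) + \<beta> p (Hi (snd p) w) *\<^sub>R e"

lemma push_Dh: "p \<in> B \<Longrightarrow> push A p (Dh (snd p) w) = Dh (snd p) (A p w) + \<beta> p w *\<^sub>R e"
  by (simp only: push_def Dh_Hi(2)[OF snd_B])

lemma FD_T_lax:
  assumes p: "p \<in> B" and A: "linear (A p)" and A': "A' (T p) = push A p"
  shows "FD T p (lax_I A p v) = lax_I A' (T p) (FD T p v)" "FD T p (lax_K A p v) = lax_K A' (T p) (FD T p v)"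
proof -
  note y = snd_B[OF p]
  note l = linear_add[OF lin_Dh[OF y]] linear_diff[OF lin_Dh[OF y]] linear_neg[OF lin_Dh[OF y]] linear_scale[OF lin_Dh[OF y]]
    linear_diff[OF lin_\<beta>[OF p]] linear_neg[OF lin_\<beta>[OF p]] linear_diff[OF A]
  have key: "x - 2 *\<^sub>R z + (- b) *\<^sub>R e = x + b *\<^sub>R e - 2 *\<^sub>R (z + b *\<^sub>R e)" for x z b
    by (simp add: scaleR_2)
  show "FD T p (lax_I A p v) = lax_I A' (T p) (FD T p v)"
    by (simp only: lax_I_def FD_T[OF p] fst_conv snd_conv A' push_Dh[OF p] l key)
  define a where "a = fst v - A p (snd v)"
  have 1: "Dh (snd p) (fst v) + \<beta> p (snd v) *\<^sub>R e - push A p (Dh (snd p) (snd v)) = Dh (snd p) a"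
    by (simp only: push_Dh[OF p] a_def l) simp
  have "lax_K A' (T p) (FD T p v) = (push A p (Dh (snd p) a) + Dh (snd p) (snd v), Dh (snd p) a)"
    by (simp only: lax_K_def FD_T[OF p] fst_conv snd_conv A' 1)
  moreover have "FD T p (lax_K A p v) = (Dh (snd p) (A p a) + Dh (snd p) (snd v) + \<beta> p a *\<^sub>R e, Dh (snd p) a)"
    by (simp only: lax_K_def FD_T[OF p] fst_conv snd_conv a_def[symmetric] l(1))
  ultimately show "FD T p (lax_K A p v) = lax_K A' (T p) (FD T p v)"
    by (simp add: push_Dh[OF p] add.commute add.left_commute)
qed

lemma smooth_on_push:
  assumes lin: "\<And>p. p \<in> B \<Longrightarrow> linear (A p)" and sm: "\<And>w. smooth_on B (\<lambda>p. A p w)"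
  shows "smooth_on B (\<lambda>p. push A p w)"
proof -
  have \<beta>: "smooth_on B (\<lambda>p. \<beta> p w)" for w
    unfolding \<beta>_def
  proof (intro smooth_on_add open_ball smooth_on_FD_compose[OF smg] smooth_intros snd_B)
    \<comment> \<open>Exchanging the derivatives takes the varying vector \<open>fst p\<close> out
      of the inner derivative.\<close>
    show "smooth_on B (\<lambda>p. FD (\<lambda>y. FD \<mu> y (fst p)) (snd p) w)"
    proof (rule smooth_on_cong[OF open_ball])
      show "smooth_on B (\<lambda>p. FD (\<lambda>y. FD \<mu> y w) (snd p) (fst p))"
        by (intro smooth_on_FD_compose[OF smooth_on_FD[OF sm\<mu>]] smooth_intros open_ball snd_B)
      show "FD (\<lambda>y. FD \<mu> y w) (snd p) (fst p) = FD (\<lambda>y. FD \<mu> y (fst p)) (snd p) w" if "p \<in> B" for p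
        by (rule smooth_FD_commute[OF open_ball sm\<mu> snd_B[OF that]])
    qed
  qed
  have "smooth_on B (\<lambda>p. u (snd p))" by (rule smooth_on_compose[OF smu _ open_ball open_ball snd_B]) (intro smooth_intros open_ball)
  then have eu: "smooth_on B (\<lambda>p. exp (u (snd p)))" by (rule smooth_on_compose[OF smooth_on_exp _ open_ball open_UNIV UNIV_I])
  have Hi: "smooth_on B (\<lambda>p. Hi (snd p) w)"
    unfolding Hi_def by (intro smooth_intros eu open_ball smooth_on_FD_compose[OF sm\<mu>] snd_B)
  have \<beta>H: "smooth_on B (\<lambda>p. \<beta> p (Hi (snd p) w))" by (rule smooth_on_linear_family[OF open_ball lin_\<beta> \<beta> Hi])
  have AH: "smooth_on B (\<lambda>p. A p (Hi (snd p) w))" by (rule smooth_on_linear_family[OF open_ball lin sm Hi])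
  show ?thesis
    unfolding push_def Dh_def
    by (intro smooth_intros open_ball \<beta>H AH smooth_on_FD_compose[OF sm\<mu>] snd_B)
qed

lemma lin_push:
  assumes p: "p \<in> B" and A: "linear (A p)"
  shows "linear (push A p)"
proof -
  note y = snd_B[OF p]
  note l = linear_add[OF lin_Dh[OF y]] linear_add[OF lin_Hi[OF y]] linear_add[OF lin_\<beta>[OF p]] linear_add[OF A]
    linear_scale[OF lin_Dh[OF y]] linear_scale[OF lin_Hi[OF y]] linear_scale[OF lin_\<beta>[OF p]] linear_scale[OF A]
  show ?thesis by (rule linearI) (simp_all add: push_def l algebra_simps)
qed

text \<open>Conjugation by \<open>Dh\<close> preserves the trace; the rank-one term contributes
  \<open>\<beta> p (Hi e)\<close>, and \<open>e\<close> is an eigenvector of \<open>Hi\<close> with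
  eigenvalue \<open>exp u\<close>.\<close>

lemma trace_push:
  assumes p: "p \<in> B" and A: "linear (A p)"
  shows "(\<Sum>b\<in>Basis. push A p b \<bullet> b) = (\<Sum>b\<in>Basis. A p b \<bullet> b) + exp (u (snd p)) * \<beta> p e"
proof -
  note y = snd_B[OF p]
  have "(\<Sum>b\<in>Basis. Dh (snd p) (A p (Hi (snd p) b)) \<bullet> b) = (\<Sum>b\<in>Basis. A p (Hi (snd p) (Dh (snd p) b)) \<bullet> b)"
    using trace_commute[OF lin_Dh[OF y] linear_compose[OF lin_Hi[OF y] A]] by simp
  moreover have "(\<Sum>b\<in>Basis. \<beta> p (Hi (snd p) b) * (e \<bullet> b)) = \<beta> p (Hi (snd p) e)"
    using linear_expand[OF linear_compose[OF lin_Hi[OF y] lin_\<beta>[OF p]], of e] by (simp add: mult.commute)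
  moreover have "Hi (snd p) e = exp (u (snd p)) *\<^sub>R e"
    by (simp add: Hi_def \<mu>e[OF y] right_diff_distrib exp_minus scaleR_diff_left)
  ultimately show ?thesis
    by (simp add: push_def inner_add_left sum.distrib Dh_Hi(2)[OF y] linear_scale[OF lin_\<beta>[OF p]])
qed

end

text \<open>Here \<open>trA\<close> is \<open>c0 y + c y x\<close> with \<open>c = du\<close>. The
  choices \<open>exp (- u) - 1\<close> and \<open>- exp (- u) * c0\<close> for the derivatives of
  \<mu> and \<open>g\<close> along \<open>e\<close> give
  \<open>\<beta> p e = - exp (- u) * trA p\<close>, which by \<open>trace_push\<close> cancels the
  trace.\<close>

lemma (in ricci_flat_chart) trace_free_chart:
  assumes p0: "p0 \<in> V" and \<phi>0: "\<phi> p0 = 0"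
  obtains V' \<phi>' r' \<kappa>' A' where "adapted U I K J V' \<phi>' r' \<kappa>' A'" "p0 \<in> V'" "\<phi>' p0 = 0"
    "\<And>p. p \<in> ball 0 r' \<Longrightarrow> (\<Sum>e\<in>Basis. A' p e \<bullet> e) = 0"
proof -
  interpret lx: lax "ball 0 r" A by (rule lax)
  have tr: "lx.trA = (\<lambda>q. \<Sum>e\<in>Basis. A q e \<bullet> e)" by (simp add: lx.trA_def[abs_def])
  have F3: "FD (\<lambda>q. FD lx.trA q (w, 0)) p (v, 0) = 0" if "p \<in> ball 0 r" for p v w
    unfolding tr by (rule laplace_trace[OF that])
  have F4: "FD (\<lambda>q. FD lx.trA q (w, 0)) p (0, v) = FD (\<lambda>q. FD lx.trA q (v, 0)) p (0, w)" if "p \<in> ball 0 r" for p v w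
    by (rule lx.trace_closed[OF F3 that])
  have emb: "(0 :: 'a, y) \<in> ball 0 r" if "y \<in> ball 0 r" for y :: 'a using that by (simp add: norm_Pair)
  have sb: "snd p \<in> ball 0 r" if "p \<in> ball 0 r" for p :: "'a \<times> 'a" using norm_snd_le[of "snd p" "fst p"] that by simp
  have semb: "smooth_on (ball 0 r) (\<lambda>y :: 'a. (0 :: 'a, y))" by (intro smooth_intros open_ball)
  have FDemb: "FD (\<lambda>y :: 'a. (0 :: 'a, y)) y v = (0, v)" for y v
    by (subst FD_eqI[OF has_derivative_Pair[OF has_derivative_const has_derivative_ident]]) (rule refl)
  define c where "c y w = FD lx.trA (0, y) (w, 0)" for y w :: 'a
  define c0 where "c0 y = lx.trA (0, y)" for y :: 'a
  have cx: "FD lx.trA p (w, 0) = c (snd p) w" if "p \<in> ball 0 r" for p w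
    using constant_along_fst[OF smooth_on_FD[OF lx.smooth_trA] F3, of "fst p" "snd p"] that by (simp add: c_def)
  have smc: "smooth_on (ball 0 r) (\<lambda>y. c y w)" for w
    unfolding c_def by (rule smooth_on_compose[OF smooth_on_FD[OF lx.smooth_trA] semb open_ball open_ball emb])
  have smc0: "smooth_on (ball 0 r) c0"
    unfolding c0_def[abs_def] by (rule smooth_on_compose[OF lx.smooth_trA semb open_ball open_ball emb])
  have linc: "linear (c y)" if "y \<in> ball 0 r" for y
    unfolding c_def[abs_def] by (rule linear_pair0[OF smooth_linear_FD[OF lx.smooth_trA emb[OF that]]])
  have closed: "FD (\<lambda>y. c y w) y v = FD (\<lambda>y. c y v) y w" if y: "y \<in> ball 0 r" for y v w
    unfolding c_def FD_compose[OF smooth_on_FD[OF lx.smooth_trA] emb[OF y] semb y] FDemb by (rule F4[OF emb[OF y]])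
  have trA: "lx.trA p = c0 (snd p) + c (snd p) (fst p)" if p: "p \<in> ball 0 r" for p
  proof -
    have s1: "smooth_on (ball 0 r) (\<lambda>q :: 'a \<times> 'a. c (snd q) x)" for x
      by (rule smooth_on_compose[OF smc _ open_ball open_ball sb]) (intro smooth_intros open_ball)
    have sf: "smooth_on (ball 0 r) (\<lambda>q :: 'a \<times> 'a. fst q)" "smooth_on (ball 0 r) (\<lambda>q :: 'a \<times> 'a. snd q)"
      by (intro smooth_intros open_ball)+
    have s2: "smooth_on (ball 0 r) (\<lambda>q :: 'a \<times> 'a. c (snd q) (fst q))"
      by (rule smooth_on_linear_family[where L="\<lambda>q. c (snd q)", OF open_ball linc[OF sb] s1 sf(1)])
    have "FD (\<lambda>q. lx.trA q - c (snd q) (fst q)) p (v, 0) = 0" if p: "p \<in> ball 0 r" for p v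
    proof -
      have "FD (\<lambda>q. c (snd q) (fst p)) p (v, 0) = 0"
        using FD_compose[OF smc sb[OF p] sf(2) p] by (simp add: FD_snd0 linear_0[OF smooth_linear_FD[OF smc sb[OF p]]])
      then have "FD (\<lambda>q. c (snd q) (fst q)) p (v, 0) = c (snd p) v"
        using FD_linear_family[where L="\<lambda>q. c (snd q)", OF open_ball linc[OF sb] s1 sf(1) p] by (simp add: FD_fst0)
      then show ?thesis using FD_diff[OF lx.smooth_trA s2 p] cx[OF p] by simp
    qed
    from constant_along_fst[OF smooth_on_diff[OF open_ball lx.smooth_trA s2] this, of "fst p" "snd p"] p
    show ?thesis by (simp add: c0_def linear_0[OF linc[OF sb[OF p]]])
  qed
  interpret pr: projection "\<lambda>v :: 'a. v" "ball 0 r" by (rule projection_id)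
  define u where "u y = integral {0..1} (\<lambda>s. c (pr.\<sigma> s y) y)" for y
  have smu: "smooth_on (ball 0 r) u"
    unfolding u_def[abs_def] by (rule pr.potential(1)[OF linc smc]) (assumption | rule closed)+
  have FDu: "FD u y w = c y w" if "y \<in> ball 0 r" for y w
    unfolding u_def[abs_def] by (rule pr.potential(2)[OF linc smc _ that]) (assumption | rule closed)+
  \<comment> \<open>Only the Jacobian determinant matters, so a shear along one fixed direction is
    enough.\<close>
  obtain e :: 'a where e: "e \<in> Basis" using nonempty_Basis by blast
  then have ne: "norm e = 1" by simp
  have "smooth_on (ball 0 r) (\<lambda>y. - u y)" by (intro smooth_intros open_ball smu)
  then have smexp: "smooth_on (ball 0 r) (\<lambda>y. exp (- u y))" by (rule smooth_on_compose[OF smooth_on_exp _ open_ball open_UNIV UNIV_I])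
  have FDexp: "FD (\<lambda>y. exp (- u y) - 1) y w = - (exp (- u y) * c y w)" if y: "y \<in> ball 0 r" for y w
  proof -
    have "((\<lambda>y. exp (- u y) - 1) has_derivative (\<lambda>w. exp (- u y) * (- FD u y w))) (at y)"
      using smooth_has_derivative[OF smu y] by (auto intro!: derivative_eq_intros)
    from FD_eqI[OF this] show ?thesis by (simp add: FDu[OF y])
  qed
  have sm1: "smooth_on (ball 0 r) (\<lambda>y. exp (- u y) - 1)" and sm2: "smooth_on (ball 0 r) (\<lambda>y. - (exp (- u y) * c0 y))"
    by (intro smooth_intros open_ball smexp smc0)+
  obtain \<mu>' where \<mu>': "smooth_on (ball 0 r) \<mu>'" "\<And>y. y \<in> ball 0 r \<Longrightarrow> FD \<mu>' y e = exp (- u y) - 1"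
    by (rule directional_antiderivative[OF ne sm1]) (assumption | rule that)+
  obtain g' where g': "smooth_on (ball 0 r) g'" "\<And>y. y \<in> ball 0 r \<Longrightarrow> FD g' y e = - (exp (- u y) * c0 y)"
    by (rule directional_antiderivative[OF ne sm2]) (assumption | rule that)+
  \<comment> \<open>Normalised at 0, like \<open>g\<close>, so that the new chart still sends
    \<open>p0\<close> to 0.\<close>
  define \<mu> where "\<mu> y = \<mu>' y - \<mu>' 0" for y
  define g where "g y = g' y - g' 0" for y
  have FD\<mu>: "FD \<mu> y v = FD \<mu>' y v" and FDg: "FD g y v = FD g' y v" if "y \<in> ball 0 r" for y v
    using FD_diff[OF \<mu>'(1) smooth_on_const[OF open_ball] that] FD_diff[OF g'(1) smooth_on_const[OF open_ball] that]
    by (simp_all add: \<mu>_def[abs_def] g_def[abs_def])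
  have sm\<mu>: "smooth_on (ball 0 r) \<mu>" and smg: "smooth_on (ball 0 r) g"
    unfolding \<mu>_def[abs_def] g_def[abs_def] by (intro smooth_intros open_ball \<mu>' g')+
  interpret sh: shear r \<mu> g u e
    by (rule shear.intro[OF sm\<mu> smg smu]) (simp_all add: FD\<mu> \<mu>' \<mu>_def g_def)
  have T0: "sh.T 0 = 0" by (rule sh.T_0[OF r])
  have 0: "(0 :: 'a \<times> 'a) \<in> ball 0 r" using r by simp
  obtain V1 W1 S where d1: "diffeo_between V1 sh.T W1 S" "0 \<in> V1" "V1 \<subseteq> ball 0 r"
    by (rule local_diffeo[OF open_ball sh.smooth_T 0 sh.FD_T_inj[OF 0]]) (assumption | rule that)+
  obtain r' where r': "r' > 0" "diffeo_between (S ` ball (sh.T 0) r') sh.T (ball (sh.T 0) r') S"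
    "0 \<in> S ` ball (sh.T 0) r'" "S ` ball (sh.T 0) r' \<subseteq> V1 \<inter> V1"
    by (rule diffeo_between_restrict_ball[OF d1(1,2) diffeo_betweenD(1)[OF d1(1)] d1(2)]) (assumption | rule that)+
  define Q where "Q = S ` ball 0 r'"
  have dT: "diffeo_between Q sh.T (ball 0 r') S" and Q: "0 \<in> Q" "Q \<subseteq> ball 0 r" using r'(2-) d1(3) by (auto simp: T0 Q_def)
  note DT = diffeo_betweenD[OF dT]
  define V' where "V' = \<kappa> ` Q"
  have dV: "diffeo_between V' \<phi> Q \<kappa>"
    unfolding V'_def by (rule diffeo_between_sym[OF diffeo_between_restrict[OF diffeo_between_sym[OF d] DT(1) Q(2)]])
  have V'V: "V' \<subseteq> V" using D(7) Q(2) by (auto simp: V'_def)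
  define A' where "A' p = sh.push A (S p)" for p
  have SB: "S p \<in> ball 0 r" if "p \<in> ball 0 r'" for p using DT(7)[OF that] Q(2) by blast
  show ?thesis
  proof (rule that)
    show "adapted U I K J V' (\<lambda>q. sh.T (\<phi> q)) r' (\<lambda>p. \<kappa> (S p)) A'"
    proof (rule adapted.intro[OF hpc _ r'(1) diffeo_between_compose[OF dV dT]])
      show "V' \<subseteq> U" using V'V VU by blast
      show "linear (A' p)" if "p \<in> ball 0 r'" for p
        unfolding A'_def by (rule sh.lin_push[where A=A, OF SB[OF that] linA[OF SB[OF that]]])
      show "smooth_on (ball 0 r') (\<lambda>p. A' p w)" for w
        unfolding A'_def by (rule smooth_on_compose[OF sh.smooth_on_push[where A=A, OF linA smA] DT(4) open_ball open_ball SB])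
      fix q v assume q': "q \<in> V'"
      then have q: "q \<in> V" and Qq: "\<phi> q \<in> Q" using V'V diffeo_betweenD(5)[OF dV] by blast+
      have b: "\<phi> q \<in> ball 0 r" using Qq Q(2) by blast
      have FD: "FD (\<lambda>q. sh.T (\<phi> q)) q v = FD sh.T (\<phi> q) (FD \<phi> q v)" for v
        by (rule FD_compose[OF sh.smooth_T b D(3) q])
      have A': "A' (sh.T (\<phi> q)) = sh.push A (\<phi> q)" by (simp add: A'_def DT(6)[OF Qq])
      show "FD (\<lambda>q. sh.T (\<phi> q)) q (I q v) = lax_I A' (sh.T (\<phi> q)) (FD (\<lambda>q. sh.T (\<phi> q)) q v)"
        unfolding FD push_I[OF q] by (rule sh.FD_T_lax(1)[where A=A and A'=A', OF b linA[OF b] A'])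
      show "FD (\<lambda>q. sh.T (\<phi> q)) q (K q v) = lax_K A' (sh.T (\<phi> q)) (FD (\<lambda>q. sh.T (\<phi> q)) q v)"
        unfolding FD push_K[OF q] by (rule sh.FD_T_lax(2)[where A=A and A'=A', OF b linA[OF b] A'])
    qed
    have "\<kappa> (\<phi> p0) = p0" by (rule D(6)[OF p0])
    then show "p0 \<in> V'" using Q(1) \<phi>0 unfolding V'_def by (metis image_eqI)
    show "sh.T (\<phi> p0) = 0" by (simp add: \<phi>0 T0)
    fix p' :: "'a \<times> 'a" assume "p' \<in> ball 0 r'"
    define p where "p = S p'"
    have p: "p \<in> ball 0 r" using SB \<open>p' \<in> ball 0 r'\<close> by (simp add: p_def)
    note y = sb[OF p]
    have "FD (\<lambda>y. FD \<mu> y (fst p)) (snd p) e = FD (\<lambda>y. FD \<mu> y e) (snd p) (fst p)"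
      by (rule smooth_FD_commute[OF open_ball sm\<mu> y])
    also have "\<dots> = FD (\<lambda>y. exp (- u y) - 1) (snd p) (fst p)"
      by (rule FD_cong2[OF open_ball y]) (simp add: FD\<mu> \<mu>')
    finally have "sh.\<beta> p e = - (exp (- u (snd p)) * lx.trA p)"
      using FDexp[OF y] g'(2)[OF y] by (simp add: sh.\<beta>_def FDg[OF y] trA[OF p] algebra_simps)
    moreover have "exp (u (snd p)) * exp (- u (snd p)) = 1" by (simp add: exp_minus)
    ultimately have "exp (u (snd p)) * sh.\<beta> p e = - lx.trA p" by (metis mult.assoc mult_1 mult_minus_right)
    then show "(\<Sum>e\<in>Basis. A' p' e \<bullet> e) = 0"
      using sh.trace_push[where A=A, OF p linA[OF p]] by (simp add: A'_def p_def[symmetric] tr)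
  qed
qed

section \<open>Homotopy operators in the \<open>x\<close>-directions\<close>

text \<open>The radial homotopy in \<open>x\<close>. The weight depends on the number of indices:
  exponent m - 2 for vector fields, m - 3 for skew arrays with two indices.\<close>

definition hom :: "nat \<Rightarrow> ('m::finite xy \<Rightarrow> real) \<Rightarrow> 'm xy \<Rightarrow> real" where
  "hom n f p = integral {0..1} (\<lambda>s. s ^ n * f (s *\<^sub>R fst p, snd p))"

locale xball =
  fixes r :: real and Q :: "'m::finite xy set"
  defines Q: "Q \<equiv> ball 0 r"
begin

lemma oQ: "open Q" by (simp add: Q)

sublocale pr: projection "\<lambda>v :: 'm xy. (fst v, 0 :: real ^ 'm)" Q
  unfolding Q by (rule projection_fst)

lemma \<sigma>: "pr.\<sigma> s p = (s *\<^sub>R fst p, snd p)"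
  by (simp add: pr.\<sigma>_def prod_eq_iff scaleR_diff_left)

lemma in_Q: "p \<in> Q \<Longrightarrow> s \<in> {0..1} \<Longrightarrow> (s *\<^sub>R fst p, snd p) \<in> Q"
  using pr.\<sigma>_in[of p s] by (simp only: \<sigma>)

lemma smooth_hom_integrand:
  assumes "smooth_on Q f"
  shows "smooth_on pr.sdom (\<lambda>z. fst z ^ n * f (fst z *\<^sub>R fst (snd z), snd (snd z)))"
proof -
  have "smooth_on pr.sdom (\<lambda>z. f (fst z *\<^sub>R fst (snd z), snd (snd z)))"
    using pr.smooth_on_\<sigma>[OF assms] unfolding \<sigma> .
  then show ?thesis
    by (induction n) (auto simp: mult.assoc intro!: smooth_intros pr.open_sdom)
qed

lemma smooth_hom: "smooth_on Q f \<Longrightarrow> smooth_on Q (hom n f)"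
  using smooth_on_integral_param[OF pr.sub_sdom oQ smooth_hom_integrand, of f n] by (simp add: hom_def[abs_def])

lemma hom_integrable:
  assumes f: "smooth_on Q f" and p: "p \<in> Q"
  shows "(\<lambda>s. s ^ n * f (s *\<^sub>R fst p, snd p)) integrable_on {0..1}"
proof (rule integrable_continuous_interval)
  have "continuous_on {0..1} (\<lambda>s. f (s *\<^sub>R fst p, snd p))"
    by (rule continuous_on_compose2[OF smooth_imp_continuous[OF f]]) (use in_Q[OF p] in \<open>auto intro!: continuous_intros\<close>)
  then show "continuous_on {0..1} (\<lambda>s. s ^ n * f (s *\<^sub>R fst p, snd p))" by (intro continuous_intros)
qed

lemma dx_hom:
  assumes f: "smooth_on Q f" and p: "p \<in> Q"
  shows "dx i (hom n f) p = hom (Suc n) (dx i f) p"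
proof -
  define g where "g z = fst z ^ n * f (fst z *\<^sub>R fst (snd z), snd (snd z))" for z :: "real \<times> 'm xy"
  have g: "smooth_on pr.sdom g" unfolding g_def[abs_def] by (rule smooth_hom_integrand[OF f])
  have "dx i (hom n f) p = integral {0..1} (\<lambda>s. FD g (s, p) (0, ex i))"
    using FD_eqI[OF has_derivative_integral_param[OF pr.sub_sdom oQ smooth_on_Ck[OF g] p]]
    by (simp add: dx_def hom_def[abs_def] g_def)
  also have "\<dots> = integral {0..1} (\<lambda>s. s ^ Suc n * dx i f (s *\<^sub>R fst p, snd p))"
  proof (rule integral_cong)
    fix s :: real assume s: "s \<in> {0..1}"
    have z: "(s, p) \<in> pr.sdom" using pr.sub_sdom s p by blast
    have "((\<lambda>h. (s, p + h *\<^sub>R ex i)) has_derivative (\<lambda>h. (0, h *\<^sub>R ex i))) (at 0)"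
      by (auto intro!: derivative_eq_intros)
    moreover have "(g has_derivative FD g (s, p)) (at (s, p + 0 *\<^sub>R ex i))" using smooth_has_derivative[OF g z] by simp
    ultimately have 1: "((\<lambda>h. g (s, p + h *\<^sub>R ex i)) has_derivative (\<lambda>h. FD g (s, p) (0, h *\<^sub>R ex i))) (at 0)"
      by (rule has_derivative_compose)
    have "((\<lambda>h. (s *\<^sub>R fst p, snd p) + (s * h) *\<^sub>R ex i) has_derivative (\<lambda>h. (s * h) *\<^sub>R ex i)) (at 0)"
      by (auto intro!: derivative_eq_intros)
    moreover have "(f has_derivative FD f (s *\<^sub>R fst p, snd p)) (at ((s *\<^sub>R fst p, snd p) + (s * 0) *\<^sub>R ex i))"
      using smooth_has_derivative[OF f in_Q[OF p s]] by simp
    ultimately have "((\<lambda>h. f ((s *\<^sub>R fst p, snd p) + (s * h) *\<^sub>R ex i)) has_derivative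
        (\<lambda>h. FD f (s *\<^sub>R fst p, snd p) ((s * h) *\<^sub>R ex i))) (at 0)"
      by (rule has_derivative_compose)
    then have "((\<lambda>h. s ^ n * f ((s *\<^sub>R fst p, snd p) + (s * h) *\<^sub>R ex i)) has_derivative
        (\<lambda>h. s ^ n * FD f (s *\<^sub>R fst p, snd p) ((s * h) *\<^sub>R ex i))) (at 0)"
      by (rule has_derivative_mult_right)
    moreover have "(\<lambda>h. g (s, p + h *\<^sub>R ex i)) = (\<lambda>h. s ^ n * f ((s *\<^sub>R fst p, snd p) + (s * h) *\<^sub>R ex i))"
      by (simp add: g_def ex_def fun_eq_iff scaleR_add_right)
    ultimately have "(\<lambda>h. FD g (s, p) (0, h *\<^sub>R ex i)) = (\<lambda>h. s ^ n * FD f (s *\<^sub>R fst p, snd p) ((s * h) *\<^sub>R ex i))"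
      using has_derivative_unique[OF 1] by simp
    from fun_cong[OF this, of 1] show "FD g (s, p) (0, ex i) = s ^ Suc n * dx i f (s *\<^sub>R fst p, snd p)"
      by (simp add: dx_def linear_scale[OF smooth_linear_FD[OF f in_Q[OF p s]]])
  qed
  finally show ?thesis by (simp add: hom_def)
qed

lemma hom_sum:
  fixes f :: "'m \<Rightarrow> 'm xy \<Rightarrow> real"
  assumes f: "\<And>j. smooth_on Q (f j)" and p: "p \<in> Q"
  shows "(\<Sum>j\<in>UNIV. hom n (f j) p) = hom n (\<lambda>q. \<Sum>j\<in>UNIV. f j q) p"
  unfolding hom_def sum_distrib_left by (rule integral_sum[symmetric]) (auto intro: hom_integrable f p)

lemma hom_zero:
  assumes "\<And>q. q \<in> Q \<Longrightarrow> f q = 0" "p \<in> Q"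
  shows "hom n f p = 0"
proof -
  have "hom n f p = integral {0..1} (\<lambda>s :: real. 0 :: real)"
    unfolding hom_def by (rule integral_cong) (simp add: assms in_Q)
  then show ?thesis by simp
qed

text \<open>Euler's identity integrated along the ray: \<open>ftc\<close> with the weight
  \<open>s ^ n\<close>.\<close>

lemma hom_homotopy:
  assumes f: "smooth_on Q f" and p: "p \<in> Q" and n: "n \<ge> 1"
  shows "(\<Sum>j\<in>UNIV. fst p $ j * hom n (dx j f) p) + real n * hom (n - 1) f p = f p"
proof -
  have sd: "smooth_on Q (dx j f)" for j by (rule smooth_on_dx[OF f])
  have eq: "s ^ n *\<^sub>R FD f (pr.\<sigma> s p) (fst p, 0) + (real n * s ^ (n - 1)) *\<^sub>R f (pr.\<sigma> s p)
      = (\<Sum>j\<in>UNIV. fst p $ j * (s ^ n * dx j f (s *\<^sub>R fst p, snd p))) + real n * (s ^ (n - 1) * f (s *\<^sub>R fst p, snd p))"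
    if s: "s \<in> {0..1}" for s :: real
  proof -
    have "FD f (s *\<^sub>R fst p, snd p) (fst p, 0) = (\<Sum>j\<in>UNIV. fst p $ j * dx j f (s *\<^sub>R fst p, snd p))"
      using FD_xy[OF f in_Q[OF p s], of "fst p" 0] by simp
    then show ?thesis by (simp add: \<sigma> sum_distrib_left mult_ac)
  qed
  have i: "(\<lambda>s. fst p $ j * (s ^ n * dx j f (s *\<^sub>R fst p, snd p))) integrable_on {0..1}" for j
    by (rule integrable_on_mult_right[OF hom_integrable[OF sd p]])
  have i': "(\<lambda>s. real n * (s ^ (n - 1) * f (s *\<^sub>R fst p, snd p))) integrable_on {0..1}"
    by (rule integrable_on_mult_right[OF hom_integrable[OF f p]])
  have "f p = integral {0..1} (\<lambda>s. s ^ n *\<^sub>R FD f (pr.\<sigma> s p) (fst p, 0) + (real n * s ^ (n - 1)) *\<^sub>R f (pr.\<sigma> s p))"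
    using integral_unique[OF pr.ftc[OF f p n]] by simp
  also have "\<dots> = integral {0..1} (\<lambda>s. (\<Sum>j\<in>UNIV. fst p $ j * (s ^ n * dx j f (s *\<^sub>R fst p, snd p))) + real n * (s ^ (n - 1) * f (s *\<^sub>R fst p, snd p)))"
    by (rule integral_cong[OF eq])
  also have "\<dots> = integral {0..1} (\<lambda>s. \<Sum>j\<in>UNIV. fst p $ j * (s ^ n * dx j f (s *\<^sub>R fst p, snd p)))
      + integral {0..1} (\<lambda>s. real n * (s ^ (n - 1) * f (s *\<^sub>R fst p, snd p)))"
    by (rule integral_add[OF integrable_sum i']) (auto intro: i)
  also have "\<dots> = (\<Sum>j\<in>UNIV. fst p $ j * hom n (dx j f) p) + real n * hom (n - 1) f p"
    by (subst integral_sum) (auto intro: i simp: hom_def)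
  finally show ?thesis by simp
qed

text \<open>The potentials below are exterior products with the Euler field, the Hodge dual of
  contracting a form with it.\<close>

definition "cm j f q = fst q $ j * f q" for j :: 'm and f :: "'m xy \<Rightarrow> real"

lemma smooth_cm: "smooth_on Q f \<Longrightarrow> smooth_on Q (cm j f)"
  unfolding cm_def by (intro smooth_intros oQ)

lemma dx_cm:
  assumes f: "smooth_on Q f" and p: "p \<in> Q"
  shows "dx i (cm j f) p = (if i = j then f p else 0) + fst p $ j * dx i f p"
proof -
  have s1: "smooth_on Q (\<lambda>q. fst q)" by (intro smooth_intros oQ)
  have s2: "smooth_on Q (\<lambda>q. fst q $ j)" by (intro smooth_intros oQ)
  have "FD (\<lambda>q. fst q $ j) p (ex i) = (if i = j then 1 else 0)"
    unfolding FD_vec_nth[OF s1 p] FD_fst0 by (simp add: ex_def axis_def)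
  then show ?thesis unfolding dx_def cm_def[abs_def] FD_mult[OF s2 f p] by simp
qed

lemma sum_delta_mult: "(\<Sum>j\<in>UNIV. (if j = i then g j else 0) + h j) = g i + (\<Sum>j\<in>UNIV. h j)" for g h :: "'m \<Rightarrow> real"
  by (simp add: sum.distrib)

text \<open>The Poincare lemma for forms of degree m - 1, read as vector fields. Differentiating the
  coordinates contributes m from the first term and removes 1 on the diagonal, so
  \<open>hom_homotopy\<close> is needed with \<open>n = m - 1\<close>; the other terms carry the
  divergence of \<open>R\<close>.\<close>

lemma div_potential:
  assumes R: "\<And>i. smooth_on Q (R i)" and div: "\<And>p. p \<in> Q \<Longrightarrow> (\<Sum>i\<in>UNIV. dx i (R i) p) = 0"
    and p: "p \<in> Q" and m: "CARD('m) \<ge> 2"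
  shows "(\<Sum>j\<in>UNIV. dx j (\<lambda>q. cm j (hom (CARD('m) - 2) (R i)) q - cm i (hom (CARD('m) - 2) (R j)) q) p) = R i p"
proof -
  define n where "n = CARD('m) - 1"
  have n: "n \<ge> 1" "Suc (CARD('m) - 2) = n" "CARD('m) - 2 = n - 1" using m by (auto simp: n_def)
  note sh = smooth_hom[OF R]
  have "dx j (\<lambda>q. cm j (hom (n - 1) (R i)) q - cm i (hom (n - 1) (R j)) q) p
      = hom (n - 1) (R i) p + fst p $ j * hom n (dx j (R i)) p
        - ((if j = i then hom (n - 1) (R j) p else 0) + fst p $ i * hom n (dx j (R j)) p)" for j
  proof -
    have "dx j (\<lambda>q. cm j (hom (n - 1) (R i)) q - cm i (hom (n - 1) (R j)) q) p
      = dx j (cm j (hom (n - 1) (R i))) p - dx j (cm i (hom (n - 1) (R j))) p"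
      unfolding dx_def by (rule FD_diff[OF smooth_cm[OF sh] smooth_cm[OF sh] p])
    then show ?thesis using n(1) by (simp add: dx_cm[OF sh p] dx_hom[OF R p])
  qed
  then have "(\<Sum>j\<in>UNIV. dx j (\<lambda>q. cm j (hom (n - 1) (R i)) q - cm i (hom (n - 1) (R j)) q) p)
      = real (CARD('m)) * hom (n - 1) (R i) p + (\<Sum>j\<in>UNIV. fst p $ j * hom n (dx j (R i)) p)
        - (hom (n - 1) (R i) p + fst p $ i * (\<Sum>j\<in>UNIV. hom n (dx j (R j)) p))"
    by (simp only: sum_subtractf sum_delta_mult) (simp add: sum.distrib sum_distrib_left)
  also have "(\<Sum>j\<in>UNIV. hom n (dx j (R j)) p) = 0"
    using hom_sum[where f="\<lambda>j. dx j (R j)" and n=n, OF smooth_on_dx[OF R] p] hom_zero[OF div p] by simp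
  also have "real (CARD('m)) = real n + 1" using m by (simp add: n_def)
  finally show ?thesis using hom_homotopy[OF R p n(1), of i] by (simp add: n(3) algebra_simps)
qed

text \<open>The same for forms of degree m - 2, read as skew arrays. Now two coincidences of indices
  are removed from m, so \<open>n = m - 2\<close> and the homotopy has exponent
  \<open>m - 3\<close>.\<close>

lemma div_potential3:
  assumes S: "\<And>k l. smooth_on Q (S k l)" and skew: "\<And>k l p. p \<in> Q \<Longrightarrow> S k l p = - S l k p"
    and div: "\<And>k p. p \<in> Q \<Longrightarrow> (\<Sum>l\<in>UNIV. dx l (S k l) p) = 0"
    and p: "p \<in> Q" and m: "CARD('m) \<ge> 3"
  defines "a \<equiv> \<lambda>k l. hom (CARD('m) - 3) (S k l)"
  shows "(\<Sum>s\<in>UNIV. dx s (\<lambda>q. cm s (a k l) q + cm k (a l s) q + cm l (a s k) q) p) = S k l p"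
proof -
  define n where "n = CARD('m) - 2"
  have n: "n \<ge> 1" "CARD('m) - 3 = n - 1" using m by (auto simp: n_def)
  have sa: "smooth_on Q (a k l)" for k l unfolding a_def by (rule smooth_hom[OF S])
  have da: "dx s (a k l) p = hom n (dx s (S k l)) p" for s k l unfolding a_def n(2) using n(1) by (simp add: dx_hom[OF S p])
  have ask: "a k l p = - a l k p" for k l
  proof -
    have "a k l p = integral {0..1} (\<lambda>s. - (s ^ (n - 1) * S l k (s *\<^sub>R fst p, snd p)))"
      unfolding a_def hom_def n(2) by (rule integral_cong) (use skew[OF in_Q[OF p], of _ k l] in simp)
    then show ?thesis by (simp add: a_def hom_def n(2))
  qed
  have "dx s (\<lambda>q. cm s (a k l) q + cm k (a l s) q + cm l (a s k) q) p
      = (a k l p + fst p $ s * dx s (a k l) p) + ((if s = k then a l s p else 0) + fst p $ k * dx s (a l s) p)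
        + ((if s = l then a s k p else 0) + fst p $ l * dx s (a s k) p)" for s
  proof -
    have "dx s (\<lambda>q. cm s (a k l) q + cm k (a l s) q + cm l (a s k) q) p
        = dx s (cm s (a k l)) p + dx s (cm k (a l s)) p + dx s (cm l (a s k)) p"
      unfolding dx_def
      by (subst FD_add[OF smooth_on_add[OF oQ smooth_cm[OF sa] smooth_cm[OF sa]] smooth_cm[OF sa] p],
          subst FD_add[OF smooth_cm[OF sa] smooth_cm[OF sa] p]) (rule refl)
    then show ?thesis by (simp add: dx_cm[OF sa p])
  qed
  then have "(\<Sum>s\<in>UNIV. dx s (\<lambda>q. cm s (a k l) q + cm k (a l s) q + cm l (a s k) q) p)
      = (real (CARD('m)) * a k l p + (\<Sum>s\<in>UNIV. fst p $ s * dx s (a k l) p))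
        + (a l k p + (\<Sum>s\<in>UNIV. fst p $ k * dx s (a l s) p)) + (a l k p + (\<Sum>s\<in>UNIV. fst p $ l * dx s (a s k) p))"
    by (simp only: sum.distrib[of "\<lambda>s. _ s + _ s"] sum_delta_mult) (simp add: sum.distrib)
  also have "(\<Sum>s\<in>UNIV. fst p $ k * dx s (a l s) p) = 0"
  proof -
    have "(\<Sum>s\<in>UNIV. dx s (a l s) p) = 0"
      unfolding da using hom_sum[where f="\<lambda>s. dx s (S l s)" and n=n, OF smooth_on_dx[OF S] p] hom_zero[OF div p] by simp
    then show ?thesis by (simp add: sum_distrib_left[symmetric])
  qed
  also have "(\<Sum>s\<in>UNIV. fst p $ l * dx s (a s k) p) = 0"
  proof -
    have "(\<Sum>s\<in>UNIV. dx s (S s k) q) = 0" if q: "q \<in> Q" for q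
    proof -
      have "dx s (S s k) q = - dx s (S k s) q" for s
      proof -
        have "dx s (S s k) q = dx s (\<lambda>q. - S k s q) q" by (rule dx_cong[OF oQ q skew])
        then show ?thesis using dx_minus(1)[OF S q] by simp
      qed
      then show ?thesis using div[OF q] by (simp add: sum_negf)
    qed
    then have "(\<Sum>s\<in>UNIV. dx s (a s k) p) = 0"
      unfolding da using hom_sum[where f="\<lambda>s. dx s (S s k)" and n=n, OF smooth_on_dx[OF S] p] hom_zero[OF _ p] by simp
    then show ?thesis by (simp add: sum_distrib_left[symmetric])
  qed
  also have "real (CARD('m)) = real n + 2" using m by (simp add: n_def)
  finally show ?thesis using hom_homotopy[OF S p n(1), of k l] ask[of l k] unfolding da
    by (simp add: a_def n(2) algebra_simps)
qed

end

section \<open>The potentials \<open>\<theta>\<close> and the forms \<open>f\<close>\<close>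

text \<open>The sign in front of \<open>f\<close> is the one for which \<open>sum_dx_form\<close> turns the divergence of \<open>F\<close> into \<open>d_x f\<close>.\<close>

lemma form_of_alternating:
  fixes F :: "'m::{finite,linorder} \<Rightarrow> 'm \<Rightarrow> 'm \<Rightarrow> 'm xy \<Rightarrow> real"
  assumes F1: "\<And>k l s q. q \<in> Q \<Longrightarrow> F l k s q = - F k l s q" and F2: "\<And>k l s q. q \<in> Q \<Longrightarrow> F k s l q = - F k l s q"
  obtains f :: "'m xform" where
    "\<And>k l s q. q \<in> Q \<Longrightarrow> k \<noteq> l \<Longrightarrow> s \<noteq> k \<Longrightarrow> s \<noteq> l \<Longrightarrow>
      F k l s q = - (sig k l * sig k s * sig l s * sg k * sg l * sg s) * f (- {k, l, s}) q"
    "\<And>T. f T = (\<lambda>_. 0) \<or> card T + 3 = CARD('m) \<and> (\<exists>k l s c. f T = (\<lambda>q. c * F k l s q))"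
proof -
  define c where "c k l s = - (sig k l * sig k s * sig l s * sg k * sg l * sg s)" for k l s :: 'm
  have cc: "c k l s * c k l s = 1" for k l s by (simp add: c_def mult_ac)
  \<comment> \<open>Without the sorting sign the array is symmetric in its three distinct indices,
    so it depends only on the set they form; \<open>f\<close> below picks any ordering of that
    set.\<close>
  define G where "G k l s q = c k l s * F k l s q" for k l s q
  have G1: "G l k s q = G k l s q" if "k \<noteq> l" "q \<in> Q" for k l s q
    using that by (simp add: G_def c_def sig_swap[of k l] F1[of q k l] mult_ac)
  have G2: "G k s l q = G k l s q" if "s \<noteq> l" "q \<in> Q" for k l s q
    using that by (simp add: G_def c_def sig_swap[of l s] F2[of q k l] mult_ac)
  have perm: "G k' l' s' q = G k l s q"
    if eq: "- {k', l', s'} = - {k, l, s}" and d: "k' \<noteq> l'" "s' \<noteq> k'" "s' \<noteq> l'" and q: "q \<in> Q" for k l s k' l' s' q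
  proof -
    have "{k', l', s'} = {k, l, s}" using eq by blast
    then have "k' \<in> {k, l, s}" "l' \<in> {k, l, s}" "s' \<in> {k, l, s}" by blast+
    then consider "k' = k" "l' = l" "s' = s" | "k' = k" "l' = s" "s' = l" | "k' = l" "l' = k" "s' = s"
      | "k' = l" "l' = s" "s' = k" | "k' = s" "l' = k" "s' = l" | "k' = s" "l' = l" "s' = k"
      using d by auto
    then show ?thesis
      using d G1[OF _ q] G2[OF _ q] by cases metis+
  qed
  define tri where "tri T x = (case x of (k, l, s) \<Rightarrow> k \<noteq> l \<and> s \<noteq> k \<and> s \<noteq> l \<and> T = - {k, l, s})" for T :: "'m set" and x
  define f where "f T = (if \<exists>x. tri T x then (case SOME x. tri T x of (k, l, s) \<Rightarrow> G k l s) else (\<lambda>_. 0))" for T :: "'m set"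
  have f: "\<exists>k l s. tri T (k, l, s) \<and> f T = G k l s" if "tri T x" for T x
  proof -
    obtain k l s where e: "(SOME x. tri T x) = (k, l, s)" by (metis prod_cases3)
    have "tri T (SOME x. tri T x)" using that by (rule someI)
    moreover have "f T = (case SOME x. tri T x of (k, l, s) \<Rightarrow> G k l s)"
      unfolding f_def using exI[of "tri T", OF that] by (rule if_P)
    ultimately show ?thesis using e by auto
  qed
  show ?thesis
  proof (rule that)
    fix k l s :: 'm and q :: "'m xy" assume q: "q \<in> Q" and d: "k \<noteq> l" "s \<noteq> k" "s \<noteq> l"
    have "tri (- {k, l, s}) (k, l, s)" using d by (simp add: tri_def)
    from f[OF this] obtain k' l' s' where t: "tri (- {k, l, s}) (k', l', s')" "f (- {k, l, s}) = G k' l' s'" by blast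
    have d': "k' \<noteq> l'" "s' \<noteq> k'" "s' \<noteq> l'" "- {k', l', s'} = - {k, l, s}" using t(1) by (simp_all add: tri_def)
    have "f (- {k, l, s}) q = G k l s q" unfolding t(2) by (rule perm[OF d'(4,1,2,3) q])
    then have "c k l s * f (- {k, l, s}) q = (c k l s * c k l s) * F k l s q" by (simp only: G_def mult.assoc)
    then show "F k l s q = - (sig k l * sig k s * sig l s * sg k * sg l * sg s) * f (- {k, l, s}) q"
      unfolding cc by (simp add: c_def)
  next
    fix T
    show "f T = (\<lambda>_. 0) \<or> card T + 3 = CARD('m) \<and> (\<exists>k l s c. f T = (\<lambda>q. c * F k l s q))"
    proof (cases "\<exists>x. tri T x")
      case True
      then obtain k l s where t: "tri T (k, l, s)" "f T = G k l s" using f by blast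
      then have T: "T = - {k, l, s}" and c3: "card {k, l, s} = 3" by (auto simp: tri_def)
      have "card {k, l, s} \<le> CARD('m)" by (rule card_mono) auto
      then have "card T + 3 = CARD('m)" unfolding T using c3 card_Diff_subset[of "{k, l, s}" UNIV] by (simp add: Compl_eq_Diff_UNIV del: card_Diff_insert)
      \<comment> \<open>An equality of functions everywhere, not only on \<open>Q\<close>;
        smoothness and vanishing at \<open>x = 0\<close> thus pass from \<open>F\<close> to
        \<open>f\<close>.\<close>
      moreover have "f T = (\<lambda>q. c k l s * F k l s q)" unfolding t(2) G_def[abs_def] by (rule refl)
      ultimately show ?thesis by blast
    qed (auto simp: f_def)
  qed
qed

lemma theta_of_skew:
  fixes B :: "'m::{finite,linorder} \<Rightarrow> 'm \<Rightarrow> 'm xy \<Rightarrow> real"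
  assumes "open U" "\<And>i j. smooth_on U (B i j)" and skew: "\<And>i j p. B i j p = - B j i p"
  defines "\<theta> \<equiv> \<lambda>k l p. sg k * sg l * B k l p"
  shows "theta_pot U \<theta>" "theta_pot.B \<theta> = B"
proof -
  show "theta_pot U \<theta>" by (rule theta_pot.intro) (auto simp: \<theta>_def intro!: smooth_intros assms)
  have 0: "B k k p = 0" for k p using skew[of k k p] by simp
  show "theta_pot.B \<theta> = B"
  proof (intro ext)
    fix k l p
    show "theta_pot.B \<theta> k l p = B k l p"
      unfolding theta_pot.B_def[OF \<open>theta_pot U \<theta>\<close>]
      using skew[of l k p] by (cases k l rule: linorder_cases) (simp_all add: skew_def \<theta>_def 0 mult_ac)
  qed
qed

locale unimodular_chart = adapted U I K J V \<phi> r \<kappa> A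
  for U :: "('m::{finite,linorder}) xy set" and I K J V \<phi> r \<kappa> A +
  assumes tr: "p \<in> ball 0 r \<Longrightarrow> (\<Sum>e\<in>Basis. A p e \<bullet> e) = 0" and m: "CARD('m) \<ge> 2"
begin

text \<open>The common end of the cases m = 2 and m \<ge> 3: what remains there is to produce a skew
  \<open>B\<close> that gives the same \<open>A\<close> and whose \<open>S\<close> is dual to
  \<open>d_x f\<close>.\<close>

lemma structure_of_potential:
  assumes B: "\<And>i j. smooth_on (ball 0 r) (B i j)" "\<And>i j p. B i j p = - B j i p"
    and Av: "\<And>p w. p \<in> ball 0 r \<Longrightarrow> div_free.Av B p w = A p w"
    and S: "\<And>i j k l p. i < j \<Longrightarrow> k < l \<Longrightarrow> p \<in> ball 0 r \<Longrightarrow> div_free.S B i j k l p = sg k * sg l * d_x (f i j) (- {k, l}) p"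
  shows "\<exists>\<theta>. solves_system f \<theta> \<and> structure_of_lax (\<phi> ` V) (lax_field (R_of \<theta>)) (lax_I A) (lax_K A) (lax_J A)"
proof -
  define \<theta> where "\<theta> = (\<lambda>k l p. sg k * sg l * B k l p)"
  interpret th: theta_pot "ball 0 r" \<theta> unfolding \<theta>_def by (rule theta_of_skew(1)[OF open_ball B])
  have thB: "th.B = B" unfolding \<theta>_def by (rule theta_of_skew(2)[OF open_ball B])
  have "solves_system f \<theta>"
    unfolding solves_system_def
  proof (intro conjI allI impI)
    show "smooth_germ (\<theta> k l)" if "k < l" for k l
      unfolding smooth_germ_def using th.sm\<theta>[OF that] r by (intro exI[of _ "ball 0 r"]) simp
    have "\<forall>\<^sub>F z in nhds 0. z \<in> ball (0 :: 'm xy) r" using r by (intro eventually_nhds_in_open) auto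
    then show "\<forall>\<^sub>F z in nhds 0. \<forall>i j k l. i < j \<longrightarrow> k < l \<longrightarrow>
        (\<Sum>p\<in>UNIV. \<Sum>q\<in>UNIV. (-1) ^ (idx p + idx q) *
           (dx i (dx p (skew \<theta> p l)) z * dx j (dx q (skew \<theta> q k)) z
            - dx j (dx p (skew \<theta> p l)) z * dx i (dx q (skew \<theta> q k)) z))
        = dy j (dx i (skew \<theta> k l)) z - dy i (dx j (skew \<theta> k l)) z + d_x (f i j) (- {k, l}) z"
    proof (rule eventually_mono, intro allI impI)
      fix z and i j k l :: 'm assume z: "z \<in> ball (0 :: 'm xy) r" and ij: "i < j" "k < l"
      show "(\<Sum>p\<in>UNIV. \<Sum>q\<in>UNIV. (-1) ^ (idx p + idx q) *
           (dx i (dx p (skew \<theta> p l)) z * dx j (dx q (skew \<theta> q k)) z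
            - dx j (dx p (skew \<theta> p l)) z * dx i (dx q (skew \<theta> q k)) z))
        = dy j (dx i (skew \<theta> k l)) z - dy i (dx j (skew \<theta> k l)) z + d_x (f i j) (- {k, l}) z"
        unfolding th.system_iff[OF z] thB by (rule S[OF ij z])
    qed
  qed
  moreover have "structure_of_lax (\<phi> ` V) (lax_field (R_of \<theta>)) (lax_I A) (lax_K A) (lax_J A)"
    unfolding diffeo_between_image[OF d]
  proof (rule structure_of_lax_lax)
    fix p :: "'m xy" assume p: "p \<in> ball 0 r"
    show "lax_I A p = lax_I A p \<and> lax_K A p = lax_K A p \<and> lax_J A p = lax_J A p \<and> linear (A p)" using linA[OF p] by simp
    fix i j
    have "dx i (R_of \<theta> j) p = dx i (th.R j) p" by (rule dx_cong[OF open_ball p th.R_of_eq])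
    then show "A p (axis i 1) $ j = dx i (R_of \<theta> j) p" using th.Av_axis[OF p] Av[OF p] by (simp add: thB)
  qed
  ultimately show ?thesis by blast
qed

sublocale xb: xball r "ball (0 :: 'm xy) r" .

text \<open>\<open>F1\<close> says that \<open>A\<close> is closed in the
  \<open>x\<close>-directions, so it is the \<open>x\<close>-differential of some \<open>R\<close>.
  By \<open>tr\<close> this \<open>R\<close> is divergence free, and \<open>div_potential\<close>
  supplies \<open>B\<close>.\<close>

lemma field_potential:
  obtains B :: "'m \<Rightarrow> 'm \<Rightarrow> 'm xy \<Rightarrow> real" where "\<And>i j. smooth_on (ball 0 r) (B i j)" "\<And>i j p. B i j p = - B j i p"
    "\<And>p w. p \<in> ball 0 r \<Longrightarrow> div_free.Av B p w = A p w"
proof -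
  define P where "P p v = A p (fst v)" for p and v :: "'m xy"
  have linP: "linear (P p)" if "p \<in> ball 0 r" for p
    using linear_compose[OF linear_fst linA[OF that]] unfolding P_def[abs_def] by (simp add: o_def)
  have smP: "smooth_on (ball 0 r) (\<lambda>p. P p v)" for v unfolding P_def by (rule smA)
  have closed: "FD (\<lambda>q. P q (fst w, 0)) p (fst v, 0) = FD (\<lambda>q. P q (fst v, 0)) p (fst w, 0)"
    if "p \<in> ball 0 r" for p and v w :: "'m xy"
    using lax.F1[OF lax that] by (simp add: P_def)
  define \<xi> where "\<xi> p = integral {0..1} (\<lambda>s. P (xb.pr.\<sigma> s p) (fst p, 0))" for p
  have s\<xi>: "smooth_on (ball 0 r) \<xi>"
    unfolding \<xi>_def by (rule xb.pr.potential(1)[where P=P, OF linP smP]) (assumption | rule closed)+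
  have FD\<xi>: "FD \<xi> p (w, 0) = A p w" if "p \<in> ball 0 r" for p w
  proof -
    have "FD \<xi> p (fst (w, 0 :: (real, 'm) vec), 0) = P p (fst (w, 0 :: (real, 'm) vec), 0)"
      unfolding \<xi>_def[abs_def] by (rule xb.pr.potential(2)[where P=P, OF linP smP _ that]) (assumption | rule closed)+
    then show ?thesis by (simp add: P_def)
  qed
  define R where "R i p = \<xi> p $ i" for i p
  have smR: "smooth_on (ball 0 r) (R i)" for i unfolding R_def by (intro smooth_intros open_ball s\<xi>)
  have dR: "dx i (R j) p = A p (axis i 1) $ j" if p: "p \<in> ball 0 r" for i j p
    unfolding dx_def R_def FD_vec_nth[OF s\<xi> p] by (simp add: ex_def FD\<xi>[OF p])
  have div: "(\<Sum>i\<in>UNIV. dx i (R i) p) = 0" if p: "p \<in> ball 0 r" for p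
    using tr[OF p] by (simp add: dR[OF p] sum_Basis_vec inner_axis)
  define B where "B i j q = xb.cm j (hom (CARD('m) - 2) (R i)) q - xb.cm i (hom (CARD('m) - 2) (R j)) q" for i j q
  have smB: "smooth_on (ball 0 r) (B i j)" for i j
    unfolding B_def[abs_def] by (intro smooth_intros open_ball xb.smooth_cm xb.smooth_hom smR)
  have skB: "B i j p = - B j i p" for i j p by (simp add: B_def)
  interpret df: div_free "ball 0 r" B by (rule div_free.intro[OF open_ball smB skB])
  have dfR: "df.R i p = R i p" if p: "p \<in> ball 0 r" for i p
  proof -
    have "df.R i p = (\<Sum>j\<in>UNIV. dx j (B i j) p)" by (rule df.R_def)
    also have "\<dots> = R i p" unfolding B_def[abs_def] by (rule xb.div_potential[OF smR div p m])
    finally show ?thesis .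
  qed
  have "df.Av p w = A p w" if p: "p \<in> ball 0 r" for p w
  proof -
    have "df.Av p w = FD \<xi> p (w, 0)"
      unfolding df.Av_def by (rule FD_cong2[OF open_ball p]) (simp add: dfR R_def vec_eq_iff)
    then show ?thesis using FD\<xi>[OF p] by simp
  qed
  then show ?thesis by (intro that[OF smB skB])
qed

text \<open>By \<open>sum_dx_S\<close> this is the equation \<open>F2\<close>.\<close>

lemma div_S0:
  fixes B :: "'m \<Rightarrow> 'm \<Rightarrow> 'm xy \<Rightarrow> real"
  assumes df: "div_free (ball 0 r) B" and Av: "\<And>p w. p \<in> ball 0 r \<Longrightarrow> div_free.Av B p w = A p w" and p: "p \<in> ball 0 r"
  shows "(\<Sum>l\<in>UNIV. dx l (div_free.S B i j k l) p) = 0"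
proof -
  interpret df: div_free "ball 0 r" B by (rule df)
  have "FD (\<lambda>q. df.Av q v) p d = FD (\<lambda>q. A q v) p d" for v d by (rule FD_cong2[OF open_ball p Av])
  then show ?thesis unfolding df.sum_dx_S[OF p] by (simp add: Av[OF p] lax.F2[OF lax p, of "axis j 1" "axis i 1"])
qed

text \<open>\<open>S i j\<close> is skew and divergence free, hence the divergence of the
  alternating array \<open>F\<close> from \<open>div_potential3\<close>. Each term of
  \<open>F\<close> has a coordinate of \<open>x\<close> as a factor, which makes the dual form
  \<open>f\<close> vanish at \<open>x = 0\<close>.\<close>

lemma converse_ge3:
  assumes m3: "CARD('m) \<ge> 3"
  shows "\<exists>f \<theta>. form_collection f \<and> solves_system f \<theta> \<and>
    structure_of_lax (\<phi> ` V) (lax_field (R_of \<theta>)) (lax_I A) (lax_K A) (lax_J A)"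
proof -
  obtain B :: "'m \<Rightarrow> 'm \<Rightarrow> 'm xy \<Rightarrow> real" where B: "\<And>i j. smooth_on (ball 0 r) (B i j)" "\<And>i j p. B i j p = - B j i p"
    and Av: "\<And>p w. p \<in> ball 0 r \<Longrightarrow> div_free.Av B p w = A p w"
    by (rule field_potential) (assumption | rule that)+
  define \<theta> where "\<theta> = (\<lambda>k l p. sg k * sg l * B k l p)"
  interpret th: theta_pot "ball 0 r" \<theta> unfolding \<theta>_def by (rule theta_of_skew(1)[OF open_ball B])
  have thB: "th.B = B" unfolding \<theta>_def by (rule theta_of_skew(2)[OF open_ball B])
  note df = th.div_free_axioms[unfolded thB] and smS = th.smS[unfolded thB] and skS = th.S_skew[unfolded thB]
  define S where "S = div_free.S B"
  define a where "a i j k l = hom (CARD('m) - 3) (S i j k l)" for i j k l :: 'm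
  have sa: "smooth_on (ball 0 r) (a i j k l)" for i j k l unfolding a_def S_def by (rule xb.smooth_hom[OF smS])
  have ska: "a i j k l q = - a i j l k q" if q: "q \<in> ball 0 r" for i j k l q
  proof -
    have "a i j k l q = integral {0..1} (\<lambda>s. - (s ^ (CARD('m) - 3) * S i j l k (s *\<^sub>R fst q, snd q)))"
      unfolding a_def hom_def S_def by (rule integral_cong) (use skS(1)[OF xb.in_Q[OF q], of _ i j k l] in simp)
    then show ?thesis by (simp add: a_def hom_def)
  qed
  define F where "F i j k l s q = xb.cm s (a i j k l) q + xb.cm k (a i j l s) q + xb.cm l (a i j s k) q" for i j k l s :: 'm and q
  have F1: "F i j l k s q = - F i j k l s q" and F2: "F i j k s l q = - F i j k l s q" if "q \<in> ball 0 r" for i j k l s q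
    using ska[OF that, of i j l k] ska[OF that, of i j s k] ska[OF that, of i j s l] by (simp_all add: F_def xb.cm_def)
  have smF: "smooth_on (ball 0 r) (F i j k l s)" for i j k l s
    unfolding F_def[abs_def] by (intro smooth_intros open_ball xb.smooth_cm sa)
  have "\<exists>g :: 'm xform. (\<forall>k l s q. q \<in> ball 0 r \<longrightarrow> k \<noteq> l \<longrightarrow> s \<noteq> k \<longrightarrow> s \<noteq> l \<longrightarrow>
      F i j k l s q = - (sig k l * sig k s * sig l s * sg k * sg l * sg s) * g (- {k, l, s}) q) \<and>
      (\<forall>T. g T = (\<lambda>_. 0) \<or> card T + 3 = CARD('m) \<and> (\<exists>k l s c. g T = (\<lambda>q. c * F i j k l s q)))" for i j
    by (rule form_of_alternating[where F="F i j" and Q="ball 0 r", OF F1 F2]) (assumption | blast)+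
  then obtain f :: "'m \<Rightarrow> 'm \<Rightarrow> 'm xform" where
    fF: "\<And>i j k l s q. q \<in> ball 0 r \<Longrightarrow> k \<noteq> l \<Longrightarrow> s \<noteq> k \<Longrightarrow> s \<noteq> l \<Longrightarrow>
      F i j k l s q = - (sig k l * sig k s * sig l s * sg k * sg l * sg s) * f i j (- {k, l, s}) q"
    and fT: "\<And>i j T. f i j T = (\<lambda>_. 0) \<or> card T + 3 = CARD('m) \<and> (\<exists>k l s c. f i j T = (\<lambda>q. c * F i j k l s q))"
    by metis
  have smf: "smooth_on (ball 0 r) (f i j T)" for i j T
    using fT[of i j T] by (auto intro!: smooth_intros open_ball smF)
  have "form_collection f"
    unfolding form_collection_def
  proof (intro allI impI conjI)
    fix i j T
    show "smooth_germ (f i j T)" unfolding smooth_germ_def using smf r by (intro exI[of _ "ball 0 r"]) simp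
    show "f i j T = (\<lambda>_. 0)" if "card T + 3 \<noteq> CARD('m)" using fT[of i j T] that by blast
    show "\<forall>\<^sub>F p in nhds 0. fst p = 0 \<longrightarrow> f i j T p = 0"
      using fT[of i j T] by (auto simp: F_def xb.cm_def)
  qed
  moreover have "\<exists>\<theta>. solves_system f \<theta> \<and> structure_of_lax (\<phi> ` V) (lax_field (R_of \<theta>)) (lax_I A) (lax_K A) (lax_J A)"
  proof (rule structure_of_potential[OF B Av])
    fix i j k l :: 'm and p assume kl: "k < l" and p: "p \<in> ball (0 :: 'm xy) r"
    have "S i j k l p = (\<Sum>s\<in>UNIV. dx s (F i j k l s) p)"
      unfolding F_def[abs_def] a_def S_def
      by (rule xb.div_potential3[symmetric, where S="div_free.S B i j", OF smS skS(1) div_S0[OF df Av] p m3])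
    also have "\<dots> = sig k l * sg k * sg l * d_x (f i j) (- {k, l}) p"
    proof (rule sum_dx_form[OF open_ball p _ smf])
      show "k \<noteq> l" using kl by simp
      show "F i j k l s q = 0" if "q \<in> ball 0 r" "s = k \<or> s = l" for s q
        using that(2) F1[OF that(1), of i j] F2[OF that(1), of i j] by (metis add.inverse_inverse eq_neg_iff_add_eq_0 neg_equal_zero)
    qed (use kl fF in auto)
    finally show "div_free.S B i j k l p = sg k * sg l * d_x (f i j) (- {k, l}) p" using kl by (simp add: sig_def S_def)
  qed
  ultimately show ?thesis by blast
qed

text \<open>For \<open>m = 2\<close> there are no forms \<open>f\<close>, but \<open>S\<close> depends on \<open>y\<close> only and is cancelled by adding
  \<open>x\<^sub>j \<beta>(y)\<close> to \<open>B i j\<close>, which changes \<open>R\<close> by a function of \<open>y\<close>.\<close>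

lemma converse_2:
  assumes m2: "CARD('m) = 2"
  shows "\<exists>f \<theta>. form_collection f \<and> solves_system f \<theta> \<and>
    structure_of_lax (\<phi> ` V) (lax_field (R_of \<theta>)) (lax_I A) (lax_K A) (lax_J A)"
proof -
  have "\<exists>i0 j0 :: 'm. i0 < j0 \<and> UNIV = {i0, j0}"
    using m2 unfolding card_2_iff by (metis insert_commute linorder_neqE)
  then obtain i0 j0 :: 'm where ij0: "i0 < j0" and UN: "UNIV = {i0, j0}" by blast
  have only: "i = i0 \<and> j = j0" if "i < j" for i j :: 'm
  proof -
    have "i \<in> {i0, j0}" "j \<in> {i0, j0}" using UN by blast+
    then show ?thesis using that ij0 by auto
  qed
  obtain B :: "'m \<Rightarrow> 'm \<Rightarrow> 'm xy \<Rightarrow> real" where B: "\<And>i j. smooth_on (ball 0 r) (B i j)" "\<And>i j p. B i j p = - B j i p"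
    and Av: "\<And>p w. p \<in> ball 0 r \<Longrightarrow> div_free.Av B p w = A p w"
    by (rule field_potential) (assumption | rule that)+
  define \<theta> where "\<theta> = (\<lambda>k l p. sg k * sg l * B k l p)"
  interpret th: theta_pot "ball 0 r" \<theta> unfolding \<theta>_def by (rule theta_of_skew(1)[OF open_ball B])
  have thB: "th.B = B" unfolding \<theta>_def by (rule theta_of_skew(2)[OF open_ball B])
  note df = th.div_free_axioms[unfolded thB] and smS = th.smS[unfolded thB] and skS = th.S_skew[unfolded thB]
  interpret df: div_free "ball 0 r" B by (rule df)
  define S where "S = df.S i0 j0 i0 j0"
  have smS': "smooth_on (ball 0 r) S" unfolding S_def by (rule smS)
  \<comment> \<open>With two indices the divergence of a skew array has one term per component, so
    both \<open>x\<close>-derivatives of the single entry \<open>S\<close> vanish.\<close>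
  have S0: "dx l S p = 0" if p: "p \<in> ball 0 r" for l p
  proof -
    have s: "(\<Sum>l\<in>UNIV. dx l (df.S i0 j0 k l) p) = dx i0 (df.S i0 j0 k i0) p + dx j0 (df.S i0 j0 k j0) p" for k
      using ij0 by (simp add: UN)
    have z: "dx l (df.S i0 j0 k k) p = 0" for k l
      by (rule dx_zero[OF open_ball p]) (use skS(1)[of _ i0 j0 k k] in simp)
    have "dx j0 S p = 0" using s[of i0] div_S0[OF df Av p, of i0 j0 i0] by (simp add: z S_def)
    moreover have "dx i0 (df.S i0 j0 j0 i0) p = 0" using s[of j0] div_S0[OF df Av p, of i0 j0 j0] by (simp add: z)
    moreover have "dx i0 S p = dx i0 (\<lambda>q. - df.S i0 j0 j0 i0 q) p" unfolding S_def by (rule dx_cong[OF open_ball p skS(1)])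
    ultimately have "dx i0 S p = 0" "dx j0 S p = 0" using dx_minus(1)[OF smS p] by simp_all
    moreover have "l \<in> {i0, j0}" using UN by blast
    ultimately show ?thesis by blast
  qed
  have S_const: "S p = S (0, snd p)" if p: "p \<in> ball 0 r" for p
    using constant_along_fst[OF smS', of "fst p" "snd p"] p FD_xy[OF smS'] S0 by simp
  have emb: "(0 :: (real, 'm) vec, y) \<in> ball 0 r" if "y \<in> ball 0 r" for y :: "(real, 'm) vec" using that by (simp add: norm_Pair)
  have sb: "snd p \<in> ball 0 r" if "p \<in> ball 0 r" for p :: "'m xy" using norm_snd_le[of "snd p" "fst p"] that by simp
  have semb: "smooth_on (ball 0 r) (\<lambda>y :: (real, 'm) vec. (0 :: (real, 'm) vec, y))" by (intro smooth_intros open_ball)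
  have "smooth_on (ball 0 r) (\<lambda>y. S (0, y))" by (rule smooth_on_compose[OF smS' semb open_ball open_ball emb])
  then have "smooth_on (ball 0 r) (\<lambda>y. - S (0, y))" by (intro smooth_intros open_ball)
  moreover have "norm (axis i0 1 :: (real, 'm) vec) = 1" by (simp add: norm_axis_1)
  \<comment> \<open>The correction \<open>C\<close> changes \<open>S\<close> only through
    \<open>dy i0 (dx j0 (C i0 j0))\<close>, the derivative of \<beta> along
    \<open>axis i0 1\<close>; this therefore has to be \<open>- S\<close>.\<close>
  ultimately obtain \<beta> where \<beta>: "smooth_on (ball 0 r) \<beta>" and FD\<beta>: "\<And>y. y \<in> ball 0 r \<Longrightarrow> FD \<beta> y (axis i0 1) = - S (0, y)"
    using directional_antiderivative by blast
  define b where "b q = \<beta> (snd q)" for q :: "'m xy"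
  have ssnd: "smooth_on (ball 0 r) (\<lambda>q :: 'm xy. snd q)" by (intro smooth_intros open_ball)
  have smb: "smooth_on (ball 0 r) b" unfolding b_def[abs_def] by (rule smooth_on_compose[OF \<beta> ssnd open_ball open_ball sb])
  have FDb: "FD b p v = FD \<beta> (snd p) (snd v)" if p: "p \<in> ball 0 r" for p v
    unfolding b_def[abs_def] using FD_compose[OF \<beta> sb[OF p] ssnd p] by (simp add: FD_snd0)
  have FDb0: "FD b p (w, 0) = 0" if p: "p \<in> ball 0 r" for p w
    by (simp add: FDb[OF p] linear_0[OF smooth_linear_FD[OF \<beta> sb[OF p]]])
  define h where "h = xb.cm j0 b"
  have smh: "smooth_on (ball 0 r) h" unfolding h_def by (rule xb.smooth_cm[OF smb])
  have dxh: "dx i h p = (if i = j0 then b p else 0)" if p: "p \<in> ball 0 r" for i p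
    unfolding h_def xb.dx_cm[OF smb p] using FDb0[OF p] by (simp add: dx_def ex_def)
  define C where "C i j p = (if i = i0 \<and> j = j0 then h p else if i = j0 \<and> j = i0 then - h p else 0)" for i j :: 'm and p
  have Cfun: "C i0 j0 = h" "C j0 i0 = (\<lambda>p. - h p)" "C i i = (\<lambda>_. 0)" for i using ij0 by (auto simp: C_def)
  have cases3: "(i = i0 \<and> j = j0) \<or> (i = j0 \<and> j = i0) \<or> i = j" for i j :: 'm
  proof -
    have "i \<in> {i0, j0}" "j \<in> {i0, j0}" using UN by blast+
    then show ?thesis by blast
  qed
  have skC: "C i j p = - C j i p" for i j p
    using cases3[of i j] by (elim disjE conjE) (simp_all only: Cfun minus_minus minus_zero)
  have smC: "smooth_on (ball 0 r) (C i j)" for i j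
    using cases3[of i j] by (elim disjE conjE) (simp_all only: Cfun smh smooth_on_minus smooth_on_const open_ball)
  have dxC: "dx j (C i j) p = (if i = i0 \<and> j = j0 then b p else 0)" if p: "p \<in> ball 0 r" for i j p
  proof -
    have ne: "i0 \<noteq> j0" using ij0 by simp
    consider "i = i0" "j = j0" | "i = j0" "j = i0" | "i = j" using cases3[of i j] by blast
    then show ?thesis
    proof cases
      case 1
      then show ?thesis by (simp add: Cfun(1) dxh[OF p])
    next
      case 2
      have "dx i0 (\<lambda>p. - h p) p = - dx i0 h p" by (rule dx_minus(1)[OF smh p])
      then show ?thesis using 2 ne by (simp add: Cfun(2) dxh[OF p])
    next
      case 3
      have "dx j (C j j) p = 0" by (simp add: Cfun(3) dx_def)
      then show ?thesis using 3 ne by auto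
    qed
  qed
  define B' where "B' i j p = B i j p + C i j p" for i j p
  have smB': "smooth_on (ball 0 r) (B' i j)" for i j unfolding B'_def[abs_def] by (intro smooth_intros open_ball B smC)
  have skB': "B' i j p = - B' j i p" for i j p unfolding B'_def using B(2)[of i j p] skC[of i j p] by simp
  interpret df': div_free "ball 0 r" B' by (rule div_free.intro[OF open_ball smB' skB'])
  have dB': "FD (B' i j) p v = FD (B i j) p v + FD (C i j) p v" if p: "p \<in> ball 0 r" for i j p v
    unfolding B'_def[abs_def] by (rule FD_add[OF B(1) smC p])
  have R': "df'.R i p = df.R i p + (if i = i0 then b p else 0)" if p: "p \<in> ball 0 r" for i p
  proof -
    have "df'.R i p = (\<Sum>j\<in>UNIV. dx j (B i j) p + dx j (C i j) p)" unfolding df'.R_def using dB'[OF p] by (simp add: dx_def)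
    also have "\<dots> = df.R i p + (\<Sum>j\<in>UNIV. dx j (C i j) p)" by (simp add: df.R_def sum.distrib)
    also have "(\<Sum>j\<in>UNIV. dx j (C i j) p) = (if i = i0 then b p else 0)" by (simp add: dxC[OF p])
    finally show ?thesis .
  qed
  have FDR: "FD (df'.R i) p (w, 0) = FD (df.R i) p (w, 0)" if p: "p \<in> ball 0 r" for i p w
  proof -
    have "FD (df'.R i) p (w, 0) = FD (\<lambda>q. df.R i q + (if i = i0 then b q else 0)) p (w, 0)" by (rule FD_cong2[OF open_ball p R'])
    also have "\<dots> = FD (df.R i) p (w, 0)"
      using FD_add[OF df.smR smb p] FDb0[OF p] by (cases "i = i0") simp_all
    finally show ?thesis .
  qed
  define f :: "'m \<Rightarrow> 'm \<Rightarrow> 'm xform" where "f i j T p = 0" for i j :: 'm and T p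
  have "form_collection f"
    unfolding form_collection_def smooth_germ_def f_def[abs_def]
    by (auto intro!: exI[of _ UNIV] smooth_intros)
  moreover have "\<exists>\<theta>. solves_system f \<theta> \<and> structure_of_lax (\<phi> ` V) (lax_field (R_of \<theta>)) (lax_I A) (lax_K A) (lax_J A)"
  proof (rule structure_of_potential[OF smB' skB'])
    show "df'.Av p w = A p w" if p: "p \<in> ball 0 r" for p w
      using Av[OF p] by (simp add: vec_eq_iff df'.Av_nth[OF p] df.Av_nth[OF p] FDR[OF p] flip: Av[OF p])
    fix i j k l :: 'm and p assume "i < j" "k < l" and p: "p \<in> ball (0 :: 'm xy) r"
    then have e: "i = i0" "j = j0" "k = i0" "l = j0" using only by blast+
    have dxR: "dx i (df'.R l) p = dx i (df.R l) p" for i l by (simp add: dx_def ex_def FDR[OF p])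
    have 1: "dy i0 (dx j0 (B' i0 j0)) p = dy i0 (dx j0 (B i0 j0)) p - S p"
    proof -
      have "dy i0 (dx j0 (B' i0 j0)) p = dy i0 (\<lambda>q. dx j0 (B i0 j0) q + b q) p"
        by (rule dy_cong[OF open_ball p]) (use dxC[where i=i0 and j=j0] dB' in \<open>simp add: dx_def\<close>)
      also have "\<dots> = dy i0 (dx j0 (B i0 j0)) p + dy i0 b p"
        unfolding dy_def by (rule FD_add[OF smooth_on_dx[OF B(1)] smb p])
      also have "dy i0 b p = - S p" by (simp add: dy_def ey_def FDb[OF p] FD\<beta>[OF sb[OF p]] S_const[OF p])
      finally show ?thesis by simp
    qed
    have 2: "dy j0 (dx i0 (B' i0 j0)) p = dy j0 (dx i0 (B i0 j0)) p"
      by (rule dy_cong[OF open_ball p]) (use dxh[of _ i0] dB' ij0 in \<open>simp add: dx_def Cfun\<close>)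
    have "df'.S i j k l p = 0"
      unfolding e df'.S_def dxR 1 2 by (simp add: S_def df.S_def)
    then show "df'.S i j k l p = sg k * sg l * d_x (f i j) (- {k, l}) p"
      by (simp add: d_x_def f_def[abs_def] dx_def)
  qed
  ultimately show ?thesis by blast
qed

lemma converse_chart:
  "\<exists>f \<theta>. form_collection f \<and> solves_system f \<theta> \<and>
    structure_of_lax (\<phi> ` V) (lax_field (R_of \<theta>)) (lax_I A) (lax_K A) (lax_J A)"
proof (cases "CARD('m) = 2")
  case True
  then show ?thesis by (rule converse_2)
next
  case False
  then have "CARD('m) \<ge> 3" using m by simp
  then show ?thesis by (rule converse_ge3)
qed

end

lemma backward:
  fixes U :: "('m::{finite,linorder}) xy set"
  assumes m: "CARD('m) \<ge> 2" and p0: "p0 \<in> U" and hpc: "hyper_para_complex_on U I K J" and rf: "ricci_flat_on U I K"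
  shows "\<exists>(f :: 'm \<Rightarrow> 'm \<Rightarrow> 'm xform) \<theta> V (\<phi> :: 'm xy \<Rightarrow> 'm xy) I' K' J'.
    form_collection f \<and> solves_system f \<theta> \<and> p0 \<in> V \<and> V \<subseteq> U \<and> diffeo_onto_image V \<phi> \<and> \<phi> p0 = 0 \<and>
    structure_of_lax (\<phi> ` V) (lax_field (R_of \<theta>)) I' K' J' \<and>
    (\<forall>q\<in>V. \<forall>v. FD \<phi> q (I q v) = I' (\<phi> q) (FD \<phi> q v) \<and> FD \<phi> q (K q v) = K' (\<phi> q) (FD \<phi> q v) \<and>
      FD \<phi> q (J q v) = J' (\<phi> q) (FD \<phi> q v))"
proof -
  obtain N where N: "chern_connection U (eigendistribution I 1) (eigendistribution I (-1)) (eigendistribution K 1) N"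
    and flat: "\<And>Y Z p. smooth_on U Y \<Longrightarrow> smooth_on U Z \<Longrightarrow> p \<in> U \<Longrightarrow> ricci N Y Z p = 0"
    using rf unfolding ricci_flat_on_def by blast
  obtain V1 \<phi>1 r1 \<kappa>1 A1 where c1: "adapted U I K J V1 \<phi>1 r1 \<kappa>1 A1" "p0 \<in> V1" "\<phi>1 p0 = 0"
    by (rule adapted_chart_exists[OF hpc p0]) (assumption | rule that)+
  have rfc: "ricci_flat_chart U I K J V1 \<phi>1 r1 \<kappa>1 A1 N"
    by (rule ricci_flat_chart.intro[OF c1(1) ricci_flat_chart_axioms.intro[OF N flat]])
  obtain V \<phi> r \<kappa> A where c: "adapted U I K J V \<phi> r \<kappa> A" "p0 \<in> V" "\<phi> p0 = 0"
    and tr: "\<And>p. p \<in> ball 0 r \<Longrightarrow> (\<Sum>e\<in>Basis. A p e \<bullet> e) = 0"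
    by (rule ricci_flat_chart.trace_free_chart[OF rfc c1(2,3)]) (assumption | rule that)+
  interpret unimodular_chart U I K J V \<phi> r \<kappa> A
    by (rule unimodular_chart.intro[OF c(1) unimodular_chart_axioms.intro[OF tr m]])
  obtain f :: "'m \<Rightarrow> 'm \<Rightarrow> 'm xform" and \<theta> where f: "form_collection f" "solves_system f \<theta>"
    "structure_of_lax (\<phi> ` V) (lax_field (R_of \<theta>)) (lax_I A) (lax_K A) (lax_J A)"
    using converse_chart by blast
  have "FD \<phi> q (J q v) = lax_J A (\<phi> q) (FD \<phi> q v)" if "q \<in> V" for q v
    using that VU IKJ(1)[of q v] push_I[OF that, of "K q v"] push_K[OF that, of v] by (auto simp: lax_J_def)
  then have "\<forall>q\<in>V. \<forall>v. FD \<phi> q (I q v) = lax_I A (\<phi> q) (FD \<phi> q v) \<and> FD \<phi> q (K q v) = lax_K A (\<phi> q) (FD \<phi> q v) \<and>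
      FD \<phi> q (J q v) = lax_J A (\<phi> q) (FD \<phi> q v)"
    using push_I push_K by blast
  then show ?thesis
    using f c(2,3) VU diffeo_between_onto_image[OF d] by blast
qed

theorem theorem3p2:
  assumes "CARD('m::{finite,linorder}) \<ge> 2"
  shows "(\<forall>(f :: 'm \<Rightarrow> 'm \<Rightarrow> 'm xform) \<theta>. form_collection f \<and> solves_system f \<theta> \<longrightarrow>
            (\<exists>W I K J. open W \<and> 0 \<in> W \<and>
               structure_of_lax W (lax_field (R_of \<theta>)) I K J \<and>
               hyper_para_complex_on W I K J \<and> ricci_flat_on W I K))
       \<and> (\<forall>(U :: 'm xy set) p0 I K J.
            p0 \<in> U \<and> hyper_para_complex_on U I K J \<and> ricci_flat_on U I K \<longrightarrow>
            (\<exists>(f :: 'm \<Rightarrow> 'm \<Rightarrow> 'm xform) \<theta> V (\<phi> :: 'm xy \<Rightarrow> 'm xy) I' K' J'.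
               form_collection f \<and> solves_system f \<theta> \<and>
               p0 \<in> V \<and> V \<subseteq> U \<and> diffeo_onto_image V \<phi> \<and> \<phi> p0 = 0 \<and>
               structure_of_lax (\<phi> ` V) (lax_field (R_of \<theta>)) I' K' J' \<and>
               (\<forall>q\<in>V. \<forall>v.
                  frechet_derivative \<phi> (at q) (I q v) = I' (\<phi> q) (frechet_derivative \<phi> (at q) v) \<and>
                  frechet_derivative \<phi> (at q) (K q v) = K' (\<phi> q) (frechet_derivative \<phi> (at q) v) \<and>
                  frechet_derivative \<phi> (at q) (J q v) = J' (\<phi> q) (frechet_derivative \<phi> (at q) v))))"
proof (intro conjI allI impI; elim conjE)
  fix f :: "'m \<Rightarrow> 'm \<Rightarrow> 'm xform" and \<theta>
  assume "form_collection f" "solves_system f \<theta>"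
  then show "\<exists>W I K J. open W \<and> 0 \<in> W \<and> structure_of_lax W (lax_field (R_of \<theta>)) I K J \<and>
      hyper_para_complex_on W I K J \<and> ricci_flat_on W I K"
    by (rule forward)
qed (rule backward[OF assms])

end
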